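(* Let $V$ be a real vector space of finite dimension $n\ge2$ and let $\{\gamma_1,\gamma_2\}$ be a generating pair of the free group $F_2$ of rank $2$. Let $b\in\mathrm{PGL}(V)$ be positive loxodromic and let $a\in\mathrm{PGL}(V)$ be loxodromic. If at least one of the tuples of flags $(b_-,a\cdot b_-,a_+,a\cdot b_+,b_+,a_-)$ and $(b_-,a\cdot b_+,a_+,a\cdot b_-,b_+,a_-)$ is positive, then the representation $\rho:F_2\to\mathrm{PGL}(V)$ defined by $\rho(\gamma_1)=a$ and $\rho(\gamma_2)=b$ is primitive stable.
   Context: Positive tuples of flags. A (complete) flag $F$ in $V$ is a nested sequence $F^{(1)}\subset\dots\subset F^{(n-1)}$ of subspaces with $\dim F^{(k)}=k$; $F^{(0)}=\{0\}$, $F^{(n)}=V$. $\mathcal F(V)$ is the space of flags, with its natural $\mathrm{PGL}(V)$-action. Flags $F,H$ are transverse if $F^{(k)}\cap H^{(n-k)}=\{0\}$ for all $k$. For an ordered basis $\mathcal B$ of $V$, $U_{>0}(\mathcal B)\subset\mathrm{PGL}(V)$ is the set of unipotent elements represented in $\mathcal B$ by an upper triangular matrix with ones on the diagonal all of whose minors are positive, except those forced to be zero by upper triangularity. For $l\ge3$, a tuple $(F_1,\dots,F_l)$ of flags is positive if $F_1,F_l$ are transverse and there are a basis $\mathcal B=(e_1,\dots,e_n)$ with $e_k\in F_1^{(n-k+1)}\cap F_l^{(k)}$ for all $k$ and $u_1,\dots,u_{l-2}\in U_{>0}(\mathcal B)$ with $(F_1,\dots,F_l)=(F_1,u_1\cdot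 F_1,u_1u_2\cdot F_1,\dots,u_1\cdots u_{l-2}\cdot F_1,F_l)$. Loxodromic elements. $g\in\mathrm{PGL}(V)$ is loxodromic if the eigenvalues of a linear representative have pairwise distinct absolute values; equivalently $g$ has a unique attracting fixed flag $g_+$ and a unique repelling fixed flag $g_-$ in $\mathcal F(V)$ ($g_+^{(k)}$, resp. $g_-^{(k)}$, is spanned by the eigenlines of the $k$ eigenvalues of largest, resp. smallest, absolute value). It is positive loxodromic if moreover all its eigenvalues have the same sign. Cartan projection. Fix an inner product on $V$ (up to scaling). For $g\in\mathrm{PGL}(V)$ let $\bar g\in\mathrm{GL}(V)$ be a representative with $|\det\bar g|=1$ and singular values $\mu_1(\bar g)\ge\dots\ge\mu_n(\bar g)$; put $\mu(g)=(\log\mu_1(\bar g),\dots,\log\mu_n(\bar g))$. Let $\Delta=\{\alpha_1,\dots,\alpha_{n-1}\}$ with $\alpha_k(x_1,\dots,x_n)=x_k-x_{k+1}$. Primitive stable. An element $\gamma_1$ of the free group $F_d$ is primitive if there are $\gamma_2,\dots,\gamma_d$ such that $\{\gamma_1,\dots,\gamma_d\}$ generates $F_d$. With a word metric on $F_d$, an axis of a non-identity $\gamma$ is a (bi-infinite) geodesic in $F_d$ invariant under $\gamma$; a primitive geodesic is an axis of a primitive element; a primitive geodesic ray is a geodesic ray lying in a primitive geodesic; a sequence $(\eta_i)_{i=0}^\infty$ is rooted if $\eta_0=\mathrm{id}$. A representation $\rho:F_d\to\mathrm{PGL}(V)$ is primitive stable if for some (equivalently any) word metric on $F_d$ there are $\kappa,\kappa'>0$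 such that $\alpha(\mu(\rho(\eta_i)))\ge\kappa i-\kappa'$ for all rooted primitive geodesic rays $(\eta_i)_{i=0}^\infty$, all $i\ge0$ and all $\alpha\in\Delta$. *)

theory Defs
  imports
    "HOL-Analysis.Analysis"
    "HOL-Algebra.Coset"
    "HOL-Algebra.Generated_Groups"
    "Jordan_Normal_Form.Char_Poly"
    "Jordan_Normal_Form.DL_Submatrix"
begin

text \<open>
  \<open>V\<close> is the type \<open>'v::euclidean_space\<close>, whose inner product is the fixed inner product on \<open>V\<close>
  and whose dimension is \<open>DIM('v)\<close>.  The source numbers basis vectors, singular values and matrix
  entries from 1; lists and matrices here are numbered from 0.
\<close>

definition GL :: "('v::euclidean_space \<Rightarrow> 'v) monoid" where
  "GL = \<lparr>carrier = {f. linear f \<and> bij f}, mult = (\<circ>), one = id\<rparr>"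

definition homotheties :: "('v::euclidean_space \<Rightarrow> 'v) set" where
  "homotheties = {(\<lambda>v. c *\<^sub>R v) | c. c \<noteq> 0}"

text \<open>An element of \<open>PGL\<close> is the set of all its linear representatives.\<close>

definition PGL :: "('v::euclidean_space \<Rightarrow> 'v) set monoid" where
  "PGL = GL Mod homotheties"

definition ordered_basis :: "'v::euclidean_space list \<Rightarrow> bool" where
  "ordered_basis B \<longleftrightarrow> distinct B \<and> independent (set B) \<and> span (set B) = UNIV"

definition matrix_in :: "'v::euclidean_space list \<Rightarrow> ('v \<Rightarrow> 'v) \<Rightarrow> real mat" where
  "matrix_in B f =
     mat (length B) (length B) (\<lambda>(i, j). representation (set B) (f (B ! j)) (B ! i))"

text \<open>
  The next two notions do not depend on the basis used.  In the second one, \<open>zs\<close> consists of the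
  complex eigenvalues repeated according to algebraic multiplicity.
\<close>

definition linear_det :: "('v::euclidean_space \<Rightarrow> 'v) \<Rightarrow> real" where
  "linear_det f = Determinant.det (matrix_in (SOME B. ordered_basis B) f)"

definition eigenvalue_list :: "('v::euclidean_space \<Rightarrow> 'v) \<Rightarrow> complex list \<Rightarrow> bool" where
  "eigenvalue_list f zs \<longleftrightarrow>
     char_poly (map_mat complex_of_real (matrix_in (SOME B. ordered_basis B) f)) =
     (\<Prod>z\<leftarrow>zs. [:- z, 1:])"

definition real_eigenvalue :: "('v::euclidean_space \<Rightarrow> 'v) \<Rightarrow> real \<Rightarrow> bool" where
  "real_eigenvalue f c \<longleftrightarrow> (\<exists>v. v \<noteq> 0 \<and> f v = c *\<^sub>R v)"

text \<open>
  The subspaces \<open>F k\<close> with \<open>k > DIM('v)\<close> carry no information; they are all forced to be \<open>UNIV\<close>,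
  so that equality of flags is equality of functions.
\<close>

definition flag :: "(nat \<Rightarrow> 'v::euclidean_space set) \<Rightarrow> bool" where
  "flag F \<longleftrightarrow>
     (\<forall>k. Real_Vector_Spaces.subspace (F k) \<and> dim (F k) = min k DIM('v) \<and> F k \<subseteq> F (Suc k))"

text \<open>All representatives of \<open>g\<close> map the subspace \<open>F k\<close> to the same subspace.\<close>

definition flag_act ::
  "('v::euclidean_space \<Rightarrow> 'v) set \<Rightarrow> (nat \<Rightarrow> 'v set) \<Rightarrow> nat \<Rightarrow> 'v set" (infixr "\<cdot>\<^sub>F" 75) where
  "g \<cdot>\<^sub>F F = (\<lambda>k. \<Union>f\<in>g. f ` F k)"

definition transverse :: "(nat \<Rightarrow> 'v::euclidean_space set) \<Rightarrow> (nat \<Rightarrow> 'v set) \<Rightarrow> bool" where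
  "transverse F H \<longleftrightarrow> (\<forall>k\<le>DIM('v). F k \<inter> H (DIM('v) - k) = {0})"

text \<open>
  A minor is forced to be zero by upper triangularity if it vanishes on every upper triangular
  matrix.
\<close>

definition totally_positive_unitriangular :: "real mat \<Rightarrow> bool" where
  "totally_positive_unitriangular M \<longleftrightarrow>
     square_mat M \<and> upper_triangular M \<and> (\<forall>i<dim_row M. M $$ (i, i) = 1) \<and>
     (\<forall>I J. I \<subseteq> {..<dim_row M} \<and> J \<subseteq> {..<dim_row M} \<and> card I = card J \<longrightarrow>
        Determinant.det (submatrix M I J) > 0 \<or>
        (\<forall>N \<in> carrier_mat (dim_row M) (dim_row M). upper_triangular N \<longrightarrow>
            Determinant.det (submatrix (N :: real mat) I J) = 0))"

definition U_pos :: "'v::euclidean_space list \<Rightarrow> ('v \<Rightarrow> 'v) set set" where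
  "U_pos B = {u \<in> carrier PGL. \<exists>f\<in>u. totally_positive_unitriangular (matrix_in B f)}"

definition positive_tuple :: "(nat \<Rightarrow> 'v::euclidean_space set) list \<Rightarrow> bool" where
  "positive_tuple Fs \<longleftrightarrow>
     3 \<le> length Fs \<and> (\<forall>F\<in>set Fs. flag F) \<and> transverse (hd Fs) (last Fs) \<and>
     (\<exists>B us. ordered_basis B \<and>
        (\<forall>k\<in>{1..DIM('v)}. B ! (k - 1) \<in> hd Fs (DIM('v) - k + 1) \<inter> last Fs k) \<and>
        length us = length Fs - 2 \<and> set us \<subseteq> U_pos B \<and>
        (\<forall>i\<le>length us. Fs ! i = foldr (\<otimes>\<^bsub>PGL\<^esub>) (take i us) \<one>\<^bsub>PGL\<^esub> \<cdot>\<^sub>F hd Fs))"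

definition loxodromic :: "('v::euclidean_space \<Rightarrow> 'v) set \<Rightarrow> bool" where
  "loxodromic g \<longleftrightarrow> g \<in> carrier PGL \<and> (\<exists>f\<in>g. \<exists>zs. eigenvalue_list f zs \<and> distinct (map cmod zs))"

text \<open>
  All eigenvalues of a loxodromic element are real and nonzero, since non-real ones would come in
  conjugate pairs of equal absolute value.
\<close>

definition positive_loxodromic :: "('v::euclidean_space \<Rightarrow> 'v) set \<Rightarrow> bool" where
  "positive_loxodromic g \<longleftrightarrow> loxodromic g \<and>
     (\<exists>f\<in>g. \<forall>c c'. real_eigenvalue f c \<and> real_eigenvalue f c' \<longrightarrow> sgn c = sgn c')"

text \<open>
  For loxodromic \<open>g\<close>, an eigenvalue is among the \<open>k\<close> largest (smallest) in absolute value iff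
  fewer than \<open>k\<close> eigenvalues have larger (smaller) absolute value; rescaling \<open>f\<close> does not affect
  this.
\<close>

definition attracting_flag :: "('v::euclidean_space \<Rightarrow> 'v) set \<Rightarrow> nat \<Rightarrow> 'v set" where
  "attracting_flag g = (\<lambda>k. span {v. \<exists>f\<in>g. \<exists>c. real_eigenvalue f c \<and> f v = c *\<^sub>R v \<and>
     card {c'. real_eigenvalue f c' \<and> \<bar>c'\<bar> > \<bar>c\<bar>} < k})"

definition repelling_flag :: "('v::euclidean_space \<Rightarrow> 'v) set \<Rightarrow> nat \<Rightarrow> 'v set" where
  "repelling_flag g = (\<lambda>k. span {v. \<exists>f\<in>g. \<exists>c. real_eigenvalue f c \<and> f v = c *\<^sub>R v \<and>
     card {c'. real_eigenvalue f c' \<and> \<bar>c'\<bar> < \<bar>c\<bar>} < k})"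

text \<open>
  The singular values are the square roots of the eigenvalues of \<open>adjoint f \<circ> f\<close>, in nonincreasing
  order.  As this map is diagonalizable, multiplicities are dimensions of eigenspaces.
\<close>

definition singular_values :: "('v::euclidean_space \<Rightarrow> 'v) \<Rightarrow> real list" where
  "singular_values f = (THE xs. sorted_wrt (\<ge>) xs \<and> (\<forall>s\<in>set xs. s \<ge> 0) \<and>
     (\<forall>s\<ge>0. count_list xs s = dim {v. adjoint f (f v) = s\<^sup>2 *\<^sub>R v}))"

text \<open>The representative with determinant \<open>\<plusminus>1\<close> is unique up to sign.\<close>

definition cartan_projection :: "('v::euclidean_space \<Rightarrow> 'v) set \<Rightarrow> real list" where
  "cartan_projection g = map ln (singular_values (SOME f. f \<in> g \<and> \<bar>linear_det f\<bar> = 1))"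

definition simple_roots :: "nat \<Rightarrow> (real list \<Rightarrow> real) set" where
  "simple_roots n = {(\<lambda>x. x ! (k - 1) - x ! k) | k. k \<in> {1..<n}}"

text \<open>The letter \<open>(x, True)\<close> stands for \<open>x\<close> and \<open>(x, False)\<close> for its inverse.\<close>

definition word_value :: "('g, 'm) monoid_scheme \<Rightarrow> ('g \<times> bool) list \<Rightarrow> 'g" where
  "word_value G w =
     foldr (\<lambda>(x, p) y. (if p then x else inv\<^bsub>G\<^esub> x) \<otimes>\<^bsub>G\<^esub> y) w \<one>\<^bsub>G\<^esub>"

definition reduced_word :: "('g \<times> bool) list \<Rightarrow> bool" where
  "reduced_word w \<longleftrightarrow> successively (\<lambda>(x, p) (y, q). \<not> (x = y \<and> p \<noteq> q)) w"

definition free_basis :: "('g, 'm) monoid_scheme \<Rightarrow> 'g set \<Rightarrow> bool" where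
  "free_basis G X \<longleftrightarrow> X \<subseteq> carrier G \<and> generate G X = carrier G \<and>
     (\<forall>w. fst ` set w \<subseteq> X \<and> reduced_word w \<and> w \<noteq> [] \<longrightarrow> word_value G w \<noteq> \<one>\<^bsub>G\<^esub>)"

definition free_group :: "('g, 'm) monoid_scheme \<Rightarrow> nat \<Rightarrow> bool" where
  "free_group G d \<longleftrightarrow> group G \<and> (\<exists>X. finite X \<and> card X = d \<and> free_basis G X)"

definition word_length :: "('g, 'm) monoid_scheme \<Rightarrow> 'g set \<Rightarrow> 'g \<Rightarrow> nat" where
  "word_length G S g = (LEAST l. \<exists>w. length w = l \<and> fst ` set w \<subseteq> S \<and> word_value G w = g)"

definition word_dist :: "('g, 'm) monoid_scheme \<Rightarrow> 'g set \<Rightarrow> 'g \<Rightarrow> 'g \<Rightarrow> nat" where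
  "word_dist G S g h = word_length G S (inv\<^bsub>G\<^esub> g \<otimes>\<^bsub>G\<^esub> h)"

definition primitive_element :: "('g, 'm) monoid_scheme \<Rightarrow> nat \<Rightarrow> 'g \<Rightarrow> bool" where
  "primitive_element G d g \<longleftrightarrow>
     (\<exists>gs. length gs = d \<and> d \<ge> 1 \<and> hd gs = g \<and> set gs \<subseteq> carrier G \<and>
        generate G (set gs) = carrier G)"

definition is_axis :: "('g, 'm) monoid_scheme \<Rightarrow> 'g set \<Rightarrow> 'g \<Rightarrow> (int \<Rightarrow> 'g) \<Rightarrow> bool" where
  "is_axis G S g \<eta> \<longleftrightarrow> g \<in> carrier G \<and> g \<noteq> \<one>\<^bsub>G\<^esub> \<and> range \<eta> \<subseteq> carrier G \<and>
     (\<forall>i j. int (word_dist G S (\<eta> i) (\<eta> j)) = \<bar>i - j\<bar>) \<and>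
     (\<lambda>h. g \<otimes>\<^bsub>G\<^esub> h) ` range \<eta> = range \<eta>"

definition primitive_geodesic ::
  "('g, 'm) monoid_scheme \<Rightarrow> nat \<Rightarrow> 'g set \<Rightarrow> (int \<Rightarrow> 'g) \<Rightarrow> bool" where
  "primitive_geodesic G d S \<eta> \<longleftrightarrow> (\<exists>g. primitive_element G d g \<and> is_axis G S g \<eta>)"

definition primitive_geodesic_ray ::
  "('g, 'm) monoid_scheme \<Rightarrow> nat \<Rightarrow> 'g set \<Rightarrow> (nat \<Rightarrow> 'g) \<Rightarrow> bool" where
  "primitive_geodesic_ray G d S \<eta> \<longleftrightarrow>
     (\<forall>i j. int (word_dist G S (\<eta> i) (\<eta> j)) = \<bar>int i - int j\<bar>) \<and>
     (\<exists>\<theta>. primitive_geodesic G d S \<theta> \<and> range \<eta> \<subseteq> range \<theta>)"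

definition primitive_stable ::
  "('g, 'm) monoid_scheme \<Rightarrow> nat \<Rightarrow> ('g \<Rightarrow> ('v::euclidean_space \<Rightarrow> 'v) set) \<Rightarrow> bool" where
  "primitive_stable G d \<rho> \<longleftrightarrow>
     (\<exists>S. finite S \<and> S \<subseteq> carrier G \<and> generate G S = carrier G \<and>
        (\<exists>\<kappa>>0. \<exists>\<kappa>'>0. \<forall>\<eta>. primitive_geodesic_ray G d S \<eta> \<and> \<eta> 0 = \<one>\<^bsub>G\<^esub> \<longrightarrow>
           (\<forall>i. \<forall>\<alpha>\<in>simple_roots DIM('v).
              \<alpha> (cartan_projection (\<rho> (\<eta> i))) \<ge> \<kappa> * real i - \<kappa>')))"

end

theory Submission
  imports Defs
begin

text \<open>
  Choose a basis \<open>E\<close> of eigenvectors of \<open>b\<close>, ordered by decreasing eigenvalue, and let \<open>M\<close> be the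
  matrix of \<open>a\<close> in \<open>E\<close>.  Either kind of positivity of the six flags makes \<open>M\<close> strictly sign regular:
  for every \<open>k\<close> all \<open>k \<times> k\<close> minors of \<open>M\<close> are nonzero and have the same sign
  (\<open>eigenframe_sign_regular\<close>, \<open>positive_tuple_sign_regular\<close>).  On the \<open>k\<close>-th exterior power, in the
  basis induced by \<open>E\<close>, the element \<open>a\<close> therefore acts, up to a sign, by a matrix with positive
  entries, while \<open>b\<close> acts by a positive diagonal matrix that has a strictly largest and a strictly
  smallest entry.

  Consider a product of such matrices in which \<open>a\<close> occurs with exponent \<open>1\<close> only.  Multiplication by
  a positive matrix averages the ratios of two columns, and a large power of the diagonal matrix
  moves almost all the weight of the average to one place.  So the columns become proportional at
  an exponential rate in the length of the word, that is, the \<open>2 \<times> 2\<close> minors are exponentially small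
  relative to the square of the largest entry (\<open>word_mat_two_minors\<close>).  For the matrix of the
  \<open>k\<close>-th exterior power of a transformation with singular values \<open>s\<^sub>1 \<ge> s\<^sub>2 \<ge> \<dots>\<close>, the ratio of the
  two largest singular values is \<open>s\<^sub>k\<^sub>+\<^sub>1 / s\<^sub>k\<close>, so that this ratio is exponentially small
  (\<open>singular_value_ratio\<close>, \<open>word_map_gap\<close>).  This is the required linear growth of the \<open>k\<close>-th simple
  root of the Cartan projection.

  It remains to see why words with both signs of \<open>a\<close> do not matter.  By Nielsen's theorem
  (\<open>nielsen_basis\<close>), every primitive element is conjugate to a positive word in \<open>\<gamma>\<^sub>1\<close> and one of
  \<open>\<gamma>\<^sub>2\<^sup>\<plusminus>\<^sup>1\<close>, or to the inverse of such a word (\<open>primitive_conjugate\<close>).  Comparing lengths with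
  exponent sums shows that in the word metric of \<open>{\<gamma>\<^sub>1, \<gamma>\<^sub>2}\<close> a primitive geodesic crosses edges
  labelled \<open>\<gamma>\<^sub>1\<close> in one direction only (\<open>primitive_ray_words\<close>).  If this direction is the negative one,
  then the inverse words are as above; in dimension \<open>n\<close>, inversion exchanges the \<open>k\<close>-th and the
  \<open>(n - k)\<close>-th simple root of the Cartan projection.
\<close>

section \<open>Words in a group\<close>

definition inv_letter :: "'g \<times> bool \<Rightarrow> 'g \<times> bool" where
  "inv_letter l = (fst l, \<not> snd l)"

definition inv_word :: "('g \<times> bool) list \<Rightarrow> ('g \<times> bool) list" where
  "inv_word w = rev (map inv_letter w)"

lemma inv_letter_simps [simp]:
  "inv_letter (inv_letter l) = l" "fst (inv_letter l) = fst l" "inv_letter l \<noteq> l" "l \<noteq> inv_letter l"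
  "inv_letter l = inv_letter m \<longleftrightarrow> l = m"
  by (auto simp: inv_letter_def prod_eq_iff)

lemma inv_word_simps [simp]:
  "inv_word [] = []" "inv_word (inv_word w) = w" "inv_word w = [] \<longleftrightarrow> w = []"
  "length (inv_word w) = length w" "inv_word (u @ v) = inv_word v @ inv_word u"
  "inv_word (l # w) = inv_word w @ [inv_letter l]"
  by (auto simp: inv_word_def rev_map comp_def)

lemma hd_inv_word [simp]: "w \<noteq> [] \<Longrightarrow> hd (inv_word w) = inv_letter (last w)"
  by (simp add: inv_word_def hd_rev last_map)

lemma last_inv_word [simp]: "w \<noteq> [] \<Longrightarrow> last (inv_word w) = inv_letter (hd w)"
  by (simp add: inv_word_def last_rev hd_map)

lemma fst_set_inv_word [simp]: "fst ` set (inv_word w) = fst ` set w"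
  by (auto simp: inv_word_def image_image)

lemma reduced_word_alt: "reduced_word w \<longleftrightarrow> successively (\<lambda>l m. m \<noteq> inv_letter l) w"
  unfolding reduced_word_def
  by (rule arg_cong[where f = "\<lambda>P. successively P w"]) (auto simp: fun_eq_iff inv_letter_def)

lemma reduced_word_Nil [simp]: "reduced_word []"
  and reduced_word_single [simp]: "reduced_word [l]"
  by (simp_all add: reduced_word_alt)

lemma reduced_word_append:
  "reduced_word (u @ v) \<longleftrightarrow>
     reduced_word u \<and> reduced_word v \<and> (u = [] \<or> v = [] \<or> hd v \<noteq> inv_letter (last u))"
  by (auto simp: reduced_word_alt successively_append_iff)

lemma reduced_word_Cons:
  "reduced_word (l # v) \<longleftrightarrow> reduced_word v \<and> (v = [] \<or> hd v \<noteq> inv_letter l)"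
  using reduced_word_append[of "[l]" v] by simp

lemma reduced_inv_word [simp]: "reduced_word (inv_word w) \<longleftrightarrow> reduced_word w"
proof (induction w)
  case (Cons l w)
  then show ?case by (cases "w = []") (auto simp: reduced_word_append reduced_word_Cons)
qed simp

text \<open>The exponent sum of \<open>z\<close> in a word, the homomorphism to the integers by which lengths of words are
  bounded from below.\<close>

definition expsum :: "'g \<Rightarrow> ('g \<times> bool) list \<Rightarrow> int" where
  "expsum z w = (\<Sum>l\<leftarrow>w. if fst l = z then (if snd l then 1 else - 1) else 0)"

lemma expsum_simps [simp]:
  "expsum z [] = 0" "expsum z (u @ v) = expsum z u + expsum z v" "expsum z (inv_word w) = - expsum z w"
proof -
  show "expsum z (inv_word w) = - expsum z w"
    by (induction w) (auto simp: expsum_def inv_letter_def inv_word_def)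
qed (auto simp: expsum_def)

lemma expsum_Cons: "expsum z (l # w) = (if fst l = z then (if snd l then 1 else - 1) else 0) + expsum z w"
  by (simp add: expsum_def)

context group begin

lemma cancel_left [simp]:
  "a \<in> carrier G \<Longrightarrow> b \<in> carrier G \<Longrightarrow> a \<otimes> (inv a \<otimes> b) = b"
  "a \<in> carrier G \<Longrightarrow> b \<in> carrier G \<Longrightarrow> inv a \<otimes> (a \<otimes> b) = b"
  by (simp_all add: m_assoc[symmetric])

lemma word_value_simps [simp]:
  "word_value G [] = \<one>"
  "word_value G (l # w) = (if snd l then fst l else inv (fst l)) \<otimes> word_value G w"
  by (auto simp: word_value_def case_prod_beta)

lemma word_value_closed [simp]: "fst ` set w \<subseteq> carrier G \<Longrightarrow> word_value G w \<in> carrier G"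
  by (induction w) auto

lemma word_value_append [simp]:
  "fst ` set u \<subseteq> carrier G \<Longrightarrow> fst ` set v \<subseteq> carrier G \<Longrightarrow>
   word_value G (u @ v) = word_value G u \<otimes> word_value G v"
  by (induction u) (auto simp: m_assoc)

lemma word_value_inv_word [simp]:
  "fst ` set u \<subseteq> carrier G \<Longrightarrow> word_value G (inv_word u) = inv (word_value G u)"
  by (induction u) (auto simp: inv_mult_group inv_letter_def)

text \<open>Cancellation, with a record of what it preserves: exponent sums survive, and the length drops
  unless the word was already reduced.\<close>

lemma exists_reduced_word:
  assumes "fst ` set w \<subseteq> carrier G"
  shows "\<exists>w'. reduced_word w' \<and> set w' \<subseteq> set w \<and> word_value G w' = word_value G w \<and>
              length w' \<le> length w \<and> (length w' = length w \<longrightarrow> w' = w) \<and>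
              (\<forall>z. expsum z w' = expsum z w)"
  using assms
proof (induction w)
  case Nil
  show ?case by (intro exI[of _ "[]"]) auto
next
  case (Cons l w)
  then obtain w' where w': "reduced_word w'" "set w' \<subseteq> set w" "word_value G w' = word_value G w"
     "length w' \<le> length w" "\<And>z. expsum z w' = expsum z w" "length w' = length w \<longrightarrow> w' = w" by auto
  show ?case
  proof (cases "w' \<noteq> [] \<and> hd w' = inv_letter l")
    case True
    then obtain w'' where w'': "w' = inv_letter l # w''" by (cases w') auto
    have c: "fst ` set w'' \<subseteq> carrier G" "fst l \<in> carrier G" using w' w'' Cons.prems by auto
    have e: "expsum z (l # w) = expsum z w''" for z
    proof -
      have "expsum z w = (if fst l = z then (if snd l then - 1 else 1) else 0) + expsum z w''"
        unfolding w'(5)[of z, symmetric] w'' expsum_Cons by (simp add: inv_letter_def)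
      then show ?thesis by (simp add: expsum_Cons)
    qed
    have v: "word_value G (l # w) = word_value G w''"
      unfolding word_value_simps w'(3)[symmetric] w'' using c by (simp add: inv_letter_def)
    show ?thesis
      apply (rule exI[of _ w''])
      using w' w'' e v by (auto simp: reduced_word_Cons)
  next
    case False
    then show ?thesis using w' Cons.prems
      by (intro exI[of _ "l # w'"]) (auto simp: reduced_word_Cons expsum_Cons)
  qed
qed

lemma generate_iff_word:
  assumes "S \<subseteq> carrier G"
  shows "g \<in> generate G S \<longleftrightarrow> (\<exists>w. fst ` set w \<subseteq> S \<and> word_value G w = g)"
proof
  assume "g \<in> generate G S"
  then show "\<exists>w. fst ` set w \<subseteq> S \<and> word_value G w = g"
  proof (induction rule: generate.induct)
    case one
    show ?case by (intro exI[of _ "[]"]) simp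
  next
    case (incl h)
    then show ?case using assms by (intro exI[of _ "[(h, True)]"]) auto
  next
    case (inv h)
    then show ?case using assms by (intro exI[of _ "[(h, False)]"]) auto
  next
    case (eng h1 h2)
    then obtain u v where "fst ` set u \<subseteq> S \<and> word_value G u = h1" "fst ` set v \<subseteq> S \<and> word_value G v = h2" by blast
    then show ?case using assms
      by (intro exI[of _ "u @ v"]) (auto simp: image_Un)
  qed
next
  assume "\<exists>w. fst ` set w \<subseteq> S \<and> word_value G w = g"
  then obtain w where w: "fst ` set w \<subseteq> S" "word_value G w = g" by blast
  have "fst ` set w \<subseteq> S \<Longrightarrow> word_value G w \<in> generate G S"
  proof (induction w)
    case (Cons l w)
    then have "(if snd l then fst l else inv (fst l)) \<in> generate G S"
      by (auto intro: generate.incl generate.inv)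
    then show ?case using Cons by (auto intro: generate.eng)
  qed (auto intro: generate.one)
  then show "g \<in> generate G S" using w by auto
qed

text \<open>Conjugation is included among the moves, because only the conjugacy classes of primitive
  elements matter later and because it makes the length reduction below short.\<close>

inductive nielsen :: "'a \<Rightarrow> 'a \<Rightarrow> 'a \<Rightarrow> 'a \<Rightarrow> bool" for g0 h0 where
  refl: "nielsen g0 h0 g0 h0"
| swap: "nielsen g0 h0 g h \<Longrightarrow> nielsen g0 h0 h g"
| invert: "nielsen g0 h0 g h \<Longrightarrow> nielsen g0 h0 (inv g) h"
| mult: "nielsen g0 h0 g h \<Longrightarrow> nielsen g0 h0 (g \<otimes> h) h"
| conj: "nielsen g0 h0 g h \<Longrightarrow> c \<in> carrier G \<Longrightarrow> nielsen g0 h0 (c \<otimes> g \<otimes> inv c) (c \<otimes> h \<otimes> inv c)"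

lemma nielsen_closed:
  "nielsen g0 h0 g h \<Longrightarrow> g0 \<in> carrier G \<Longrightarrow> h0 \<in> carrier G \<Longrightarrow> g \<in> carrier G \<and> h \<in> carrier G"
  by (induction rule: nielsen.induct) auto

lemma nielsen_trans: "nielsen g1 h1 g2 h2 \<Longrightarrow> nielsen g0 h0 g1 h1 \<Longrightarrow> nielsen g0 h0 g2 h2"
  by (induction rule: nielsen.induct) (auto intro: nielsen.intros)

lemma nielsen_invert2: "nielsen g0 h0 g h \<Longrightarrow> nielsen g0 h0 g (inv h)"
  by (blast intro: nielsen.intros)

lemma nielsen_sym:
  "nielsen g0 h0 g h \<Longrightarrow> g0 \<in> carrier G \<Longrightarrow> h0 \<in> carrier G \<Longrightarrow> nielsen g h g0 h0"
proof (induction rule: nielsen.induct)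
  case refl
  show ?case by (rule nielsen.refl)
next
  case (swap g h)
  then show ?case by (meson nielsen.refl nielsen.swap nielsen_trans)
next
  case (invert g h)
  then have c: "g \<in> carrier G" using nielsen_closed by blast
  have "nielsen (inv g) h (inv (inv g)) h" by (intro nielsen.invert nielsen.refl)
  then show ?case using invert c by (metis inv_inv nielsen_trans)
next
  case (mult g h)
  then have c: "g \<in> carrier G" "h \<in> carrier G" using nielsen_closed by blast+
  have "nielsen (g \<otimes> h) h ((g \<otimes> h) \<otimes> inv h) (inv (inv h))"
    by (intro nielsen_invert2 nielsen.mult nielsen.refl)
  then have "nielsen (g \<otimes> h) h g h" using c by (simp add: m_assoc)
  then show ?case using mult nielsen_trans by blast
next
  case (conj g h c)
  then have c: "g \<in> carrier G" "h \<in> carrier G" using nielsen_closed by blast+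
  have "nielsen (c \<otimes> g \<otimes> inv c) (c \<otimes> h \<otimes> inv c)
     (inv c \<otimes> (c \<otimes> g \<otimes> inv c) \<otimes> inv (inv c)) (inv c \<otimes> (c \<otimes> h \<otimes> inv c) \<otimes> inv (inv c))"
    using conj by (intro nielsen.conj nielsen.refl) auto
  then have "nielsen (c \<otimes> g \<otimes> inv c) (c \<otimes> h \<otimes> inv c) g h" using c conj by (simp add: m_assoc)
  then show ?case using conj nielsen_trans by blast
qed

lemma nielsen_conj':
  assumes "g \<in> carrier G" "h \<in> carrier G" "c \<in> carrier G"
  shows "nielsen g h (inv c \<otimes> g \<otimes> c) (inv c \<otimes> h \<otimes> c)"
  using nielsen.conj[OF nielsen.refl, of "inv c" g h] assms by simp

lemma nielsen_left_div:
  assumes "g \<in> carrier G" "h \<in> carrier G"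
  shows "nielsen g h g (inv g \<otimes> h)"
proof -
  have "nielsen g h (inv (inv h \<otimes> inv (inv g))) g"
    by (metis assms inv_closed inv_inv nielsen.invert nielsen.mult nielsen.refl nielsen.swap)
  then show ?thesis using assms by (simp add: inv_mult_group nielsen.swap)
qed

lemma nielsen_right_div:
  assumes "g \<in> carrier G" "h \<in> carrier G"
  shows "nielsen g h g (h \<otimes> inv g)"
proof -
  have "nielsen g h (h \<otimes> inv g) (inv (inv g))"
    by (metis nielsen.invert nielsen.mult nielsen.refl nielsen.swap)
  then show ?thesis using assms by (simp add: nielsen.swap)
qed

lemma nielsen_generate:
  assumes "nielsen g0 h0 g h" "g0 \<in> carrier G" "h0 \<in> carrier G" "generate G {g0, h0} = carrier G"
  shows "generate G {g, h} = carrier G"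
  using assms
proof (induction rule: nielsen.induct)
  case (swap g h)
  then show ?case by (simp add: insert_commute)
next
  case (invert g h)
  then have c: "g \<in> carrier G" "h \<in> carrier G" using nielsen_closed by blast+
  have "z \<in> generate G {inv g, h}" if "z \<in> generate G {g, h}" for z
    using that
  proof (induction rule: generate.induct)
    case (incl k)
    then show ?case using c generate.incl[of h "{inv g, h}" G] generate.inv[of "inv g" "{inv g, h}" G] by auto
  next
    case (inv k)
    then show ?case
      using generate.incl[of "inv g" "{inv g, h}" G] generate.inv[of h "{inv g, h}" G] by auto
  qed (auto intro: generate.intros)
  then show ?case using invert c by (auto dest: generate_in_carrier[of "{inv g, h}", rotated])
next
  case (mult g h)
  then have c: "g \<in> carrier G" "h \<in> carrier G" using nielsen_closed by blast+
  let ?H = "generate G {g \<otimes> h, h}"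
  have H: "subgroup ?H G" using c by (intro generate_is_subgroup) auto
  have "(g \<otimes> h) \<otimes> inv h \<in> ?H"
    by (intro generate.eng generate.incl generate.inv) auto
  then have "g \<in> ?H" using c by (simp add: m_assoc)
  moreover have "h \<in> ?H" by (auto intro: generate.incl)
  ultimately have "generate G {g, h} \<subseteq> ?H" using H by (intro generate_subgroup_incl) auto
  then show ?case using mult c H by (auto dest: subgroup.mem_carrier)
next
  case (conj g h c)
  then have c: "g \<in> carrier G" "h \<in> carrier G" using nielsen_closed by blast+
  let ?H = "generate G {c \<otimes> g \<otimes> inv c, c \<otimes> h \<otimes> inv c}"
  have H: "subgroup ?H G" using c conj by (intro generate_is_subgroup) auto
  have *: "z \<in> carrier G \<and> c \<otimes> z \<otimes> inv c \<in> ?H" if "z \<in> generate G {g, h}" for z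
    using that
  proof (induction rule: generate.induct)
    case one
    then show ?case using conj by (auto intro: generate.one)
  next
    case (incl k)
    then show ?case using c by (auto intro: generate.incl)
  next
    case (inv k)
    then have "inv (c \<otimes> k \<otimes> inv c) \<in> ?H" by (auto intro: generate.inv)
    then show ?case using inv c conj by (auto simp: inv_mult_group m_assoc)
  next
    case (eng h1 h2)
    then have "(c \<otimes> h1 \<otimes> inv c) \<otimes> (c \<otimes> h2 \<otimes> inv c) \<in> ?H" by (auto intro: generate.eng)
    then show ?case using eng conj by (auto simp: m_assoc)
  qed
  have "z \<in> ?H" if "z \<in> carrier G" for z
  proof -
    have "c \<otimes> (inv c \<otimes> z \<otimes> c) \<otimes> inv c \<in> ?H" using * conj that by auto
    then show ?thesis using that conj by (simp add: m_assoc)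
  qed
  then show ?case using H by (auto dest: subgroup.mem_carrier)
qed auto

text \<open>
  Values of nonempty reduced words in two symbols, together with the first letter of the word.  The
  symbols are \<open>True\<close> and \<open>False\<close> and \<open>k\<close> assigns group elements to them; remembering the first letter
  is what a ping-pong argument needs.
\<close>

inductive alternating :: "(bool \<Rightarrow> 'a) \<Rightarrow> bool \<times> bool \<Rightarrow> 'a \<Rightarrow> bool" for k where
  single: "alternating k s (if snd s then k (fst s) else inv (k (fst s)))"
| step: "alternating k t z \<Longrightarrow> t \<noteq> inv_letter s \<Longrightarrow>
     alternating k s ((if snd s then k (fst s) else inv (k (fst s))) \<otimes> z)"

lemma alternating_generate:
  assumes k: "\<And>b. k b \<in> carrier G" and z: "z \<in> generate G {k True, k False}"
  shows "z = \<one> \<or> (\<exists>s. alternating k s z)"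
proof -
  have closed: "alternating k s z \<Longrightarrow> z \<in> carrier G" for s z
    by (induction rule: alternating.induct) (auto simp: k)
  have step: "(if snd s then k (fst s) else inv (k (fst s))) \<otimes> z = \<one> \<or>
     (\<exists>t. alternating k t ((if snd s then k (fst s) else inv (k (fst s))) \<otimes> z))"
    if "z = \<one> \<or> (\<exists>s. alternating k s z)" for s z
    using that
  proof
    assume "z = \<one>"
    then show ?thesis using alternating.single[of k s] by (intro disjI2 exI[of _ s]) (simp add: k)
  next
    assume "\<exists>t. alternating k t z"
    then obtain t where t: "alternating k t z" by blast
    show ?thesis
    proof (cases "t = inv_letter s")
      case False
      then show ?thesis using alternating.step[OF t] by blast
    next
      case True
      from t show ?thesis
      proof cases
        case single
        then show ?thesis using True by (auto simp: inv_letter_def k)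
      next
        case (step t' z')
        then have "(if snd s then k (fst s) else inv (k (fst s))) \<otimes> z = z'"
          using True closed[OF step(2)] by (auto simp: inv_letter_def k)
        then show ?thesis using step(2) by (intro disjI2 exI[of _ t']) simp
      qed
    qed
  qed
  obtain w where w: "fst ` set w \<subseteq> {k True, k False}" "word_value G w = z"
    using z generate_iff_word[of "{k True, k False}"] k by auto
  have "fst ` set w \<subseteq> {k True, k False} \<Longrightarrow> word_value G w = \<one> \<or> (\<exists>s. alternating k s (word_value G w))"
  proof (induction w)
    case (Cons l w)
    then obtain b where "fst l = k b" by auto
    then show ?case using step[of "word_value G w" "(b, snd l)"] Cons
      by (cases "snd l") (simp_all del: split_paired_Ex)
  qed simp
  then show ?thesis using w by auto
qed

end

section \<open>Generating pairs of a free group of rank two\<close>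

lemma common_prefix:
  obtains p u' v' where "u = p @ u'" "v = p @ v'" "u' = [] \<or> v' = [] \<or> hd u' \<noteq> hd v'"
proof -
  have "\<exists>p u' v'. u = p @ u' \<and> v = p @ v' \<and> (u' = [] \<or> v' = [] \<or> hd u' \<noteq> hd v')"
  proof (induction u arbitrary: v)
    case (Cons l u)
    show ?case
    proof (cases "v \<noteq> [] \<and> hd v = l")
      case True
      then obtain v1 where v: "v = l # v1" by (cases v) auto
      from Cons[of v1] obtain p u' v' where "u = p @ u'" "v1 = p @ v'" "u' = [] \<or> v' = [] \<or> hd u' \<noteq> hd v'"
        by blast
      then show ?thesis using v by (intro exI[of _ "l # p"] exI[of _ u'] exI[of _ v']) simp
    next
      case False
      then show ?thesis by (intro exI[of _ "[]"] exI[of _ "l # u"] exI[of _ v]) auto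
    qed
  qed auto
  then show thesis using that by blast
qed

lemma common_suffix:
  obtains s t r where "u = s @ r" "v = t @ r" "s = [] \<or> t = [] \<or> last s \<noteq> last t"
proof -
  obtain p u' v' where *: "rev u = p @ u'" "rev v = p @ v'" "u' = [] \<or> v' = [] \<or> hd u' \<noteq> hd v'"
    by (rule common_prefix)
  show thesis
    by (rule that[of "rev u'" "rev p" "rev v'"])
       (use * in \<open>auto simp: rev_swap last_rev\<close>)
qed

text \<open>The core \<open>c\<close> is cyclically reduced, so that its powers are reduced as written.\<close>

lemma cyclic_core:
  assumes "reduced_word u" "u \<noteq> []"
  obtains X c where "u = X @ c @ inv_word X" "c \<noteq> []" "hd c \<noteq> inv_letter (last c)"
proof -
  have "\<exists>X c. u = X @ c @ inv_word X \<and> c \<noteq> [] \<and> hd c \<noteq> inv_letter (last c)"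
    using assms
  proof (induction "length u" arbitrary: u rule: less_induct)
    case less
    show ?case
    proof (cases "hd u = inv_letter (last u)")
      case False
      then show ?thesis using less by (intro exI[of _ "[]"] exI[of _ u]) auto
    next
      case True
      obtain l u1 where u: "u = l # u1" using less by (cases u) auto
      have "u1 \<noteq> []" using True u by auto
      then obtain u2 where u2: "u1 = u2 @ [inv_letter l]"
        using True u by (metis append_butlast_last_id inv_letter_simps(1) last_ConsR list.sel(1))
      have "u2 \<noteq> []" using less u u2 by (auto simp: reduced_word_Cons)
      moreover have "reduced_word u2" using less u u2 by (auto simp: reduced_word_Cons reduced_word_append)
      ultimately obtain X c where "u2 = X @ c @ inv_word X" "c \<noteq> []" "hd c \<noteq> inv_letter (last c)"
        using less.hyps[of u2] u u2 by auto
      then show ?thesis using u u2 by (intro exI[of _ "l # X"] exI[of _ c]) auto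
    qed
  qed
  then show thesis using that by blast
qed

locale free_pair = group G for G :: "('g, 'm) monoid_scheme" (structure) +
  fixes x y :: 'g
  assumes free: "free_basis G {x, y}" and xy: "x \<noteq> y"
begin

definition is_word :: "('g \<times> bool) list \<Rightarrow> bool" where
  "is_word w \<longleftrightarrow> fst ` set w \<subseteq> {x, y}"

lemma basis_closed [simp]: "x \<in> carrier G" "y \<in> carrier G"
  using free by (auto simp: free_basis_def)

lemma is_word_carrier [simp]: "is_word w \<Longrightarrow> fst ` set w \<subseteq> carrier G"
  using basis_closed unfolding is_word_def by blast

lemma is_word_simps [simp]:
  "is_word []" "is_word (u @ v) \<longleftrightarrow> is_word u \<and> is_word v" "is_word (inv_word u) \<longleftrightarrow> is_word u"
  "is_word (l # w) \<longleftrightarrow> (fst l = x \<or> fst l = y) \<and> is_word w"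
  by (auto simp: is_word_def image_Un)

lemma word_value_word [simp]:
  "is_word u \<Longrightarrow> word_value G u \<in> carrier G"
  "is_word u \<Longrightarrow> is_word v \<Longrightarrow> word_value G (u @ v) = word_value G u \<otimes> word_value G v"
  "is_word u \<Longrightarrow> word_value G (inv_word u) = inv (word_value G u)"
  by simp_all

lemma word_exists:
  assumes "g \<in> carrier G"
  obtains w where "is_word w" "reduced_word w" "word_value G w = g"
proof -
  have "g \<in> generate G {x, y}" using free assms by (auto simp: free_basis_def)
  then obtain w where w: "is_word w" "word_value G w = g"
    by (auto simp: generate_iff_word is_word_def)
  then obtain w' where "reduced_word w'" "set w' \<subseteq> set w" "word_value G w' = word_value G w"
    using exists_reduced_word[of w] by auto
  then show thesis using w by (intro that[of w']) (auto simp: is_word_def)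
qed

lemma reduced_word_nontrivial:
  "is_word w \<Longrightarrow> reduced_word w \<Longrightarrow> w \<noteq> [] \<Longrightarrow> word_value G w \<noteq> \<one>"
  using free by (auto simp: free_basis_def is_word_def)

lemma reduced_word_unique:
  assumes "is_word u" "is_word v" "reduced_word u" "reduced_word v" "word_value G u = word_value G v"
  shows "u = v"
  using assms
proof (induction u arbitrary: v)
  case Nil
  then show ?case using reduced_word_nontrivial[of v] by auto
next
  case (Cons l u)
  have "fst l \<in> {x, y}" and u: "is_word u" "reduced_word u"
    using Cons.prems(1,3) unfolding is_word_def by (auto simp: reduced_word_Cons)
  then have lc: "fst l \<in> carrier G" using basis_closed by blast
  show ?case
  proof (cases "v \<noteq> [] \<and> hd v = l")
    case True
    then obtain v' where v: "v = l # v'" by (cases v) auto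
    have "is_word v'" "reduced_word v'" "(if snd l then fst l else inv (fst l)) \<in> carrier G"
      using Cons.prems v lc by (auto simp: reduced_word_Cons)
    moreover have "word_value G u = word_value G v'"
    proof -
      let ?c = "if snd l then fst l else inv (fst l)"
      have "inv ?c \<otimes> (?c \<otimes> word_value G u) = inv ?c \<otimes> (?c \<otimes> word_value G v')"
        using Cons.prems(5) unfolding v by simp
      then show ?thesis
        using cancel_left(2)[OF \<open>?c \<in> carrier G\<close>] u calculation by (simp del: cancel_left)
    qed
    ultimately show ?thesis using Cons.IH[of v'] u v by simp
  next
    case False
    have "reduced_word (inv_word (l # u) @ v)"
      unfolding reduced_word_append reduced_inv_word using Cons.prems(3,4) False
      by (auto simp del: inv_word_simps(6))
    moreover have "word_value G (inv_word (l # u) @ v) = \<one>"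
    proof -
      have "word_value G (inv_word (l # u) @ v) = inv (word_value G (l # u)) \<otimes> word_value G v"
        using is_word_carrier[OF Cons.prems(1)] is_word_carrier[OF Cons.prems(2)]
        by (subst word_value_append) (simp_all only: word_value_inv_word fst_set_inv_word)
      then show ?thesis using Cons.prems(5) is_word_carrier[OF Cons.prems(2)] by simp
    qed
    ultimately show ?thesis using reduced_word_nontrivial[of "inv_word (l # u) @ v"] Cons.prems(1,2) by auto
  qed
qed

lemma expsum_unique:
  assumes "is_word u" "is_word v" "word_value G u = word_value G v"
  shows "expsum z u = expsum z v"
proof -
  let ?w = "u @ inv_word v"
  have w: "is_word ?w" "word_value G ?w = \<one>" using assms by auto
  obtain w' where w': "reduced_word w'" "set w' \<subseteq> set ?w" "word_value G w' = word_value G ?w"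
     "\<And>z. expsum z w' = expsum z ?w" using exists_reduced_word[OF is_word_carrier[OF w(1)]] by blast
  have "is_word w'" using w' w(1) unfolding is_word_def by blast
  then have "w' = []" using reduced_word_nontrivial[of w'] w' w by auto
  then show ?thesis using w'(4)[of z] by simp
qed

end

context group begin

text \<open>Two homomorphisms to the integers that take the values of a dual basis on \<open>(g, h)\<close>.\<close>

definition dual_pair :: "'a \<Rightarrow> 'a \<Rightarrow> ('a \<Rightarrow> int) \<Rightarrow> ('a \<Rightarrow> int) \<Rightarrow> bool" where
  "dual_pair g h e1 e2 \<longleftrightarrow>
     (\<forall>u\<in>carrier G. \<forall>v\<in>carrier G. e1 (u \<otimes> v) = e1 u + e1 v \<and> e2 (u \<otimes> v) = e2 u + e2 v) \<and>
     e1 g = 1 \<and> e1 h = 0 \<and> e2 g = 0 \<and> e2 h = 1"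

lemma additive_one_inv:
  fixes e :: "'a \<Rightarrow> int"
  assumes "\<And>u v. u \<in> carrier G \<Longrightarrow> v \<in> carrier G \<Longrightarrow> e (u \<otimes> v) = e u + e v"
  shows "e \<one> = 0" and "u \<in> carrier G \<Longrightarrow> e (inv u) = - e u"
proof -
  show 1: "e \<one> = 0" using assms[of \<one> \<one>] by simp
  show "u \<in> carrier G \<Longrightarrow> e (inv u) = - e u" using assms[of u "inv u"] 1 by simp
qed

text \<open>Each Nielsen move acts on dual pairs by the transposed inverse matrix; conjugation acts
  trivially.\<close>

lemma nielsen_dual_pair:
  assumes "nielsen g0 h0 g h" "g0 \<in> carrier G" "h0 \<in> carrier G" "\<exists>e1 e2. dual_pair g0 h0 e1 e2"
  shows "\<exists>e1 e2. dual_pair g h e1 e2"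
  using assms
proof (induction rule: nielsen.induct)
  case (swap g h)
  then obtain e1 e2 where "dual_pair g h e1 e2" by blast
  then have "dual_pair h g e2 e1" by (auto simp: dual_pair_def)
  then show ?case by blast
next
  case (invert g h)
  then obtain e1 e2 where e: "dual_pair g h e1 e2" by blast
  moreover have "g \<in> carrier G" using nielsen_closed invert by blast
  ultimately have "dual_pair (inv g) h (\<lambda>z. - e1 z) e2"
    using additive_one_inv(2)[of e1 g] additive_one_inv(2)[of e2 g] by (auto simp: dual_pair_def)
  then show ?case by blast
next
  case (mult g h)
  then obtain e1 e2 where e: "dual_pair g h e1 e2" by blast
  moreover have "g \<in> carrier G" "h \<in> carrier G" using nielsen_closed mult by blast+
  ultimately have "dual_pair (g \<otimes> h) h e1 (\<lambda>z. e2 z - e1 z)"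
    by (auto simp: dual_pair_def)
  then show ?case by blast
next
  case (conj g h c)
  then obtain e1 e2 where e: "dual_pair g h e1 e2" by blast
  moreover have "g \<in> carrier G" "h \<in> carrier G" using nielsen_closed conj by blast+
  ultimately have "dual_pair (c \<otimes> g \<otimes> inv c) (c \<otimes> h \<otimes> inv c) e1 e2"
    using additive_one_inv(2)[of e1 c] additive_one_inv(2)[of e2 c] conj by (auto simp: dual_pair_def)
  then show ?case by blast
qed auto

end

context free_pair begin

text \<open>Exponent sums of any word representing an element.\<close>

lemma dual_pair_basis: "\<exists>e1 e2. dual_pair x y e1 e2"
proof -
  define W where "W g = (SOME w. is_word w \<and> word_value G w = g)" for g
  have W: "is_word (W g) \<and> word_value G (W g) = g" if "g \<in> carrier G" for g
    unfolding W_def by (rule someI_ex) (use word_exists[OF that] in blast)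
  have add: "expsum z (W (u \<otimes> v)) = expsum z (W u) + expsum z (W v)"
    if "u \<in> carrier G" "v \<in> carrier G" for u v z
    using expsum_unique[of "W (u \<otimes> v)" "W u @ W v" z] W[OF that(1)] W[OF that(2)] W[of "u \<otimes> v"] that
    by auto
  have gen: "expsum z (W s) = expsum z [(s, True)]" if "s = x \<or> s = y" for s z
    using expsum_unique[of "W s" "[(s, True)]"] W[of s] that by auto
  have "dual_pair x y (\<lambda>g. expsum x (W g)) (\<lambda>g. expsum y (W g))"
    unfolding dual_pair_def using add xy by (auto simp: gen expsum_Cons)
  then show ?thesis by blast
qed

text \<open>In the abelianization \<open>\<int>\<^sup>2\<close> the multiples of one vector cannot contain both basis vectors.\<close>

lemma not_cyclic:
  assumes "h \<in> carrier G" "generate G {\<one>, h} = carrier G"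
  shows False
proof -
  obtain e1 e2 where e: "dual_pair x y e1 e2" using dual_pair_basis by blast
  have one_exp: "e1 \<one> = 0" "e2 \<one> = 0" and inv_exp: "e1 (inv h) = - e1 h" "e2 (inv h) = - e2 h"
    using additive_one_inv[where e = e1] additive_one_inv[where e = e2] e assms by (auto simp: dual_pair_def)
  have *: "z \<in> carrier G \<and> (\<exists>m. e1 z = m * e1 h \<and> e2 z = m * e2 h)" if "z \<in> generate G {\<one>, h}" for z
    using that
  proof (induction rule: generate.induct)
    case one
    then show ?case using one_exp by (auto intro: exI[of _ 0])
  next
    case (incl k)
    then show ?case using assms one_exp by (auto intro: exI[of _ 0] exI[of _ 1])
  next
    case (inv k)
    then show ?case using assms one_exp inv_exp
      by (auto intro: exI[of _ 0] exI[of _ "-1"])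
  next
    case (eng h1 h2)
    then obtain m m' where "e1 h1 = m * e1 h \<and> e2 h1 = m * e2 h" "e1 h2 = m' * e1 h \<and> e2 h2 = m' * e2 h" by blast
    then show ?case using eng e by (auto simp: dual_pair_def algebra_simps intro!: exI[of _ "m + m'"])
  qed
  obtain m m' where "1 = m * e1 h \<and> 0 = m * e2 h" "0 = m' * e1 h \<and> 1 = m' * e2 h"
    using *[of x] *[of y] assms e by (auto simp: dual_pair_def)
  then show False by (metis mult_zero_left mult_eq_0_iff zero_neq_one)
qed

text \<open>
  The ping-pong scheme used twice below.  Let \<open>\<Phi> s z\<close> describe the reduced words \<open>z\<close> that may arise
  from a nonempty reduced product of \<open>u\<close>, \<open>v\<close> and their inverses whose first factor is \<open>s\<close>.  If \<open>\<Phi>\<close>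
  is kept when a factor that does not cancel is put in front, then every nontrivial element of the
  generated subgroup satisfies it; when \<open>u\<close> and \<open>v\<close> generate the group, so do the letters.
\<close>

lemma alternating_word:
  fixes u v :: "('g \<times> bool) list"
  assumes u: "is_word u" and v: "is_word v"
    and pw_def: "\<And>s. pw s = (let w = (if fst s then u else v) in if snd s then w else inv_word w)"
    and base: "\<And>s. \<Phi> s (pw s)"
    and step: "\<And>s t z. \<Phi> t z \<Longrightarrow> is_word z \<Longrightarrow> t \<noteq> inv_letter s \<Longrightarrow>
       \<exists>z'. \<Phi> s z' \<and> is_word z' \<and> word_value G z' = word_value G (pw s) \<otimes> word_value G z"
    and red: "\<And>s z. \<Phi> s z \<Longrightarrow> reduced_word z"
    and gen: "generate G {word_value G u, word_value G v} = carrier G"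
    and w: "is_word w" "reduced_word w" "w \<noteq> []"
  shows "\<exists>s. \<Phi> s w"
proof -
  let ?k = "\<lambda>b. word_value G (if b then u else v)"
  have kpw: "(if snd s then ?k (fst s) else inv (?k (fst s))) = word_value G (pw s)" for s
    using u v by (auto simp: pw_def)
  have pw: "is_word (pw s)" for s using u v by (auto simp: pw_def Let_def)
  have *: "\<exists>z'. \<Phi> s z' \<and> is_word z' \<and> word_value G z' = z" if "alternating ?k s z" for s z
    using that
  proof (induction rule: alternating.induct)
    case (single s)
    show ?case unfolding kpw using base pw by blast
  next
    case (step t z s)
    then obtain z' where "\<Phi> t z'" "is_word z'" "word_value G z' = z" by blast
    then show ?case unfolding kpw using assms(5)[of t z' s] step(2) by auto
  qed
  have "word_value G w \<in> generate G {?k True, ?k False}" using gen w by simp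
  then have "word_value G w = \<one> \<or> (\<exists>s. alternating ?k s (word_value G w))"
    by (intro alternating_generate) (use u v in auto)
  then obtain s where "alternating ?k s (word_value G w)" using reduced_word_nontrivial[of w] w by blast
  then obtain z' where "\<Phi> s z'" "is_word z'" "word_value G z' = word_value G w" using * by blast
  then show ?thesis using reduced_word_unique[of z' w] red w by blast
qed

abbreviation wpow :: "('g \<times> bool) list \<Rightarrow> bool \<Rightarrow> ('g \<times> bool) list" where
  "wpow w p \<equiv> (if p then w else inv_word w)"

text \<open>
  Suppose that no cancellation occurs between a factor \<open>u\<^sup>\<plusminus>\<^sup>1\<close> and a factor \<open>v\<^sup>\<plusminus>\<^sup>1\<close>, and write the
  factors as conjugates \<open>X c X\<^sup>-\<^sup>1\<close> of cyclically reduced words.  Then only \<open>X\<^sup>-\<^sup>1 X\<close> cancels in a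
  reduced product, which therefore starts with \<open>X c\<close> of its first factor.  If the value is a letter,
  then \<open>X\<close> is empty and \<open>c\<close> is that letter.
\<close>

lemma disjoint_ends_letters:
  assumes u: "is_word u" "reduced_word u" "u \<noteq> []" and v: "is_word v" "reduced_word v" "v \<noteq> []"
    and gen: "generate G {word_value G u, word_value G v} = carrier G"
    and disj: "\<And>p q. hd (wpow u p) \<noteq> hd (wpow v q)"
    and c: "c = x \<or> c = y"
  shows "\<exists>b p. wpow (if b then u else v) p = [(c, True)]"
proof -
  obtain X1 c1 where 1: "u = X1 @ c1 @ inv_word X1" "c1 \<noteq> []" "hd c1 \<noteq> inv_letter (last c1)"
    by (rule cyclic_core[OF u(2,3)])
  obtain X2 c2 where 2: "v = X2 @ c2 @ inv_word X2" "c2 \<noteq> []" "hd c2 \<noteq> inv_letter (last c2)"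
    by (rule cyclic_core[OF v(2,3)])
  define X where "X b = (if b then X1 else X2)" for b
  define k where "k b p = wpow (if b then c1 else c2) p" for b p
  define w where "w b p = wpow (if b then u else v) p" for b p
  have w: "w b p = X b @ k b p @ inv_word (X b)" for b p
    by (simp add: w_def X_def k_def 1 2)
  have k: "k b p \<noteq> []" "hd (k b p) \<noteq> inv_letter (last (k b p))" for b p
    using 1 2 by (auto simp: k_def)
  have rw: "reduced_word (w b p)" "is_word (w b p)" "w b p \<noteq> []" for b p
    using u v by (auto simp: w_def)
  have last_w: "last (w b p) = inv_letter (hd (w b (\<not> p)))" for b p
    using u v by (cases p) (auto simp: w_def)
  have hd_w: "hd (w b p) \<noteq> hd (w (\<not> b) q)" for b p q
    using disj[of p q] disj[of q p] by (cases b) (auto simp: w_def)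
  define \<Phi> where "\<Phi> s z \<longleftrightarrow> reduced_word z \<and> (\<exists>r. z = X (fst s) @ k (fst s) (snd s) @ r)"
    for s :: "bool \<times> bool" and z
  have "\<exists>s. \<Phi> s [(c, True)]"
  proof (rule alternating_word[where pw = "\<lambda>s. w (fst s) (snd s)" and u = u and v = v])
    show "\<exists>z'. \<Phi> s z' \<and> is_word z' \<and> word_value G z' = word_value G (w (fst s) (snd s)) \<otimes> word_value G z"
      if A: "\<Phi> t z" "is_word z" "t \<noteq> inv_letter s" for s t z
    proof -
      obtain b p b' p' where st: "s = (b, p)" "t = (b', p')" by fastforce
      obtain r where r: "z = X b' @ k b' p' @ r" "reduced_word z" using A st by (auto simp: \<Phi>_def)
      show ?thesis
      proof (cases "b = b'")
        case True
        then have "p = p'" using A st by (auto simp: inv_letter_def)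
        let ?z = "X b @ k b p @ k b p @ r"
        have "reduced_word ?z"
          using rw(1)[of b p] r(2) k[of b p] unfolding w r True \<open>p = p'\<close> by (auto simp: reduced_word_append)
        moreover have "is_word ?z" "word_value G ?z = word_value G (w b p) \<otimes> word_value G z"
          using rw(2)[of b p] A(2) unfolding w r True \<open>p = p'\<close> by (auto simp: m_assoc)
        ultimately show ?thesis unfolding st \<Phi>_def by auto
      next
        case False
        have "hd z = hd (w b' p')" using r(1) k(1)[of b' p'] by (cases "X b' = []") (auto simp: w)
        then have "hd z \<noteq> inv_letter (last (w b p))" using hd_w[of b "\<not> p" p'] False by (simp add: last_w)
        then have "reduced_word (w b p @ z)" using rw r by (auto simp: reduced_word_append)
        then show ?thesis using A(2) rw(2)[of b p]
          by (intro exI[of _ "w b p @ z"]) (auto simp: st \<Phi>_def w m_assoc)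
      qed
    qed
    show "w (fst s) (snd s) = (let w = if fst s then u else v in if snd s then w else inv_word w)" for s
      by (simp add: w_def Let_def)
    show "\<Phi> s (w (fst s) (snd s))" for s using rw by (auto simp: \<Phi>_def w)
  qed (use u(1) v(1) gen c in \<open>auto simp: \<Phi>_def simp del: word_value_simps\<close>)
  then obtain b p r where r: "[(c, True)] = X b @ k b p @ r" by (auto simp: \<Phi>_def)
  have "length (X b) + length (k b p) + length r = 1" using arg_cong[OF r, of length] by simp
  then have "X b = []" "r = []" using k(1)[of b p] by (cases "k b p"; auto)+
  with r have "X b = []" "k b p = [(c, True)]" by auto
  then have "wpow (if b then u else v) p = [(c, True)]" using w[of b p] by (simp add: w_def)
  then show ?thesis by blast
qed

text \<open>
  The words \<open>s @ r\<close> and \<open>t @ r\<close> are the two closed paths of a theta graph with edges \<open>s\<close>, \<open>t\<close> and \<open>r\<close>,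
  and the graph is folded at both vertices.  A nonempty reduced product then runs through at least
  two edges, so its length is at least \<open>2\<close> and no letter is reached.
\<close>

lemma theta_not_generating:
  assumes u: "is_word (s @ r)" "reduced_word (s @ r)" and v: "is_word (t @ r)" "reduced_word (t @ r)"
    and ne: "s \<noteq> []" "t \<noteq> []" "r \<noteq> []"
    and hd: "hd s \<noteq> hd t" and last: "last s \<noteq> last t"
    and rs: "hd s \<noteq> inv_letter (last r)" "hd t \<noteq> inv_letter (last r)"
    and gen: "generate G {word_value G (s @ r), word_value G (t @ r)} = carrier G"
  shows False
proof -
  define S where "S b = (if b then s else t)" for b
  have S: "S b \<noteq> []" "reduced_word (S b @ r)" "is_word (S b @ r)" "hd (S b) \<noteq> inv_letter (last r)" for b
    using assms by (auto simp: S_def)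
  have hdS: "hd (S (\<not> b)) \<noteq> hd (S b)" "last (S (\<not> b)) \<noteq> last (S b)" for b
    using hd last by (auto simp: S_def)
  define w where "w b p = wpow (S b @ r) p" for b p
  define \<Phi> where "\<Phi> m z \<longleftrightarrow> reduced_word z \<and>
      (\<exists>z'. if snd m then z = S (fst m) @ z' \<and> z' \<noteq> [] else z = inv_word r @ inv_word (S (fst m)) @ z')"
    for m :: "bool \<times> bool" and z
  have red_inv: "reduced_word (inv_word r @ inv_word (S b))" for b
    using reduced_inv_word[of "S b @ r"] S(2)[of b] by simp
  have prepend_inv: "reduced_word (inv_word r @ inv_word (S b) @ z)"
    if "reduced_word z" "hd z \<noteq> hd (S b)" for z b
    using reduced_word_append[of "inv_word r @ inv_word (S b)" z] red_inv[of b] S(1)[of b] that by simp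
  have "\<exists>m. \<Phi> m [(x, True)]"
  proof (rule alternating_word[where pw = "\<lambda>m. w (fst m) (snd m)" and u = "s @ r" and v = "t @ r"])
    show "\<exists>z'. \<Phi> m z' \<and> is_word z' \<and> word_value G z' = word_value G (w (fst m) (snd m)) \<otimes> word_value G z"
      if A: "\<Phi> n z" "is_word z" "n \<noteq> inv_letter m" for m n z
    proof -
      obtain b p b' p' where mn: "m = (b, p)" "n = (b', p')" by fastforce
      have iw: "is_word (S b)" "is_word (S b')" "is_word r" using S(3)[of b] S(3)[of b'] by auto
      have rS: "reduced_word (S b)" "reduced_word (S b')" "reduced_word r"
        using S(2)[of b] S(2)[of b'] by (auto simp: reduced_word_append)
      consider (TT) "p" "p'" | (TF) "p" "\<not> p'" "b' = (\<not> b)" | (FT) "\<not> p" "p'" "b' = (\<not> b)" | (FF) "\<not> p" "\<not> p'"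
        using A(3) mn by (auto simp: inv_letter_def)
      then show ?thesis
      proof cases
        case TT
        then obtain z' where z: "z = S b' @ z'" "z' \<noteq> []" "reduced_word z" using A mn by (auto simp: \<Phi>_def)
        let ?z = "S b @ r @ z"
        have "reduced_word ?z" using S[of b] S[of b'] z ne(3) unfolding z by (auto simp: reduced_word_append)
        then show ?thesis using A(2) iw TT ne(3)
          by (intro exI[of _ ?z]) (auto simp: mn \<Phi>_def w_def m_assoc)
      next
        case TF
        then obtain z' where z: "z = inv_word r @ inv_word (S b') @ z'" "reduced_word z"
          using A mn by (auto simp: \<Phi>_def)
        let ?z = "S b @ inv_word (S b') @ z'"
        have "reduced_word (inv_word (S b') @ z')" using z by (auto simp: reduced_word_append)
        then have "reduced_word ?z" using S(1)[of b] S(1)[of b'] rS hdS(2)[of b] TF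
          by (auto simp: reduced_word_append)
        moreover have "is_word z'" using A(2) z by auto
        ultimately show ?thesis using iw TF S(1)[of b']
          by (intro exI[of _ ?z]) (auto simp: mn \<Phi>_def w_def z m_assoc)
      next
        case FT
        then obtain z' where z: "z = S b' @ z'" "z' \<noteq> []" "reduced_word z" using A mn by (auto simp: \<Phi>_def)
        let ?z = "inv_word r @ inv_word (S b) @ z"
        have "hd z = hd (S b')" using z S(1)[of b'] by simp
        then have "hd z \<noteq> hd (S b)" using hdS(1)[of b] FT(3) by simp
        then have "reduced_word ?z" using prepend_inv[of z b] z(3) by simp
        then show ?thesis using A(2) iw FT
          by (intro exI[of _ ?z]) (auto simp: mn \<Phi>_def w_def m_assoc)
      next
        case FF
        then obtain z' where z: "z = inv_word r @ inv_word (S b') @ z'" "reduced_word z"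
          using A mn by (auto simp: \<Phi>_def)
        let ?z = "inv_word r @ inv_word (S b) @ z"
        have "hd z = inv_letter (last r)" using z ne(3) by simp
        then have "hd z \<noteq> hd (S b)" using S(4)[of b] by simp
        then have "reduced_word ?z" using prepend_inv[of z b] z(2) by simp
        then show ?thesis using A(2) iw FF
          by (intro exI[of _ ?z]) (auto simp: mn \<Phi>_def w_def m_assoc)
      qed
    qed
    show "w (fst m) (snd m) = (let w = if fst m then s @ r else t @ r in if snd m then w else inv_word w)" for m
      by (simp add: w_def S_def Let_def)
    show "\<Phi> m (w (fst m) (snd m))" for m
      using S[of "fst m"] red_inv[of "fst m"] ne(3) by (cases "snd m") (auto simp: \<Phi>_def w_def)
  qed (use u(1) v(1) gen in \<open>simp_all add: \<Phi>_def\<close>)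
  then obtain b p where "\<Phi> (b, p) [(x, True)]" by auto
  then obtain z' where z': "if p then [(x, True)] = S b @ z' \<and> z' \<noteq> [] else [(x, True)] = inv_word r @ inv_word (S b) @ z'"
    unfolding \<Phi>_def fst_conv snd_conv by blast
  have "length (S b) > 0" "length r > 0" using S(1)[of b] ne(3) by auto
  show False
  proof (cases p)
    case True
    then have "1 = length (S b) + length z'" "length z' > 0" using z' by (auto dest!: arg_cong[where f = length])
    then show False using \<open>length (S b) > 0\<close> by linarith
  next
    case False
    then have "1 = length r + length (S b) + length z'" using z' by (auto dest!: arg_cong[where f = length])
    then show False using \<open>length (S b) > 0\<close> \<open>length r > 0\<close> by linarith
  qed
qed

lemma nielsen_step:
  assumes IH: "\<And>u' v'. length u' + length v' < N \<Longrightarrow> is_word u' \<Longrightarrow> is_word v' \<Longrightarrow>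
       reduced_word u' \<Longrightarrow> reduced_word v' \<Longrightarrow>
       generate G {word_value G u', word_value G v'} = carrier G \<Longrightarrow>
       nielsen (word_value G u') (word_value G v') x y"
    and gh: "g \<in> carrier G" "h \<in> carrier G" "generate G {g, h} = carrier G"
    and n: "nielsen g h (word_value G u') (word_value G v')"
    and w: "is_word u'" "is_word v'" and len: "length u' + length v' < N"
  shows "nielsen g h x y"
proof -
  obtain u1 where u1: "reduced_word u1" "set u1 \<subseteq> set u'" "word_value G u1 = word_value G u'" "length u1 \<le> length u'"
    using exists_reduced_word[OF is_word_carrier[OF w(1)]] by blast
  obtain v1 where v1: "reduced_word v1" "set v1 \<subseteq> set v'" "word_value G v1 = word_value G v'" "length v1 \<le> length v'"
    using exists_reduced_word[OF is_word_carrier[OF w(2)]] by blast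
  have "is_word u1" using order_trans[OF image_mono[OF u1(2)]] w(1) unfolding is_word_def by blast
  moreover have "is_word v1" using order_trans[OF image_mono[OF v1(2)]] w(2) unfolding is_word_def by blast
  moreover have "generate G {word_value G u1, word_value G v1} = carrier G"
    using nielsen_generate[OF n gh] unfolding u1(3) v1(3) by simp
  ultimately have "nielsen (word_value G u1) (word_value G v1) x y"
    using IH[of u1 v1] u1 v1 len by simp
  then show ?thesis using nielsen_trans[OF _ n] unfolding u1(3) v1(3) by simp
qed

text \<open>The length reduction.  If one of the words ends with the inverse of the common first letter \<open>c\<close>,
  then conjugation by \<open>c\<close> shortens it.  Otherwise let \<open>p\<close> be the longest common prefix.  When one word
  is exhausted by \<open>p\<close>, a Nielsen move shortens the other; when not, conjugate by \<open>p\<close>, which moves \<open>p\<close>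
  to the end, and look at the longest common suffix \<open>r\<close>.  Again a Nielsen move shortens one word if
  \<open>r\<close> exhausts the other, and if it does not, the two words form a theta graph and do not generate.\<close>

lemma nielsen_common_head:
  assumes IH: "\<And>u' v'. length u' + length v' < length u + length v \<Longrightarrow> is_word u' \<Longrightarrow> is_word v' \<Longrightarrow>
       reduced_word u' \<Longrightarrow> reduced_word v' \<Longrightarrow>
       generate G {word_value G u', word_value G v'} = carrier G \<Longrightarrow>
       nielsen (word_value G u') (word_value G v') x y"
    and u: "is_word u" "reduced_word u" "u \<noteq> []" and v: "is_word v" "reduced_word v" "v \<noteq> []"
    and gen: "generate G {word_value G u, word_value G v} = carrier G"
    and hd: "hd u = hd v"
  shows "nielsen (word_value G u) (word_value G v) x y"
proof -
  have uc: "word_value G u \<in> carrier G" and vc: "word_value G v \<in> carrier G" using u v by auto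
  have step: ?thesis if "nielsen (word_value G u) (word_value G v) (word_value G u') (word_value G v')"
    "is_word u'" "is_word v'" "length u' + length v' < length u + length v" for u' v'
    using nielsen_step[OF IH uc vc gen that(1-3)] that(4) by blast
  define c where "c = hd u"
  have shorten: "\<exists>w'. is_word w' \<and> word_value G w' = inv (word_value G [c]) \<otimes> word_value G w \<otimes> word_value G [c] \<and>
      length w' \<le> length w \<and> (last w = inv_letter c \<longrightarrow> length w' < length w)"
    if w: "is_word w" "reduced_word w" "w \<noteq> []" "hd w = c" for w
  proof -
    obtain w1 where w1: "w = c # w1" using w by (cases w) auto
    have cw: "is_word [c]" "is_word w1" using w w1 by auto
    have val: "word_value G w = word_value G [c] \<otimes> word_value G w1"
      using word_value_word(2)[OF cw] unfolding w1 by simp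
    have conj: "inv (word_value G [c]) \<otimes> word_value G w \<otimes> word_value G [c] = word_value G w1 \<otimes> word_value G [c]"
      using cw unfolding val by (simp del: word_value_simps(2) is_word_simps(4) add: m_assoc)
    show ?thesis
    proof (cases "last w = inv_letter c")
      case True
      have "w1 \<noteq> []" using True w1 by auto
      then obtain w2 where w2: "w1 = w2 @ [inv_letter c]"
        using True w1 by (metis append_butlast_last_id last_ConsR)
      have ic: "[inv_letter c] = inv_word [c]" by simp
      have "word_value G w1 = word_value G w2 \<otimes> inv (word_value G [c])"
        using cw unfolding w2 ic by (subst word_value_word(2)) (simp_all del: word_value_simps(2) inv_word_simps(6) is_word_simps(4))
      then have "word_value G w1 \<otimes> word_value G [c] = word_value G w2"
        using cw w2 by (simp del: word_value_simps(2) is_word_simps(4) add: m_assoc)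
      then show ?thesis using cw w1 w2 conj by (intro exI[of _ w2]) auto
    next
      case False
      then show ?thesis using cw w1 conj word_value_word(2)[OF cw(2,1)]
        by (intro exI[of _ "w1 @ [c]"]) simp
    qed
  qed
  show ?thesis
  proof (cases "last u = inv_letter c \<or> last v = inv_letter c")
    case True
    obtain u' where u': "is_word u'" "word_value G u' = inv (word_value G [c]) \<otimes> word_value G u \<otimes> word_value G [c]"
      "length u' \<le> length u" "last u = inv_letter c \<longrightarrow> length u' < length u"
      using shorten[OF u] c_def by blast
    obtain v' where v': "is_word v'" "word_value G v' = inv (word_value G [c]) \<otimes> word_value G v \<otimes> word_value G [c]"
      "length v' \<le> length v" "last v = inv_letter c \<longrightarrow> length v' < length v"
      using shorten[OF v] c_def hd by auto
    have "is_word [c]" using u(1,3) by (cases u) (auto simp: c_def)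
    then have "nielsen (word_value G u) (word_value G v) (word_value G u') (word_value G v')"
      unfolding u'(2) v'(2) by (intro nielsen_conj' uc vc word_value_word)
    then show ?thesis using u' v' True by (intro step[of u' v']) auto
  next
    case False
    obtain p u1 v1 where p: "u = p @ u1" "v = p @ v1" "u1 = [] \<or> v1 = [] \<or> hd u1 \<noteq> hd v1"
      by (rule common_prefix)
    have pw: "is_word p" "is_word u1" "is_word v1" using u v p by auto
    have p0: "p \<noteq> []" using p hd u v by auto
    have hdp: "hd p = c" using p0 p c_def by simp
    consider "u1 = []" | "v1 = []" | "u1 \<noteq> []" "v1 \<noteq> []" "hd u1 \<noteq> hd v1" using p by blast
    then show ?thesis
    proof cases
      case 1
      then have "word_value G v1 = inv (word_value G u) \<otimes> word_value G v" using p pw by simp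
      then have "nielsen (word_value G u) (word_value G v) (word_value G u) (word_value G v1)"
        using nielsen_left_div[OF uc vc] by simp
      then show ?thesis using u pw p p0 by (intro step[of u v1]) auto
    next
      case 2
      then have "word_value G u1 = inv (word_value G v) \<otimes> word_value G u" using p pw by simp
      then have "nielsen (word_value G v) (word_value G u) (word_value G v) (word_value G u1)"
        using nielsen_left_div[OF vc uc] by simp
      then have "nielsen (word_value G u) (word_value G v) (word_value G v) (word_value G u1)"
        using nielsen_trans nielsen.swap[OF nielsen.refl] by blast
      then show ?thesis using v pw p p0 by (intro step[of v u1]) auto
    next
      case 3
      define u' where "u' = u1 @ p"
      define v' where "v' = v1 @ p"
      have conj: "word_value G u' = inv (word_value G p) \<otimes> word_value G u \<otimes> word_value G p"
        "word_value G v' = inv (word_value G p) \<otimes> word_value G v \<otimes> word_value G p"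
        using pw by (simp_all add: u'_def v'_def p)
      have n: "nielsen (word_value G u) (word_value G v) (word_value G u') (word_value G v')"
        unfolding conj by (intro nielsen_conj' uc vc) (use pw in simp)
      have w': "is_word u'" "is_word v'" using pw by (auto simp: u'_def v'_def)
      have uc': "word_value G u' \<in> carrier G" "word_value G v' \<in> carrier G" using w' by auto
      have gen': "generate G {word_value G u', word_value G v'} = carrier G"
        using nielsen_generate[OF n uc vc gen] .
      have ne: "last u1 \<noteq> inv_letter c" "last v1 \<noteq> inv_letter c" using False p 3 by auto
      have red: "reduced_word u'" "reduced_word v'"
        using u(2) v(2) ne hdp p by (auto simp: u'_def v'_def reduced_word_append)
      have junction: "hd u1 \<noteq> inv_letter (last p)" "hd v1 \<noteq> inv_letter (last p)"
        using u(2) v(2) p 3 p0 by (auto simp: reduced_word_append)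
      obtain s t r where r: "u' = s @ r" "v' = t @ r" "s = [] \<or> t = [] \<or> last s \<noteq> last t"
        by (rule common_suffix)
      have rw: "is_word s" "is_word t" "is_word r" using w' r by auto
      have lastp: "last u' = last p" "last v' = last p" using p0 by (auto simp: u'_def v'_def)
      have r0: "r \<noteq> []" using r lastp 3 by (auto simp: u'_def v'_def)
      consider "s = []" | "t = []" | "s \<noteq> []" "t \<noteq> []" "last s \<noteq> last t" using r by blast
      then show ?thesis
      proof cases
        case s: 1
        then have "word_value G t = word_value G v' \<otimes> inv (word_value G u')"
          using r rw by (simp add: m_assoc)
        then have "nielsen (word_value G u') (word_value G v') (word_value G u') (word_value G t)"
          using nielsen_right_div[OF uc'] by simp
        then have "nielsen (word_value G u) (word_value G v) (word_value G u') (word_value G t)"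
          using n nielsen_trans by blast
        then show ?thesis
          using arg_cong[OF r(2), of length] length_greater_0_conv[THEN iffD2, OF r0]
          by (intro step[of u' t] w' rw) (auto simp: u'_def v'_def p simp del: length_greater_0_conv)
      next
        case t: 2
        then have "word_value G s = word_value G u' \<otimes> inv (word_value G v')"
          using r rw by (simp add: m_assoc)
        then have "nielsen (word_value G v') (word_value G u') (word_value G v') (word_value G s)"
          using nielsen_right_div[OF uc'(2,1)] by simp
        then have "nielsen (word_value G u) (word_value G v) (word_value G v') (word_value G s)"
          using n nielsen_trans nielsen.swap by blast
        then show ?thesis
          using arg_cong[OF r(1), of length] length_greater_0_conv[THEN iffD2, OF r0]
          by (intro step[of v' s] w' rw) (auto simp: u'_def v'_def p simp del: length_greater_0_conv)
      next
        case st: 3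
        have "hd s = hd u1" "hd t = hd v1"
          using arg_cong[OF r(1), of hd] arg_cong[OF r(2), of hd] st 3 by (auto simp: u'_def v'_def)
        moreover have "last r = last p" using r r0 lastp by auto
        ultimately have False
          using theta_not_generating[of s r t] r w' red gen' st r0 3 junction by auto
        then show ?thesis ..
      qed
    qed
  qed
qed

text \<open>Nielsen's theorem in rank two: up to the moves there is only one generating pair.  When no
  choice of signs gives the two words a common first letter, ping-pong shows that both are letters.\<close>

theorem nielsen_basis:
  assumes "is_word u" "is_word v" "reduced_word u" "reduced_word v"
    and "generate G {word_value G u, word_value G v} = carrier G"
  shows "nielsen (word_value G u) (word_value G v) x y"
  using assms
proof (induction "length u + length v" arbitrary: u v rule: less_induct)
  case less
  have uc: "word_value G u \<in> carrier G" and vc: "word_value G v \<in> carrier G" using less.prems by auto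
  have u0: "u \<noteq> []"
  proof
    assume "u = []"
    then show False using not_cyclic[OF vc] less.prems(5) by simp
  qed
  have v0: "v \<noteq> []"
  proof
    assume "v = []"
    then show False using not_cyclic[OF uc] less.prems(5) by (simp add: insert_commute)
  qed
  show ?case
  proof (cases "\<exists>p q. hd (wpow u p) = hd (wpow v q)")
    case True
    then obtain p q where pq: "hd (wpow u p) = hd (wpow v q)" by blast
    have n: "nielsen (word_value G u) (word_value G v) (word_value G (wpow u p)) (word_value G (wpow v q))"
    proof -
      have "nielsen (word_value G u) (word_value G v) (word_value G (wpow u p)) (word_value G v)"
        using less.prems nielsen.invert[OF nielsen.refl] nielsen.refl by (cases p) auto
      then show ?thesis
        using less.prems nielsen_invert2 by (cases q) auto
    qed
    have "nielsen (word_value G (wpow u p)) (word_value G (wpow v q)) x y"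
    proof (rule nielsen_common_head)
      show "generate G {word_value G (wpow u p), word_value G (wpow v q)} = carrier G"
        using nielsen_generate[OF n uc vc less.prems(5)] .
      show "hd (wpow u p) = hd (wpow v q)" by (rule pq)
      fix u' v' :: "('g \<times> bool) list"
      assume "length u' + length v' < length (wpow u p) + length (wpow v q)"
        "is_word u'" "is_word v'" "reduced_word u'" "reduced_word v'"
        "generate G {word_value G u', word_value G v'} = carrier G"
      then show "nielsen (word_value G u') (word_value G v') x y"
        by (intro less.hyps) (auto split: if_splits)
    qed (use less.prems(1-4) u0 v0 in simp_all)
    then show ?thesis using n nielsen_trans by blast
  next
    case False
    have *: "\<exists>b p. wpow (if b then u else v) p = [(c, True)]" if "c = x \<or> c = y" for c
      using disjoint_ends_letters[OF less.prems(1,3) u0 less.prems(2,4) v0 less.prems(5) _ that] False by blast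
    obtain b p where bp: "wpow (if b then u else v) p = [(x, True)]" using * by blast
    obtain b' p' where bp': "wpow (if b' then u else v) p' = [(y, True)]" using * by blast
    have letter: "word_value G w = z \<or> word_value G w = inv z"
      if "wpow w p = [(z, True)]" "is_word w" "z = x \<or> z = y" for w p z
    proof -
      have zc: "z \<in> carrier G" using that(3) by auto
      have "word_value G (wpow w p) = z" using that(1) zc by (simp split: if_splits)
      then show ?thesis using that(2) by (cases p) auto
    qed
    have "b \<noteq> b'"
    proof
      assume "b = b'"
      define w where "w = (if b then u else v)"
      have "fst ` set (wpow w q) = fst ` set w" for q by simp
      then have "fst ` set (wpow w p) = fst ` set (wpow w p')" by blast
      moreover have "wpow w p = [(x, True)]" using bp unfolding w_def .
      moreover have "wpow w p' = [(y, True)]" using bp' unfolding w_def \<open>b = b'\<close> .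
      ultimately have "{x} = {y}" by (simp only:) simp
      then show False using xy by simp
    qed
    then consider "b" "\<not> b'" | "\<not> b" "b'" by blast
    then show ?thesis
    proof cases
      case 1
      then have b: "b = True" "b' = False" by auto
      have "word_value G u = x \<or> word_value G u = inv x" "word_value G v = y \<or> word_value G v = inv y"
        using letter[where w = u and p = p and z = x] letter[where w = v and p = p' and z = y]
          bp[unfolded b if_True] bp'[unfolded b if_False] less.prems(1,2) by blast+
      moreover have "nielsen x y x y" "nielsen (inv x) y x y" "nielsen x (inv y) x y" "nielsen (inv x) (inv y) x y"
        using nielsen.refl[of x y] nielsen.invert[OF nielsen.refl, of "inv x" y]
          nielsen_invert2[OF nielsen.refl, of x "inv y"]
          nielsen_invert2[OF nielsen.invert[OF nielsen.refl, of "inv x" "inv y"]]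
        by simp_all
      ultimately show ?thesis by (elim disjE) simp_all
    next
      case 2
      then have b: "b = False" "b' = True" by auto
      have "word_value G u = y \<or> word_value G u = inv y" "word_value G v = x \<or> word_value G v = inv x"
        using letter[where w = v and p = p and z = x] letter[where w = u and p = p' and z = y]
          bp[unfolded b if_False] bp'[unfolded b if_True] less.prems(1,2) by blast+
      moreover have "nielsen y x x y" "nielsen (inv y) x x y" "nielsen y (inv x) x y" "nielsen (inv y) (inv x) x y"
        using nielsen.swap[OF nielsen.refl, of y x] nielsen.swap[OF nielsen.invert[OF nielsen.refl, of "inv y" x]]
          nielsen.swap[OF nielsen_invert2[OF nielsen.refl, of y "inv x"]]
          nielsen.swap[OF nielsen_invert2[OF nielsen.invert[OF nielsen.refl, of "inv y" "inv x"]]]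
        by simp_all
      ultimately show ?thesis by (elim disjE) simp_all
    qed
  qed
qed

corollary generating_pairs_nielsen:
  assumes "g \<in> carrier G" "h \<in> carrier G" "generate G {g, h} = carrier G"
    and "g' \<in> carrier G" "h' \<in> carrier G" "generate G {g', h'} = carrier G"
  shows "nielsen g h g' h'"
proof -
  have *: "nielsen g h x y" if H: "g \<in> carrier G" "h \<in> carrier G" "generate G {g, h} = carrier G" for g h
  proof -
    obtain u where u: "is_word u" "reduced_word u" "word_value G u = g" by (rule word_exists[OF H(1)])
    obtain v where v: "is_word v" "reduced_word v" "word_value G v = h" by (rule word_exists[OF H(2)])
    show ?thesis using nielsen_basis[OF u(1) v(1) u(2) v(2)] H(3) unfolding u(3) v(3) by simp
  qed
  have "nielsen x y g' h'" by (rule nielsen_sym[OF *[OF assms(4-6)] assms(4,5)])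
  then show ?thesis by (rule nielsen_trans) (rule *[OF assms(1-3)])
qed

corollary exists_dual_pair:
  assumes "g \<in> carrier G" "h \<in> carrier G" "generate G {g, h} = carrier G"
  shows "\<exists>e1 e2. dual_pair g h e1 e2"
proof -
  have "generate G {x, y} = carrier G" using free by (simp add: free_basis_def)
  then have "nielsen x y g h" by (intro generating_pairs_nielsen basis_closed assms)
  then show ?thesis by (rule nielsen_dual_pair[OF _ basis_closed dual_pair_basis])
qed

end

section \<open>Primitive elements as positive words\<close>

text \<open>
  The words obtained in this way are Christoffel words; all that is used of them is that they are
  positive words in the letters \<open>k\<close> and \<open>l\<close>.
\<close>

inductive christoffel_pair :: "'l \<Rightarrow> 'l \<Rightarrow> 'l list \<Rightarrow> 'l list \<Rightarrow> bool" for k l where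
  letters: "christoffel_pair k l [k] [l]"
| left: "christoffel_pair k l u v \<Longrightarrow> christoffel_pair k l (u @ v) v"
| right: "christoffel_pair k l u v \<Longrightarrow> christoffel_pair k l u (u @ v)"

lemma christoffel_pair_words:
  "christoffel_pair k l u v \<Longrightarrow> u \<noteq> [] \<and> v \<noteq> [] \<and> set u \<subseteq> {k, l} \<and> set v \<subseteq> {k, l}"
  by (induction rule: christoffel_pair.induct) auto

locale generating_pair = free_pair G x y for G :: "('g, 'm) monoid_scheme" (structure) and x y :: 'g +
  fixes a b :: 'g
  assumes ab: "a \<in> carrier G" "b \<in> carrier G" and gen_ab: "generate G {a, b} = carrier G"
begin

definition cpair :: "'g \<Rightarrow> 'g \<Rightarrow> bool" where
  "cpair U V \<longleftrightarrow> (\<exists>p u v. christoffel_pair (a, True) (b, p) u v \<and> U = word_value G u \<and> V = word_value G v)"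

text \<open>The class of all pairs that agree with a Christoffel pair up to conjugation, order and inverting
  either element.  It is closed under the Nielsen moves, so it contains all generating pairs.\<close>

definition cclass :: "'g \<Rightarrow> 'g \<Rightarrow> bool" where
  "cclass g h \<longleftrightarrow> g \<in> carrier G \<and> h \<in> carrier G \<and> (\<exists>c\<in>carrier G. \<exists>U V. cpair U V \<and>
     ((c \<otimes> g \<otimes> inv c \<in> {U, inv U} \<and> c \<otimes> h \<otimes> inv c \<in> {V, inv V}) \<or>
      (c \<otimes> h \<otimes> inv c \<in> {U, inv U} \<and> c \<otimes> g \<otimes> inv c \<in> {V, inv V})))"

lemma ab_word_carrier:
  assumes "christoffel_pair (a, True) (b, p) u v"
  shows "fst ` set u \<subseteq> carrier G" "fst ` set v \<subseteq> carrier G"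
proof -
  have "set u \<subseteq> {(a, True), (b, p)}" "set v \<subseteq> {(a, True), (b, p)}"
    using christoffel_pair_words[OF assms] by auto
  then show "fst ` set u \<subseteq> carrier G" "fst ` set v \<subseteq> carrier G" using ab by auto
qed

lemma cpair_closed: "cpair U V \<Longrightarrow> U \<in> carrier G \<and> V \<in> carrier G"
  unfolding cpair_def using ab_word_carrier by auto

lemma cpair_letters: "cpair a b" "cpair a (inv b)"
proof -
  have "cpair (word_value G [(a, True)]) (word_value G [(b, p)])" for p
    unfolding cpair_def using christoffel_pair.letters[of "(a, True)" "(b, p)"] by blast
  from this[of True] this[of False] show "cpair a b" "cpair a (inv b)" using ab by simp_all
qed

lemma cpair_mult:
  assumes "cpair U V"
  shows "cpair (U \<otimes> V) V" "cpair U (U \<otimes> V)"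
proof -
  obtain p u v where p: "christoffel_pair (a, True) (b, p) u v" "U = word_value G u" "V = word_value G v"
    using assms unfolding cpair_def by blast
  have "word_value G (u @ v) = U \<otimes> V" using ab_word_carrier[OF p(1)] p by simp
  moreover have "cpair (word_value G (u @ v)) (word_value G v)" "cpair (word_value G u) (word_value G (u @ v))"
    unfolding cpair_def using christoffel_pair.left[OF p(1)] christoffel_pair.right[OF p(1)] by blast+
  ultimately show "cpair (U \<otimes> V) V" "cpair U (U \<otimes> V)" using p(2,3) by simp_all
qed

lemma cpair_cases:
  assumes "cpair U V"
  obtains "U = a" "V = b \<or> V = inv b"
    | U' where "cpair U' V" "U = U' \<otimes> V"
    | V' where "cpair U V'" "V = U \<otimes> V'"
proof -
  obtain p u v where p: "christoffel_pair (a, True) (b, p) u v" "U = word_value G u" "V = word_value G v"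
    using assms unfolding cpair_def by blast
  from p(1) show thesis
  proof cases
    case letters
    then show thesis using that(1) p ab by (cases p) auto
  next
    case (left u')
    then have "cpair (word_value G u') V" using p unfolding cpair_def by blast
    moreover have "U = word_value G u' \<otimes> V" using left p ab_word_carrier[OF left(2)] by simp
    ultimately show thesis by (rule that(2))
  next
    case (right v')
    then have "cpair U (word_value G v')" using p unfolding cpair_def by blast
    moreover have "V = U \<otimes> word_value G v'" using right p ab_word_carrier[OF right(2)] by simp
    ultimately show thesis by (rule that(3))
  qed
qed

lemma cclassI:
  assumes "cpair U V" "(g \<in> {U, inv U} \<and> h \<in> {V, inv V}) \<or> (h \<in> {U, inv U} \<and> g \<in> {V, inv V})"
  shows "cclass g h"
proof -
  have "U \<in> carrier G" "V \<in> carrier G" using cpair_closed assms by auto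
  then have c: "g \<in> carrier G" "h \<in> carrier G" using assms by auto
  then show ?thesis unfolding cclass_def using assms by (intro conjI bexI[of _ \<one>]) auto
qed

lemma cclass_conjI:
  assumes "g \<in> carrier G" "h \<in> carrier G" "c \<in> carrier G" "cpair U V"
    "(c \<otimes> g \<otimes> inv c \<in> {U, inv U} \<and> c \<otimes> h \<otimes> inv c \<in> {V, inv V}) \<or>
      (c \<otimes> h \<otimes> inv c \<in> {U, inv U} \<and> c \<otimes> g \<otimes> inv c \<in> {V, inv V})"
  shows "cclass g h"
  unfolding cclass_def using assms by blast

lemma cclass_closed: "cclass g h \<Longrightarrow> g \<in> carrier G \<and> h \<in> carrier G"
  unfolding cclass_def by blast

lemma cclass_swap: "cclass g h \<Longrightarrow> cclass h g"
  unfolding cclass_def by blast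

lemma cclass_invert: "cclass g h \<Longrightarrow> cclass (inv g) h"
proof -
  assume "cclass g h"
  then obtain c U V where *: "g \<in> carrier G" "h \<in> carrier G" "c \<in> carrier G" "cpair U V"
    "(c \<otimes> g \<otimes> inv c \<in> {U, inv U} \<and> c \<otimes> h \<otimes> inv c \<in> {V, inv V}) \<or>
      (c \<otimes> h \<otimes> inv c \<in> {U, inv U} \<and> c \<otimes> g \<otimes> inv c \<in> {V, inv V})"
    unfolding cclass_def by blast
  have e: "c \<otimes> inv g \<otimes> inv c = inv (c \<otimes> g \<otimes> inv c)" using * by (simp add: inv_mult_group m_assoc)
  have "inv (c \<otimes> g \<otimes> inv c) \<in> {W, inv W}" if "c \<otimes> g \<otimes> inv c \<in> {W, inv W}" "W \<in> carrier G" for W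
    using that by auto
  then show ?thesis
    using * cpair_closed[OF *(4)] by (intro cclass_conjI[OF _ *(2,3,4)]) (auto simp only: e inv_closed)
qed

lemma cclass_invert2: "cclass g h \<Longrightarrow> cclass g (inv h)"
  using cclass_swap cclass_invert by blast

lemma cclass_conj_iff:
  assumes "g \<in> carrier G" "h \<in> carrier G" "d \<in> carrier G" "cclass (d \<otimes> g \<otimes> inv d) (d \<otimes> h \<otimes> inv d)"
  shows "cclass g h"
proof -
  obtain c U V where *: "c \<in> carrier G" "cpair U V"
    "(c \<otimes> (d \<otimes> g \<otimes> inv d) \<otimes> inv c \<in> {U, inv U} \<and> c \<otimes> (d \<otimes> h \<otimes> inv d) \<otimes> inv c \<in> {V, inv V}) \<or>
      (c \<otimes> (d \<otimes> h \<otimes> inv d) \<otimes> inv c \<in> {U, inv U} \<and> c \<otimes> (d \<otimes> g \<otimes> inv d) \<otimes> inv c \<in> {V, inv V})"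
    using assms(4) unfolding cclass_def by blast
  have e: "(c \<otimes> d) \<otimes> z \<otimes> inv (c \<otimes> d) = c \<otimes> (d \<otimes> z \<otimes> inv d) \<otimes> inv c" if "z \<in> carrier G" for z
    using assms(3) *(1) that by (simp add: inv_mult_group m_assoc)
  show ?thesis
    using *(3) unfolding e[OF assms(1), symmetric] e[OF assms(2), symmetric]
    by (rule cclass_conjI[OF assms(1,2) m_closed[OF *(1) assms(3)] *(2)])
qed

lemma cclass_conj:
  assumes "cclass g h" "d \<in> carrier G"
  shows "cclass (d \<otimes> g \<otimes> inv d) (d \<otimes> h \<otimes> inv d)"
proof (rule cclass_conj_iff[of _ _ "inv d"])
  have c: "g \<in> carrier G" "h \<in> carrier G" using cclass_closed[OF assms(1)] by auto
  then show "d \<otimes> g \<otimes> inv d \<in> carrier G" "d \<otimes> h \<otimes> inv d \<in> carrier G" "inv d \<in> carrier G" using assms(2) by auto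
  have "inv d \<otimes> (d \<otimes> z \<otimes> inv d) \<otimes> inv (inv d) = z" if "z \<in> carrier G" for z
    using that assms(2) by (simp add: m_assoc)
  then show "cclass (inv d \<otimes> (d \<otimes> g \<otimes> inv d) \<otimes> inv (inv d)) (inv d \<otimes> (d \<otimes> h \<otimes> inv d) \<otimes> inv (inv d))"
    using c assms by simp
qed

text \<open>The only move that is not positive.  Dividing undoes the last step of the construction of the
  pair, up to conjugation; at the initial pair it changes the sign of \<open>b\<close> instead.\<close>

lemma cclass_quotient:
  assumes UV: "cpair U V"
  shows "cclass (U \<otimes> inv V) V" "cclass (U \<otimes> inv V) U"
proof -
  have c: "U \<in> carrier G" "V \<in> carrier G" using cpair_closed[OF UV] by auto
  from UV have "cclass (U \<otimes> inv V) V \<and> cclass (U \<otimes> inv V) U"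
  proof (cases rule: cpair_cases)
    case 1
    then have "cpair a (inv V)" using cpair_letters ab by auto
    then have *: "cpair (U \<otimes> inv V) (inv V)" "cpair U (U \<otimes> inv V)" using cpair_mult 1 by auto
    show ?thesis using cclassI[OF *(1), of "U \<otimes> inv V" V] cclassI[OF *(2), of "U \<otimes> inv V" U] c by auto
  next
    case (2 U')
    then have "U' \<in> carrier G" using cpair_closed by blast
    then have e: "U \<otimes> inv V = U'" using 2 c by (simp add: m_assoc)
    show ?thesis unfolding e
      using cclassI[OF 2(1), of U' V] cclassI[OF cpair_mult(2)[OF 2(1)], of U' U] 2(2) by auto
  next
    case (3 V')
    then have V': "V' \<in> carrier G" using cpair_closed by blast
    have e: "U \<otimes> inv V = U \<otimes> inv V' \<otimes> inv U" using 3 c V' by (simp add: inv_mult_group m_assoc)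
    have "cpair V V'" using cpair_mult(1)[OF 3(1)] 3(2) by simp
    then have "cclass (inv V') V" by (rule cclassI) auto
    moreover have "inv V \<otimes> (U \<otimes> inv V) \<otimes> inv (inv V) = inv V'" "inv V \<otimes> V \<otimes> inv (inv V) = V"
      using 3 c V' by (simp_all add: inv_mult_group m_assoc)
    ultimately have 1: "cclass (U \<otimes> inv V) V" by - (rule cclass_conj_iff[of _ _ "inv V"], use c in auto)
    have "cclass (inv V') U" using 3(1) by (rule cclassI) auto
    moreover have "inv U \<otimes> (U \<otimes> inv V) \<otimes> inv (inv U) = inv V'" "inv U \<otimes> U \<otimes> inv (inv U) = U"
      using 3 c V' by (simp_all add: inv_mult_group m_assoc)
    ultimately have 2: "cclass (U \<otimes> inv V) U" by - (rule cclass_conj_iff[of _ _ "inv U"], use c in auto)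
    show ?thesis using 1 2 by blast
  qed
  then show "cclass (U \<otimes> inv V) V" "cclass (U \<otimes> inv V) U" by auto
qed

text \<open>For all eight choices of signs and order, the product is conjugate to \<open>U \<otimes> V\<close> or to \<open>U \<otimes> inv V\<close>,
  or to the inverse of one of these, by an element that commutes with the second member.\<close>

lemma cclass_mult:
  assumes gh: "cclass g h"
  shows "cclass (g \<otimes> h) h"
proof -
  have main: "cclass (g \<otimes> h) h"
    if UV: "cpair U V" and "(g \<in> {U, inv U} \<and> h \<in> {V, inv V}) \<or> (h \<in> {U, inv U} \<and> g \<in> {V, inv V})"
    for g h U V
  proof -
    have c: "U \<in> carrier G" "V \<in> carrier G" using cpair_closed[OF UV] by auto
    have 1: "cclass (U \<otimes> V) V" "cclass (U \<otimes> V) U"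
      using cclassI[OF cpair_mult(1)[OF UV]] cclassI[OF cpair_mult(2)[OF UV]] by auto
    note 2 = cclass_quotient[OF UV]
    have VU: "cclass (V \<otimes> U) V" "cclass (V \<otimes> U) U"
    proof -
      show "cclass (V \<otimes> U) V"
        using cclass_conj_iff[of "V \<otimes> U" V "inv V"] 1(1) c by (simp add: m_assoc)
      show "cclass (V \<otimes> U) U"
        using cclass_conj_iff[of "V \<otimes> U" U U] 1(2) c by (simp add: m_assoc)
    qed
    have VU': "cclass (inv V \<otimes> U) V" "cclass (inv V \<otimes> U) U"
    proof -
      show "cclass (inv V \<otimes> U) V"
        using cclass_conj_iff[of "inv V \<otimes> U" V V] 2(1) c by (simp add: m_assoc)
      show "cclass (inv V \<otimes> U) U"
        using cclass_conj_iff[of "inv V \<otimes> U" U U] 2(2) c by (simp add: m_assoc)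
    qed
    note inv = cclass_invert cclass_invert2
    have "cclass (U \<otimes> V) V" "cclass (inv U \<otimes> V) V" "cclass (U \<otimes> inv V) (inv V)" "cclass (inv U \<otimes> inv V) (inv V)"
      "cclass (V \<otimes> U) U" "cclass (V \<otimes> inv U) (inv U)" "cclass (inv V \<otimes> U) U" "cclass (inv V \<otimes> inv U) (inv U)"
      using 1(1) inv(1)[OF VU'(1)] inv(2)[OF 2(1)] inv(1)[OF inv(2)[OF VU(1)]]
        VU(2) inv(1)[OF inv(2)[OF 2(2)]] VU'(2) inv(1)[OF inv(2)[OF 1(2)]] c
      by (simp_all add: inv_mult_group)
    then show ?thesis using that(2) by auto
  qed
  obtain d U V where *: "g \<in> carrier G" "h \<in> carrier G" "d \<in> carrier G" "cpair U V"
    "(d \<otimes> g \<otimes> inv d \<in> {U, inv U} \<and> d \<otimes> h \<otimes> inv d \<in> {V, inv V}) \<or>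
      (d \<otimes> h \<otimes> inv d \<in> {U, inv U} \<and> d \<otimes> g \<otimes> inv d \<in> {V, inv V})"
    using gh unfolding cclass_def by blast
  have "cclass ((d \<otimes> g \<otimes> inv d) \<otimes> (d \<otimes> h \<otimes> inv d)) (d \<otimes> h \<otimes> inv d)"
    by (rule main[OF *(4,5)])
  then show ?thesis using *(1-3) by - (rule cclass_conj_iff[of "g \<otimes> h" h d], simp_all add: m_assoc)
qed

lemma cclass_generating:
  assumes "g \<in> carrier G" "h \<in> carrier G" "generate G {g, h} = carrier G"
  shows "cclass g h"
proof -
  have "nielsen a b g h" using generating_pairs_nielsen[OF ab gen_ab assms] .
  then show ?thesis
  proof (induction rule: nielsen.induct)
    case refl
    then show ?case using cclassI[OF cpair_letters(1)] by auto
  next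
    case (swap g h)
    show ?case by (rule cclass_swap) (rule swap.IH)
  next
    case (invert g h)
    show ?case by (rule cclass_invert) (rule invert.IH)
  next
    case (mult g h)
    show ?case by (rule cclass_mult) (rule mult.IH)
  next
    case (conj g h c)
    show ?case by (rule cclass_conj) (rule conj.IH, rule conj.hyps)
  qed
qed

lemma primitive_conjugate:
  assumes "primitive_element G 2 g"
  obtains p w c where "w \<noteq> []" "set w \<subseteq> {(a, True), (b, p)}" "c \<in> carrier G"
    "g = c \<otimes> word_value G w \<otimes> inv c \<or> g = inv (c \<otimes> word_value G w \<otimes> inv c)"
proof -
  obtain gs where gs: "length gs = 2" "hd gs = g" "set gs \<subseteq> carrier G" "generate G (set gs) = carrier G"
    using assms unfolding primitive_element_def by blast
  then obtain h where "gs = [g, h]" by (cases gs; cases "tl gs") auto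
  then have gh: "cclass g h" using gs by (intro cclass_generating) auto
  have g: "g \<in> carrier G" using cclass_closed[OF gh] by blast
  obtain d U V where d: "d \<in> carrier G" "cpair U V" "d \<otimes> g \<otimes> inv d \<in> {U, inv U} \<or> d \<otimes> g \<otimes> inv d \<in> {V, inv V}"
    using gh unfolding cclass_def by blast
  obtain p u v where p: "christoffel_pair (a, True) (b, p) u v" "U = word_value G u" "V = word_value G v"
    using d unfolding cpair_def by blast
  note w = christoffel_pair_words[OF p(1)]
  define w where "w = (if d \<otimes> g \<otimes> inv d \<in> {U, inv U} then u else v)"
  have wv: "d \<otimes> g \<otimes> inv d \<in> {word_value G w, inv (word_value G w)}" using d p by (auto simp: w_def)
  have wc: "word_value G w \<in> carrier G" using cpair_closed[OF d(2)] p by (auto simp: w_def)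
  have "g = inv d \<otimes> (d \<otimes> g \<otimes> inv d) \<otimes> inv (inv d)" using g d(1) by (simp add: m_assoc)
  then have "g = inv d \<otimes> word_value G w \<otimes> inv (inv d) \<or> g = inv (inv d \<otimes> word_value G w \<otimes> inv (inv d))"
    using wv d(1) wc by (auto simp: inv_mult_group m_assoc)
  then show thesis using that[of w p "inv d"] w d(1) by (auto simp: w_def)
qed

end

section \<open>Primitive geodesics\<close>

lemma nat_isometry:
  fixes \<sigma> :: "nat \<Rightarrow> int"
  assumes "\<And>i j. \<bar>\<sigma> i - \<sigma> j\<bar> = \<bar>int i - int j\<bar>"
  shows "(\<forall>i. \<sigma> i = \<sigma> 0 + int i) \<or> (\<forall>i. \<sigma> i = \<sigma> 0 - int i)"
proof -
  have *: "\<sigma> i = \<sigma> 0 + int i \<or> \<sigma> i = \<sigma> 0 - int i" "\<sigma> i = \<sigma> 1 + (int i - 1) \<or> \<sigma> i = \<sigma> 1 - (int i - 1)" for i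
    using assms[of i 0] assms[of i 1] by auto
  show ?thesis
  proof (cases "\<sigma> 1 = \<sigma> 0 + 1")
    case True
    have "\<sigma> i = \<sigma> 0 + int i" for i using *[of i] True by auto
    then show ?thesis by blast
  next
    case False
    then have "\<sigma> 1 = \<sigma> 0 - 1" using *(1)[of 1] by auto
    then have "\<sigma> i = \<sigma> 0 - int i" for i using *[of i] by auto
    then show ?thesis by blast
  qed
qed

lemma expsum_count: "expsum z u = int (count_list u (z, True)) - int (count_list u (z, False))"
  by (induction u) (auto simp: expsum_Cons)

lemma length_count:
  "fst ` set u \<subseteq> {a, b} \<Longrightarrow> a \<noteq> b \<Longrightarrow>
   length u = count_list u (a, True) + count_list u (a, False) + count_list u (b, True) + count_list u (b, False)"
proof (induction u)
  case (Cons l u)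
  then show ?case by (cases l; cases "snd l") auto
qed simp

text \<open>No cancellation happens in the exponent sums of a positive word, so they see its full length.\<close>

lemma positive_word_expsum:
  assumes "set w \<subseteq> {(a, True), (b, p)}" "a \<noteq> b"
  shows "int (length w) = \<bar>expsum a w\<bar> + \<bar>expsum b w\<bar>"
proof -
  have "fst ` set w \<subseteq> {a, b}" using assms by auto
  note l = length_count[OF this assms(2)]
  have "count_list w (a, False) = 0" "count_list w (b, \<not> p) = 0"
    using assms by (auto simp: count_list_0_iff)
  then show ?thesis unfolding l expsum_count by (cases p) auto
qed

text \<open>A word as short as its exponent sums allow uses each letter with one sign only.\<close>

lemma monotone_letters:
  assumes "fst ` set u \<subseteq> {a, b}" "a \<noteq> b" "int (length u) \<le> \<bar>expsum a u\<bar> + \<bar>expsum b u\<bar>"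
  shows "\<exists>q. set u \<subseteq> {(a, q), (b, True), (b, False)}"
proof -
  have "count_list u (a, True) = 0 \<or> count_list u (a, False) = 0"
    using assms(3) unfolding length_count[OF assms(1,2)] expsum_count by linarith
  then obtain q where "(a, \<not> q) \<notin> set u" by (metis (full_types) count_list_0_iff)
  have "l \<in> {(a, q), (b, True), (b, False)}" if "l \<in> set u" for l
  proof -
    have "fst l \<in> {a, b}" using that assms(1) by blast
    moreover have "l \<noteq> (a, \<not> q)" using that \<open>(a, \<not> q) \<notin> set u\<close> by blast
    ultimately show ?thesis by (cases l) auto
  qed
  then show ?thesis by blast
qed

lemma int_isometry:
  fixes \<sigma> :: "int \<Rightarrow> int"
  assumes "\<And>i j. \<bar>\<sigma> i - \<sigma> j\<bar> = \<bar>i - j\<bar>"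
  shows "(\<forall>i. \<sigma> i = \<sigma> 0 + i) \<or> (\<forall>i. \<sigma> i = \<sigma> 0 - i)"
proof -
  have *: "\<sigma> i = \<sigma> 0 + i \<or> \<sigma> i = \<sigma> 0 - i" "\<sigma> i = \<sigma> 1 + (i - 1) \<or> \<sigma> i = \<sigma> 1 - (i - 1)" for i
    using assms[of i 0] assms[of i 1] by auto
  show ?thesis
  proof (cases "\<sigma> 1 = \<sigma> 0 + 1")
    case True
    have "\<sigma> i = \<sigma> 0 + i" for i using *[of i] True by auto
    then show ?thesis by blast
  next
    case False
    then have "\<sigma> 1 = \<sigma> 0 - 1" using *(1)[of 1] by auto
    then have "\<sigma> i = \<sigma> 0 - i" for i using *[of i] by auto
    then show ?thesis by blast
  qed
qed

context group begin

lemma word_length_le: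
  assumes "fst ` set w \<subseteq> S" "word_value G w = g"
  shows "word_length G S g \<le> length w"
  unfolding word_length_def by (rule Least_le) (use assms in blast)

lemma word_length_attained:
  assumes "S \<subseteq> carrier G" "g \<in> generate G S"
  obtains w where "length w = word_length G S g" "fst ` set w \<subseteq> S" "word_value G w = g"
proof -
  have "\<exists>l w. length w = l \<and> fst ` set w \<subseteq> S \<and> word_value G w = g"
    using assms generate_iff_word[of S g] by auto
  then have "\<exists>w. length w = word_length G S g \<and> fst ` set w \<subseteq> S \<and> word_value G w = g"
    unfolding word_length_def by (rule LeastI_ex)
  then show thesis using that by blast
qed

text \<open>Otherwise cancellation would give a shorter word for the same element.\<close>

lemma geodesic_word_reduced:
  assumes "S \<subseteq> carrier G" "fst ` set w \<subseteq> S" "word_length G S (word_value G w) = length w"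
  shows "reduced_word w"
proof (rule ccontr)
  assume "\<not> reduced_word w"
  obtain w' where w': "reduced_word w'" "set w' \<subseteq> set w" "word_value G w' = word_value G w" "length w' \<le> length w"
    "length w' = length w \<longrightarrow> w' = w"
    using exists_reduced_word[of w] assms by blast
  have "fst ` set w' \<subseteq> S" using w'(2) assms(2) by blast
  then have "length w' \<ge> length w" using word_length_le[of w' S] w'(3) assms(3) by simp
  then have l: "length w' = length w" using w'(4) by simp
  then have "w' = w" using w'(5) by simp
  then show False using w'(1) \<open>\<not> reduced_word w\<close> by simp
qed

end

context group begin

lemma dual_pair_word_value:
  assumes "dual_pair a b e1 e2" "a \<in> carrier G" "b \<in> carrier G" "fst ` set w \<subseteq> {a, b}"
  shows "e1 (word_value G w) = expsum a w" "e2 (word_value G w) = expsum b w" "a \<noteq> b"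
proof -
  show ab: "a \<noteq> b" using assms(1) by (auto simp: dual_pair_def)
  have add: "e1 (u \<otimes> v) = e1 u + e1 v" "e2 (u \<otimes> v) = e2 u + e2 v"
    if "u \<in> carrier G" "v \<in> carrier G" for u v
    using assms(1) that by (auto simp: dual_pair_def)
  note one = additive_one_inv(1)[of e1, OF add(1)] additive_one_inv(1)[of e2, OF add(2)]
  note inv = additive_one_inv(2)[of e1, OF add(1)] additive_one_inv(2)[of e2, OF add(2)]
  have val: "e1 a = 1" "e1 b = 0" "e2 a = 0" "e2 b = 1" using assms(1) by (auto simp: dual_pair_def)
  have "e1 (word_value G w) = expsum a w \<and> e2 (word_value G w) = expsum b w"
    using assms(4)
  proof (induction w)
    case (Cons l w)
    have c: "word_value G w \<in> carrier G" using Cons.prems assms(2,3) by (intro word_value_closed) auto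
    have l: "fst l = a \<or> fst l = b" using Cons.prems by auto
    have lc: "fst l \<in> carrier G" using l assms(2,3) by auto
    have "e1 (word_value G (l # w)) = (if snd l then 1 else -1) * e1 (fst l) + e1 (word_value G w)"
      "e2 (word_value G (l # w)) = (if snd l then 1 else -1) * e2 (fst l) + e2 (word_value G w)"
      using c lc add inv by (cases "snd l"; simp)+
    then show ?case using Cons l val ab by (auto simp: expsum_Cons)
  qed (use one in simp)
  then show "e1 (word_value G w) = expsum a w" "e2 (word_value G w) = expsum b w" by auto
qed

end

context generating_pair begin

lemma word_dist_left_mult:
  assumes "k \<in> carrier G" "g \<in> carrier G" "h \<in> carrier G"
  shows "word_dist G S (k \<otimes> g) (k \<otimes> h) = word_dist G S g h"
  using assms by (simp add: word_dist_def inv_mult_group m_assoc)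

lemma unit_step_letter:
  assumes "g \<in> carrier G" "h \<in> carrier G" "word_dist G {a, b} g h = 1"
  shows "\<exists>l. fst l \<in> {a, b} \<and> word_value G [l] = inv g \<otimes> h"
proof -
  have H: "{a, b} \<subseteq> carrier G" "inv g \<otimes> h \<in> generate G {a, b}" using assms(1,2) ab gen_ab by auto
  obtain w where "length w = word_length G {a, b} (inv g \<otimes> h)" and w: "fst ` set w \<subseteq> {a, b}" "word_value G w = inv g \<otimes> h"
    by (rule word_length_attained[OF H])
  have "length w = 1" using assms(3) \<open>length w = word_length G {a, b} (inv g \<otimes> h)\<close> by (simp add: word_dist_def)
  then obtain l where "w = [l]" by (metis length_Suc_conv One_nat_def length_0_conv)
  then show ?thesis using w by (intro exI[of _ l]) (simp del: word_value_simps(2))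
qed

text \<open>Write the primitive element as \<open>g = c W\<^sup>\<plusminus>\<^sup>1 c\<^sup>-\<^sup>1\<close> with a positive word \<open>W\<close>.  It acts on its axis as a
  translation by some \<open>t\<close>.  Since \<open>g\<^sup>N\<close> moves a point of the axis by \<open>N \<bar>t\<bar>\<close> and is represented by a word
  of length \<open>N \<bar>W\<bar> + O(1)\<close>, the period \<open>\<bar>t\<bar>\<close> is at most \<open>\<bar>W\<bar>\<close>, which is the sum of the absolute
  exponent sums of \<open>g\<close>.  The word read along one period has the same exponent sums up to a common sign
  and length \<open>\<bar>t\<bar>\<close>, so it leaves no room for a letter with both signs.\<close>

lemma primitive_geodesic_letters:
  assumes "primitive_geodesic G 2 {a, b} \<theta>"
  obtains q where "range \<theta> \<subseteq> carrier G" "\<And>i. \<exists>l\<in>{(a, q), (b, True), (b, False)}. \<theta> (i + 1) = \<theta> i \<otimes> word_value G [l]"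
proof -
  obtain g where g: "primitive_element G 2 g" "g \<in> carrier G" "g \<noteq> \<one>" "range \<theta> \<subseteq> carrier G"
    "\<And>i j. int (word_dist G {a, b} (\<theta> i) (\<theta> j)) = \<bar>i - j\<bar>"
    "(\<lambda>h. g \<otimes> h) ` range \<theta> = range \<theta>"
    using assms unfolding primitive_geodesic_def is_axis_def by blast
  have tc [simp]: "\<theta> i \<in> carrier G" for i using g(4) by auto
  obtain p w c where w: "w \<noteq> []" "set w \<subseteq> {(a, True), (b, p)}" "c \<in> carrier G"
    "g = c \<otimes> word_value G w \<otimes> inv c \<or> g = inv (c \<otimes> word_value G w \<otimes> inv c)"
    by (rule primitive_conjugate[OF g(1)])
  have wS: "fst ` set w \<subseteq> {a, b}" using w(2) by auto
  then have wc: "fst ` set w \<subseteq> carrier G" using ab by auto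
  define w' where "w' = (if g = c \<otimes> word_value G w \<otimes> inv c then w else inv_word w)"
  have w': "fst ` set w' \<subseteq> {a, b}" "length w' = length w" "fst ` set w' \<subseteq> carrier G"
    using wS wc by (auto simp: w'_def)
  have gw': "g = c \<otimes> word_value G w' \<otimes> inv c"
    using w(3,4) wc by (auto simp: w'_def inv_mult_group m_assoc)
  obtain e1 e2 where e: "dual_pair a b e1 e2" using exists_dual_pair[OF ab gen_ab] by blast
  have aneb: "a \<noteq> b" using dual_pair_word_value(3)[OF e ab, of "[]"] by simp
  have add: "e1 (u \<otimes> v) = e1 u + e1 v" "e2 (u \<otimes> v) = e2 u + e2 v"
    if "u \<in> carrier G" "v \<in> carrier G" for u v
    using e that by (auto simp: dual_pair_def)
  note one = additive_one_inv(1)[of e1, OF add(1)] additive_one_inv(1)[of e2, OF add(2)]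
  note einv = additive_one_inv(2)[of e1, OF add(1)] additive_one_inv(2)[of e2, OF add(2)]
  have "e1 g = e1 (word_value G w')" "e2 g = e2 (word_value G w')"
    unfolding gw' using w(3) w'(3) by (simp_all add: add einv)
  then have eg: "e1 g = expsum a w'" "e2 g = expsum b w'"
    using dual_pair_word_value[OF e ab w'(1)] by auto
  have lenw: "int (length w) = \<bar>e1 g\<bar> + \<bar>e2 g\<bar>"
    unfolding eg using positive_word_expsum[OF w(2) aneb] by (simp add: w'_def)
  define \<sigma> where "\<sigma> i = (SOME j. \<theta> j = g \<otimes> \<theta> i)" for i
  have \<sigma>: "\<theta> (\<sigma> i) = g \<otimes> \<theta> i" for i
  proof -
    have "g \<otimes> \<theta> i \<in> range \<theta>" using g(6) by blast
    then have "\<exists>j. \<theta> j = g \<otimes> \<theta> i" by (metis rangeE)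
    then show ?thesis unfolding \<sigma>_def by (rule someI_ex)
  qed
  have inj: "i = j" if "\<theta> i = \<theta> j" for i j
    using g(5)[of i j] g(5)[of j j] that by simp
  have "\<bar>\<sigma> i - \<sigma> j\<bar> = \<bar>i - j\<bar>" for i j
    unfolding g(5)[symmetric] \<sigma> using g(2) by (simp add: word_dist_left_mult)
  then have "(\<forall>i. \<sigma> i = \<sigma> 0 + i) \<or> (\<forall>i. \<sigma> i = \<sigma> 0 - i)" by (rule int_isometry)
  \<comment> \<open>a reflection would give \<open>g\<close> order two, but \<open>g\<close> has a nonzero exponent sum\<close>
  moreover have "\<not> (\<forall>i. \<sigma> i = \<sigma> 0 - i)"
  proof
    assume *: "\<forall>i. \<sigma> i = \<sigma> 0 - i"
    have "g \<otimes> (g \<otimes> \<theta> 0) = \<theta> (\<sigma> (\<sigma> 0))" by (simp add: \<sigma>)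
    also have "\<sigma> (\<sigma> 0) = 0" using *[rule_format, of "\<sigma> 0"] by simp
    finally have "(g \<otimes> g) \<otimes> \<theta> 0 = \<one> \<otimes> \<theta> 0" using g(2) by (simp add: m_assoc)
    then have "g \<otimes> g = \<one>" using g(2) using right_cancel[of "\<theta> 0" "g \<otimes> g" \<one>] by simp
    then have "e1 g = 0" "e2 g = 0" using add(1)[OF g(2) g(2)] add(2)[OF g(2) g(2)] one by auto
    then show False using lenw w(1) by simp
  qed
  ultimately have \<sigma>0: "\<forall>i. \<sigma> i = \<sigma> 0 + i" by blast
  have trans: "\<theta> (i + \<sigma> 0) = g \<otimes> \<theta> i" for i
    using \<sigma>[of i] unfolding \<sigma>0[rule_format, of i] by (simp only: add.commute)
  define t where "t = \<sigma> 0"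
  note trans = trans[folded t_def]
  have t0: "t \<noteq> 0"
  proof
    assume "t = 0"
    then have "g \<otimes> \<theta> 0 = \<one> \<otimes> \<theta> 0" using trans[of 0] by simp
    then show False using g(2,3) right_cancel[of "\<theta> 0" g \<one>] by simp
  qed
  define T where "T = nat \<bar>t\<bar>"
  \<comment> \<open>the period is at most the length of the positive word\<close>
  have period: "T \<le> length w"
  proof (rule ccontr)
    assume "\<not> T \<le> length w"
    obtain z where z: "fst ` set z \<subseteq> {a, b}" "word_value G z = inv (\<theta> 0) \<otimes> c"
    proof -
      have "inv (\<theta> 0) \<otimes> c \<in> generate G {a, b}" using gen_ab w(3) by simp
      then show thesis using that generate_iff_word[of "{a, b}"] ab by auto
    qed
    have zc: "fst ` set z \<subseteq> carrier G" using z(1) ab by auto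
    define P where "P N = concat (replicate N w')" for N
    have P: "fst ` set (P N) \<subseteq> {a, b}" "length (P N) = N * length w" "fst ` set (P N) \<subseteq> carrier G" for N
    proof -
      show *: "fst ` set (P N) \<subseteq> {a, b}" for N
        using w'(1) unfolding P_def by (induction N) (simp_all add: image_Un)
      show "length (P N) = N * length w"
        using w'(2) by (induction N) (auto simp: P_def)
      show "fst ` set (P N) \<subseteq> carrier G" using *[of N] ab by auto
    qed
    have th: "\<theta> (int N * t) = c \<otimes> word_value G (P N) \<otimes> inv c \<otimes> \<theta> 0" for N
    proof (induction N)
      case 0
      then show ?case using w(3) by (simp add: P_def)
    next
      case (Suc N)
      have "\<theta> (int (Suc N) * t) = g \<otimes> \<theta> (int N * t)"
        using trans[of "int N * t"] by (simp add: algebra_simps)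
      also have "\<dots> = c \<otimes> (word_value G w' \<otimes> word_value G (P N)) \<otimes> inv c \<otimes> \<theta> 0"
        unfolding Suc gw' using w(3) w'(3) P(3)[of N] by (simp add: m_assoc)
      also have "word_value G w' \<otimes> word_value G (P N) = word_value G (P (Suc N))"
        using w'(3) P(3)[of N] by (simp add: P_def)
      finally show ?case .
    qed
    \<comment> \<open>\<open>z\<close> joins \<open>\<theta> 0\<close> to the axis of \<open>W\<close>; this \<open>N\<close> outweighs the two copies of \<open>z\<close>\<close>
    define N where "N = 2 * length z + 1"
    have "inv (\<theta> 0) \<otimes> \<theta> (int N * t) = word_value G (z @ P N @ inv_word z)"
    proof -
      have "word_value G (z @ P N @ inv_word z) = word_value G z \<otimes> (word_value G (P N) \<otimes> inv (word_value G z))"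
        using zc P(3)[of N] by (subst word_value_append) (auto simp: image_Un)
      then show ?thesis unfolding th using z(2) w(3) P(3)[of N] by (simp add: m_assoc inv_mult_group)
    qed
    then have "word_dist G {a, b} (\<theta> 0) (\<theta> (int N * t)) \<le> length (z @ P N @ inv_word z)"
      unfolding word_dist_def using z(1) P(1)[of N] by (intro word_length_le) (auto simp: image_Un)
    then have "N * T \<le> 2 * length z + N * length w"
    proof -
      have "int (N * T) = int (word_dist G {a, b} (\<theta> 0) (\<theta> (int N * t)))"
        using g(5)[of 0 "int N * t"] by (simp add: T_def abs_mult)
      then have "N * T = word_dist G {a, b} (\<theta> 0) (\<theta> (int N * t))" by linarith
      also have "\<dots> \<le> length (z @ P N @ inv_word z)" by fact
      finally show ?thesis using P(2)[of N] by simp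
    qed
    moreover have "N * (length w + 1) \<le> N * T" using \<open>\<not> T \<le> length w\<close> by (intro mult_le_mono2) simp
    ultimately show False by (simp add: N_def)
  qed
  \<comment> \<open>the labels of the edges, periodic with period \<open>t\<close>\<close>
  define D where "D i = inv (\<theta> i) \<otimes> \<theta> (i + 1)" for i
  have Dt: "D (i + t) = D i" for i
    unfolding D_def using trans[of i] trans[of "i + 1"] g(2)
    by (simp add: inv_mult_group m_assoc ac_simps)
  have DT: "D (i + int m * t) = D i" for i m
  proof (induction m)
    case (Suc m)
    have "D (i + int (Suc m) * t) = D ((i + int m * t) + t)" by (simp add: algebra_simps)
    then show ?case using Suc Dt by simp
  qed simp
  have Dmod: "D i = D (i mod int T)" for i
  proof -
    have DT': "D (i + m * t) = D i" for i m
    proof (cases "m \<ge> 0")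
      case True
      then show ?thesis using DT[of i "nat m"] by simp
    next
      case False
      then show ?thesis using DT[of "i + m * t" "nat (- m)"] by simp
    qed
    have "\<exists>m. i mod int T = i + m * t"
      by (rule exI[of _ "- (i div int T) * sgn t"])
         (simp add: T_def abs_sgn minus_div_mult_eq_mod[symmetric] algebra_simps)
    then show ?thesis using DT' by metis
  qed
  define l where "l d = (SOME l. fst l \<in> {a, b} \<and> word_value G [l] = d)" for d
  have l: "fst (l (D i)) \<in> {a, b} \<and> word_value G [l (D i)] = D i" for i
    unfolding l_def
    by (rule someI_ex) (use unit_step_letter[of "\<theta> i" "\<theta> (i + 1)"] g(5)[of i "i + 1"] in \<open>auto simp: D_def\<close>)
  define u where "u m = map (\<lambda>j. l (D (int j))) [0..<m]" for m
  have uS: "fst ` set (u m) \<subseteq> {a, b}" for m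
  proof -
    have "fst ` set (u m) = (\<lambda>j. fst (l (D (int j)))) ` {..<m}" by (auto simp: u_def image_image)
    also have "\<dots> \<subseteq> {a, b}" by (rule image_subsetI) (rule l[THEN conjunct1])
    finally show ?thesis .
  qed
  then have uc: "fst ` set (u m) \<subseteq> carrier G" for m using ab by (meson empty_subsetI insert_subset order_trans)
  have uval: "\<theta> (int m) = \<theta> 0 \<otimes> word_value G (u m)" for m
  proof (induction m)
    case 0
    then show ?case by (simp add: u_def)
  next
    case (Suc m)
    have "word_value G (u (Suc m)) = word_value G (u m) \<otimes> D (int m)"
      using uc[of m] l[of "int m"] uc[of "Suc m"] by (simp add: u_def del: word_value_simps(2))
    then have "\<theta> 0 \<otimes> word_value G (u (Suc m)) = \<theta> (int m) \<otimes> D (int m)"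
      unfolding Suc using uc[of m] by (simp add: m_assoc D_def)
    then show ?case by (simp add: D_def add.commute)
  qed
  have "\<bar>e1 (word_value G (u T))\<bar> = \<bar>e1 g\<bar> \<and> \<bar>e2 (word_value G (u T))\<bar> = \<bar>e2 g\<bar>"
  proof (cases "t > 0")
    case True
    then have "\<theta> (int T) = g \<otimes> \<theta> 0" using trans[of 0] by (simp add: T_def)
    then have "e1 g + e1 (\<theta> 0) = e1 (\<theta> 0) + e1 (word_value G (u T))" "e2 g + e2 (\<theta> 0) = e2 (\<theta> 0) + e2 (word_value G (u T))"
      using uval[of T] add g(2) uc[of T] by (metis tc word_value_closed)+
    then show ?thesis by simp
  next
    case False
    then have "\<theta> 0 = g \<otimes> \<theta> (int T)" using trans[of "- t"] by (simp add: T_def)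
    then have "e1 (\<theta> 0) = e1 g + (e1 (\<theta> 0) + e1 (word_value G (u T)))" "e2 (\<theta> 0) = e2 g + (e2 (\<theta> 0) + e2 (word_value G (u T)))"
      using uval[of T] add g(2) uc[of T] by (metis tc word_value_closed)+
    then have "e1 (word_value G (u T)) = - e1 g" "e2 (word_value G (u T)) = - e2 g" by linarith+
    then show ?thesis by simp
  qed
  then have "int (length (u T)) \<le> \<bar>expsum a (u T)\<bar> + \<bar>expsum b (u T)\<bar>"
    using period lenw dual_pair_word_value[OF e ab uS[of T]] by (simp add: u_def)
  then obtain q where q: "set (u T) \<subseteq> {(a, q), (b, True), (b, False)}"
    using monotone_letters[OF uS aneb] by blast
  have "\<exists>l\<in>{(a, q), (b, True), (b, False)}. \<theta> (i + 1) = \<theta> i \<otimes> word_value G [l]" for i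
  proof
    have "0 \<le> i mod int T" "i mod int T < int T" using t0 by (simp_all add: T_def)
    then have "l (D (i mod int T)) \<in> set (u T)"
      by (auto simp: u_def intro!: image_eqI[of _ _ "nat (i mod int T)"])
    then show "l (D i) \<in> {(a, q), (b, True), (b, False)}" using q Dmod[of i] by auto
    show "\<theta> (i + 1) = \<theta> i \<otimes> word_value G [l (D i)]" using l[of i] by (simp add: D_def del: word_value_simps(2))
  qed
  then show thesis using that g(4) by blast
qed

text \<open>A ray may run through the primitive geodesic backwards; then all letters are inverted, which
  replaces the sign of \<open>a\<close> by the opposite one and leaves the condition on \<open>b\<close> unchanged.\<close>

theorem primitive_ray_words:
  assumes "primitive_geodesic_ray G 2 {a, b} \<eta>" "\<eta> 0 = \<one>"
  obtains q where "\<And>i. \<exists>w. length w = i \<and> set w \<subseteq> {(a, q), (b, True), (b, False)} \<and>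
      reduced_word w \<and> word_value G w = \<eta> i"
proof -
  obtain \<theta> where dist: "\<And>i j. int (word_dist G {a, b} (\<eta> i) (\<eta> j)) = \<bar>int i - int j\<bar>"
    and \<theta>: "primitive_geodesic G 2 {a, b} \<theta>" "range \<eta> \<subseteq> range \<theta>"
    using assms unfolding primitive_geodesic_ray_def by blast
  obtain q where q: "range \<theta> \<subseteq> carrier G"
    "\<And>i. \<exists>l\<in>{(a, q), (b, True), (b, False)}. \<theta> (i + 1) = \<theta> i \<otimes> word_value G [l]"
    using primitive_geodesic_letters[OF \<theta>(1)] by blast
  have tc [simp]: "\<theta> i \<in> carrier G" for i using q(1) by auto
  have "\<exists>j. \<theta> j = \<eta> i" for i using \<theta>(2) by (metis rangeE rangeI subsetD)
  then obtain \<tau> where \<tau>: "\<And>i. \<theta> (\<tau> i) = \<eta> i" by metis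
  have \<theta>dist: "int (word_dist G {a, b} (\<theta> i) (\<theta> j)) = \<bar>i - j\<bar>" for i j
    using \<theta>(1) unfolding primitive_geodesic_def is_axis_def by blast
  have "\<bar>\<tau> i - \<tau> j\<bar> = \<bar>int i - int j\<bar>" for i j
    using \<theta>dist[of "\<tau> i" "\<tau> j"] dist[of i j] by (simp add: \<tau>)
  then have \<tau>': "(\<forall>i. \<tau> i = \<tau> 0 + int i) \<or> (\<forall>i. \<tau> i = \<tau> 0 - int i)" by (rule nat_isometry)
  have "\<exists>q'. \<forall>i. \<exists>l\<in>{(a, q'), (b, True), (b, False)}. \<eta> (Suc i) = \<eta> i \<otimes> word_value G [l]"
    using \<tau>'
  proof
    assume *: "\<forall>i. \<tau> i = \<tau> 0 + int i"
    have "\<exists>l\<in>{(a, q), (b, True), (b, False)}. \<eta> (Suc i) = \<eta> i \<otimes> word_value G [l]" for i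
    proof -
      have "\<tau> (Suc i) = \<tau> i + 1" using *[rule_format, of i] *[rule_format, of "Suc i"] by simp
      then show ?thesis using q(2)[of "\<tau> i"] \<tau>[of i] \<tau>[of "Suc i"] by simp
    qed
    then show ?thesis by blast
  next
    assume *: "\<forall>i. \<tau> i = \<tau> 0 - int i"
    have "\<exists>l\<in>{(a, \<not> q), (b, True), (b, False)}. \<eta> (Suc i) = \<eta> i \<otimes> word_value G [l]" for i
    proof -
      have "\<tau> i = \<tau> (Suc i) + 1" using *[rule_format, of i] *[rule_format, of "Suc i"] by simp
      then obtain l where l: "l \<in> {(a, q), (b, True), (b, False)}" "\<eta> i = \<eta> (Suc i) \<otimes> word_value G [l]"
        using q(2)[of "\<tau> (Suc i)"] \<tau>[of i] \<tau>[of "Suc i"] by metis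
      have lc: "fst ` set [l] \<subseteq> carrier G" using l(1) ab by auto
      have "\<eta> (Suc i) \<in> carrier G" using tc[of "\<tau> (Suc i)"] \<tau>[of "Suc i"] by simp
      then have "\<eta> (Suc i) = \<eta> i \<otimes> word_value G (inv_word [l])"
        unfolding l(2) using lc by (simp add: m_assoc del: word_value_simps(2) inv_word_simps(6))
      moreover have "inv_letter l \<in> {(a, \<not> q), (b, True), (b, False)}" using l(1) by (auto simp: inv_letter_def)
      ultimately show ?thesis by (intro bexI[of _ "inv_letter l"]) (simp_all del: word_value_simps(2))
    qed
    then show ?thesis by blast
  qed
  then obtain q' m where m: "\<And>i. m i \<in> {(a, q'), (b, True), (b, False)}" "\<And>i. \<eta> (Suc i) = \<eta> i \<otimes> word_value G [m i]"
    by metis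
  define w where "w i = map m [0..<i]" for i
  have wS: "set (w i) \<subseteq> {(a, q'), (b, True), (b, False)}" for i
    unfolding w_def set_map by (rule image_subsetI) (rule m(1))
  then have wf: "fst ` set (w i) \<subseteq> {a, b}" for i using image_mono[OF wS[of i], of fst] by simp
  then have wc: "fst ` set (w i) \<subseteq> carrier G" for i using ab by (meson empty_subsetI insert_subset order_trans)
  have val: "word_value G (w i) = \<eta> i" for i
  proof (induction i)
    case (Suc i)
    have "fst ` set [m i] \<subseteq> carrier G" using wc[of "Suc i"] by (simp add: w_def)
    then have "word_value G (w i @ [m i]) = \<eta> (Suc i)" using wc[of i] Suc m(2)[of i]
      by (simp del: word_value_simps(2))
    then show ?case by (simp add: w_def)
  qed (use assms in \<open>simp add: w_def\<close>)
  have "reduced_word (w i)" for i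
  proof (rule geodesic_word_reduced[OF _ wf])
    show "{a, b} \<subseteq> carrier G" using ab by simp
    have "\<eta> i \<in> carrier G" using tc[of "\<tau> i"] \<tau>[of i] by simp
    then show "word_length G {a, b} (word_value G (w i)) = length (w i)"
      using dist[of 0 i] assms(2) unfolding val by (simp add: word_dist_def w_def)
  qed
  then show thesis using that[of q'] wS val by (metis diff_zero length_map length_upt w_def)
qed

end

section \<open>Minors\<close>

text \<open>Rows and columns are lists rather than sets, since the proofs move, reverse and repeat them.\<close>

definition minor :: "real mat \<Rightarrow> nat list \<Rightarrow> nat list \<Rightarrow> real" where
  "minor X I J = Determinant.det (mat (length I) (length J) (\<lambda>(r, c). X $$ (I ! r, J ! c)))"

definition row_det :: "(nat \<Rightarrow> real) list \<Rightarrow> real" where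
  "row_det vs = Determinant.det (mat (length vs) (length vs) (\<lambda>(r, c). (vs ! r) c))"

text \<open>The \<open>k\<close>-element subsets of \<open>{..<n}\<close>, each listed in increasing order.\<close>

definition index_lists :: "nat \<Rightarrow> nat \<Rightarrow> nat list set" where
  "index_lists n k = {K. sorted_wrt (<) K \<and> length K = k \<and> set K \<subseteq> {..<n}}"

lemma minor_row_det:
  "length I = length J \<Longrightarrow> minor X I J = row_det (map (\<lambda>r c. X $$ (r, J ! c)) I)"
  unfolding minor_def row_det_def by (intro arg_cong[where f = Determinant.det] eq_matI) auto

lemma nth_less_bound: "set I \<subseteq> {..<n} \<Longrightarrow> r < length I \<Longrightarrow> I ! r < (n::nat)"
  by (meson lessThan_iff nth_mem subsetD)

lemma minor_transpose:
  assumes "X \<in> carrier_mat n n" "set I \<subseteq> {..<n}" "set J \<subseteq> {..<n}" "length I = length J"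
  shows "minor (transpose_mat X) I J = minor X J I"
proof -
  have "I ! r < n" "J ! r < n" if "r < length I" for r
    using nth_less_bound[OF assms(2)] nth_less_bound[OF assms(3)] assms(4) that by auto
  then have "mat (length I) (length J) (\<lambda>(r, c). transpose_mat X $$ (I ! r, J ! c)) =
      transpose_mat (mat (length J) (length I) (\<lambda>(r, c). X $$ (J ! r, I ! c)))"
    using assms by (intro eq_matI) auto
  then show ?thesis using assms(4) unfolding minor_def
    by (simp add: det_transpose[of _ "length J"])
qed

lemma finite_index_lists [simp]: "finite (index_lists n k)"
proof (rule finite_subset)
  show "index_lists n k \<subseteq> {K. set K \<subseteq> {..<n} \<and> length K = k}" by (auto simp: index_lists_def)
qed (simp add: finite_lists_length_eq)

lemma index_lists_upt [simp]: "i + k \<le> n \<Longrightarrow> [i..<i + k] \<in> index_lists n k"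
  by (auto simp: index_lists_def sorted_wrt_upt)

lemma index_lists_upt0 [simp]: "k \<le> n \<Longrightarrow> [0..<k] \<in> index_lists n k"
  using index_lists_upt[of 0 k n] by simp

lemma index_lists_length: "K \<in> index_lists n k \<Longrightarrow> length K = k"
  by (simp add: index_lists_def)

lemma index_lists_distinct: "K \<in> index_lists n k \<Longrightarrow> distinct K"
  by (simp add: index_lists_def strict_sorted_iff)

lemma index_lists_le: "K \<in> index_lists n k \<Longrightarrow> k \<le> n"
  using distinct_card[of K] card_mono[of "{..<n}" "set K"] index_lists_distinct[of K n k]
  by (auto simp: index_lists_def)

lemma index_lists_nth: "K \<in> index_lists n k \<Longrightarrow> i < k \<Longrightarrow> K ! i < n"
  using nth_less_bound[of K n i] by (auto simp: index_lists_def)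

lemma index_lists_set_eq: "K \<in> index_lists n k \<Longrightarrow> K' \<in> index_lists n k \<Longrightarrow> set K = set K' \<Longrightarrow> K = K'"
  by (auto simp: index_lists_def strict_sorted_equal)

lemma upt_unique:
  assumes "K \<in> index_lists n k" "set K \<subseteq> {i..<i + k}"
  shows "K = [i..<i + k]"
proof -
  have "card (set K) = card {i..<i + k}"
    using distinct_card[OF index_lists_distinct[OF assms(1)]] assms(1) by (simp add: index_lists_def)
  then have "set K = {i..<i + k}" using assms(2) by (intro card_subset_eq) auto
  then show ?thesis using assms(1) strict_sorted_equal[of "[i..<i + k]" K]
    by (simp add: index_lists_def sorted_wrt_upt)
qed

lemma row_det_repeated:
  assumes "i < length vs" "j < length vs" "i \<noteq> j" "vs ! i = vs ! j"
  shows "row_det vs = 0"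
  unfolding row_det_def
  by (rule det_identical_rows[of _ "length vs" i j]) (use assms in \<open>auto intro!: eq_vecI\<close>)

lemma row_det_swap: "row_det (P @ [a, b] @ Q) = - row_det (P @ [b, a] @ Q)"
proof -
  let ?n = "length (P @ [b, a] @ Q)" and ?p = "length P"
  let ?A = "mat ?n ?n (\<lambda>(r, c). ((P @ [b, a] @ Q) ! r) c)"
  have "mat ?n ?n (\<lambda>(r, c). ((P @ [a, b] @ Q) ! r) c) = swaprows ?p (Suc ?p) ?A"
  proof (rule eq_matI)
    fix r c assume "r < dim_row (swaprows ?p (Suc ?p) ?A)" "c < dim_col (swaprows ?p (Suc ?p) ?A)"
    then show "mat ?n ?n (\<lambda>(r, c). ((P @ [a, b] @ Q) ! r) c) $$ (r, c) = swaprows ?p (Suc ?p) ?A $$ (r, c)"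
      by (auto simp: nth_append nth_Cons split: nat.splits)
  qed auto
  then show ?thesis unfolding row_det_def by (simp add: det_swaprows[of _ ?n])
qed

lemma row_det_move: "row_det (P @ S @ [v] @ Q) = (-1) ^ length S * row_det (P @ [v] @ S @ Q)"
proof (induction S arbitrary: Q rule: rev_induct)
  case (snoc s S)
  have "row_det (P @ (S @ [s]) @ [v] @ Q) = - row_det ((P @ S) @ [v, s] @ Q)"
    using row_det_swap[of "P @ S" s v Q] by simp
  also have "\<dots> = - ((-1) ^ length S * row_det (P @ [v] @ S @ [s] @ Q))"
    using snoc[of "[s] @ Q"] by simp
  finally show ?case by simp
qed simp

text \<open>The sign \<open>(-1)\<close> to the power \<open>k (k - 1) / 2\<close> of the permutation that reverses \<open>k\<close> elements.\<close>

fun rev_sign :: "nat \<Rightarrow> real" where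
  "rev_sign 0 = 1"
| "rev_sign (Suc k) = (-1) ^ k * rev_sign k"

lemma rev_sign_square [simp]: "rev_sign k * rev_sign k = 1" "rev_sign k \<noteq> 0"
proof -
  have "rev_sign k * rev_sign k = 1"
  proof (induction k)
    case (Suc k)
    have "rev_sign (Suc k) * rev_sign (Suc k) = ((-1) ^ k * (-1) ^ k) * (rev_sign k * rev_sign k)"
      by (simp add: mult_ac)
    then show ?case using Suc by (simp add: power_mult_distrib[symmetric])
  qed simp
  then show "rev_sign k * rev_sign k = 1" "rev_sign k \<noteq> 0" by auto
qed

lemma row_det_rev: "row_det (P @ rev S) = rev_sign (length S) * row_det (P @ S)"
proof (induction S arbitrary: P)
  case (Cons s S)
  have "row_det (P @ rev (s # S)) = (-1) ^ length S * row_det ((P @ [s]) @ rev S)"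
    using row_det_move[of P "rev S" s "[]"] by simp
  then show ?case using Cons[of "P @ [s]"] by simp
qed simp

lemma minor_rev_cols:
  assumes "X \<in> carrier_mat n n" "set I \<subseteq> {..<n}" "set J \<subseteq> {..<n}" "length I = length J"
  shows "minor X I (rev J) = rev_sign (length J) * minor X I J"
proof -
  have "minor X I (rev J) = minor (transpose_mat X) (rev J) I"
    using assms minor_transpose[OF assms(1), of "rev J" I] by simp
  also have "\<dots> = rev_sign (length J) * minor (transpose_mat X) J I"
    using row_det_rev[of "[]" "map (\<lambda>r c. transpose_mat X $$ (r, I ! c)) J"] assms(4)
    by (simp add: minor_row_det rev_map)
  finally show ?thesis using assms minor_transpose[OF assms(1), of J I] by simp
qed

subsection \<open>The Cauchy--Binet formula\<close>

text \<open>Multilinearity in the rows.\<close>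

lemma det_rows_of_product:
  fixes a b :: "nat \<Rightarrow> nat \<Rightarrow> real"
  shows "Determinant.det (mat k k (\<lambda>(r, c). \<Sum>l<n. a r l * b l c)) =
    (\<Sum>f | (\<forall>i\<in>{0..<k}. f i \<in> {..<n}) \<and> (\<forall>i. i \<notin> {0..<k} \<longrightarrow> f i = i).
       (\<Prod>r\<in>{0..<k}. a r (f r)) * Determinant.det (mat k k (\<lambda>(r, c). b (f r) c)))"
proof -
  let ?y = "\<lambda>l. vec k (b l)"
  have fin: "finsum_vec TYPE(real) k (\<lambda>l. a r l \<cdot>\<^sub>v ?y l) {..<n} = vec k (\<lambda>c. \<Sum>l<n. a r l * b l c)" for r
    by (rule eq_vecI) (auto simp: index_finsum_vec finsum_vec_closed[THEN carrier_vecD])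
  have "mat k k (\<lambda>(r, c). \<Sum>l<n. a r l * b l c) =
      mat\<^sub>r k k (\<lambda>r. finsum_vec TYPE(real) k (\<lambda>l. a r l \<cdot>\<^sub>v ?y l) {..<n})"
    unfolding fin by (rule eq_matI) (auto simp: mat_of_rows_def)
  then have "Determinant.det (mat k k (\<lambda>(r, c). \<Sum>l<n. a r l * b l c)) =
    (\<Sum>f | (\<forall>i\<in>{0..<k}. f i \<in> {..<n}) \<and> (\<forall>i. i \<notin> {0..<k} \<longrightarrow> f i = i).
        Determinant.det (mat\<^sub>r k k (\<lambda>r. a r (f r) \<cdot>\<^sub>v ?y (f r))))"
    by (simp add: det_linear_rows_sum)
  also have "\<dots> = (\<Sum>f | (\<forall>i\<in>{0..<k}. f i \<in> {..<n}) \<and> (\<forall>i. i \<notin> {0..<k} \<longrightarrow> f i = i).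
       (\<Prod>r\<in>{0..<k}. a r (f r)) * Determinant.det (mat k k (\<lambda>(r, c). b (f r) c)))"
  proof (rule sum.cong[OF HOL.refl])
    fix f :: "nat \<Rightarrow> nat"
    have "Determinant.det (mat\<^sub>r k k (\<lambda>r. a r (f r) \<cdot>\<^sub>v ?y (f r))) =
       prod (\<lambda>r. a r (f r)) {0..<k} * Determinant.det (mat\<^sub>r k k (\<lambda>r. ?y (f r)))"
      by (rule det_rows_mul) auto
    also have "mat\<^sub>r k k (\<lambda>r. ?y (f r)) = mat k k (\<lambda>(r, c). b (f r) c)"
      by (rule eq_matI) auto
    finally show "Determinant.det (mat\<^sub>r k k (\<lambda>r. a r (f r) \<cdot>\<^sub>v ?y (f r))) =
      (\<Prod>r\<in>{0..<k}. a r (f r)) * Determinant.det (mat k k (\<lambda>(r, c). b (f r) c))" .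
  qed
  finally show ?thesis .
qed

text \<open>An injective map is its sorted image together with a permutation; this turns the sum over
  injective maps in the multilinear expansion into a sum over minors.\<close>

lemma injective_maps_bij:
  "bij_betw (\<lambda>(K, p) i. if i < k then K ! (p i) else i)
     (index_lists n k \<times> {p. p permutes {0..<k}})
     {f. (\<forall>i\<in>{0..<k}. f i \<in> {..<n}) \<and> (\<forall>i. i \<notin> {0..<k} \<longrightarrow> f i = i) \<and> inj_on f {0..<k}}"
  (is "bij_betw ?F (?A \<times> ?P) ?B")
  unfolding bij_betw_def
proof (intro conjI subset_antisym subsetI)
  have img: "?F (K, p) ` {0..<k} = set K" if "K \<in> ?A" "p permutes {0..<k}" for K p
  proof -
    have "?F (K, p) ` {0..<k} = (\<lambda>i. K ! i) ` (p ` {0..<k})" by (auto simp: image_image)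
    also have "\<dots> = set K" using permutes_image[OF that(2)] index_lists_length[OF that(1)]
      by (auto simp: set_conv_nth)
    finally show ?thesis .
  qed
  show "inj_on ?F (?A \<times> ?P)"
  proof (rule inj_onI, clarify)
    fix K p K' p' assume *: "K \<in> ?A" "p permutes {0..<k}" "K' \<in> ?A" "p' permutes {0..<k}"
      "(\<lambda>i. if i < k then K ! (p i) else i) = (\<lambda>i. if i < k then K' ! (p' i) else i)"
    then have "set K = set K'" using img[of K p] img[of K' p'] by simp
    then have K: "K = K'" using * index_lists_set_eq by blast
    have "p i = p' i" for i
    proof (cases "i < k")
      case True
      have "K ! (p i) = K ! (p' i)" using fun_cong[OF *(5), of i] True K by simp
      moreover have "p i < k" "p' i < k" using True permutes_in_image[OF *(2)] permutes_in_image[OF *(4)] by auto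
      ultimately show ?thesis using index_lists_distinct[OF *(1)] index_lists_length[OF *(1)]
        by (simp add: nth_eq_iff_index_eq)
    next
      case False
      then show ?thesis using *(2,4) by (simp add: permutes_def)
    qed
    then show "K = K' \<and> p = p'" using K by auto
  qed
  show "f \<in> ?B" if f: "f \<in> ?F ` (?A \<times> ?P)" for f
  proof -
    from f obtain K p where Kp: "K \<in> ?A" "p permutes {0..<k}" "f = ?F (K, p)" by auto
    have "p i < k" if "i < k" for i using that permutes_in_image[OF Kp(2)] by auto
    then have "inj_on f {0..<k}" "\<forall>i\<in>{0..<k}. f i \<in> {..<n}"
      using Kp index_lists_distinct[OF Kp(1)] index_lists_length[OF Kp(1)] index_lists_nth[OF Kp(1)]
        permutes_inj[OF Kp(2)]
      by (auto simp: inj_on_def nth_eq_iff_index_eq)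
    then show ?thesis using Kp by auto
  qed
  show "f \<in> ?F ` (?A \<times> ?P)" if f: "f \<in> ?B" for f
  proof -
    define K where "K = sorted_list_of_set (f ` {0..<k})"
    have inj: "inj_on f {0..<k}" using f by auto
    have K: "K \<in> ?A" "set K = f ` {0..<k}"
      using f card_image[OF inj] by (auto simp: K_def index_lists_def)
    have lK: "length K = k" using index_lists_length[OF K(1)] .
    have "\<exists>j<k. K ! j = f i" if "i < k" for i
      using K(2) lK that by (metis atLeastLessThan_iff imageI in_set_conv_nth zero_le)
    then obtain q where q: "\<And>i. i < k \<Longrightarrow> q i < k \<and> K ! (q i) = f i" by metis
    define p where "p i = (if i < k then q i else i)" for i
    have "inj_on p {0..<k}"
      using inj q by (auto simp: inj_on_def p_def) (metis atLeastLessThan_iff zero_le)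
    moreover have "p ` {0..<k} \<subseteq> {0..<k}" using q by (auto simp: p_def)
    ultimately have "bij_betw p {0..<k} {0..<k}"
      by (simp add: bij_betw_def endo_inj_surj)
    then have "p permutes {0..<k}" by (intro bij_imp_permutes) (auto simp: p_def)
    moreover have "f = ?F (K, p)" using f q by (auto simp: fun_eq_iff p_def)
    ultimately show ?thesis using K(1) by (intro image_eqI[of _ _ "(K, p)"]) auto
  qed
qed

theorem cauchy_binet:
  assumes X: "X \<in> carrier_mat n n" and Y: "Y \<in> carrier_mat n n"
    and I: "set I \<subseteq> {..<n}" "length I = k" and J: "set J \<subseteq> {..<n}" "length J = k"
  shows "minor (X * Y) I J = (\<Sum>K\<in>index_lists n k. minor X I K * minor Y K J)"
proof -
  define a where "a r l = X $$ (I ! r, l)" for r l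
  define b where "b l c = Y $$ (l, J ! c)" for l c
  have lt: "I ! r < n" "J ! r < n" if "r < k" for r
    using nth_less_bound[OF I(1)] nth_less_bound[OF J(1)] I(2) J(2) that by auto
  let ?S = "{f. (\<forall>i\<in>{0..<k}. f i \<in> {..<n}) \<and> (\<forall>i. i \<notin> {0..<k} \<longrightarrow> f i = i)}"
  let ?B = "{f. (\<forall>i\<in>{0..<k}. f i \<in> {..<n}) \<and> (\<forall>i. i \<notin> {0..<k} \<longrightarrow> f i = i) \<and> inj_on f {0..<k}}"
  let ?t = "\<lambda>f. (\<Prod>r\<in>{0..<k}. a r (f r)) * Determinant.det (mat k k (\<lambda>(r, c). b (f r) c))"
  have "mat k k (\<lambda>(r, c). (X * Y) $$ (I ! r, J ! c)) = mat k k (\<lambda>(r, c). \<Sum>l<n. a r l * b l c)"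
    using X Y lt by (intro eq_matI) (auto simp: scalar_prod_def a_def b_def atLeast0LessThan)
  then have "minor (X * Y) I J = (\<Sum>f\<in>?S. ?t f)"
    unfolding minor_def I(2) J(2) by (simp only: det_rows_of_product)
  also have "\<dots> = (\<Sum>f\<in>?B. ?t f)"
  proof (rule sum.mono_neutral_right)
    show "finite ?S" by (rule finite_bounded_functions) auto
    show "?B \<subseteq> ?S" by auto
    show "\<forall>f\<in>?S - ?B. ?t f = 0"
    proof
      fix f assume "f \<in> ?S - ?B"
      then obtain i j where ij: "i < k" "j < k" "i \<noteq> j" "f i = f j" by (auto simp: inj_on_def)
      have "Determinant.det (mat k k (\<lambda>(r, c). b (f r) c)) = 0"
        by (rule det_identical_rows[of _ k i j]) (use ij in \<open>auto intro!: eq_vecI\<close>)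
      then show "?t f = 0" by simp
    qed
  qed
  also have "\<dots> = (\<Sum>(K, p)\<in>index_lists n k \<times> {p. p permutes {0..<k}}. ?t (\<lambda>i. if i < k then K ! (p i) else i))"
    using sum.reindex_bij_betw[OF injective_maps_bij[of k n], of ?t] by (simp add: case_prod_unfold)
  also have "\<dots> = (\<Sum>K\<in>index_lists n k. \<Sum>p | p permutes {0..<k}. ?t (\<lambda>i. if i < k then K ! (p i) else i))"
    by (subst sum.cartesian_product) simp
  also have "\<dots> = (\<Sum>K\<in>index_lists n k. minor X I K * minor Y K J)"
  proof (rule sum.cong[OF HOL.refl])
    fix K assume K: "K \<in> index_lists n k"
    note lK = index_lists_length[OF K]
    have "?t (\<lambda>i. if i < k then K ! (p i) else i) =
        signof p * (\<Prod>r = 0..<k. X $$ (I ! r, K ! (p r))) * minor Y K J" if p: "p permutes {0..<k}" for p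
    proof -
      have pk: "p r < k" if "r < k" for r using that permutes_in_image[OF p] by auto
      have "mat k k (\<lambda>(r, c). b (if r < k then K ! (p r) else r) c) =
          mat k k (\<lambda>(r, c). mat k k (\<lambda>(r, c). Y $$ (K ! r, J ! c)) $$ (p r, c))"
        using pk by (intro eq_matI) (auto simp: b_def)
      then have "Determinant.det (mat k k (\<lambda>(r, c). b (if r < k then K ! (p r) else r) c)) = signof p * minor Y K J"
        using det_permute_rows[OF _ p, of "mat k k (\<lambda>(r, c). Y $$ (K ! r, J ! c))"]
        unfolding minor_def lK J(2) by simp
      moreover have "(\<Prod>r\<in>{0..<k}. a r (if r < k then K ! (p r) else r)) = (\<Prod>r = 0..<k. X $$ (I ! r, K ! (p r)))"
        by (rule prod.cong) (auto simp: a_def)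
      ultimately show ?thesis by (simp add: mult_ac)
    qed
    then have "(\<Sum>p | p permutes {0..<k}. ?t (\<lambda>i. if i < k then K ! (p i) else i)) =
        (\<Sum>p | p permutes {0..<k}. signof p * (\<Prod>r = 0..<k. X $$ (I ! r, K ! (p r)))) * minor Y K J"
      by (simp add: sum_distrib_right)
    also have "(\<Sum>p | p permutes {0..<k}. signof p * (\<Prod>r = 0..<k. X $$ (I ! r, K ! (p r)))) = minor X I K"
    proof -
      have "(\<Prod>r = 0..<k. X $$ (I ! r, K ! (p r))) = (\<Prod>r = 0..<k. mat k k (\<lambda>(r, c). X $$ (I ! r, K ! c)) $$ (r, p r))"
        if "p permutes {0..<k}" for p
        by (rule prod.cong) (use permutes_in_image[OF that] in auto)
      then show ?thesis unfolding minor_def I(2) lK by (simp add: det_def'[of _ k])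
    qed
    finally show "(\<Sum>p | p permutes {0..<k}. ?t (\<lambda>i. if i < k then K ! (p i) else i)) = minor X I K * minor Y K J" .
  qed
  finally show ?thesis .
qed

subsection \<open>A three-term relation\<close>

lemma row_det_linear:
  "\<exists>w. \<forall>v. row_det (P @ [v] @ Q) = (\<Sum>c<length P + 1 + length Q. v c * w c)"
proof -
  let ?k = "length P + 1 + length Q" and ?r = "length P"
  let ?A = "\<lambda>v. mat ?k ?k (\<lambda>(r, c). ((P @ [v] @ Q) ! r) c)"
  have del: "mat_delete (?A v) ?r c = mat_delete (?A v') ?r c" for v v' c
    by (rule eq_matI) (auto simp: mat_delete_def nth_append nth_Cons split: nat.splits)
  have "row_det (P @ [v] @ Q) = (\<Sum>c<?k. v c * cofactor (?A (\<lambda>_. 0)) ?r c)" for v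
  proof -
    have "row_det (P @ [v] @ Q) = Determinant.det (?A v)" by (simp add: row_det_def)
    also have "\<dots> = (\<Sum>c<?k. ?A v $$ (?r, c) * cofactor (?A v) ?r c)"
      by (rule laplace_expansion_row) auto
    also have "\<dots> = (\<Sum>c<?k. v c * cofactor (?A (\<lambda>_. 0)) ?r c)"
    proof (rule sum.cong[OF HOL.refl])
      fix c assume "c \<in> {..<?k}"
      moreover have "cofactor (?A v) ?r c = cofactor (?A (\<lambda>_. 0)) ?r c"
        unfolding cofactor_def by (subst del[of v c "\<lambda>_. 0"]) (rule HOL.refl)
      ultimately show "?A v $$ (?r, c) * cofactor (?A v) ?r c = v c * cofactor (?A (\<lambda>_. 0)) ?r c"
        by (simp add: nth_append)
    qed
    finally show ?thesis .
  qed
  then show ?thesis by blast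
qed

text \<open>The \<open>k + 1\<close> vectors in dimension \<open>k\<close> satisfy the linear relation given by Cramer's rule, and a
  linear form \<open>\<phi>\<close> may be applied to it: the determinant with first column \<open>\<phi>\<close> vanishes.\<close>

lemma cramer_relation:
  assumes len: "length vs = Suc k" and \<phi>: "\<And>v. \<phi> v = (\<Sum>c<k. v c * w c)"
  shows "(\<Sum>m<Suc k. \<phi> (vs ! m) * ((-1) ^ m * row_det (take m vs @ drop (Suc m) vs))) = 0"
proof -
  let ?E = "mat (Suc k) (Suc k) (\<lambda>(m, c). if c = 0 then \<phi> (vs ! m) else (vs ! m) (c - 1))"
  have "Determinant.det ?E = (\<Sum>m<Suc k. ?E $$ (m, 0) * cofactor ?E m 0)"
    by (rule laplace_expansion_column) auto
  also have "\<dots> = (\<Sum>m<Suc k. \<phi> (vs ! m) * ((-1) ^ m * row_det (take m vs @ drop (Suc m) vs)))"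
  proof (rule sum.cong[OF HOL.refl])
    fix m assume m: "m \<in> {..<Suc k}"
    have "mat_delete ?E m 0 = mat k k (\<lambda>(r, c). ((take m vs @ drop (Suc m) vs) ! r) c)"
      using m len by (intro eq_matI) (auto simp: mat_delete_def nth_append)
    then show "?E $$ (m, 0) * cofactor ?E m 0 = \<phi> (vs ! m) * ((-1) ^ m * row_det (take m vs @ drop (Suc m) vs))"
      using m len by (simp add: cofactor_def row_det_def)
  qed
  finally have 1: "Determinant.det ?E = \<dots>" .
  let ?x = "vec (Suc k) (\<lambda>c. if c = 0 then 1 else - w (c - 1))"
  have "?E *\<^sub>v ?x = 0\<^sub>v (Suc k)"
  proof (rule eq_vecI)
    fix m assume "m < dim_vec (0\<^sub>v (Suc k) :: real vec)"
    then have "(?E *\<^sub>v ?x) $ m = (\<Sum>c<Suc k. ?E $$ (m, c) * ?x $ c)"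
      by (simp add: scalar_prod_def atLeast0LessThan)
    also have "\<dots> = 0" using \<open>m < _\<close>
      by (subst sum.lessThan_Suc_shift) (simp add: \<phi> sum_negf)
    finally show "(?E *\<^sub>v ?x) $ m = 0\<^sub>v (Suc k) $ m" using \<open>m < _\<close> by simp
  qed simp
  moreover have "?x \<noteq> 0\<^sub>v (Suc k)"
  proof
    assume "?x = 0\<^sub>v (Suc k)"
    then have "?x $ 0 = 0\<^sub>v (Suc k) $ 0" by (rule arg_cong)
    then show False by simp
  qed
  moreover have "?x \<in> carrier_vec (Suc k)" by simp
  ultimately have "\<exists>x. x \<in> carrier_vec (Suc k) \<and> x \<noteq> 0\<^sub>v (Suc k) \<and> ?E *\<^sub>v x = 0\<^sub>v (Suc k)" by blast
  then have "Determinant.det ?E = 0"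
    by (subst det_0_iff_vec_prod_zero[of ?E "Suc k"]) simp_all
  then show ?thesis using 1 by simp
qed

text \<open>A Pluecker relation.  In Cramer's relation for the vectors \<open>i, S, j, T, l\<close>, apply the linear form
  \<open>v \<mapsto> row_det (e # S @ [v] @ T)\<close>; it vanishes on the members of \<open>S\<close> and \<open>T\<close>, so three terms remain.\<close>

lemma three_term_relation:
  "row_det (e # S @ [j] @ T) * row_det (i # S @ T @ [l]) =
   row_det (e # i # S @ T) * row_det (S @ [j] @ T @ [l]) + row_det (e # S @ T @ [l]) * row_det (i # S @ [j] @ T)"
proof -
  define \<phi> where "\<phi> v = row_det ((e # S) @ [v] @ T)" for v
  define s where "s = length S"
  define t where "t = length T"
  define k where "k = s + t + 2"
  obtain w where w: "\<And>v. \<phi> v = (\<Sum>c<k. v c * w c)"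
    using row_det_linear[of "e # S" T] unfolding \<phi>_def k_def s_def t_def by (auto simp: ac_simps numeral_2_eq_2)
  let ?vs = "i # S @ [j] @ T @ [l]"
  have "(\<Sum>m<Suc k. \<phi> (?vs ! m) * ((-1) ^ m * row_det (take m ?vs @ drop (Suc m) ?vs))) = 0"
    by (rule cramer_relation[OF _ w]) (simp add: k_def s_def t_def)
  moreover have "(\<Sum>m<Suc k. \<phi> (?vs ! m) * ((-1) ^ m * row_det (take m ?vs @ drop (Suc m) ?vs))) =
     (\<Sum>m\<in>{0, s + 1, k}. \<phi> (?vs ! m) * ((-1) ^ m * row_det (take m ?vs @ drop (Suc m) ?vs)))"
  proof (rule sum.mono_neutral_right)
    show "\<forall>m\<in>{..<Suc k} - {0, s + 1, k}. \<phi> (?vs ! m) * ((-1) ^ m * row_det (take m ?vs @ drop (Suc m) ?vs)) = 0"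
    proof
      fix m assume m: "m \<in> {..<Suc k} - {0, s + 1, k}"
      then have "0 < m" "m \<noteq> s + 1" "m < k" by (auto simp: k_def)
      then consider "0 < m" "m \<le> s" | "s + 1 < m" "m < k" by linarith
      then have "\<phi> (?vs ! m) = 0"
      proof cases
        case 1
        then have "?vs ! m = S ! (m - 1)" by (auto simp: nth_Cons nth_append s_def split: nat.splits)
        then show ?thesis unfolding \<phi>_def using 1
          by (intro row_det_repeated[of m _ "Suc s"]) (auto simp: nth_Cons nth_append s_def split: nat.splits)
      next
        case 2
        then obtain a where a: "m = Suc (Suc (s + a))"
          using less_imp_Suc_add[of "s + 1" m] by auto
        then have "a < t" using 2 by (simp add: k_def)
        then have "?vs ! m = T ! a" by (simp add: a nth_append s_def t_def)
        moreover have "((e # S) @ [T ! a] @ T) ! m = T ! a" by (simp add: a nth_append s_def)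
        moreover have "((e # S) @ [T ! a] @ T) ! Suc s = T ! a" by (simp add: nth_append s_def)
        ultimately show ?thesis unfolding \<phi>_def using a \<open>a < t\<close>
          by (intro row_det_repeated[of m _ "Suc s"]) (simp_all add: s_def t_def)
      qed
      then show "\<phi> (?vs ! m) * ((-1) ^ m * row_det (take m ?vs @ drop (Suc m) ?vs)) = 0" by simp
    qed
  qed (auto simp: k_def)
  moreover have "(\<Sum>m\<in>{0, s + 1, k}. \<phi> (?vs ! m) * ((-1) ^ m * row_det (take m ?vs @ drop (Suc m) ?vs))) =
     \<phi> i * row_det (S @ [j] @ T @ [l]) - (-1) ^ s * (\<phi> j * row_det (i # S @ T @ [l]))
       + (-1) ^ k * (\<phi> l * row_det (i # S @ [j] @ T))"
    by (simp add: k_def s_def t_def nth_append nth_Cons numeral_2_eq_2)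
  moreover have "\<phi> i = (-1) ^ s * row_det (e # i # S @ T)"
    using row_det_move[of "[e]" S i T] by (simp add: \<phi>_def s_def)
  moreover have "row_det (e # S @ T @ [l]) = (-1) ^ t * \<phi> l"
    using row_det_move[of "e # S" T l "[]"] by (simp add: \<phi>_def t_def)
  moreover have "\<phi> j = row_det (e # S @ [j] @ T)" by (simp add: \<phi>_def)
  moreover have "((-1) ^ s * (-1) ^ s :: real) = 1" "((-1) ^ t * (-1) ^ t :: real) = 1"
    by (simp_all add: power_mult_distrib[symmetric])
  moreover have "((-1) ^ k :: real) = (-1) ^ s * (-1) ^ t" by (simp add: k_def power_add)
  ultimately have *: "(-1) ^ s * row_det (e # i # S @ T) * row_det (S @ [j] @ T @ [l])
      - (-1) ^ s * (row_det (e # S @ [j] @ T) * row_det (i # S @ T @ [l]))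
      + (-1) ^ s * ((-1) ^ t * \<phi> l) * row_det (i # S @ [j] @ T) = 0"
    and l: "row_det (e # S @ T @ [l]) = (-1) ^ t * \<phi> l" by (simp_all add: mult_ac)
  have "(-1) ^ s * (row_det (e # i # S @ T) * row_det (S @ [j] @ T @ [l])
      - row_det (e # S @ [j] @ T) * row_det (i # S @ T @ [l])
      + row_det (e # S @ T @ [l]) * row_det (i # S @ [j] @ T)) = 0"
    using * unfolding l by (simp add: algebra_simps)
  then show ?thesis by simp
qed

subsection \<open>Fekete's criterion\<close>

lemma minor_Nil [simp]: "minor X [] [] = 1"
  unfolding minor_def by simp

lemma row_det_unit:
  assumes "length K = k" "length C = Suc k"
  shows "row_det ((\<lambda>c. if c = 0 then 1 else 0) # map (\<lambda>r c. X $$ (r, C ! c)) K) = minor X K (tl C)"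
proof -
  let ?e = "\<lambda>c::nat. if c = 0 then 1 else (0::real)"
  let ?vs = "?e # map (\<lambda>r c. X $$ (r, C ! c)) K"
  let ?A = "mat (Suc k) (Suc k) (\<lambda>(r, c). (?vs ! r) c)"
  have "row_det ?vs = Determinant.det ?A" using assms by (simp add: row_det_def)
  also have "\<dots> = (\<Sum>c<Suc k. ?A $$ (0, c) * cofactor ?A 0 c)"
    by (rule laplace_expansion_row) auto
  also have "\<dots> = cofactor ?A 0 0" by (subst sum.lessThan_Suc_shift) simp
  also have "\<dots> = Determinant.det (mat_delete ?A 0 0)" by (simp add: cofactor_def)
  also have "mat_delete ?A 0 0 = mat (length K) (length (tl C)) (\<lambda>(r, c). X $$ (K ! r, tl C ! c))"
    using assms by (intro eq_matI) (auto simp: mat_delete_def nth_tl)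
  finally show ?thesis by (simp add: minor_def)
qed

lemma sorted_split:
  "sorted_wrt (<) xs \<Longrightarrow> j \<notin> set xs \<Longrightarrow> xs = filter (\<lambda>x. x < j) xs @ filter (\<lambda>x. j < x) (xs :: nat list)"
proof (induction xs)
  case (Cons x xs)
  show ?case
  proof (cases "x < j")
    case False
    then have "j < x" using Cons by auto
    then have "\<forall>y\<in>set xs. j < y" using Cons by auto
    then show ?thesis using \<open>j < x\<close> by (auto simp: filter_empty_conv filter_id_conv)
  qed (use Cons in auto)
qed simp

text \<open>Fekete's argument: minors on consecutive rows decide.  If \<open>K\<close> has a gap at \<open>j\<close>, then the three-term
  relation, with \<open>e\<close> the first unit vector so that determinants containing it are minors of size \<open>k\<close>
  on the columns \<open>tl C\<close>, expresses the minor on \<open>K\<close> by minors whose rows are spread less.\<close>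

lemma fekete_rows:
  assumes C: "length C = Suc k"
    and sub: "\<And>K. K \<in> index_lists n k \<Longrightarrow> minor X K (tl C) > 0"
    and consec: "\<And>i. i + Suc k \<le> n \<Longrightarrow> minor X [i..<i + Suc k] C > 0"
    and K: "K \<in> index_lists n (Suc k)"
  shows "minor X K C > 0"
  using K
proof (induction "last K - hd K" arbitrary: K rule: less_induct)
  case less
  note K = less.prems
  have lK: "length K = Suc k" using index_lists_length[OF K] .
  have K0: "K \<noteq> []" using lK by auto
  have srt: "sorted_wrt (<) K" and lt: "set K \<subseteq> {..<n}" using K by (auto simp: index_lists_def)
  show ?case
  proof (cases "last K < hd K + Suc k")
    case True
    have "x \<ge> hd K \<and> x \<le> last K" if x: "x \<in> set K" for x
    proof -
      obtain r where r: "r < length K" "x = K ! r" using x by (auto simp: in_set_conv_nth)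
      have "sorted K" using srt by (rule strict_sorted_imp_sorted)
      then show ?thesis using r K0 sorted_nth_mono[of K 0 r] sorted_nth_mono[of K r "length K - 1"]
        by (simp add: hd_conv_nth last_conv_nth)
    qed
    then have "set K \<subseteq> {hd K..<hd K + Suc k}" using True by fastforce
    then have e: "K = [hd K..<hd K + Suc k]" by (rule upt_unique[OF K])
    have "hd K + k \<in> set K" by (subst e) simp
    then have "hd K + Suc k \<le> n" using lt by auto
    then show ?thesis using consec[of "hd K"] e by simp
  next
    case False
    have "k > 0"
    proof (rule ccontr)
      assume "\<not> k > 0"
      then have "K = [hd K]" using lK by (cases K) auto
      then have "last K = hd K" by (metis last.simps)
      then show False using False by simp
    qed
    obtain i S' l where iS: "K = i # S' @ [l]"
    proof -
      obtain i K' where "K = i # K'" using K0 by (cases K) auto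
      moreover have "K' \<noteq> []" using \<open>k > 0\<close> lK calculation by auto
      ultimately show thesis using that[of i "butlast K'" "last K'"] by simp
    qed
    have il: "last K = l" "hd K = i" using iS by auto
    have lS: "length S' = k - 1" using lK iS by simp
    have inner: "\<forall>x\<in>set S'. i < x \<and> x < l" "i < l" using srt iS by (auto simp: sorted_wrt_append)
    have "\<exists>j. i < j \<and> j < l \<and> j \<notin> set S'"
    proof (rule ccontr)
      assume "\<not> ?thesis"
      then have "{i<..<l} \<subseteq> set S'" by auto
      then have "card {i<..<l} \<le> length S'" by (meson card_length card_mono finite_set le_trans)
      then show False using False il lS \<open>k > 0\<close> by simp
    qed
    then obtain j where j: "i < j" "j < l" "j \<notin> set S'" by blast
    define S where "S = filter (\<lambda>x. x < j) S'"
    define T where "T = filter (\<lambda>x. j < x) S'"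
    have srt': "sorted_wrt (<) S'" using srt iS by (simp add: sorted_wrt_append)
    have ST: "S' = S @ T" unfolding S_def T_def by (rule sorted_split[OF srt' j(3)])
    have sS: "sorted_wrt (<) S" "sorted_wrt (<) T" "\<forall>x\<in>set S. i < x \<and> x < j" "\<forall>x\<in>set T. j < x \<and> x < l"
      using srt' inner by (auto simp: S_def T_def sorted_wrt_filter)
    have sST: "\<forall>x\<in>set S. \<forall>y\<in>set T. x < y" using sS by fastforce
    have ln: "l < n" "i < n" using lt iS by auto
    have bnd: "\<forall>x\<in>set S. x < n" "\<forall>x\<in>set T. x < n" "j < n" using sS ln j by fastforce+
    have lST: "length S + length T = k - 1" using lS ST by simp
    have mem: "S @ [j] @ T @ [l] \<in> index_lists n (Suc k)" "i # S @ [j] @ T \<in> index_lists n (Suc k)"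
      "S @ [j] @ T \<in> index_lists n k" "i # S @ T \<in> index_lists n k" "S @ T @ [l] \<in> index_lists n k"
      using sS sST j ln bnd lST \<open>k > 0\<close> inner(2)
      by (auto simp: index_lists_def sorted_wrt_append intro: less_trans)
    have m1: "minor X (S @ [j] @ T @ [l]) C > 0"
    proof (rule less.hyps[OF _ mem(1)])
      have "hd (S @ [j] @ T @ [l]) > i" using sS j by (cases S) auto
      then show "last (S @ [j] @ T @ [l]) - hd (S @ [j] @ T @ [l]) < last K - hd K"
        using inner(2) il by simp
    qed
    have m2: "minor X (i # S @ [j] @ T) C > 0"
    proof (rule less.hyps[OF _ mem(2)])
      have "last (i # S @ [j] @ T) < l" using sS j by (cases T rule: rev_cases) auto
      then show "last (i # S @ [j] @ T) - hd (i # S @ [j] @ T) < last K - hd K"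
        using inner(2) il by simp
    qed
    define \<rho> where "\<rho> = (\<lambda>r c. X $$ (r, C ! c))"
    define e where "e = (\<lambda>c::nat. if c = 0 then 1 else (0::real))"
    have big: "minor X Q C = row_det (map \<rho> Q)" if "Q \<in> index_lists n (Suc k)" for Q
      using minor_row_det[of Q C X] index_lists_length[OF that] C by (simp add: \<rho>_def)
    have small: "row_det (e # map \<rho> Q) > 0" if "Q \<in> index_lists n k" for Q
      using row_det_unit[OF index_lists_length[OF that] C, of X] sub[OF that] by (simp add: e_def \<rho>_def)
    have KST: "K = i # S @ T @ [l]" using iS ST by simp
    have "row_det (e # map \<rho> S @ [\<rho> j] @ map \<rho> T) * row_det (\<rho> i # map \<rho> S @ map \<rho> T @ [\<rho> l]) =
      row_det (e # \<rho> i # map \<rho> S @ map \<rho> T) * row_det (map \<rho> S @ [\<rho> j] @ map \<rho> T @ [\<rho> l]) +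
      row_det (e # map \<rho> S @ map \<rho> T @ [\<rho> l]) * row_det (\<rho> i # map \<rho> S @ [\<rho> j] @ map \<rho> T)"
      by (rule three_term_relation)
    then have "row_det (e # map \<rho> (S @ [j] @ T)) * minor X K C =
      row_det (e # map \<rho> (i # S @ T)) * minor X (S @ [j] @ T @ [l]) C +
      row_det (e # map \<rho> (S @ T @ [l])) * minor X (i # S @ [j] @ T) C"
      using big[OF mem(1)] big[OF mem(2)] big[OF K] KST by simp
    moreover have "\<dots> > 0" using small[OF mem(4)] small[OF mem(5)] m1 m2 by (intro add_pos_pos mult_pos_pos)
    ultimately have "row_det (e # map \<rho> (S @ [j] @ T)) * minor X K C > 0" by (simp only:)
    then show ?thesis using small[OF mem(3)] by (rule zero_less_mult_pos)
  qed
qed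

definition strictly_tp :: "nat \<Rightarrow> real mat \<Rightarrow> bool" where
  "strictly_tp n X \<longleftrightarrow> X \<in> carrier_mat n n \<and>
     (\<forall>k. \<forall>I\<in>index_lists n k. \<forall>J\<in>index_lists n k. minor X I J > 0)"

text \<open>First the rows, then, by transposition, the columns.\<close>

lemma strictly_tp_consecutive:
  assumes X: "X \<in> carrier_mat n n"
    and pos: "\<And>i j k. i + k \<le> n \<Longrightarrow> j + k \<le> n \<Longrightarrow> minor X [i..<i + k] [j..<j + k] > 0"
  shows "strictly_tp n X"
proof -
  have sub: "set K \<subseteq> {..<n}" if "K \<in> index_lists n k" for K k using that by (simp add: index_lists_def)
  have rows: "minor X K [j..<j + k] > 0" if "K \<in> index_lists n k" "j + k \<le> n" for K j k
    using that
  proof (induction k arbitrary: j K)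
    case 0
    then show ?case by (simp add: index_lists_def)
  next
    case (Suc k)
    show ?case
    proof (rule fekete_rows[OF _ _ _ Suc.prems(1)])
      have "tl [j..<j + Suc k] = [Suc j..<Suc j + k]" by (simp add: upt_conv_Cons del: upt_Suc)
      then show "minor X K (tl [j..<j + Suc k]) > 0" if "K \<in> index_lists n k" for K
        using Suc.IH[OF that, of "Suc j"] Suc.prems(2) by simp
      show "length [j..<j + Suc k] = Suc k" by (simp del: upt_Suc)
      show "minor X [i..<i + Suc k] [j..<j + Suc k] > 0" if "i + Suc k \<le> n" for i
        by (rule pos[OF that Suc.prems(2)])
    qed
  qed
  have "minor X I J > 0" if "I \<in> index_lists n k" "J \<in> index_lists n k" for I J k
    using that
  proof (induction k arbitrary: I J)
    case 0
    then show ?case by (simp add: index_lists_def)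
  next
    case (Suc k)
    have tr: "minor (transpose_mat X) Q I' = minor X I' Q"
      if "Q \<in> index_lists n m" "I' \<in> index_lists n m" for Q I' m
      using minor_transpose[OF X sub[OF that(1)] sub[OF that(2)]] that by (simp add: index_lists_def)
    have tl: "tl I \<in> index_lists n k" using Suc.prems(1) by (cases I) (auto simp: index_lists_def)
    have "minor (transpose_mat X) J I > 0"
    proof (rule fekete_rows[OF _ _ _ Suc.prems(2)])
      show "length I = Suc k" using Suc.prems(1) by (rule index_lists_length)
      show "minor (transpose_mat X) K (tl I) > 0" if "K \<in> index_lists n k" for K
        using Suc.IH[OF tl that] tr[OF that tl] by simp
      show "minor (transpose_mat X) [i..<i + Suc k] I > 0" if "i + Suc k \<le> n" for i
        using rows[OF Suc.prems(1) that] tr[OF index_lists_upt[OF that] Suc.prems(1)] by (simp del: upt_Suc)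
    qed
    then show ?case using tr[OF Suc.prems(2,1)] by simp
  qed
  then show ?thesis using X by (simp add: strictly_tp_def)
qed

subsection \<open>Triangular matrices\<close>

definition upper :: "nat \<Rightarrow> real mat \<Rightarrow> bool" where
  "upper n X \<longleftrightarrow> X \<in> carrier_mat n n \<and> (\<forall>i<n. \<forall>j<i. X $$ (i, j) = 0)"

definition lower :: "nat \<Rightarrow> real mat \<Rightarrow> bool" where
  "lower n X \<longleftrightarrow> X \<in> carrier_mat n n \<and> (\<forall>j<n. \<forall>i<j. X $$ (i, j) = 0)"

definition unit_diag :: "nat \<Rightarrow> real mat \<Rightarrow> bool" where
  "unit_diag n X \<longleftrightarrow> (\<forall>i<n. X $$ (i, i) = 1)"

lemma lower_transpose: "X \<in> carrier_mat n n \<Longrightarrow> lower n X \<longleftrightarrow> upper n (transpose_mat X)"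
  by (auto simp: lower_def upper_def)

lemma upper_carrier: "upper n X \<Longrightarrow> X \<in> carrier_mat n n"
  and lower_carrier: "lower n X \<Longrightarrow> X \<in> carrier_mat n n"
  by (auto simp: upper_def lower_def)

lemma mult_entry:
  "X \<in> carrier_mat n n \<Longrightarrow> Y \<in> carrier_mat n n \<Longrightarrow> i < n \<Longrightarrow> j < n \<Longrightarrow>
   (X * Y) $$ (i, j) = (\<Sum>l<n. X $$ (i, l) * Y $$ (l, j))"
  by (simp add: scalar_prod_def atLeast0LessThan)

lemma upper_mult:
  assumes "upper n X" "upper n Y"
  shows "upper n (X * Y)" and "i < n \<Longrightarrow> (X * Y) $$ (i, i) = X $$ (i, i) * Y $$ (i, i)"
    and "Suc i < n \<Longrightarrow> (X * Y) $$ (i, Suc i) =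
       X $$ (i, i) * Y $$ (i, Suc i) + X $$ (i, Suc i) * Y $$ (Suc i, Suc i)"
proof -
  have c: "X \<in> carrier_mat n n" "Y \<in> carrier_mat n n" using assms by (auto simp: upper_def)
  have z: "X $$ (i, l) * Y $$ (l, j) = 0" if "i < n" "l < n" "l < i \<or> j < l" for i j l
    using assms that by (auto simp: upper_def)
  have "(X * Y) $$ (i, j) = 0" if "i < n" "j < i" for i j
  proof -
    have "X $$ (i, l) * Y $$ (l, j) = 0" if "l < n" for l
      using z[of i l j] that \<open>i < n\<close> \<open>j < i\<close> by linarith
    then show ?thesis using that mult_entry[OF c, of i j] by (auto intro!: sum.neutral)
  qed
  then show "upper n (X * Y)" using c by (auto simp: upper_def)
  show "(X * Y) $$ (i, i) = X $$ (i, i) * Y $$ (i, i)" if "i < n"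
  proof -
    have "(\<Sum>l<n. X $$ (i, l) * Y $$ (l, i)) = (\<Sum>l\<in>{i}. X $$ (i, l) * Y $$ (l, i))"
      using that z[of i _ i] by (intro sum.mono_neutral_right) (auto simp del: mult_eq_0_iff simp: nat_neq_iff)
    then show ?thesis using that c by (simp add: mult_entry del: index_mult_mat)
  qed
  show "(X * Y) $$ (i, Suc i) = X $$ (i, i) * Y $$ (i, Suc i) + X $$ (i, Suc i) * Y $$ (Suc i, Suc i)" if "Suc i < n"
  proof -
    have "(\<Sum>l<n. X $$ (i, l) * Y $$ (l, Suc i)) = (\<Sum>l\<in>{i, Suc i}. X $$ (i, l) * Y $$ (l, Suc i))"
    proof (rule sum.mono_neutral_right)
      show "\<forall>l\<in>{..<n} - {i, Suc i}. X $$ (i, l) * Y $$ (l, Suc i) = 0"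
      proof
        fix l assume "l \<in> {..<n} - {i, Suc i}"
        then have "l < n" "l < i \<or> Suc i < l" by auto
        then show "X $$ (i, l) * Y $$ (l, Suc i) = 0" using z[of i l "Suc i"] that by simp
      qed
    qed (use that in auto)
    then show ?thesis using that c by (simp add: mult_entry del: index_mult_mat)
  qed
qed

lemma lower_mult:
  assumes "lower n X" "lower n Y"
  shows "lower n (X * Y)" and "i < n \<Longrightarrow> (X * Y) $$ (i, i) = X $$ (i, i) * Y $$ (i, i)"
proof -
  have c: "X \<in> carrier_mat n n" "Y \<in> carrier_mat n n" using assms by (auto simp: lower_def)
  have t: "transpose_mat (X * Y) = transpose_mat Y * transpose_mat X" using c by (simp add: transpose_mult)
  have u: "upper n (transpose_mat X)" "upper n (transpose_mat Y)" using assms c by (auto simp: lower_transpose)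
  show "lower n (X * Y)" using c upper_mult(1)[OF u(2,1)] by (simp add: lower_transpose t)
  show "(X * Y) $$ (i, i) = X $$ (i, i) * Y $$ (i, i)" if "i < n"
  proof -
    have "(X * Y) $$ (i, i) = transpose_mat (X * Y) $$ (i, i)" using c that by simp
    also have "\<dots> = transpose_mat Y $$ (i, i) * transpose_mat X $$ (i, i)"
      unfolding t by (rule upper_mult(2)[OF u(2,1) that])
    finally show ?thesis using c that by simp
  qed
qed

lemma minor_upper_initial:
  assumes R: "upper n R" and K: "K \<in> index_lists n k"
  shows "minor R K [0..<k] = (if K = [0..<k] then \<Prod>i<k. R $$ (i, i) else 0)"
proof -
  have kn: "k \<le> n" using index_lists_le[OF K] .
  have lK: "length K = k" using index_lists_length[OF K] .
  let ?A = "mat k k (\<lambda>(r, c). R $$ (K ! r, [0..<k] ! c))"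
  have m: "minor R K [0..<k] = Determinant.det ?A" by (simp add: minor_def lK)
  show ?thesis
  proof (cases "K = [0..<k]")
    case True
    have "Determinant.det ?A = prod_list (diag_mat ?A)"
      by (rule det_upper_triangular[of _ k]) (use R True kn in \<open>auto simp: upper_def upper_triangular_def\<close>)
    also have "\<dots> = (\<Prod>i<k. R $$ (i, i))"
      by (simp add: prod_list_diag_prod True atLeast0LessThan)
    finally show ?thesis using m True by simp
  next
    case False
    then have "\<not> set K \<subseteq> {0..<0 + k}" using upt_unique[OF K, of 0] by auto
    then obtain x where "x \<in> set K" "x \<notin> {0..<0 + k}" by blast
    then have "x \<in> set K" "x \<ge> k" by auto
    then obtain r where r: "r < k" "K ! r \<ge> k" using lK by (auto simp: in_set_conv_nth)
    have "Determinant.det ?A = (\<Sum>c<k. ?A $$ (r, c) * cofactor ?A r c)"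
      by (rule laplace_expansion_row) (use r in auto)
    also have "\<dots> = 0"
      by (rule sum.neutral) (use r R index_lists_nth[OF K r(1)] in \<open>auto simp: upper_def\<close>)
    finally show ?thesis using m False by simp
  qed
qed

lemma minor_lower_initial:
  assumes L: "lower n L" and K: "K \<in> index_lists n k"
  shows "minor L [0..<k] K = (if K = [0..<k] then \<Prod>i<k. L $$ (i, i) else 0)"
proof -
  have c: "L \<in> carrier_mat n n" using L by (simp add: lower_def)
  have kn: "k \<le> n" using index_lists_le[OF K] .
  have "minor L [0..<k] K = minor (transpose_mat L) K [0..<k]"
  proof -
    have "set [0..<k] \<subseteq> {..<n}" using kn by auto
    then show ?thesis using minor_transpose[OF c, of K "[0..<k]"] K by (simp add: index_lists_def)
  qed
  also have "\<dots> = (if K = [0..<k] then \<Prod>i<k. transpose_mat L $$ (i, i) else 0)"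
    by (rule minor_upper_initial) (use L c K in \<open>auto simp: lower_transpose\<close>)
  also have "\<dots> = (if K = [0..<k] then \<Prod>i<k. L $$ (i, i) else 0)"
    using c kn by (auto intro!: prod.cong)
  finally show ?thesis .
qed

lemma minor_mult_upper:
  assumes "upper n R" "Z \<in> carrier_mat n n" "I \<in> index_lists n k"
  shows "minor (Z * R) I [0..<k] = minor Z I [0..<k] * (\<Prod>i<k. R $$ (i, i))"
proof -
  have kn: "k \<le> n" using index_lists_le assms by blast
  have "minor (Z * R) I [0..<k] = (\<Sum>K\<in>index_lists n k. minor Z I K * minor R K [0..<k])"
    by (rule cauchy_binet) (use assms kn in \<open>auto simp: upper_def index_lists_def\<close>)
  also have "\<dots> = (\<Sum>K\<in>index_lists n k. if K = [0..<k] then minor Z I K * (\<Prod>i<k. R $$ (i, i)) else 0)"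
    by (rule sum.cong) (auto simp: minor_upper_initial[OF assms(1)])
  finally show ?thesis using kn by simp
qed

lemma minor_lower_mult:
  assumes "lower n L" "Z \<in> carrier_mat n n" "J \<in> index_lists n k"
  shows "minor (L * Z) [0..<k] J = (\<Prod>i<k. L $$ (i, i)) * minor Z [0..<k] J"
proof -
  have kn: "k \<le> n" using index_lists_le assms by blast
  have "minor (L * Z) [0..<k] J = (\<Sum>K\<in>index_lists n k. minor L [0..<k] K * minor Z K J)"
    by (rule cauchy_binet) (use assms kn in \<open>auto simp: lower_def index_lists_def\<close>)
  also have "\<dots> = (\<Sum>K\<in>index_lists n k. if K = [0..<k] then (\<Prod>i<k. L $$ (i, i)) * minor Z K J else 0)"
    by (rule sum.cong) (auto simp: minor_lower_initial[OF assms(1)])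
  finally show ?thesis using kn by simp
qed

lemma minor_upper_block:
  assumes R: "upper n R" and ik: "i + k \<le> n" and K: "K \<in> index_lists n k" "set K \<subseteq> {i..}"
  shows "minor R [0..<i + k] ([0..<i] @ K) = (\<Prod>j<i. R $$ (j, j)) * minor R [i..<i + k] K"
proof -
  have lK: "length K = k" using index_lists_length[OF K(1)] .
  let ?A = "mat i i (\<lambda>(r, c). R $$ (r, c))"
  let ?B = "mat i k (\<lambda>(r, c). R $$ (r, K ! c))"
  let ?D = "mat k k (\<lambda>(r, c). R $$ (i + r, K ! c))"
  have "mat (i + k) (i + k) (\<lambda>(r, c). R $$ ([0..<i + k] ! r, ([0..<i] @ K) ! c)) = four_block_mat ?A ?B (0\<^sub>m k i) ?D"
    using R ik by (intro eq_matI) (auto simp: four_block_mat_def nth_append upper_def)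
  then have "minor R [0..<i + k] ([0..<i] @ K) = Determinant.det (four_block_mat ?A ?B (0\<^sub>m k i) ?D)"
    by (simp add: minor_def lK)
  also have "\<dots> = Determinant.det ?A * Determinant.det ?D"
    by (rule det_four_block_mat_lower_left_zero) auto
  also have "Determinant.det ?A = (\<Prod>j<i. R $$ (j, j))"
  proof -
    have "Determinant.det ?A = prod_list (diag_mat ?A)"
      by (rule det_upper_triangular[of _ i]) (use R ik in \<open>auto simp: upper_def upper_triangular_def\<close>)
    then show ?thesis by (simp add: prod_list_diag_prod atLeast0LessThan)
  qed
  also have "Determinant.det ?D = minor R [i..<i + k] K"
    unfolding minor_def using lK by (intro arg_cong[where f = Determinant.det] eq_matI) auto
  finally show ?thesis .
qed

lemma minor_upper_zero:
  assumes R: "upper n R" and ik: "i + k \<le> n" and K: "K \<in> index_lists n k" "\<not> set K \<subseteq> {i..}"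
  shows "minor R [i..<i + k] K = 0"
proof -
  have lK: "length K = k" using index_lists_length[OF K(1)] .
  let ?A = "mat k k (\<lambda>(r, c). R $$ (i + r, K ! c))"
  obtain x where "x \<in> set K" "x \<notin> {i..}" using K(2) by blast
  then have "x \<in> set K" "x < i" by auto
  then obtain c where c: "c < k" "K ! c < i" using lK by (auto simp: in_set_conv_nth)
  have "minor R [i..<i + k] K = Determinant.det ?A"
    unfolding minor_def using lK by (intro arg_cong[where f = Determinant.det] eq_matI) auto
  also have "\<dots> = (\<Sum>r<k. ?A $$ (r, c) * cofactor ?A r c)"
    by (rule laplace_expansion_column) (use c in auto)
  also have "\<dots> = 0" by (rule sum.neutral) (use c R ik in \<open>auto simp: upper_def\<close>)
  finally show ?thesis .
qed

lemma upper_inverse: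
  assumes A: "upper n A" and B: "B \<in> carrier_mat n n" and AB: "A * B = 1\<^sub>m n"
  shows "upper n B" and "i < n \<Longrightarrow> A $$ (i, i) * B $$ (i, i) = 1"
proof -
  have Ac: "A \<in> carrier_mat n n" using A by (simp add: upper_def)
  have "Determinant.det A * Determinant.det B = 1" using AB det_mult[OF Ac B] by simp
  moreover have "Determinant.det A = (\<Prod>i<n. A $$ (i, i))"
    using det_upper_triangular[of A n] A Ac
    by (auto simp: upper_def upper_triangular_def prod_list_diag_prod atLeast0LessThan)
  ultimately have "(\<Prod>i<n. A $$ (i, i)) \<noteq> 0" by (metis mult_zero_left zero_neq_one)
  then have nz: "A $$ (i, i) \<noteq> 0" if "i < n" for i using that prod_zero[of "{..<n}" "\<lambda>i. A $$ (i, i)"] by auto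
  have "B $$ (i, j) = 0" if "i < n" "j < i" for i j
    using that
  proof (induction "n - i" arbitrary: i rule: less_induct)
    case less
    have "0 = (A * B) $$ (i, j)" using less.prems AB by simp
    also have "\<dots> = (\<Sum>l<n. A $$ (i, l) * B $$ (l, j))" using less.prems Ac B by (intro mult_entry) auto
    also have "\<dots> = (\<Sum>l\<in>{i}. A $$ (i, l) * B $$ (l, j))"
    proof (rule sum.mono_neutral_right)
      show "\<forall>l\<in>{..<n} - {i}. A $$ (i, l) * B $$ (l, j) = 0"
      proof
        fix l assume "l \<in> {..<n} - {i}"
        then consider "l < i" | "i < l" "l < n" by force
        then show "A $$ (i, l) * B $$ (l, j) = 0"
          using A less.prems less.hyps[of l] by cases (auto simp: upper_def)
      qed
    qed (use less.prems in auto)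
    finally show ?case using nz[OF less.prems(1)] by simp
  qed
  then show u: "upper n B" using B by (simp add: upper_def)
  show "A $$ (i, i) * B $$ (i, i) = 1" if "i < n"
    using upper_mult(2)[OF A u that] AB that by simp
qed

lemma lower_inverse:
  assumes A: "lower n A" and B: "B \<in> carrier_mat n n" and AB: "A * B = 1\<^sub>m n"
  shows "lower n B" and "i < n \<Longrightarrow> A $$ (i, i) * B $$ (i, i) = 1"
proof -
  have Ac: "A \<in> carrier_mat n n" using A by (simp add: lower_def)
  have BA: "B * A = 1\<^sub>m n" using mat_mult_left_right_inverse[OF Ac B AB] .
  have "transpose_mat A * transpose_mat B = transpose_mat (B * A)" using Ac B by (simp add: transpose_mult)
  then have t: "transpose_mat A * transpose_mat B = 1\<^sub>m n" using BA by simp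
  have u: "upper n (transpose_mat A)" using A Ac by (simp add: lower_transpose)
  show "lower n B" using upper_inverse(1)[OF u _ t] B by (simp add: lower_transpose)
  show "A $$ (i, i) * B $$ (i, i) = 1" if "i < n"
    using upper_inverse(2)[OF u _ t that] B Ac that by simp
qed

lemma exists_inverse:
  assumes "A \<in> carrier_mat n n" "Determinant.det A \<noteq> (0::real)"
  obtains B where "B \<in> carrier_mat n n" "A * B = 1\<^sub>m n" "B * A = 1\<^sub>m n"
  using det_non_zero_imp_unit[OF assms, of undefined] unfolding Units_def ring_mat_def by auto

text \<open>Clear the entries above the diagonal by column operations \<open>U\<close>; the leading minors make the required
  linear systems solvable.  Then \<open>X U\<close> is lower triangular and its diagonal is moved to the other
  factor.\<close>

lemma lu_decomposition:
  assumes X: "X \<in> carrier_mat n n" and nz: "\<And>k. k \<le> n \<Longrightarrow> minor X [0..<k] [0..<k] \<noteq> 0"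
  obtains L R where "lower n L" "unit_diag n L" "upper n R" "X = L * R"
proof -
  have "\<exists>y. y j = 1 \<and> (\<forall>i. j < i \<longrightarrow> y i = 0) \<and> (\<forall>i<j. (\<Sum>l<n. X $$ (i, l) * y l) = 0)"
    if j: "j < n" for j
  proof -
    let ?A = "mat j j (\<lambda>(r, c). X $$ (r, c))"
    have "minor X [0..<j] [0..<j] = Determinant.det ?A"
      unfolding minor_def by (intro arg_cong[where f = Determinant.det] eq_matI) auto
    then have "Determinant.det ?A \<noteq> 0" using nz[of j] j by simp
    then obtain B where B: "B \<in> carrier_mat j j" "?A * B = 1\<^sub>m j" using exists_inverse[of ?A j] by auto
    define z where "z = B *\<^sub>v vec j (\<lambda>i. - X $$ (i, j))"
    have zc: "z \<in> carrier_vec j" using B by (simp add: z_def)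
    have "?A *\<^sub>v z = (?A * B) *\<^sub>v vec j (\<lambda>i. - X $$ (i, j))"
      unfolding z_def by (rule assoc_mult_mat_vec[symmetric]) (use B in auto)
    then have Az: "?A *\<^sub>v z = vec j (\<lambda>i. - X $$ (i, j))" using B by simp
    have s: "(\<Sum>l<j. X $$ (i, l) * z $ l) = - X $$ (i, j)" if "i < j" for i
      using arg_cong[OF Az, of "\<lambda>v. v $ i"] that zc by (simp add: scalar_prod_def atLeast0LessThan)
    define y where "y l = (if l < j then z $ l else if l = j then 1 else 0)" for l
    have "(\<Sum>l<n. X $$ (i, l) * y l) = 0" if "i < j" for i
    proof -
      have "(\<Sum>l<n. X $$ (i, l) * y l) = (\<Sum>l<Suc j. X $$ (i, l) * y l)"
        by (rule sum.mono_neutral_right) (use j in \<open>auto simp: y_def\<close>)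
      also have "\<dots> = (\<Sum>l<j. X $$ (i, l) * z $ l) + X $$ (i, j)" by (simp add: y_def)
      finally show ?thesis using s[OF that] by simp
    qed
    then show ?thesis by (intro exI[of _ y]) (auto simp: y_def)
  qed
  then obtain y where y: "\<And>j. j < n \<Longrightarrow> y j j = 1" "\<And>i j. j < n \<Longrightarrow> j < i \<Longrightarrow> y j i = 0"
    "\<And>i j. j < n \<Longrightarrow> i < j \<Longrightarrow> (\<Sum>l<n. X $$ (i, l) * y j l) = 0" by metis
  define U where "U = mat n n (\<lambda>(i, j). y j i)"
  have U: "upper n U" using y by (auto simp: U_def upper_def)
  then have Uc: "U \<in> carrier_mat n n" by (simp add: upper_def)
  have Ud: "U $$ (i, i) = 1" if "i < n" for i using y that by (simp add: U_def)
  have XU: "X * U \<in> carrier_mat n n" using X Uc by simp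
  have XUe: "(X * U) $$ (i, j) = (\<Sum>l<n. X $$ (i, l) * y j l)" if "i < n" "j < n" for i j
    using mult_entry[OF X Uc that] that by (simp add: U_def)
  have XUl: "lower n (X * U)" unfolding lower_def using XU XUe y(3) by auto
  have prodnz: "(\<Prod>i<k. (X * U) $$ (i, i)) \<noteq> 0" if "k \<le> n" for k
  proof -
    have "(\<Prod>i<k. (X * U) $$ (i, i)) = minor (X * U) [0..<k] [0..<k]"
      using minor_lower_initial[OF XUl index_lists_upt0[OF that]] by simp
    also have "\<dots> = minor X [0..<k] [0..<k] * (\<Prod>i<k. U $$ (i, i))"
      by (rule minor_mult_upper[OF U X index_lists_upt0[OF that]])
    also have "(\<Prod>i<k. U $$ (i, i)) = 1" using Ud that by (intro prod.neutral) auto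
    finally show ?thesis using nz[OF that] by simp
  qed
  define d where "d i = (X * U) $$ (i, i)" for i
  have dnz: "d i \<noteq> 0" if "i < n" for i
    using prodnz[of "Suc i"] that by (simp add: d_def)
  have "Determinant.det U = (\<Prod>i<n. U $$ (i, i))"
    using det_upper_triangular[of U n] U Uc
    by (auto simp: upper_def upper_triangular_def prod_list_diag_prod atLeast0LessThan)
  then have "Determinant.det U \<noteq> 0" using Ud by simp
  then obtain V where V: "V \<in> carrier_mat n n" "U * V = 1\<^sub>m n" using exists_inverse[OF Uc] by blast
  have Vu: "upper n V" using upper_inverse(1)[OF U V] .
  define L where "L = mat n n (\<lambda>(i, j). (X * U) $$ (i, j) / d j)"
  define R where "R = mat n n (\<lambda>(i, j). d i * V $$ (i, j))"
  have LR: "L \<in> carrier_mat n n" "R \<in> carrier_mat n n" by (simp_all add: L_def R_def)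
  have "L * R = (X * U) * V"
  proof (rule eq_matI)
    fix i j assume "i < dim_row (X * U * V)" "j < dim_col (X * U * V)"
    then have ij: "i < n" "j < n" using X V by auto
    have "(L * R) $$ (i, j) = (\<Sum>l<n. L $$ (i, l) * R $$ (l, j))" by (rule mult_entry[OF LR ij])
    also have "\<dots> = (\<Sum>l<n. (X * U) $$ (i, l) * V $$ (l, j))"
      by (rule sum.cong) (use ij dnz in \<open>auto simp: L_def R_def\<close>)
    also have "\<dots> = (X * U * V) $$ (i, j)" by (rule mult_entry[OF XU V(1) ij, symmetric])
    finally show "(L * R) $$ (i, j) = (X * U * V) $$ (i, j)" .
  qed (use LR X V in auto)
  also have "\<dots> = X" using X Uc V by (simp add: assoc_mult_mat[of _ n n _ n _ n])
  finally have "X = L * R" by simp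
  moreover have "lower n L" using XUl by (auto simp: lower_def L_def)
  moreover have "unit_diag n L" using dnz by (auto simp: unit_diag_def L_def d_def)
  moreover have "upper n R" using Vu by (auto simp: upper_def R_def)
  ultimately show thesis using that by blast
qed

subsection \<open>Total positivity of triangular factors\<close>

text \<open>A weak form of total positivity that is easy to check and to multiply: only minors on consecutive
  rows are required to be positive, and only where triangularity permits.\<close>

definition upper_pos :: "nat \<Rightarrow> real mat \<Rightarrow> bool" where
  "upper_pos n X \<longleftrightarrow> upper n X \<and>
     (\<forall>i k. \<forall>K\<in>index_lists n k. i + k \<le> n \<longrightarrow> set K \<subseteq> {i..} \<longrightarrow> minor X [i..<i + k] K > 0)"

definition lower_pos :: "nat \<Rightarrow> real mat \<Rightarrow> bool" where
  "lower_pos n Y \<longleftrightarrow> lower n Y \<and>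
     (\<forall>j k. \<forall>K\<in>index_lists n k. j + k \<le> n \<longrightarrow> set K \<subseteq> {j..} \<longrightarrow> minor Y K [j..<j + k] > 0)"

lemma strictly_tpD:
  "strictly_tp n Z \<Longrightarrow> I \<in> index_lists n k \<Longrightarrow> J \<in> index_lists n k \<Longrightarrow> minor Z I J > 0"
  by (simp add: strictly_tp_def)

lemma upper_posD:
  "upper_pos n X \<Longrightarrow> K \<in> index_lists n k \<Longrightarrow> i + k \<le> n \<Longrightarrow> set K \<subseteq> {i..} \<Longrightarrow> minor X [i..<i + k] K > 0"
  by (simp add: upper_pos_def)

lemma lower_posD:
  "lower_pos n X \<Longrightarrow> K \<in> index_lists n k \<Longrightarrow> i + k \<le> n \<Longrightarrow> set K \<subseteq> {i..} \<Longrightarrow> minor X K [i..<i + k] > 0"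
  by (simp add: lower_pos_def)

lemma index_lists_sub: "K \<in> index_lists n k \<Longrightarrow> set K \<subseteq> {..<n}"
  by (simp add: index_lists_def)

lemma minor_transpose_index:
  "X \<in> carrier_mat n n \<Longrightarrow> I \<in> index_lists n k \<Longrightarrow> J \<in> index_lists n k \<Longrightarrow>
   minor (transpose_mat X) I J = minor X J I"
  by (rule minor_transpose) (auto simp: index_lists_def)

lemma lower_pos_transpose: "X \<in> carrier_mat n n \<Longrightarrow> lower_pos n X \<longleftrightarrow> upper_pos n (transpose_mat X)"
  unfolding lower_pos_def upper_pos_def using minor_transpose_index[OF _ index_lists_upt]
  by (auto simp: lower_transpose)

text \<open>Even the minors on initial rows suffice, since the rows before \<open>i\<close> can be added as a triangular
  block.\<close>

lemma upper_posI:
  assumes X: "upper n X" and pos: "\<And>k J. J \<in> index_lists n k \<Longrightarrow> minor X [0..<k] J > 0"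
  shows "upper_pos n X"
  unfolding upper_pos_def
proof (intro conjI allI ballI impI X)
  fix i k K assume K: "K \<in> index_lists n k" and ik: "i + k \<le> n" "set K \<subseteq> {i..}"
  have "[0..<i] @ K \<in> index_lists n (i + k)"
    using K ik by (auto simp: index_lists_def sorted_wrt_append sorted_wrt_upt)
  then have "(\<Prod>j<i. X $$ (j, j)) * minor X [i..<i + k] K > 0"
    using pos[of "[0..<i] @ K" "i + k"] minor_upper_block[OF X ik(1) K ik(2)] by simp
  moreover have "(\<Prod>j<i. X $$ (j, j)) > 0"
    using pos[of "[0..<i]" i] ik minor_upper_initial[OF X, of "[0..<i]" i] by simp
  ultimately show "minor X [i..<i + k] K > 0" by (rule zero_less_mult_pos)
qed

lemma lower_posI:
  assumes X: "lower n X" and pos: "\<And>k I. I \<in> index_lists n k \<Longrightarrow> minor X I [0..<k] > 0"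
  shows "lower_pos n X"
proof -
  have c: "X \<in> carrier_mat n n" using X by (rule lower_carrier)
  have "upper_pos n (transpose_mat X)"
  proof (rule upper_posI)
    show "upper n (transpose_mat X)" using X c by (simp add: lower_transpose)
    fix k J assume J: "J \<in> index_lists n k"
    then show "minor (transpose_mat X) [0..<k] J > 0"
      using pos[OF J] minor_transpose_index[OF c index_lists_upt0 J] index_lists_le[OF J] by simp
  qed
  then show ?thesis using c by (simp add: lower_pos_transpose)
qed

lemma upper_pos_nonneg:
  assumes "upper_pos n X" "K \<in> index_lists n k" "i + k \<le> n"
  shows "minor X [i..<i + k] K \<ge> 0"
  using assms minor_upper_zero[of n X i k K] by (cases "set K \<subseteq> {i..}") (auto simp: upper_pos_def less_imp_le)

text \<open>In the Cauchy--Binet formula for consecutive rows no term is negative and at least one is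
  positive.\<close>

lemma upper_pos_mult_strictly_tp:
  assumes X: "upper_pos n X" and Z: "strictly_tp n Z"
  shows "strictly_tp n (X * Z)"
proof (rule strictly_tp_consecutive)
  have c: "X \<in> carrier_mat n n" "Z \<in> carrier_mat n n"
    using X Z by (auto simp: upper_pos_def upper_def strictly_tp_def)
  then show "X * Z \<in> carrier_mat n n" by simp
  fix i j k assume ij: "i + k \<le> n" "j + k \<le> n"
  have "minor (X * Z) [i..<i + k] [j..<j + k] =
      (\<Sum>K\<in>index_lists n k. minor X [i..<i + k] K * minor Z K [j..<j + k])"
    by (rule cauchy_binet) (use c ij in auto)
  also have "\<dots> > 0"
  proof (rule sum_pos2[of _ "[i..<i + k]"])
    have sub: "set [i..<i + k] \<subseteq> {i..}" by auto
    show "0 < minor X [i..<i + k] [i..<i + k] * minor Z [i..<i + k] [j..<j + k]"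
      using mult_pos_pos[OF upper_posD[OF X index_lists_upt[OF ij(1)] ij(1) sub]
          strictly_tpD[OF Z index_lists_upt[OF ij(1)] index_lists_upt[OF ij(2)]]] .
    show "0 \<le> minor X [i..<i + k] K * minor Z K [j..<j + k]" if "K \<in> index_lists n k" for K
      using upper_pos_nonneg[OF X that ij(1)] Z ij that index_lists_upt[OF ij(2)]
      by (auto simp: strictly_tp_def less_imp_le intro!: mult_nonneg_nonneg)
  qed (use ij in auto)
  finally show "minor (X * Z) [i..<i + k] [j..<j + k] > 0" .
qed

lemma lower_pos_nonneg:
  assumes "lower_pos n X" "K \<in> index_lists n k" "i + k \<le> n"
  shows "minor X K [i..<i + k] \<ge> 0"
proof -
  have c: "X \<in> carrier_mat n n" using assms by (auto simp: lower_pos_def lower_def)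
  then have "upper_pos n (transpose_mat X)" using assms by (simp add: lower_pos_transpose)
  from upper_pos_nonneg[OF this assms(2,3)] show ?thesis
    using minor_transpose_index[OF c index_lists_upt[OF assms(3)] assms(2)] by simp
qed

lemma upper_pos_mult_lower_pos:
  assumes X: "upper_pos n X" and Y: "lower_pos n Y"
  shows "strictly_tp n (X * Y)"
proof (rule strictly_tp_consecutive)
  have c: "X \<in> carrier_mat n n" "Y \<in> carrier_mat n n"
    using X Y by (auto simp: upper_pos_def upper_def lower_pos_def lower_def)
  then show "X * Y \<in> carrier_mat n n" by simp
  fix i j k assume ij: "i + k \<le> n" "j + k \<le> n"
  define m where "m = max i j"
  have m: "m + k \<le> n" "i \<le> m" "j \<le> m" using ij by (auto simp: m_def)
  have "minor (X * Y) [i..<i + k] [j..<j + k] =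
      (\<Sum>K\<in>index_lists n k. minor X [i..<i + k] K * minor Y K [j..<j + k])"
    by (rule cauchy_binet) (use c ij in auto)
  also have "\<dots> > 0"
  proof (rule sum_pos2[of _ "[m..<m + k]"])
    show "0 < minor X [i..<i + k] [m..<m + k] * minor Y [m..<m + k] [j..<j + k]"
      by (intro mult_pos_pos upper_posD[OF X] lower_posD[OF Y] index_lists_upt ij m) (use m in auto)
    show "0 \<le> minor X [i..<i + k] K * minor Y K [j..<j + k]" if "K \<in> index_lists n k" for K
      using upper_pos_nonneg[OF X that ij(1)] lower_pos_nonneg[OF Y that ij(2)]
      by (rule mult_nonneg_nonneg)
  qed (use m in auto)
  finally show "minor (X * Y) [i..<i + k] [j..<j + k] > 0" .
qed

text \<open>On the last columns, triangularity never forces a minor to vanish.\<close>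

lemma upper_pos_last:
  assumes X: "upper_pos n X" and K: "K \<in> index_lists n k"
  shows "minor X K [n - k..<n] > 0"
  using K
proof (induction k arbitrary: K)
  case 0
  then show ?case by (simp add: index_lists_def)
next
  case (Suc k)
  have kn: "Suc k \<le> n" using index_lists_le[OF Suc.prems] .
  show ?case
  proof (rule fekete_rows[OF _ _ _ Suc.prems])
    show "length [n - Suc k..<n] = Suc k" using kn by simp
    have "tl [n - Suc k..<n] = [n - k..<n]" using kn by (simp add: upt_conv_Cons Suc_diff_Suc)
    then show "minor X K (tl [n - Suc k..<n]) > 0" if "K \<in> index_lists n k" for K
      using Suc.IH[OF that] by simp
    fix i assume i: "i + Suc k \<le> n"
    have "[n - Suc k..<n] \<in> index_lists n (Suc k)" using index_lists_upt[of "n - Suc k" "Suc k" n] kn by simp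
    moreover have "set [n - Suc k..<n] \<subseteq> {i..}" using i by auto
    ultimately show "minor X [i..<i + Suc k] [n - Suc k..<n] > 0"
      using X i unfolding upper_pos_def by blast
  qed
qed

text \<open>Up to positive diagonal factors, minors of \<open>L R\<close> on initial rows are those of \<open>R\<close>, and minors on
  initial columns are those of \<open>L\<close>.\<close>

lemma strictly_tp_factors:
  assumes Z: "strictly_tp n (L * R)" and L: "lower n L" "unit_diag n L" and R: "upper n R"
  shows "lower_pos n L" "upper_pos n R"
proof -
  have c: "L \<in> carrier_mat n n" "R \<in> carrier_mat n n" using L R by (auto simp: upper_def lower_def)
  have pL: "(\<Prod>i<k. L $$ (i, i)) = 1" if "k \<le> n" for k
    using L(2) that by (intro prod.neutral) (auto simp: unit_diag_def)
  show R': "upper_pos n R"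
  proof (rule upper_posI[OF R])
    fix k J assume J: "J \<in> index_lists n k"
    have kn: "k \<le> n" using index_lists_le[OF J] .
    then show "minor R [0..<k] J > 0"
      using minor_lower_mult[OF L(1) c(2) J] pL[OF kn] strictly_tpD[OF Z index_lists_upt0[OF kn] J] by simp
  qed
  show "lower_pos n L"
  proof (rule lower_posI[OF L(1)])
    fix k I assume I: "I \<in> index_lists n k"
    have kn: "k \<le> n" using index_lists_le[OF I] .
    have "(\<Prod>i<k. R $$ (i, i)) > 0"
      using R' minor_upper_initial[OF R, of "[0..<k]" k] kn index_lists_upt[of 0 k n] unfolding upper_pos_def
      by (metis add_0 atLeast_0 atLeast_upt subset_UNIV)
    moreover have "minor L I [0..<k] * (\<Prod>i<k. R $$ (i, i)) > 0"
      using minor_mult_upper[OF R c(1) I] strictly_tpD[OF Z I index_lists_upt0[OF kn]] by simp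
    ultimately show "minor L I [0..<k] > 0" by (metis mult.commute zero_less_mult_pos)
  qed
qed

lemma strictly_tp_lu:
  assumes "strictly_tp n Z"
  obtains L R where "lower_pos n L" "unit_diag n L" "upper_pos n R" "Z = L * R"
proof -
  have "minor Z [0..<k] [0..<k] \<noteq> 0" if "k \<le> n" for k
    using assms index_lists_upt0[OF that] unfolding strictly_tp_def by (metis less_irrefl)
  moreover have "Z \<in> carrier_mat n n" using assms by (simp add: strictly_tp_def)
  ultimately obtain L R where "lower n L" "unit_diag n L" "upper n R" "Z = L * R"
    using lu_decomposition by blast
  then show thesis using that strictly_tp_factors assms by blast
qed

text \<open>The permutation matrix of order reversal.  Multiplication by it from the right turns the flag spanned
  by the first columns of a matrix into the flag spanned by the last ones.\<close>

definition flip_mat :: "nat \<Rightarrow> real mat" where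
  "flip_mat n = mat n n (\<lambda>(i, j). if i + j = n - 1 then 1 else 0)"

lemma flip_mat_carrier [simp]: "flip_mat n \<in> carrier_mat n n"
  by (simp add: flip_mat_def)

lemma mult_flip_entry:
  assumes "X \<in> carrier_mat n n" "i < n" "j < n"
  shows "(X * flip_mat n) $$ (i, j) = X $$ (i, n - 1 - j)" "(flip_mat n * X) $$ (i, j) = X $$ (n - 1 - i, j)"
proof -
  have "(X * flip_mat n) $$ (i, j) = (\<Sum>l<n. X $$ (i, l) * flip_mat n $$ (l, j))"
    by (rule mult_entry) (use assms in auto)
  also have "\<dots> = (\<Sum>l<n. if l = n - 1 - j then X $$ (i, l) else 0)"
    by (rule sum.cong) (use assms in \<open>auto simp: flip_mat_def\<close>)
  finally show "(X * flip_mat n) $$ (i, j) = X $$ (i, n - 1 - j)" using assms by simp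
  have "(flip_mat n * X) $$ (i, j) = (\<Sum>l<n. flip_mat n $$ (i, l) * X $$ (l, j))"
    by (rule mult_entry) (use assms in auto)
  also have "\<dots> = (\<Sum>l<n. if l = n - 1 - i then X $$ (l, j) else 0)"
    by (rule sum.cong) (use assms in \<open>auto simp: flip_mat_def\<close>)
  finally show "(flip_mat n * X) $$ (i, j) = X $$ (n - 1 - i, j)" using assms by simp
qed

lemma flip_flip [simp]: "flip_mat n * flip_mat n = 1\<^sub>m n"
proof (rule eq_matI)
  fix i j assume "i < dim_row (1\<^sub>m n :: real mat)" "j < dim_col (1\<^sub>m n :: real mat)"
  then show "(flip_mat n * flip_mat n) $$ (i, j) = 1\<^sub>m n $$ (i, j)"
    using mult_flip_entry(1)[of "flip_mat n" n i j] by (auto simp: flip_mat_def)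
qed (auto simp: flip_mat_def)

lemma flip_upper:
  assumes "upper n X"
  shows "lower n (flip_mat n * (X * flip_mat n))"
    and "i < n \<Longrightarrow> (flip_mat n * (X * flip_mat n)) $$ (i, i) = X $$ (n - 1 - i, n - 1 - i)"
proof -
  have c: "X \<in> carrier_mat n n" "X * flip_mat n \<in> carrier_mat n n" using assms by (auto simp: upper_def)
  have e: "(flip_mat n * (X * flip_mat n)) $$ (i, j) = X $$ (n - 1 - i, n - 1 - j)" if "i < n" "j < n" for i j
    using mult_flip_entry(2)[OF c(2) that] mult_flip_entry(1)[OF c(1), of "n - 1 - i" j] that by simp
  show "lower n (flip_mat n * (X * flip_mat n))"
    unfolding lower_def using e assms c mult_carrier_mat[OF flip_mat_carrier c(2)] by (auto simp: upper_def)
  show "i < n \<Longrightarrow> (flip_mat n * (X * flip_mat n)) $$ (i, i) = X $$ (n - 1 - i, n - 1 - i)"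
    using e by simp
qed

lemma flip_lower:
  assumes "lower n X"
  shows "upper n (flip_mat n * (X * flip_mat n))"
    and "i < n \<Longrightarrow> (flip_mat n * (X * flip_mat n)) $$ (i, i) = X $$ (n - 1 - i, n - 1 - i)"
proof -
  have c: "X \<in> carrier_mat n n" "X * flip_mat n \<in> carrier_mat n n" using assms by (auto simp: lower_def)
  have e: "(flip_mat n * (X * flip_mat n)) $$ (i, j) = X $$ (n - 1 - i, n - 1 - j)" if "i < n" "j < n" for i j
    using mult_flip_entry(2)[OF c(2) that] mult_flip_entry(1)[OF c(1), of "n - 1 - i" j] that by simp
  show "upper n (flip_mat n * (X * flip_mat n))"
    unfolding upper_def using e assms c mult_carrier_mat[OF flip_mat_carrier c(2)] by (auto simp: lower_def)
  show "i < n \<Longrightarrow> (flip_mat n * (X * flip_mat n)) $$ (i, i) = X $$ (n - 1 - i, n - 1 - i)"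
    using e by simp
qed

lemma minor_mult_flip:
  assumes X: "X \<in> carrier_mat n n" and I: "I \<in> index_lists n k" and J: "J \<in> index_lists n k"
  defines "J' \<equiv> rev (map (\<lambda>j. n - 1 - j) J)"
  shows "J' \<in> index_lists n k" "minor (X * flip_mat n) I J = rev_sign k * minor X I J'"
proof -
  have lJ: "length J = k" "length I = k" using I J by (auto simp: index_lists_def)
  have sJ: "sorted_wrt (<) J" "set J \<subseteq> {..<n}" using J by (auto simp: index_lists_def)
  have "sorted_wrt (\<lambda>x y. y < x) (map (\<lambda>j. n - 1 - j) J)"
    unfolding sorted_wrt_map using sJ
    by (intro sorted_wrt_mono_rel[OF _ sJ(1)]) auto
  then have "sorted_wrt (<) J'" unfolding J'_def by (simp add: sorted_wrt_rev)
  moreover have "n - 1 - j < n" if "j \<in> set J" for j using that sJ by auto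
  ultimately show J': "J' \<in> index_lists n k" using lJ by (auto simp: index_lists_def J'_def)
  have "minor (X * flip_mat n) I J = minor X I (rev J')"
    unfolding minor_def
  proof (intro arg_cong[where f = Determinant.det] eq_matI)
    fix r c assume "r < dim_row (mat (length I) (length (rev J')) (\<lambda>(r, c). X $$ (I ! r, rev J' ! c)))"
      "c < dim_col (mat (length I) (length (rev J')) (\<lambda>(r, c). X $$ (I ! r, rev J' ! c)))"
    then have rc: "r < k" "c < k" using lJ by (auto simp: J'_def)
    then show "mat (length I) (length J) (\<lambda>(r, c). (X * flip_mat n) $$ (I ! r, J ! c)) $$ (r, c) =
        mat (length I) (length (rev J')) (\<lambda>(r, c). X $$ (I ! r, rev J' ! c)) $$ (r, c)"
      using mult_flip_entry(1)[OF X index_lists_nth[OF I rc(1)] index_lists_nth[OF J rc(2)]] lJ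
      by (simp add: J'_def)
  qed (auto simp: J'_def)
  also have "\<dots> = rev_sign k * minor X I J'"
    using minor_rev_cols[OF X index_lists_sub[OF I] index_lists_sub[OF J']] index_lists_length[OF I] index_lists_length[OF J']
    by simp
  finally show "minor (X * flip_mat n) I J = rev_sign k * minor X I J'" .
qed

text \<open>The initial minors of \<open>X W\<close>, where \<open>W\<close> is the flip, are the last-column minors of \<open>X\<close> up to
  \<open>rev_sign\<close>.  So \<open>X W\<close> has an LU-decomposition with positive lower factor, and the diagonal of the
  upper factor consists of quotients of successive values of \<open>rev_sign\<close>, up to positive factors.\<close>

lemma upper_pos_flip_lu:
  assumes X: "upper_pos n X"
  obtains N R where "lower_pos n N" "unit_diag n N" "upper n R" "X * flip_mat n = N * R"
    "\<And>i. i < n \<Longrightarrow> (-1) ^ i * R $$ (i, i) > 0"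
proof -
  have c: "X \<in> carrier_mat n n" using X by (auto simp: upper_pos_def upper_def)
  have init: "minor (X * flip_mat n) I [0..<k] = rev_sign k * minor X I [n - k..<n]" if I: "I \<in> index_lists n k" for I k
  proof -
    have kn: "k \<le> n" using index_lists_le[OF I] .
    have "rev (map (\<lambda>j. n - 1 - j) [0..<k]) = [n - k..<n]"
      by (rule nth_equalityI) (use kn in \<open>auto simp: rev_nth\<close>)
    then show ?thesis using minor_mult_flip(2)[OF c I index_lists_upt0[OF kn]] by simp
  qed
  have "minor (X * flip_mat n) [0..<k] [0..<k] \<noteq> 0" if "k \<le> n" for k
    using init[OF index_lists_upt0[OF that]] upper_pos_last[OF X index_lists_upt0[OF that]] by simp
  then obtain N R where NR: "lower n N" "unit_diag n N" "upper n R" "X * flip_mat n = N * R"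
    using lu_decomposition[of "X * flip_mat n" n] c by auto
  have Nc: "N \<in> carrier_mat n n" using NR by (simp add: lower_def)
  define q where "q k = (\<Prod>i<k. R $$ (i, i))" for k
  have fac: "minor N I [0..<k] * q k = rev_sign k * minor X I [n - k..<n]" if "I \<in> index_lists n k" for I k
    using init[OF that] minor_mult_upper[OF NR(3) Nc that] NR(4) by (simp add: q_def)
  have q: "rev_sign k * q k > 0" if "k \<le> n" for k
  proof -
    have "minor N [0..<k] [0..<k] = 1"
      using minor_lower_initial[OF NR(1) index_lists_upt0[OF that]] NR(2) that
      by (auto simp: unit_diag_def intro!: prod.neutral)
    then have "rev_sign k * q k = (rev_sign k * rev_sign k) * minor X [0..<k] [n - k..<n]"
      using fac[OF index_lists_upt0[OF that]] by simp
    then show ?thesis using upper_pos_last[OF X index_lists_upt0[OF that]] by simp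
  qed
  have N: "lower_pos n N"
  proof (rule lower_posI[OF NR(1)])
    fix k I assume I: "I \<in> index_lists n k"
    have kn: "k \<le> n" using index_lists_le[OF I] .
    have "(rev_sign k * q k) * minor N I [0..<k] = rev_sign k * (minor N I [0..<k] * q k)" by simp
    also have "\<dots> = (rev_sign k * rev_sign k) * minor X I [n - k..<n]" unfolding fac[OF I] by simp
    also have "\<dots> > 0" using upper_pos_last[OF X I] by simp
    finally show "minor N I [0..<k] > 0" using q[OF kn] by (rule zero_less_mult_pos)
  qed
  have "(-1) ^ i * R $$ (i, i) > 0" if "i < n" for i
  proof -
    have "rev_sign (Suc i) * q (Suc i) = (rev_sign i * q i) * ((-1) ^ i * R $$ (i, i))"
      by (simp add: q_def)
    then have "(rev_sign i * q i) * ((-1) ^ i * R $$ (i, i)) > 0" using q[of "Suc i"] that by (simp only: Suc_leI)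
    then show ?thesis using q[of i] that by (metis less_imp_le zero_less_mult_pos)
  qed
  then show thesis using that N NR by blast
qed

lemma pick_nth:
  assumes "sorted_wrt (<) K" "r < length K"
  shows "pick (set K) r = K ! r"
proof -
  have srt: "K ! p < K ! q" if "p < q" "q < length K" for p q
    using sorted_wrt_nth_less[OF assms(1) that] .
  have "{a \<in> set K. a < K ! r} = (\<lambda>p. K ! p) ` {..<r}"
  proof (intro subset_antisym subsetI)
    fix a assume "a \<in> {a \<in> set K. a < K ! r}"
    then obtain p where p: "p < length K" "a = K ! p" "K ! p < K ! r" by (auto simp: in_set_conv_nth)
    then have "p < r" using srt[of r p] by (metis less_asym less_irrefl linorder_neqE_nat)
    then show "a \<in> (\<lambda>p. K ! p) ` {..<r}" using p by auto
  qed (use srt assms(2) in auto)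
  moreover have "inj_on (\<lambda>p. K ! p) {..<r}"
    using assms strict_sorted_iff[of K] by (auto simp: inj_on_def nth_eq_iff_index_eq)
  ultimately have "card {a \<in> set K. a < K ! r} = r" by (simp add: card_image)
  then show ?thesis using pick_card_in_set[of "K ! r" "set K"] assms(2) by simp
qed

lemma submatrix_minor:
  assumes M: "M \<in> carrier_mat n n" and I: "I \<in> index_lists n k" and J: "J \<in> index_lists n k"
  shows "Determinant.det (submatrix M (set I) (set J)) = minor M I J"
proof -
  have "{i. i < n \<and> i \<in> set I} = set I" "{i. i < n \<and> i \<in> set J} = set J"
    using index_lists_sub[OF I] index_lists_sub[OF J] by auto
  moreover have "card (set I) = k" "card (set J) = k"
    using distinct_card[OF index_lists_distinct[OF I]] distinct_card[OF index_lists_distinct[OF J]]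
      index_lists_length[OF I] index_lists_length[OF J] by auto
  ultimately have "submatrix M (set I) (set J) = mat k k (\<lambda>(r, c). M $$ (pick (set I) r, pick (set J) c))"
    using M by (simp add: submatrix_def)
  also have "\<dots> = mat (length I) (length J) (\<lambda>(r, c). M $$ (I ! r, J ! c))"
    using I J pick_nth[of I] pick_nth[of J] by (intro eq_matI) (auto simp: index_lists_def)
  finally show ?thesis by (simp add: minor_def)
qed

text \<open>A minor on rows \<open>[i..<i + k]\<close> and columns \<open>K \<subseteq> {i..}\<close> is not forced to vanish, because it is \<open>1\<close> for
  the partial permutation matrix \<open>N\<close> with these rows and columns.\<close>

lemma totally_positive_upper_pos:
  assumes M: "totally_positive_unitriangular M" and n: "dim_row M = n"
  shows "upper_pos n M" "unit_diag n M"
proof -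
  have c: "M \<in> carrier_mat n n" using assms by (auto simp: totally_positive_unitriangular_def)
  have up: "upper n M"
    using assms c by (auto simp: totally_positive_unitriangular_def upper_def upper_triangular_def)
  show "unit_diag n M" using assms by (auto simp: totally_positive_unitriangular_def unit_diag_def)
  have "minor M [i..<i + k] K > 0" if K: "K \<in> index_lists n k" and ik: "i + k \<le> n" "set K \<subseteq> {i..}" for i k K
  proof -
    have I: "[i..<i + k] \<in> index_lists n k" using ik by simp
    have lK: "length K = k" using index_lists_length[OF K] .
    have kK: "i + r \<le> K ! r" if "r < k" for r
      using that
    proof (induction r)
      case 0
      then have "K ! 0 \<in> {i..}" using ik(2) lK nth_mem[of 0 K] by blast
      then show ?case by simp
    next
      case (Suc r)
      then have "K ! r < K ! Suc r" using K sorted_wrt_nth_less[of "(<)" K r "Suc r"] lK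
        by (simp add: index_lists_def)
      then show ?case using Suc by simp
    qed
    define N where "N = mat n n (\<lambda>(p, q). if \<exists>r<k. p = i + r \<and> q = K ! r then 1 else (0::real))"
    have N: "N \<in> carrier_mat n n" by (simp add: N_def)
    have "upper_triangular N" using kK by (force simp: N_def upper_triangular_def)
    moreover have "minor N [i..<i + k] K = 1"
    proof -
      have "N $$ (i + r, K ! c) = (if r = c then 1 else 0)" if "r < k" "c < k" for r c
        using that ik(1) index_lists_nth[OF K that(2)] index_lists_distinct[OF K] lK
        by (auto simp: N_def nth_eq_iff_index_eq)
      then have "mat (length [i..<i + k]) (length K) (\<lambda>(r, c). N $$ ([i..<i + k] ! r, K ! c)) = 1\<^sub>m k"
        using lK by (intro eq_matI) auto
      then show ?thesis by (simp add: minor_def)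
    qed
    ultimately have "\<not> (\<forall>N\<in>carrier_mat n n. upper_triangular N \<longrightarrow>
        Determinant.det (submatrix (N :: real mat) (set [i..<i + k]) (set K)) = 0)"
      using N submatrix_minor[OF N I K] by (intro notI) (auto simp del: set_upt)
    moreover have "set [i..<i + k] \<subseteq> {..<n}" "set K \<subseteq> {..<n}" "card (set [i..<i + k]) = card (set K)"
      using index_lists_sub[OF I] index_lists_sub[OF K] distinct_card[OF index_lists_distinct[OF K]] lK by auto
    ultimately have "Determinant.det (submatrix M (set [i..<i + k]) (set K)) > 0"
      using M unfolding totally_positive_unitriangular_def n by blast
    then show ?thesis using submatrix_minor[OF c I K] by simp
  qed
  then show "upper_pos n M" using up by (auto simp: upper_pos_def)
qed

subsection \<open>The matrix of a contraction in an eigenbasis\<close>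

lemma mat_mult_closed [simp]:
  "A \<in> carrier_mat n n \<Longrightarrow> B \<in> carrier_mat n n \<Longrightarrow> A * B \<in> carrier_mat n n"
  by (rule mult_carrier_mat)

lemma mat_assoc:
  "A \<in> carrier_mat n n \<Longrightarrow> B \<in> carrier_mat n n \<Longrightarrow> C \<in> carrier_mat n n \<Longrightarrow> A * B * C = A * (B * (C :: real mat))"
  by (rule assoc_mult_mat)

lemma mat_cancel:
  assumes "A * B = 1\<^sub>m n" "A \<in> carrier_mat n n" "B \<in> carrier_mat n n" "C \<in> carrier_mat n n"
  shows "A * (B * C) = (C :: real mat)"
  using assms mat_assoc[of A n B C] by simp

lemma mat_extend:
  assumes "A * B = A' * B'" "A \<in> carrier_mat n n" "B \<in> carrier_mat n n" "A' \<in> carrier_mat n n"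
    "B' \<in> carrier_mat n n" "C \<in> carrier_mat n n"
  shows "A * (B * C) = A' * (B' * (C :: real mat))"
  using assms mat_assoc[of A n B C] mat_assoc[of A' n B' C] by simp

lemma upper_unit_inverse:
  assumes "upper n X" "unit_diag n X"
  obtains Y where "upper n Y" "X * Y = 1\<^sub>m n" "Y * X = 1\<^sub>m n"
proof -
  have c: "X \<in> carrier_mat n n" using assms by (simp add: upper_def)
  have "Determinant.det X = (\<Prod>i<n. X $$ (i, i))"
    using det_upper_triangular[of X n] assms c
    by (auto simp: upper_def upper_triangular_def prod_list_diag_prod atLeast0LessThan)
  then have "Determinant.det X \<noteq> 0" using assms(2) by (simp add: unit_diag_def)
  then obtain Y where Y: "Y \<in> carrier_mat n n" "X * Y = 1\<^sub>m n" "Y * X = 1\<^sub>m n"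
    using exists_inverse[OF c] by blast
  then show thesis using that[of Y] upper_inverse(1)[OF assms(1) Y(1,2)] by blast
qed

lemma lower_unit_inverse:
  assumes "lower n X" "unit_diag n X"
  obtains Y where "lower n Y" "unit_diag n Y" "X * Y = 1\<^sub>m n" "Y * X = 1\<^sub>m n"
proof -
  have c: "X \<in> carrier_mat n n" using assms by (simp add: lower_def)
  have "upper n (transpose_mat X)" "unit_diag n (transpose_mat X)"
    using assms c by (auto simp: lower_transpose unit_diag_def)
  then obtain Z where Z: "upper n Z" "transpose_mat X * Z = 1\<^sub>m n" "Z * transpose_mat X = 1\<^sub>m n"
    by (rule upper_unit_inverse)
  let ?Y = "transpose_mat Z"
  have Zc: "Z \<in> carrier_mat n n" using Z by (simp add: upper_def)
  have "X * ?Y = transpose_mat (Z * transpose_mat X)" using c Zc by (simp add: transpose_mult)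
  then have 1: "X * ?Y = 1\<^sub>m n" using Z by simp
  have Yc: "?Y \<in> carrier_mat n n" using Zc by simp
  have 2: "?Y * X = 1\<^sub>m n" by (rule mat_mult_left_right_inverse[OF c Yc 1])
  have "unit_diag n ?Y" unfolding unit_diag_def
    using lower_inverse(2)[OF assms(1) Yc 1] assms(2) by (auto simp: unit_diag_def)
  then show thesis using that[OF lower_inverse(1)[OF assms(1) Yc 1] _ 1 2] by blast
qed

lemma unit_diag_mult_upper: "upper n X \<Longrightarrow> upper n Y \<Longrightarrow> unit_diag n X \<Longrightarrow> unit_diag n Y \<Longrightarrow> unit_diag n (X * Y)"
  using upper_mult(2)[of n X Y] by (simp add: unit_diag_def)

text \<open>The matrix \<open>D = Y\<^sup>-\<^sup>1 A X\<close> preserves the standard flag, being a product of upper triangular matrices,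
  and the opposite flag, by \<open>eq\<close>.\<close>

lemma flag_map_diagonal:
  assumes A: "upper n A" and X: "upper n X" and Y: "upper n Y" "unit_diag n Y" and Q: "upper n Q"
    and eq: "A * (X * flip_mat n) = Y * (flip_mat n * Q)"
  obtains D where "upper n D" "lower n D" "A * X = Y * D"
proof -
  let ?W = "flip_mat n"
  note c = upper_carrier[OF A] upper_carrier[OF X] upper_carrier[OF Y(1)] upper_carrier[OF Q]
  let ?D = "?W * (Q * ?W)"
  have "A * X = (A * (X * ?W)) * ?W" using c by (simp add: mat_assoc[of _ n])
  also have "\<dots> = Y * ?D" unfolding eq using c by (simp add: mat_assoc[of _ n])
  finally have AX: "A * X = Y * ?D" .
  obtain Yi where Yi: "upper n Yi" "Y * Yi = 1\<^sub>m n" "Yi * Y = 1\<^sub>m n" by (rule upper_unit_inverse[OF Y])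
  have l: "lower n ?D" by (rule flip_upper(1)[OF Q])
  have "?D = Yi * (Y * ?D)"
    by (rule mat_cancel[OF Yi(3), symmetric]) (use c lower_carrier[OF l] upper_carrier[OF Yi(1)] in auto)
  also have "\<dots> = Yi * (A * X)" by (simp add: AX)
  finally have "upper n ?D" using upper_mult(1)[OF Yi(1) upper_mult(1)[OF A X]] by simp
  then show thesis using that l AX by blast
qed

lemma minor_mult_diagonal:
  assumes X: "X \<in> carrier_mat n n" and T: "upper n T" "lower n T"
    and I: "I \<in> index_lists n k" and J: "J \<in> index_lists n k"
  shows "minor (X * T) I J = minor X I J * (\<Prod>c<k. T $$ (J ! c, J ! c))"
proof -
  have Tc: "T \<in> carrier_mat n n" using T by (simp add: upper_def)
  have e: "(X * T) $$ (i, j) = X $$ (i, j) * T $$ (j, j)" if "i < n" "j < n" for i j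
  proof -
    have "(X * T) $$ (i, j) = (\<Sum>l<n. X $$ (i, l) * T $$ (l, j))" by (rule mult_entry[OF X Tc that])
    also have "\<dots> = (\<Sum>l<n. if l = j then X $$ (i, j) * T $$ (j, j) else 0)"
    proof (rule sum.cong[OF HOL.refl])
      fix l assume "l \<in> {..<n}"
      then show "X $$ (i, l) * T $$ (l, j) = (if l = j then X $$ (i, j) * T $$ (j, j) else 0)"
        using T that by (cases l j rule: linorder_cases) (auto simp: upper_def lower_def)
    qed
    finally show ?thesis using that by simp
  qed
  let ?A = "mat k k (\<lambda>(r, c). X $$ (I ! r, J ! c))"
  let ?D = "mat k k (\<lambda>(r, c). if r = c then T $$ (J ! c, J ! c) else 0)"
  have l: "length I = k" "length J = k" using I J by (auto simp: index_lists_length)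
  have "mat k k (\<lambda>(r, c). (X * T) $$ (I ! r, J ! c)) = ?A * ?D"
  proof (rule eq_matI)
    fix r c assume "r < dim_row (?A * ?D)" "c < dim_col (?A * ?D)"
    then have rc: "r < k" "c < k" by auto
    have "(?A * ?D) $$ (r, c) = (\<Sum>l<k. ?A $$ (r, l) * ?D $$ (l, c))"
      by (rule mult_entry) (use rc in auto)
    also have "\<dots> = (\<Sum>l<k. if l = c then X $$ (I ! r, J ! c) * T $$ (J ! c, J ! c) else 0)"
      by (rule sum.cong) (use rc in auto)
    finally show "mat k k (\<lambda>(r, c). (X * T) $$ (I ! r, J ! c)) $$ (r, c) = (?A * ?D) $$ (r, c)"
      using rc e[OF index_lists_nth[OF I rc(1)] index_lists_nth[OF J rc(2)]] by simp
  qed auto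
  then have "minor (X * T) I J = Determinant.det (?A * ?D)" by (simp add: minor_def l)
  also have "\<dots> = Determinant.det ?A * Determinant.det ?D" by (rule det_mult[of _ k]) auto
  also have "Determinant.det ?D = (\<Prod>c<k. T $$ (J ! c, J ! c))"
    using det_upper_triangular[of ?D k] by (auto simp: upper_triangular_def prod_list_diag_prod atLeast0LessThan)
  finally show ?thesis by (simp add: minor_def l)
qed

text \<open>Let \<open>W\<close> be the flip.  An equation \<open>X W = Y W Q\<close> with \<open>Q\<close> upper triangular says that \<open>X\<close> and \<open>Y\<close> map the
  opposite flag, which is the first flag of the positive tuple, to the same flag.  In the application \<open>A\<close>
  is the matrix of \<open>a\<close> in the basis of the tuple and the columns of \<open>L\<close> are the eigenvectors of \<open>b\<close>, so
  the hypotheses say where the flags of \<open>a\<close> and \<open>b\<close> are; \<open>L\<^sup>-\<^sup>1 A L\<close> is the matrix of \<open>a\<close> in the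
  eigenbasis.

  The proof factors this matrix as \<open>R N T\<close> in the first case and as \<open>R N T W\<close> in the second, where
  \<open>R N\<close> is strictly totally positive and \<open>T\<close> is diagonal with entries of one sign.  The matrices \<open>R\<close>
  and \<open>N\<close> depend only on \<open>u1, \<dots>, u4\<close> and \<open>L\<close>.  That \<open>T\<close> is diagonal follows from computing it in two
  ways, once from each of the two conditions in a case.  The signs of its entries follow from the signs of
  the eigenvalues of \<open>A\<close>, and these from comparing superdiagonal entries of unipotent matrices.\<close>

theorem eigenframe_sign_regular:
  assumes u: "upper_pos n u1" "upper_pos n u2" "upper_pos n u3" "upper_pos n u4"
    and ud: "unit_diag n u1" "unit_diag n u2" "unit_diag n u3" "unit_diag n u4"
    and A: "upper n A" "Determinant.det A \<noteq> 0"
    and L: "lower n L" "unit_diag n L" and Li: "Li \<in> carrier_mat n n" "L * Li = 1\<^sub>m n"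
    and Q: "upper n Q1" "upper n Q2" "upper n Q3" "upper n Q4"
    and fix_x: "A * ((u1 * u2) * flip_mat n) = (u1 * u2) * (flip_mat n * Q1)"
    and L_flag: "L = u1 * (u2 * (u3 * (u4 * (flip_mat n * Q2))))"
    and cases: "A * flip_mat n = u1 * (flip_mat n * Q3) \<and> A * L = u1 * (u2 * (u3 * (flip_mat n * Q4))) \<or>
                A * flip_mat n = u1 * (u2 * (u3 * (flip_mat n * Q3))) \<and> A * L = u1 * (flip_mat n * Q4)"
  shows "\<exists>\<epsilon>. \<forall>k. \<forall>I\<in>index_lists n k. \<forall>J\<in>index_lists n k. \<epsilon> k * minor (Li * (A * L)) I J > 0"
proof -
  let ?W = "flip_mat n"
  have up: "upper n u1" "upper n u2" "upper n u3" "upper n u4" using u by (auto simp: upper_pos_def)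
  have c: "u1 \<in> carrier_mat n n" "u2 \<in> carrier_mat n n" "u3 \<in> carrier_mat n n" "u4 \<in> carrier_mat n n"
    "A \<in> carrier_mat n n" "L \<in> carrier_mat n n" "Q1 \<in> carrier_mat n n" "Q2 \<in> carrier_mat n n"
    "Q3 \<in> carrier_mat n n" "Q4 \<in> carrier_mat n n"
    using up A L Q by (auto simp: upper_def lower_def)
  note assoc = mat_assoc[of _ n]
  have LiL: "Li * L = 1\<^sub>m n" by (rule mat_mult_left_right_inverse[OF c(6) Li])
  obtain u1i where u1i: "upper n u1i" "u1 * u1i = 1\<^sub>m n" "u1i * u1 = 1\<^sub>m n" by (rule upper_unit_inverse[OF up(1) ud(1)])
  have u1ic: "u1i \<in> carrier_mat n n" using u1i by (simp add: upper_def)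
  \<comment> \<open>move lower triangular factors to the left, starting from the innermost product in \<open>L_flag\<close>\<close>
  obtain N4 R4 where N4: "lower_pos n N4" "unit_diag n N4" "upper n R4" "u4 * ?W = N4 * R4"
    using upper_pos_flip_lu[OF u(4)] by metis
  have tp: "strictly_tp n (u2 * (u3 * N4))"
    by (rule upper_pos_mult_strictly_tp[OF u(2) upper_pos_mult_lower_pos[OF u(3) N4(1)]])
  obtain L2 R' where L2: "lower_pos n L2" "unit_diag n L2" "upper_pos n R'" "u2 * (u3 * N4) = L2 * R'"
    by (rule strictly_tp_lu[OF tp])
  obtain N R5 where N: "lower_pos n N" "unit_diag n N" "upper n R5" "R' * ?W = N * R5"
    and R5: "\<And>i. i < n \<Longrightarrow> (-1) ^ i * R5 $$ (i, i) > 0"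
    by (rule upper_pos_flip_lu[OF L2(3)]) blast
  have lo: "lower n N4" "lower n L2" "lower n N" and R'u: "upper n R'"
    using N4 L2 N by (auto simp: lower_pos_def upper_pos_def)
  have c2: "N4 \<in> carrier_mat n n" "L2 \<in> carrier_mat n n" "N \<in> carrier_mat n n" "R4 \<in> carrier_mat n n"
    "R' \<in> carrier_mat n n" "R5 \<in> carrier_mat n n"
    using lo R'u N4(3) N(3) by (auto simp: upper_def lower_def)
  obtain N4i where N4i: "lower n N4i" "unit_diag n N4i" "N4 * N4i = 1\<^sub>m n" by (rule lower_unit_inverse[OF lo(1) N4(2)])
  obtain L2i where L2i: "lower n L2i" "unit_diag n L2i" "L2 * L2i = 1\<^sub>m n" "L2i * L2 = 1\<^sub>m n"
    by (rule lower_unit_inverse[OF lo(2) L2(2)])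
  obtain Ni where Ni: "lower n Ni" "unit_diag n Ni" "N * Ni = 1\<^sub>m n" "Ni * N = 1\<^sub>m n"
    by (rule lower_unit_inverse[OF lo(3) N(2)])
  have c3: "N4i \<in> carrier_mat n n" "L2i \<in> carrier_mat n n" "Ni \<in> carrier_mat n n"
    using N4i L2i Ni by (auto simp: lower_def)
  note cc = c c2 c3 Li(1) u1ic flip_mat_carrier[of n]
  define R where "R = Li * (u1 * L2)"
  have Rc: "R \<in> carrier_mat n n" using cc by (simp add: R_def)
  have u23: "u2 * (u3 * (N4 * Z)) = L2 * (R' * Z)" if "Z \<in> carrier_mat n n" for Z
  proof -
    have "u2 * (u3 * (N4 * Z)) = (u2 * (u3 * N4)) * Z" using cc that by (simp add: assoc)
    then show ?thesis using cc that by (simp add: L2(4) assoc)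
  qed
  have u4W: "u4 * (?W * Z) = N4 * (R4 * Z)" if "Z \<in> carrier_mat n n" for Z
    by (rule mat_extend[OF N4(4)]) (use cc that in auto)
  have R'W: "R' * (?W * Z) = N * (R5 * Z)" if "Z \<in> carrier_mat n n" for Z
    by (rule mat_extend[OF N(4)]) (use cc that in auto)
  have LR: "L * R = u1 * L2" unfolding R_def by (rule mat_cancel[OF Li(2)]) (use cc in auto)
  \<comment> \<open>the inverse of \<open>R\<close> is \<open>R' R4 Q2\<close>, by \<open>L_flag\<close>\<close>
  have Ru: "upper n R"
  proof -
    let ?S = "R' * (R4 * Q2)"
    have S: "upper n ?S" by (intro upper_mult(1) R'u N4(3) Q(2))
    have "L = u1 * (L2 * ?S)" using cc by (subst L_flag) (simp add: u4W u23)
    moreover have "R * ?S = Li * (u1 * (L2 * ?S))" using cc unfolding R_def by (simp add: assoc)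
    ultimately have "R * ?S = 1\<^sub>m n" using LiL by simp
    then have "?S * R = 1\<^sub>m n" using mat_mult_left_right_inverse[OF Rc upper_carrier[OF S]] by blast
    then show ?thesis by (rule upper_inverse(1)[OF S Rc])
  qed
  have Rp: "upper_pos n R"
    using strictly_tp_factors(2)[OF _ L Ru] upper_pos_mult_lower_pos[OF u(1) L2(1)] LR by simp
  have RN: "strictly_tp n (R * N)" by (rule upper_pos_mult_lower_pos[OF Rp N(1)])
  have RL2i: "Li * (u1 * Z) = R * (L2i * Z)" if "Z \<in> carrier_mat n n" for Z
  proof -
    have "R * (L2i * Z) = Li * (u1 * (L2 * (L2i * Z)))" using cc that unfolding R_def by (simp add: assoc)
    also have "L2 * (L2i * Z) = Z" by (rule mat_cancel[OF L2i(3)]) (use cc that in auto)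
    finally show ?thesis by simp
  qed
  have Rcancel: "Z = Z'" if "R * Z = R * Z'" "Z \<in> carrier_mat n n" "Z' \<in> carrier_mat n n" for Z Z'
  proof -
    have "L2i * (u1i * (L * (R * Y))) = Y" if "Y \<in> carrier_mat n n" for Y
    proof -
      have "L * (R * Y) = u1 * (L2 * Y)" using mat_extend[OF LR, of n Y] cc Rc that by simp
      then have "u1i * (L * (R * Y)) = L2 * Y" using mat_cancel[OF u1i(3), of "L2 * Y"] cc that by simp
      then show ?thesis using mat_cancel[OF L2i(4), of Y] cc that by simp
    qed
    then show ?thesis using that by metis
  qed
  \<comment> \<open>the eigenvalues of \<open>A\<close>, and the superdiagonals of the unipotent factors\<close>
  define d where "d i = A $$ (i, i)" for i
  define s1 where "s1 i = u1 $$ (i, Suc i)" for i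
  define s2 where "s2 i = u2 $$ (i, Suc i)" for i
  define s3 where "s3 i = u3 $$ (i, Suc i)" for i
  have entry: "X $$ (i, Suc i) > 0" if "upper_pos n X" "Suc i < n" for X i
  proof -
    have "minor X [i..<i + 1] [Suc i] > 0" using that by (intro upper_posD) (auto simp: index_lists_def)
    then show ?thesis by (simp add: minor_def det_single)
  qed
  have s: "s1 i > 0" "s2 i > 0" "s3 i > 0" if "Suc i < n" for i
    using entry[OF u(1) that] entry[OF u(2) that] entry[OF u(3) that] by (auto simp: s1_def s2_def s3_def)
  have d0: "d i \<noteq> 0" if "i < n" for i
  proof -
    have "Determinant.det A = (\<Prod>i<n. d i)"
      using det_upper_triangular[of A n] A c
      by (auto simp: upper_def upper_triangular_def prod_list_diag_prod atLeast0LessThan d_def)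
    then show ?thesis using A(2) that prod_zero[of "{..<n}" d] by auto
  qed
  \<comment> \<open>a diagonal \<open>D\<close> with \<open>A X = Y D\<close> carries the eigenvalues of \<open>A\<close>\<close>
  have sup: "A $$ (i, Suc i) + d i * X $$ (i, Suc i) = Y $$ (i, Suc i) * d (Suc i)"
    and diag: "j < n \<Longrightarrow> D $$ (j, j) = d j"
    if "Suc i < n" "A * X = Y * D" "upper n X" "unit_diag n X" "upper n Y" "unit_diag n Y" "upper n D" "lower n D"
    for X Y D i j
  proof -
    have dd: "D $$ (j, j) = d j" if j: "j < n" for j
      using upper_mult(2)[OF A(1) \<open>upper n X\<close> j] upper_mult(2)[OF \<open>upper n Y\<close> \<open>upper n D\<close> j]
        \<open>A * X = Y * D\<close> \<open>unit_diag n X\<close> \<open>unit_diag n Y\<close> j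
      by (simp add: unit_diag_def d_def)
    then show "j < n \<Longrightarrow> D $$ (j, j) = d j" .
    have "D $$ (i, Suc i) = 0" using that by (simp add: lower_def)
    then show "A $$ (i, Suc i) + d i * X $$ (i, Suc i) = Y $$ (i, Suc i) * d (Suc i)"
      using upper_mult(3)[OF A(1) \<open>upper n X\<close> that(1)] upper_mult(3)[OF \<open>upper n Y\<close> \<open>upper n D\<close> that(1)]
        \<open>A * X = Y * D\<close> \<open>unit_diag n X\<close> \<open>unit_diag n Y\<close> dd[OF that(1)] that(1)
      by (simp add: unit_diag_def d_def)
  qed
  have x: "upper n (u1 * u2)" "unit_diag n (u1 * u2)"
    by (intro upper_mult(1) unit_diag_mult_upper up ud)+
  have y: "upper n (u1 * (u2 * u3))" "unit_diag n (u1 * (u2 * u3))"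
    by (intro upper_mult(1) unit_diag_mult_upper up ud)+
  have xs: "(u1 * u2) $$ (i, Suc i) = s1 i + s2 i" if "Suc i < n" for i
    using upper_mult(3)[OF up(1,2) that] ud that by (simp add: unit_diag_def s1_def s2_def)
  have ys: "(u1 * (u2 * u3)) $$ (i, Suc i) = s1 i + s2 i + s3 i" if "Suc i < n" for i
    using upper_mult(3)[OF up(1) upper_mult(1)[OF up(2,3)] that] upper_mult(3)[OF up(2,3) that]
      upper_mult(2)[OF up(2,3) that] ud that by (simp add: unit_diag_def s1_def s2_def s3_def)
  obtain D1 where D1: "upper n D1" "lower n D1" "A * (u1 * u2) = (u1 * u2) * D1"
    by (rule flag_map_diagonal[OF A(1) x(1) x Q(1) fix_x])
  \<comment> \<open>\<open>A\<close> fixes the flag of \<open>u1 u2\<close>; subtracting the analogous equation of each case leaves a recursion for \<open>d\<close>\<close>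
  have rel: "A $$ (i, Suc i) + d i * (s1 i + s2 i) = (s1 i + s2 i) * d (Suc i)" if "Suc i < n" for i
    using sup[OF that D1(3) x x D1(1,2)] xs[OF that] by simp
  have one: "upper n (1\<^sub>m n)" "unit_diag n (1\<^sub>m n)" by (auto simp: upper_def unit_diag_def)
  have finish: ?thesis
    if T: "upper n T" "lower n T" and sg: "\<And>i. i < n \<Longrightarrow> \<sigma> * T $$ (i, i) > 0"
      and M: "Li * (A * L) = R * N * T \<or> Li * (A * L) = R * N * T * ?W" for T \<sigma>
  proof -
    have RNc: "R * N \<in> carrier_mat n n" "R * N * T \<in> carrier_mat n n" using Rc cc T by (auto simp: upper_def)
    have pos: "\<sigma> ^ k * minor (R * N * T) I J > 0" if I: "I \<in> index_lists n k" and J: "J \<in> index_lists n k" for I J k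
    proof -
      have "\<sigma> ^ k * minor (R * N * T) I J = minor (R * N) I J * (\<Prod>c<k. \<sigma> * T $$ (J ! c, J ! c))"
        unfolding minor_mult_diagonal[OF RNc(1) T I J] by (simp add: prod.distrib)
      also have "\<dots> > 0"
        using strictly_tpD[OF RN I J] prod_pos[of "{..<k}" "\<lambda>c. \<sigma> * T $$ (J ! c, J ! c)"] sg index_lists_nth[OF J]
        by (intro mult_pos_pos) (simp_all del: zero_less_mult_iff)
      finally show ?thesis .
    qed
    from M show ?thesis
    proof
      assume "Li * (A * L) = R * N * T"
      then show ?thesis using pos by (intro exI[of _ "\<lambda>k. \<sigma> ^ k"]) simp
    next
      assume e: "Li * (A * L) = R * N * T * ?W"
      have "(\<sigma> ^ k * rev_sign k) * minor (Li * (A * L)) I J > 0" if I: "I \<in> index_lists n k" and J: "J \<in> index_lists n k" for I J k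
      proof -
        obtain J' where J': "J' \<in> index_lists n k" "minor (R * N * T * ?W) I J = rev_sign k * minor (R * N * T) I J'"
          using minor_mult_flip[OF RNc(2) I J] by blast
        have "(\<sigma> ^ k * rev_sign k) * minor (Li * (A * L)) I J = (rev_sign k * rev_sign k) * (\<sigma> ^ k * minor (R * N * T) I J')"
          unfolding e J'(2) by (simp only: mult_ac)
        then show ?thesis using pos[OF I J'(1)] by (simp only: rev_sign_square mult_1)
      qed
      then show ?thesis by (intro exI[of _ "\<lambda>k. \<sigma> ^ k * rev_sign k"]) blast
    qed
  qed
  from cases show ?thesis
  proof
    assume 1: "A * ?W = u1 * (?W * Q3) \<and> A * L = u1 * (u2 * (u3 * (?W * Q4)))"
    have e: "A * (1\<^sub>m n * ?W) = u1 * (?W * Q3)" using conjunct1[OF 1] left_mult_one_mat[OF flip_mat_carrier] by simp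
    obtain D where D: "upper n D" "lower n D" "A * 1\<^sub>m n = u1 * D"
      by (rule flag_map_diagonal[OF A(1) one(1) up(1) ud(1) Q(3) e])
    have Dc: "D \<in> carrier_mat n n" using D by (simp add: upper_def)
    have AD: "A = u1 * D" using D(3) cc by simp
    \<comment> \<open>the recursion is \<open>d i * (s1 i + s2 i) = s2 i * d (Suc i)\<close>: all eigenvalues have the same sign\<close>
    have dsign: "d 0 * d i > 0" if "i < n" for i
      using that
    proof (induction i)
      case 0
      then show ?case using d0[of 0] by (simp add: zero_less_mult_iff) (metis linorder_neqE_linordered_idom)
    next
      case (Suc i)
      have "A $$ (i, Suc i) = s1 i * d (Suc i)"
        using sup[OF Suc.prems D(3) one up(1) ud(1) D(1,2)] Suc.prems by (simp add: s1_def)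
      then have e: "d i * (s1 i + s2 i) = s2 i * d (Suc i)" using rel[OF Suc.prems] by (simp add: algebra_simps)
      have "s2 i * (d 0 * d (Suc i)) = (d 0 * d i) * (s1 i + s2 i)" using e by (simp add: mult_ac)
      also have "\<dots> > 0" by (rule mult_pos_pos) (use Suc s[OF Suc.prems] in \<open>simp_all del: zero_less_mult_iff\<close>)
      finally show ?case using s(2)[OF Suc.prems] by (rule zero_less_mult_pos)
    qed
    have Ddiag: "D $$ (j, j) = d j" if "j < n" for j
      using upper_mult(2)[OF up(1) D(1) that] AD ud(1) that by (simp add: unit_diag_def d_def)
    define T where "T = R5 * ((?W * (N4i * ?W)) * Q4)"
    have Tu: "upper n T" unfolding T_def by (intro upper_mult(1) N(3) flip_lower(1) N4i(1) Q(4))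
    have Tc: "T \<in> carrier_mat n n" using Tu by (simp add: upper_def)
    have "A * L = u1 * (u2 * (u3 * (N4 * (N4i * (?W * Q4)))))"
      using 1 mat_cancel[OF N4i(3), of "?W * Q4"] cc by simp
    also have "\<dots> = u1 * (L2 * (R' * (N4i * (?W * Q4))))" using cc by (simp add: u23)
    also have "\<dots> = u1 * (L2 * (R' * (?W * (?W * (N4i * (?W * Q4))))))"
      using mat_cancel[OF flip_flip, of n "N4i * (?W * Q4)"] cc by simp
    also have "\<dots> = u1 * (L2 * (N * T))" using cc by (simp add: R'W T_def assoc)
    finally have "Li * (A * L) = Li * (u1 * (L2 * (N * T)))" by simp
    also have "\<dots> = R * (L2i * (L2 * (N * T)))" using cc Tc by (simp add: RL2i)
    also have "L2i * (L2 * (N * T)) = N * T" by (rule mat_cancel[OF L2i(4)]) (use cc Tc in auto)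
    finally have M: "Li * (A * L) = R * (N * T)" .
    have "Li * (A * L) = R * (L2i * (D * L))" using cc Dc by (simp add: AD assoc RL2i)
    with M have "R * (N * T) = R * (L2i * (D * L))" by (simp only:)
    then have "N * T = L2i * (D * L)" by (rule Rcancel) (use cc Tc Dc in simp_all)
    then have Te: "T = Ni * (L2i * (D * L))" using mat_cancel[OF Ni(4), of T] cc Tc by simp
    have lo': "lower n (D * L)" "lower n (L2i * (D * L))" by (intro lower_mult(1) D L L2i(1))+
    have Tl: "lower n T" unfolding Te by (intro lower_mult(1) Ni(1) lo')
    have Td: "T $$ (i, i) = d i" if "i < n" for i
      using lower_mult(2)[OF Ni(1) lo'(2) that] lower_mult(2)[OF L2i(1) lo'(1) that] lower_mult(2)[OF D(2) L(1) that]
        Ni(2) L2i(2) L(2) Ddiag[OF that] that by (simp add: Te unit_diag_def)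
    show ?thesis
      by (rule finish[OF Tu Tl, of "d 0"]) (use Td dsign M cc Tc Rc in \<open>auto simp: assoc\<close>)
  next
    assume 2: "A * ?W = u1 * (u2 * (u3 * (?W * Q3))) \<and> A * L = u1 * (?W * Q4)"
    have "A * (1\<^sub>m n * ?W) = u1 * (u2 * (u3 * (?W * Q3)))"
      using conjunct1[OF 2] left_mult_one_mat[OF flip_mat_carrier] by simp
    also have "\<dots> = (u1 * (u2 * u3)) * (?W * Q3)" using cc by (simp add: assoc)
    finally have e: "A * (1\<^sub>m n * ?W) = (u1 * (u2 * u3)) * (?W * Q3)" .
    obtain D where D: "upper n D" "lower n D" "A * 1\<^sub>m n = (u1 * (u2 * u3)) * D"
      by (rule flag_map_diagonal[OF A(1) one(1) y Q(3) e])
    have Dc: "D \<in> carrier_mat n n" using D by (simp add: upper_def)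
    have AD: "A = u1 * (u2 * (u3 * D))" using D(3) cc Dc by (simp add: assoc)
    \<comment> \<open>the recursion is \<open>d i * (s1 i + s2 i) = - s3 i * d (Suc i)\<close>: the signs of the eigenvalues alternate\<close>
    have dsign: "(-1) ^ i * (d 0 * d i) > 0" if "i < n" for i
      using that
    proof (induction i)
      case 0
      then show ?case using d0[of 0] by (simp add: zero_less_mult_iff) (metis linorder_neqE_linordered_idom)
    next
      case (Suc i)
      have "A $$ (i, Suc i) = (s1 i + s2 i + s3 i) * d (Suc i)"
        using sup[OF Suc.prems D(3) one y D(1,2)] Suc.prems ys[OF Suc.prems] by simp
      then have e: "d i * (s1 i + s2 i) = - (s3 i * d (Suc i))" using rel[OF Suc.prems] by (simp add: algebra_simps)
      have "s3 i * ((-1) ^ Suc i * (d 0 * d (Suc i))) = ((-1) ^ i * (d 0 * d i)) * (s1 i + s2 i)"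
        using arg_cong[OF e, of "\<lambda>t. (-1) ^ i * d 0 * t"] by (simp add: mult_ac)
      also have "\<dots> > 0" by (rule mult_pos_pos) (use Suc s[OF Suc.prems] in \<open>simp_all del: zero_less_mult_iff\<close>)
      finally show ?case using s(3)[OF Suc.prems] by (rule zero_less_mult_pos)
    qed
    have Ddiag: "D $$ (j, j) = d j" if "j < n" for j
      using upper_mult(2)[OF y(1) D(1) that] D(3) cc y(2) that by (simp add: unit_diag_def d_def)
    define \<Lambda> where "\<Lambda> = N4i * (D * L)"
    have \<Lambda>: "lower n \<Lambda>" unfolding \<Lambda>_def by (intro lower_mult(1) N4i(1) D(2) L(1))
    have \<Lambda>c: "\<Lambda> \<in> carrier_mat n n" using \<Lambda> by (simp add: lower_def)
    have \<Lambda>d: "\<Lambda> $$ (i, i) = d i" if "i < n" for i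
      using lower_mult(2)[OF N4i(1) lower_mult(1)[OF D(2) L(1)] that] lower_mult(2)[OF D(2) L(1) that]
        N4i(2) L(2) Ddiag[OF that] that by (simp add: \<Lambda>_def unit_diag_def)
    define T where "T = R5 * (?W * (\<Lambda> * ?W))"
    have Tu: "upper n T" unfolding T_def by (intro upper_mult(1) N(3) flip_lower(1) \<Lambda>)
    have Tc: "T \<in> carrier_mat n n" using Tu by (simp add: upper_def)
    have "Li * (A * L) = R * (L2i * (u2 * (u3 * (D * L))))" using cc Dc by (simp add: AD assoc RL2i)
    also have "u2 * (u3 * (D * L)) = u2 * (u3 * (N4 * \<Lambda>))"
      unfolding \<Lambda>_def using mat_cancel[OF N4i(3), of "D * L"] cc Dc by simp
    also have "\<dots> = L2 * (R' * \<Lambda>)" by (rule u23[OF \<Lambda>c])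
    also have "L2i * (L2 * (R' * \<Lambda>)) = R' * \<Lambda>" by (rule mat_cancel[OF L2i(4)]) (use cc \<Lambda>c in auto)
    also have "R' * \<Lambda> = R' * (?W * (?W * \<Lambda>))" using mat_cancel[OF flip_flip, of n \<Lambda>] \<Lambda>c by simp
    also have "\<dots> = N * (R5 * (?W * \<Lambda>))" using cc \<Lambda>c by (simp add: R'W)
    also have "\<dots> = N * (T * ?W)"
      unfolding T_def using cc \<Lambda>c by (simp add: assoc)
    finally have M: "Li * (A * L) = R * (N * (T * ?W))" .
    have "Li * (A * L) = R * (L2i * (?W * Q4))" using 2 cc by (simp add: RL2i)
    with M have "R * (N * (T * ?W)) = R * (L2i * (?W * Q4))" by (simp only:)
    then have "N * (T * ?W) = L2i * (?W * Q4)" by (rule Rcancel) (use cc Tc in simp_all)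
    then have "N * (T * ?W) * ?W = L2i * (?W * Q4) * ?W" by simp
    then have "N * T = L2i * (?W * (Q4 * ?W))" using cc Tc by (simp add: assoc)
    then have Te: "T = Ni * (L2i * (?W * (Q4 * ?W)))" using mat_cancel[OF Ni(4), of T] cc Tc by simp
    have Tl: "lower n T" unfolding Te by (intro lower_mult(1) Ni(1) L2i(1) flip_upper(1) Q(4))
    have Td: "T $$ (i, i) = R5 $$ (i, i) * d (n - 1 - i)" if "i < n" for i
      using upper_mult(2)[OF N(3) flip_lower(1)[OF \<Lambda>] that] flip_lower(2)[OF \<Lambda> that] \<Lambda>d[of "n - 1 - i"] that
      by (simp add: T_def)
    have "((-1) ^ (n - 1) * d 0) * T $$ (i, i) > 0" if "i < n" for i
    proof -
      have "((-1) ^ (n - 1) :: real) = (-1) ^ i * (-1) ^ (n - 1 - i)" using that by (simp add: power_add[symmetric])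
      then have "((-1) ^ (n - 1) * d 0) * T $$ (i, i) =
          ((-1) ^ i * R5 $$ (i, i)) * ((-1) ^ (n - 1 - i) * (d 0 * d (n - 1 - i)))"
        by (simp add: Td[OF that] mult_ac)
      also have "\<dots> > 0" by (rule mult_pos_pos[OF R5[OF that] dsign]) (use that in simp)
      finally show ?thesis .
    qed
    then show ?thesis
      by (rule finish[OF Tu Tl]) (use M cc Tc Rc in \<open>auto simp: assoc\<close>)
  qed
qed

section \<open>Products of positive matrices and diagonal matrices\<close>

text \<open>The two bounds come from the two ways in which one step contracts: by a fixed factor, which is good for
  small exponents \<open>m\<close>, and by \<open>K q\<^sup>m\<close>, which is good for large ones.\<close>

lemma exponential_rate:
  fixes c K q :: real
  assumes c: "0 < c" "c \<le> 1" and K: "K > 0" and q: "0 < q" "q < 1"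
  obtains \<kappa> :: real where "\<kappa> > 0"
    "\<And>m. 1 - c \<le> exp (- \<kappa> * (real m + 1)) \<or> K * q ^ m \<le> exp (- \<kappa> * (real m + 1))"
    "\<And>m. q ^ m \<le> exp (- \<kappa> * real m)"
proof -
  define p where "p = sqrt q"
  have p: "0 < p" "p < 1" "p * p = q" using q by (auto simp: p_def)
  have "(\<lambda>m. K * p ^ m) \<longlonglongrightarrow> K * 0" by (intro tendsto_mult tendsto_const LIMSEQ_realpow_zero) (use p in auto)
  then have "\<forall>\<^sub>F m in sequentially. K * p ^ m < p" using p by (intro order_tendstoD(2)[of _ 0]) auto
  then obtain m0 where m0: "\<And>m. m \<ge> m0 \<Longrightarrow> K * p ^ m < p" by (auto simp: eventually_sequentially)
  define \<kappa> where "\<kappa> = min (- ln p) (c / (real m0 + 1))"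
  have \<kappa>: "\<kappa> > 0" "\<kappa> \<le> - ln p" "\<kappa> \<le> c / (real m0 + 1)" using p c by (auto simp: \<kappa>_def ln_less_zero_iff)
  have pe: "p ^ m \<le> exp (- \<kappa> * real m)" for m
  proof -
    have "p ^ m = exp (ln p * real m)" using p by (simp add: exp_of_nat2_mult)
    also have "\<dots> \<le> exp (- \<kappa> * real m)" using mult_right_mono[of "ln p" "- \<kappa>" "real m"] \<kappa>(2) by simp
    finally show ?thesis .
  qed
  show thesis
  proof (rule that[OF \<kappa>(1)])
    fix m :: nat
    have "q \<le> p" using mult_left_mono[of p 1 p] p by simp
    then have "q ^ m \<le> p ^ m" using q by (intro power_mono) auto
    then show "q ^ m \<le> exp (- \<kappa> * real m)" using pe[of m] by linarith
    show "1 - c \<le> exp (- \<kappa> * (real m + 1)) \<or> K * q ^ m \<le> exp (- \<kappa> * (real m + 1))"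
    proof (cases "m \<ge> m0")
      case True
      have "K * q ^ m = (K * p ^ m) * p ^ m" by (simp add: p(3)[symmetric] power_mult_distrib)
      also have "\<dots> \<le> p * p ^ m" using m0[OF True] p by (intro mult_right_mono) auto
      also have "\<dots> \<le> exp (- \<kappa> * (real m + 1))" using pe[of "Suc m"] by (simp add: algebra_simps)
      finally show ?thesis by simp
    next
      case False
      have "\<kappa> * (real m + 1) \<le> c / (real m0 + 1) * (real m0 + 1)" using False \<kappa> c
        by (intro mult_mono) auto
      also have "\<dots> = c" by simp
      finally have "- c \<le> - \<kappa> * (real m + 1)" by (simp only: mult_minus_left neg_le_iff_le)
      then have "exp (- c) \<le> exp (- \<kappa> * (real m + 1))" by (simp only: exp_le_cancel_iff)
      moreover have "1 - c \<le> exp (- c)" using exp_ge_add_one_self[of "- c"] by simp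
      ultimately have "1 - c \<le> exp (- \<kappa> * (real m + 1))" by linarith
      then show ?thesis ..
    qed
  qed
qed

text \<open>The two weights share the mass \<open>c\<close>, on which the averages cancel.\<close>

lemma weighted_mean_contraction:
  fixes w w' r :: "'i \<Rightarrow> real"
  assumes fin: "finite S" and ne: "S \<noteq> {}"
    and w: "\<And>l. l \<in> S \<Longrightarrow> w l \<ge> 0" "(\<Sum>l\<in>S. w l) = 1" and w': "(\<Sum>l\<in>S. w' l) = 1"
    and c: "\<And>l. l \<in> S \<Longrightarrow> w' l \<ge> c * w l"
    and osc: "\<And>l l'. l \<in> S \<Longrightarrow> l' \<in> S \<Longrightarrow> \<bar>r l - r l'\<bar> \<le> \<omega>" and c1: "c \<le> 1"
  shows "(\<Sum>l\<in>S. w l * r l) - (\<Sum>l\<in>S. w' l * r l) \<le> (1 - c) * \<omega>"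
proof -
  define m where "m = Min (r ` S)"
  have "m \<in> r ` S" using Min_in[of "r ` S"] fin ne by (auto simp: m_def)
  then obtain l0 where l0: "l0 \<in> S" "m = r l0" by blast
  have m: "m \<le> r l" if "l \<in> S" for l using fin that by (auto simp: m_def)
  have rm: "r l - m \<le> \<omega>" if "l \<in> S" for l using osc[OF that l0(1)] l0(2) by auto
  have s: "(\<Sum>l\<in>S. w l * r l) = m + (\<Sum>l\<in>S. w l * (r l - m))" "(\<Sum>l\<in>S. w' l * r l) = m + (\<Sum>l\<in>S. w' l * (r l - m))"
    using w w' by (simp_all add: right_diff_distrib sum_subtractf sum_distrib_right[symmetric])
  have "(\<Sum>l\<in>S. w' l * (r l - m)) \<ge> (\<Sum>l\<in>S. c * w l * (r l - m))"
    using c m by (intro sum_mono mult_right_mono) auto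
  then have "(\<Sum>l\<in>S. w l * r l) - (\<Sum>l\<in>S. w' l * r l) \<le> (1 - c) * (\<Sum>l\<in>S. w l * (r l - m))"
  proof -
    have "(\<Sum>l\<in>S. c * w l * (r l - m)) = c * (\<Sum>l\<in>S. w l * (r l - m))"
      by (simp add: sum_distrib_left mult.assoc)
    then show ?thesis using \<open>(\<Sum>l\<in>S. w' l * (r l - m)) \<ge> _\<close> unfolding s by (simp add: algebra_simps)
  qed
  also have "(\<Sum>l\<in>S. w l * (r l - m)) \<le> (\<Sum>l\<in>S. w l * \<omega>)"
    using rm w by (intro sum_mono mult_left_mono) auto
  also have "(\<Sum>l\<in>S. w l * \<omega>) = \<omega>" using w by (simp add: sum_distrib_right[symmetric])
  finally show ?thesis using c1 by (simp add: mult_left_mono)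
qed

text \<open>In the application \<open>P\<close> and \<open>D\<close> are the matrices of \<open>a\<close> and \<open>b\<close> on an exterior power: \<open>top\<close> and \<open>bot\<close>
  are the places of the dominant entries of the positive and the negative powers of \<open>D\<close>.\<close>

locale positive_words =
  fixes S :: "'i set" and P :: "'i \<Rightarrow> 'i \<Rightarrow> real" and D :: "'i \<Rightarrow> real" and top bot :: 'i and q :: real
  assumes fin: "finite S" and tb: "top \<in> S" "bot \<in> S"
    and P: "\<And>i j. i \<in> S \<Longrightarrow> j \<in> S \<Longrightarrow> P i j > 0"
    and D: "\<And>i. i \<in> S \<Longrightarrow> D i > 0"
    and q: "0 < q" "q < 1"
    and D_top: "\<And>i. i \<in> S \<Longrightarrow> i \<noteq> top \<Longrightarrow> D i \<le> q * D top"
    and D_bot: "\<And>i. i \<in> S \<Longrightarrow> i \<noteq> bot \<Longrightarrow> D bot \<le> q * D i"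
begin

text \<open>
  The matrix of \<open>D\<^sup>k\<^sup>0 P D\<^sup>k\<^sup>1 P \<dots> P D\<^sup>k\<^sup>r\<close>.  In \<open>inner_mat\<close> the outer powers of \<open>D\<close> are omitted, which leaves
  a matrix that begins and ends with \<open>P\<close> and so has entries of comparable size.
\<close>

fun word_mat :: "int list \<Rightarrow> 'i \<Rightarrow> 'i \<Rightarrow> real" where
  "word_mat [] i j = (if i = j then 1 else 0)"
| "word_mat [k] i j = (if i = j then D i powi k else 0)"
| "word_mat (k # k' # ks) i j = D i powi k * (\<Sum>l\<in>S. P i l * word_mat (k' # ks) l j)"

fun inner_mat :: "int list \<Rightarrow> 'i \<Rightarrow> 'i \<Rightarrow> real" where
  "inner_mat [] i j = P i j"
| "inner_mat (m # ms) i j = (\<Sum>l\<in>S. P i l * (D l powi m * inner_mat ms l j))"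

lemma word_mat_inner:
  assumes "i \<in> S" "j \<in> S"
  shows "word_mat (k # ms @ [k']) i j = D i powi k * inner_mat ms i j * D j powi k'"
  using assms
proof (induction ms arbitrary: k i)
  case Nil
  have "(\<Sum>l\<in>S. P i l * (if l = j then D l powi k' else 0)) = (\<Sum>l\<in>S. if l = j then P i j * D j powi k' else 0)"
    by (rule sum.cong) auto
  then show ?case using Nil fin by simp
next
  case (Cons m ms)
  have "word_mat (k # (m # ms) @ [k']) i j = D i powi k * (\<Sum>l\<in>S. P i l * word_mat (m # ms @ [k']) l j)"
    by simp
  also have "(\<Sum>l\<in>S. P i l * word_mat (m # ms @ [k']) l j) = (\<Sum>l\<in>S. P i l * (D l powi m * inner_mat ms l j * D j powi k'))"
    using Cons by (intro sum.cong) auto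
  also have "\<dots> = inner_mat (m # ms) i j * D j powi k'"
    by (simp add: sum_distrib_right mult.assoc)
  finally show ?case by simp
qed

definition peak :: "int \<Rightarrow> 'i" where "peak k = (if k \<ge> 0 then top else bot)"

lemma peak [simp]: "peak k \<in> S" using tb by (simp add: peak_def)

lemma powi_pos [simp]: "i \<in> S \<Longrightarrow> D i powi k > 0"
  using D by (simp add: zero_less_power_int)

lemma D_powi_peak:
  assumes "i \<in> S" "i \<noteq> peak k"
  shows "D i powi k \<le> q ^ nat \<bar>k\<bar> * D (peak k) powi k"
proof (cases "k \<ge> 0")
  case True
  then have "D i ^ nat k \<le> (q * D top) ^ nat k"
    using assms D[OF assms(1)] by (intro power_mono D_top) (auto simp: peak_def less_imp_le)
  then show ?thesis using True by (simp add: peak_def power_int_def power_mult_distrib)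
next
  case False
  then have "D bot \<le> q * D i" using assms by (intro D_bot) (auto simp: peak_def)
  then have "D bot ^ nat (- k) \<le> (q * D i) ^ nat (- k)"
    using D[OF tb(2)] by (intro power_mono) (auto simp: less_imp_le)
  then have "D bot ^ nat (- k) \<le> q ^ nat (- k) * D i ^ nat (- k)" by (simp add: power_mult_distrib)
  then have "inverse (D i ^ nat (- k)) \<le> q ^ nat (- k) * inverse (D bot ^ nat (- k))"
    using D[OF tb(2)] D[OF assms(1)] by (simp add: field_simps)
  then show ?thesis using False by (simp add: peak_def power_int_def power_inverse)
qed

lemma D_powi_le_peak:
  assumes "i \<in> S"
  shows "D i powi k \<le> D (peak k) powi k"
proof (cases "i = peak k")
  case False
  have "q ^ nat \<bar>k\<bar> * D (peak k) powi k \<le> D (peak k) powi k"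
    using q powi_pos[of "peak k" k] by (intro mult_left_le_one_le power_le_one) (auto simp: less_imp_le)
  then show ?thesis using D_powi_peak[OF assms False] by linarith
qed simp

lemma D_powi_pair:
  assumes "i \<in> S" "i' \<in> S" "i \<noteq> i'"
  shows "D i powi k * D i' powi k \<le> q ^ nat \<bar>k\<bar> * (D (peak k) powi k)\<^sup>2"
proof -
  have *: "D i powi k * D i' powi k \<le> q ^ nat \<bar>k\<bar> * (D (peak k) powi k)\<^sup>2"
    if "i \<in> S" "i' \<in> S" "i \<noteq> peak k" for i i'
  proof -
    have "D i powi k * D i' powi k \<le> (q ^ nat \<bar>k\<bar> * D (peak k) powi k) * D (peak k) powi k"
      using that D_powi_peak D_powi_le_peak q
      by (intro mult_mono) (auto simp: less_imp_le intro!: mult_nonneg_nonneg)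
    then show ?thesis by (simp add: power2_eq_square)
  qed
  show ?thesis
  proof (cases "i = peak k")
    case True
    then show ?thesis using *[OF assms(2,1)] assms(3) by (simp add: mult.commute)
  qed (use * assms in auto)
qed

lemma ratio_bound: "\<exists>c\<ge>1. \<forall>i\<in>S. \<forall>i'\<in>S. \<forall>j\<in>S. \<forall>j'\<in>S. P i j \<le> c * P i' j'"
proof -
  have fin2: "finite ((\<lambda>(i, j). P i j) ` (S \<times> S))" and ne: "(\<lambda>(i, j). P i j) ` (S \<times> S) \<noteq> {}"
    using fin tb by auto
  define hi where "hi = Max ((\<lambda>(i, j). P i j) ` (S \<times> S))"
  define lo where "lo = Min ((\<lambda>(i, j). P i j) ` (S \<times> S))"
  have b: "lo \<le> P i j" "P i j \<le> hi" if "i \<in> S" "j \<in> S" for i j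
    unfolding lo_def hi_def using that fin2 by (auto intro!: Min_le Max_ge)
  have "lo > 0" using Min_in[OF fin2 ne] P by (auto simp: lo_def)
  moreover have "lo \<le> hi" using b[OF tb] by linarith
  ultimately have "hi / lo \<ge> 1" "hi / lo > 0" by auto
  moreover have "P i j \<le> hi / lo * P i' j'" if "i \<in> S" "i' \<in> S" "j \<in> S" "j' \<in> S" for i i' j j'
  proof -
    have "hi = hi / lo * lo" using \<open>lo > 0\<close> by simp
    also have "\<dots> \<le> hi / lo * P i' j'" using b that \<open>hi / lo > 0\<close> by (intro mult_left_mono) auto
    finally show ?thesis using b(2)[of i j] that by linarith
  qed
  ultimately show ?thesis by blast
qed

lemma inner_mat_pos: "i \<in> S \<Longrightarrow> j \<in> S \<Longrightarrow> inner_mat ms i j > 0"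
  by (induction ms arbitrary: i) (use P tb fin in \<open>auto intro!: sum_pos mult_pos_pos\<close>)

lemma inner_mat_ratio:
  assumes c: "\<And>i i' j j'. i \<in> S \<Longrightarrow> i' \<in> S \<Longrightarrow> j \<in> S \<Longrightarrow> j' \<in> S \<Longrightarrow> P i j \<le> c * P i' j'"
    and "i \<in> S" "i' \<in> S" "j \<in> S" "j' \<in> S"
  shows "inner_mat ms i j \<le> c * inner_mat ms i' j" "inner_mat ms i j \<le> c * inner_mat ms i j'"
proof -
  show "inner_mat ms i j \<le> c * inner_mat ms i' j"
  proof (cases ms)
    case (Cons m ms')
    have "(\<Sum>l\<in>S. P i l * (D l powi m * inner_mat ms' l j)) \<le> (\<Sum>l\<in>S. (c * P i' l) * (D l powi m * inner_mat ms' l j))"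
      using assms inner_mat_pos by (intro sum_mono mult_right_mono) (auto simp: less_imp_le)
    then show ?thesis using Cons by (simp add: sum_distrib_left mult.assoc)
  qed (use assms in simp)
  show "inner_mat ms i j \<le> c * inner_mat ms i j'"
    using \<open>i \<in> S\<close>
  proof (induction ms arbitrary: i)
    case (Cons m ms)
    have "(\<Sum>l\<in>S. P i l * (D l powi m * inner_mat ms l j)) \<le> (\<Sum>l\<in>S. P i l * (D l powi m * (c * inner_mat ms l j')))"
      using Cons P by (intro sum_mono mult_left_mono) (auto simp: less_imp_le)
    then show ?case by (simp add: sum_distrib_left mult_ac)
  qed (use assms in simp)
qed

text \<open>Multiplication by \<open>P D\<^sup>m\<close> replaces the ratios \<open>x l / y l\<close> by averages of them, with weights
  \<open>w i l\<close> proportional to \<open>P i l * D l powi m * y l\<close>.  The first bound holds because the weights for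
  different rows are comparable, and the second because all weights but the one at the peak of
  \<open>D\<^sup>m\<close> are \<open>O(q\<^sup>\<bar>\<^sup>m\<^sup>\<bar>)\<close>.\<close>

lemma mean_contraction:
  fixes m :: int and x y :: "'i \<Rightarrow> real" and c :: real
  assumes c: "c \<ge> 1" "\<And>i i' j j'. i \<in> S \<Longrightarrow> i' \<in> S \<Longrightarrow> j \<in> S \<Longrightarrow> j' \<in> S \<Longrightarrow> P i j \<le> c * P i' j'"
    and y: "\<And>i. i \<in> S \<Longrightarrow> y i > 0" "\<And>i i'. i \<in> S \<Longrightarrow> i' \<in> S \<Longrightarrow> y i \<le> c * y i'"
    and osc: "\<And>i i'. i \<in> S \<Longrightarrow> i' \<in> S \<Longrightarrow> \<bar>x i / y i - x i' / y i'\<bar> \<le> \<omega>"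
    and i: "i \<in> S" "i' \<in> S"
  defines "X \<equiv> \<lambda>i. \<Sum>l\<in>S. P i l * (D l powi m * x l)" and "Y \<equiv> \<lambda>i. \<Sum>l\<in>S. P i l * (D l powi m * y l)"
  shows "\<bar>X i / Y i - X i' / Y i'\<bar> \<le> (1 - 1 / c\<^sup>2) * \<omega>"
    and "\<bar>X i / Y i - X i' / Y i'\<bar> \<le> 2 * real (card S) * c\<^sup>2 * q ^ nat \<bar>m\<bar> * \<omega>"
proof -
  define w where "w i l = P i l * (D l powi m * y l) / Y i" for i l
  have Y: "Y i > 0" if "i \<in> S" for i
    unfolding Y_def using that fin tb P y by (intro sum_pos mult_pos_pos) auto
  have w0: "w i l > 0" if "i \<in> S" "l \<in> S" for i l
    unfolding w_def using that P y Y by (intro divide_pos_pos mult_pos_pos) auto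
  have w1: "(\<Sum>l\<in>S. w i l) = 1" if "i \<in> S" for i
  proof -
    have "(\<Sum>l\<in>S. w i l) = (\<Sum>l\<in>S. P i l * (D l powi m * y l)) / Y i"
      by (simp add: w_def sum_divide_distrib)
    also have "(\<Sum>l\<in>S. P i l * (D l powi m * y l)) = Y i" by (simp add: Y_def)
    finally show ?thesis using Y[OF that] by simp
  qed
  have XY: "X i / Y i = (\<Sum>l\<in>S. w i l * (x l / y l))" for i
  proof -
    have "w i l * (x l / y l) = P i l * (D l powi m * x l) / Y i" if "l \<in> S" for l
      using y(1)[OF that] by (simp add: w_def)
    then show ?thesis by (simp add: X_def sum_divide_distrib)
  qed
  have \<omega>: "\<omega> \<ge> 0" using osc[OF tb(1) tb(1)] by simp
  have comp: "w i' l \<ge> 1 / c\<^sup>2 * w i l" if "i \<in> S" "i' \<in> S" "l \<in> S" for i i' l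
  proof -
    have "Y i' \<le> c * Y i" unfolding Y_def sum_distrib_left
    proof (rule sum_mono)
      fix l assume "l \<in> S"
      then show "P i' l * (D l powi m * y l) \<le> c * (P i l * (D l powi m * y l))"
        using c(2)[of i' i l l] that y(1)[of l] by (simp add: mult.assoc[symmetric] mult_right_mono less_imp_le)
    qed
    moreover have "P i l \<le> c * P i' l" using c(2) that by auto
    ultimately have "P i l * Y i' \<le> (c * P i' l) * (c * Y i)"
      using P[OF that(1,3)] P[OF that(2,3)] Y[OF that(1)] Y[OF that(2)] c(1)
      by (intro mult_mono) (auto simp: less_imp_le)
    then have "P i l / Y i \<le> c\<^sup>2 * (P i' l / Y i')"
      using Y[OF that(1)] Y[OF that(2)] by (simp add: field_simps power2_eq_square)
    then have "P i l / Y i * (D l powi m * y l) \<le> c\<^sup>2 * (P i' l / Y i') * (D l powi m * y l)"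
      using y(1)[OF that(3)] that(3) by (intro mult_right_mono) (auto simp: less_imp_le)
    then have "w i l \<le> c\<^sup>2 * w i' l" by (simp add: w_def)
    then show ?thesis using c(1) by (simp add: field_simps)
  qed
  have c2: "1 / c\<^sup>2 \<le> 1" using c(1) by simp
  have one: "X i / Y i - X i' / Y i' \<le> (1 - 1 / c\<^sup>2) * \<omega>" if "i \<in> S" "i' \<in> S" for i i'
    unfolding XY
    by (rule weighted_mean_contraction[OF fin _ _ _ _ _ osc c2]) (use that w0 w1 comp tb in \<open>auto simp: less_imp_le\<close>)
  show "\<bar>X i / Y i - X i' / Y i'\<bar> \<le> (1 - 1 / c\<^sup>2) * \<omega>"
    using one[OF i] one[OF i(2,1)] by (simp add: abs_le_iff)
  define p where "p = peak m"
  have p: "p \<in> S" by (simp add: p_def)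
  have two: "\<bar>X i / Y i - x p / y p\<bar> \<le> real (card S) * c\<^sup>2 * q ^ nat \<bar>m\<bar> * \<omega>" if i: "i \<in> S" for i
  proof -
    have "X i / Y i - x p / y p = (\<Sum>l\<in>S. w i l * (x l / y l - x p / y p))"
      unfolding XY using w1[OF i] by (simp add: right_diff_distrib sum_subtractf sum_distrib_right[symmetric] del: times_divide_eq_right)
    also have "\<bar>\<dots>\<bar> \<le> (\<Sum>l\<in>S. \<bar>w i l * (x l / y l - x p / y p)\<bar>)" by (rule sum_abs)
    also have "\<dots> \<le> (\<Sum>l\<in>S. c\<^sup>2 * q ^ nat \<bar>m\<bar> * \<omega>)"
    proof (rule sum_mono)
      fix l assume l: "l \<in> S"
      show "\<bar>w i l * (x l / y l - x p / y p)\<bar> \<le> c\<^sup>2 * q ^ nat \<bar>m\<bar> * \<omega>"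
      proof (cases "l = p")
        case True
        then show ?thesis using c q \<omega> by simp
      next
        case False
        have "P i p * (D p powi m * y p) \<le> Y i"
          unfolding Y_def using fin p i P y by (intro member_le_sum) (auto simp: less_imp_le)
        moreover have "P i l * (D l powi m * y l) \<le> (c * P i p) * ((q ^ nat \<bar>m\<bar> * D p powi m) * (c * y p))"
          using c i l p P y q D_powi_peak[OF l False[unfolded p_def]]
          by (intro mult_mono) (auto simp: less_imp_le p_def intro!: mult_nonneg_nonneg)
        ultimately have "P i l * (D l powi m * y l) \<le> (c\<^sup>2 * q ^ nat \<bar>m\<bar>) * Y i"
        proof -
          assume a: "P i p * (D p powi m * y p) \<le> Y i"
            and b: "P i l * (D l powi m * y l) \<le> (c * P i p) * ((q ^ nat \<bar>m\<bar> * D p powi m) * (c * y p))"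
          have "(c * P i p) * ((q ^ nat \<bar>m\<bar> * D p powi m) * (c * y p)) = (c\<^sup>2 * q ^ nat \<bar>m\<bar>) * (P i p * (D p powi m * y p))"
            by (simp add: power2_eq_square mult_ac)
          also have "\<dots> \<le> (c\<^sup>2 * q ^ nat \<bar>m\<bar>) * Y i" using a q by (intro mult_left_mono) auto
          finally show ?thesis using b by linarith
        qed
        then have "w i l \<le> c\<^sup>2 * q ^ nat \<bar>m\<bar>" using Y[OF i] by (simp add: w_def pos_divide_le_eq)
        then have "w i l * \<bar>x l / y l - x p / y p\<bar> \<le> (c\<^sup>2 * q ^ nat \<bar>m\<bar>) * \<omega>"
          using w0[OF i l] osc[OF l p] q by (intro mult_mono) (auto simp: less_imp_le)
        then show ?thesis using w0[OF i l] by (simp add: abs_mult)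
      qed
    qed
    also have "\<dots> = real (card S) * c\<^sup>2 * q ^ nat \<bar>m\<bar> * \<omega>" by simp
    finally show ?thesis .
  qed
  show "\<bar>X i / Y i - X i' / Y i'\<bar> \<le> 2 * real (card S) * c\<^sup>2 * q ^ nat \<bar>m\<bar> * \<omega>"
    using two[OF i(1)] two[OF i(2)] by linarith
qed

text \<open>The exponent is the length of the word.  A \<open>2 \<times> 2\<close> minor of \<open>inner_mat\<close> is a difference of two
  ratios of entries times a product of two entries, and \<open>mean_contraction\<close> controls the difference; the
  outer powers contribute a factor \<open>q\<close> per letter by \<open>D_powi_pair\<close>, because two different rows cannot both
  be the peak.\<close>

theorem word_mat_two_minors:
  "\<exists>C>0. \<exists>\<kappa>>0. \<forall>ks. ks \<noteq> [] \<longrightarrow> (\<exists>p\<in>S. \<exists>r\<in>S. \<forall>i\<in>S. \<forall>i'\<in>S. \<forall>j\<in>S. \<forall>j'\<in>S.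
     \<bar>word_mat ks i j * word_mat ks i' j' - word_mat ks i j' * word_mat ks i' j\<bar>
       \<le> C * exp (- \<kappa> * real_of_int (int (length ks) - 1 + (\<Sum>k\<leftarrow>ks. \<bar>k\<bar>))) * (word_mat ks p r)\<^sup>2)"
proof -
  obtain c where c: "c \<ge> 1" "\<And>i i' j j'. i \<in> S \<Longrightarrow> i' \<in> S \<Longrightarrow> j \<in> S \<Longrightarrow> j' \<in> S \<Longrightarrow> P i j \<le> c * P i' j'"
    using ratio_bound by blast
  have cc: "0 < 1 / c\<^sup>2" "1 / c\<^sup>2 \<le> 1" using c(1) by auto
  have "card S > 0" using fin tb by (auto simp: card_gt_0_iff)
  then have K: "2 * real (card S) * c\<^sup>2 > 0" using c(1) by simp
  obtain \<kappa> :: real where \<kappa>: "\<kappa> > 0"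
    "\<And>m. 1 - 1 / c\<^sup>2 \<le> exp (- \<kappa> * (real m + 1)) \<or> 2 * real (card S) * c\<^sup>2 * q ^ m \<le> exp (- \<kappa> * (real m + 1))"
    "\<And>m. q ^ m \<le> exp (- \<kappa> * real m)"
    by (rule exponential_rate[OF cc K q]) blast
  have osc: "\<bar>inner_mat ms i j / inner_mat ms i j' - inner_mat ms i' j / inner_mat ms i' j'\<bar>
      \<le> c * exp (- \<kappa> * (\<Sum>m\<leftarrow>ms. real_of_int \<bar>m\<bar> + 1))"
    if "i \<in> S" "i' \<in> S" "j \<in> S" "j' \<in> S" for ms i i' j j'
    using that(1,2)
  proof (induction ms arbitrary: i i')
    case Nil
    have "0 < P i j / P i j' \<and> P i j / P i j' \<le> c" if "i \<in> S" for i
      using P[OF that \<open>j \<in> S\<close>] P[OF that \<open>j' \<in> S\<close>] c(2)[OF that that \<open>j \<in> S\<close> \<open>j' \<in> S\<close>]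
      by (simp add: pos_divide_le_eq)
    from this[OF Nil(1)] this[OF Nil(2)] have "\<bar>P i j / P i j' - P i' j / P i' j'\<bar> \<le> c" by linarith
    then show ?case by simp
  next
    case (Cons m ms)
    let ?\<omega> = "c * exp (- \<kappa> * (\<Sum>m\<leftarrow>ms. real_of_int \<bar>m\<bar> + 1))"
    have pos: "inner_mat ms i j' > 0" if "i \<in> S" for i by (rule inner_mat_pos[OF that \<open>j' \<in> S\<close>])
    have rat: "inner_mat ms i j' \<le> c * inner_mat ms i' j'" if "i \<in> S" "i' \<in> S" for i i'
      by (rule inner_mat_ratio(1)[OF c(2) that \<open>j' \<in> S\<close> \<open>j' \<in> S\<close>])
    note mc = mean_contraction[where m = m, OF c pos rat Cons.IH Cons.prems]
    let ?d = "\<bar>inner_mat (m # ms) i j / inner_mat (m # ms) i j' - inner_mat (m # ms) i' j / inner_mat (m # ms) i' j'\<bar>"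
    have "?d \<le> exp (- \<kappa> * (real (nat \<bar>m\<bar>) + 1)) * ?\<omega>"
      using \<kappa>(2)[of "nat \<bar>m\<bar>"]
    proof
      assume *: "1 - 1 / c\<^sup>2 \<le> exp (- \<kappa> * (real (nat \<bar>m\<bar>) + 1))"
      have "?d \<le> (1 - 1 / c\<^sup>2) * ?\<omega>" using mc(1) by simp
      also have "\<dots> \<le> exp (- \<kappa> * (real (nat \<bar>m\<bar>) + 1)) * ?\<omega>" using * c(1) by (intro mult_right_mono) auto
      finally show ?thesis .
    next
      assume *: "2 * real (card S) * c\<^sup>2 * q ^ nat \<bar>m\<bar> \<le> exp (- \<kappa> * (real (nat \<bar>m\<bar>) + 1))"
      have "?d \<le> (2 * real (card S) * c\<^sup>2 * q ^ nat \<bar>m\<bar>) * ?\<omega>" using mc(2) by simp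
      also have "\<dots> \<le> exp (- \<kappa> * (real (nat \<bar>m\<bar>) + 1)) * ?\<omega>" using * c(1) by (intro mult_right_mono) auto
      finally show ?thesis .
    qed
    also have "\<dots> = c * exp (- \<kappa> * (\<Sum>m\<leftarrow>m # ms. real_of_int \<bar>m\<bar> + 1))"
      by (simp add: exp_add[symmetric] algebra_simps)
    finally show ?case .
  qed
  \<comment> \<open>one \<open>c\<close> from the oscillation, four from comparing entries, and \<open>exp \<kappa>\<close> because a word with \<open>r + 1\<close> letters \<open>P\<close> has only \<open>r\<close> inner powers\<close>
  define C where "C = c ^ 5 * exp \<kappa>"
  have C1: "C \<ge> 1" unfolding C_def using c(1) \<kappa>(1) mult_mono[of 1 "c ^ 5" 1 "exp \<kappa>"] one_le_power[of c 5] by simp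
  have qk: "q ^ nat \<bar>k\<bar> \<le> exp (- \<kappa> * \<bar>k\<bar>)" for k :: int using \<kappa>(3)[of "nat \<bar>k\<bar>"] by simp
  have "\<exists>p\<in>S. \<exists>r\<in>S. \<forall>i\<in>S. \<forall>i'\<in>S. \<forall>j\<in>S. \<forall>j'\<in>S.
     \<bar>word_mat ks i j * word_mat ks i' j' - word_mat ks i j' * word_mat ks i' j\<bar>
       \<le> C * exp (- \<kappa> * real_of_int (int (length ks) - 1 + (\<Sum>k\<leftarrow>ks. \<bar>k\<bar>))) * (word_mat ks p r)\<^sup>2"
    if ne: "ks \<noteq> []" for ks
  proof (cases "tl ks = []")
    case True
    then obtain k where ks: "ks = [k]" using ne by (cases ks) auto
    have "\<bar>word_mat ks i j * word_mat ks i' j' - word_mat ks i j' * word_mat ks i' j\<bar>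
       \<le> C * exp (- \<kappa> * real_of_int \<bar>k\<bar>) * (word_mat ks (peak k) (peak k))\<^sup>2"
      if "i \<in> S" "i' \<in> S" "j \<in> S" "j' \<in> S" for i i' j j'
    proof (cases "i = i' \<or> j = j'")
      case True
      then have "word_mat ks i j * word_mat ks i' j' - word_mat ks i j' * word_mat ks i' j = 0" by (auto simp: mult.commute)
      then show ?thesis using C1 by simp
    next
      case False
      have "\<bar>word_mat ks i j * word_mat ks i' j' - word_mat ks i j' * word_mat ks i' j\<bar> \<le> D i powi k * D i' powi k"
        using False that by (auto simp: ks abs_mult less_imp_le)
      also have "\<dots> \<le> q ^ nat \<bar>k\<bar> * (D (peak k) powi k)\<^sup>2" using D_powi_pair[OF that(1,2)] False by auto
      also have "\<dots> \<le> (C * exp (- \<kappa> * \<bar>k\<bar>)) * (D (peak k) powi k)\<^sup>2"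
        using mult_mono[OF C1 qk[of k]] C1 q by (intro mult_right_mono) auto
      finally show ?thesis by (simp add: ks)
    qed
    then show ?thesis using peak by (intro bexI[of _ "peak k"]) (auto simp: ks)
  next
    case False
    obtain k ms k' where ks: "ks = k # ms @ [k']"
    proof -
      have "ks = hd ks # butlast (tl ks) @ [last (tl ks)]" using ne False by simp
      then show thesis using that by blast
    qed
    define p where "p = peak k"
    define r where "r = peak k'"
    have pr: "p \<in> S" "r \<in> S" by (auto simp: p_def r_def)
    define E where "E = exp (- \<kappa> * (\<Sum>m\<leftarrow>ms. real_of_int \<bar>m\<bar> + 1))"
    have N: "exp \<kappa> * exp (- \<kappa> * real_of_int (int (length ks) - 1 + (\<Sum>k\<leftarrow>ks. \<bar>k\<bar>))) =
        exp (- \<kappa> * \<bar>k\<bar>) * exp (- \<kappa> * \<bar>k'\<bar>) * E"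
    proof -
      have "(\<Sum>m\<leftarrow>ms. real_of_int \<bar>m\<bar> + 1) = length ms + real_of_int (\<Sum>m\<leftarrow>ms. \<bar>m\<bar>)"
        by (induction ms) auto
      then show ?thesis unfolding E_def by (simp add: ks exp_add[symmetric] algebra_simps)
    qed
    have "\<bar>word_mat ks i j * word_mat ks i' j' - word_mat ks i j' * word_mat ks i' j\<bar>
       \<le> C * exp (- \<kappa> * real_of_int (int (length ks) - 1 + (\<Sum>k\<leftarrow>ks. \<bar>k\<bar>))) * (word_mat ks p r)\<^sup>2"
      if S: "i \<in> S" "i' \<in> S" "j \<in> S" "j' \<in> S" for i i' j j'
    proof (cases "i = i' \<or> j = j'")
      case True
      then have "word_mat ks i j * word_mat ks i' j' - word_mat ks i j' * word_mat ks i' j = 0" by (auto simp: mult.commute)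
      then show ?thesis using C1 by simp
    next
      case False
      let ?B = "inner_mat ms"
      define F where "F = (D i powi k * D i' powi k) * (D j powi k' * D j' powi k')"
      have B: "?B i j > 0" "?B i j' > 0" "?B i' j > 0" "?B i' j' > 0" "?B p r > 0"
        using inner_mat_pos S pr by auto
      have F0: "F \<ge> 0" unfolding F_def using S by (intro mult_nonneg_nonneg) (auto simp: less_imp_le)
      have "word_mat ks i j * word_mat ks i' j' - word_mat ks i j' * word_mat ks i' j =
          F * (?B i j * ?B i' j' - ?B i j' * ?B i' j)"
        unfolding ks using S by (simp add: word_mat_inner F_def algebra_simps)
      also have "?B i j * ?B i' j' - ?B i j' * ?B i' j = (?B i j' * ?B i' j') * (?B i j / ?B i j' - ?B i' j / ?B i' j')"
        using B by (simp add: field_simps)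
      finally have "\<bar>word_mat ks i j * word_mat ks i' j' - word_mat ks i j' * word_mat ks i' j\<bar> =
          F * (?B i j' * ?B i' j') * \<bar>?B i j / ?B i j' - ?B i' j / ?B i' j'\<bar>"
        using F0 B by (simp add: abs_mult)
      also have "\<dots> \<le> F * (?B i j' * ?B i' j') * (c * E)"
        using osc[OF S] F0 B unfolding E_def by (intro mult_left_mono) auto
      also have "\<dots> \<le> (exp (- \<kappa> * \<bar>k\<bar>) * (D p powi k)\<^sup>2 * (exp (- \<kappa> * \<bar>k'\<bar>) * (D r powi k')\<^sup>2)) * ((c\<^sup>2 * ?B p r) * (c\<^sup>2 * ?B p r)) * (c * E)"
      proof -
        have Bpr: "?B a j' \<le> c\<^sup>2 * ?B p r" if "a \<in> S" for a
        proof -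
          have "?B a j' \<le> c * ?B p j'" by (rule inner_mat_ratio(1)[OF c(2) that pr(1) S(4) S(4)])
          also have "\<dots> \<le> c * (c * ?B p r)"
            using inner_mat_ratio(2)[OF c(2) pr(1) pr(1) S(4) pr(2)] c(1) by (intro mult_left_mono) auto
          finally show ?thesis by (simp add: power2_eq_square mult.assoc)
        qed
        have k1: "D i powi k * D i' powi k \<le> exp (- \<kappa> * \<bar>k\<bar>) * (D p powi k)\<^sup>2"
          using D_powi_pair[OF S(1,2), of k] False mult_right_mono[OF qk[of k], of "(D p powi k)\<^sup>2"] by (simp add: p_def)
        have k2: "D j powi k' * D j' powi k' \<le> exp (- \<kappa> * \<bar>k'\<bar>) * (D r powi k')\<^sup>2"
          using D_powi_pair[OF S(3,4), of k'] False mult_right_mono[OF qk[of k'], of "(D r powi k')\<^sup>2"] by (simp add: r_def)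
        have "F \<le> exp (- \<kappa> * \<bar>k\<bar>) * (D p powi k)\<^sup>2 * (exp (- \<kappa> * \<bar>k'\<bar>) * (D r powi k')\<^sup>2)"
          unfolding F_def using S by (intro mult_mono k1 k2) (auto simp: less_imp_le intro!: mult_nonneg_nonneg)
        then have "F * (?B i j' * ?B i' j') \<le> (exp (- \<kappa> * \<bar>k\<bar>) * (D p powi k)\<^sup>2 * (exp (- \<kappa> * \<bar>k'\<bar>) * (D r powi k')\<^sup>2)) * (?B i j' * ?B i' j')"
          using B by (intro mult_right_mono) auto
        also have "?B i j' * ?B i' j' \<le> (c\<^sup>2 * ?B p r) * (c\<^sup>2 * ?B p r)"
          using Bpr S B by (intro mult_mono) (auto simp: less_imp_le intro!: mult_nonneg_nonneg)
        finally have "F * (?B i j' * ?B i' j') \<le> (exp (- \<kappa> * \<bar>k\<bar>) * (D p powi k)\<^sup>2 * (exp (- \<kappa> * \<bar>k'\<bar>) * (D r powi k')\<^sup>2)) * ((c\<^sup>2 * ?B p r) * (c\<^sup>2 * ?B p r))"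
          by (simp add: mult_left_mono)
        then show ?thesis using c(1) by (intro mult_right_mono) (auto simp: E_def)
      qed
      also have "\<dots> = c ^ 5 * (exp (- \<kappa> * \<bar>k\<bar>) * exp (- \<kappa> * \<bar>k'\<bar>) * E) * (D p powi k * ?B p r * D r powi k')\<^sup>2"
        by (simp add: power2_eq_square eval_nat_numeral mult_ac)
      also have "\<dots> = C * exp (- \<kappa> * real_of_int (int (length ks) - 1 + (\<Sum>k\<leftarrow>ks. \<bar>k\<bar>))) * (word_mat ks p r)\<^sup>2"
        unfolding N[symmetric] C_def by (simp add: ks word_mat_inner[OF pr] mult_ac)
      finally show ?thesis .
    qed
    then show ?thesis using pr by blast
  qed
  then show ?thesis using C1 \<kappa>(1) by (intro exI[of _ C] conjI exI[of _ \<kappa>]) auto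
qed

end

section \<open>Coordinates\<close>

definition coord :: "'v::euclidean_space list \<Rightarrow> nat \<Rightarrow> 'v \<Rightarrow> real" where
  "coord B i v = representation (set B) v (B ! i)"

lemma ordered_basis_length: "ordered_basis (B :: 'v::euclidean_space list) \<Longrightarrow> length B = DIM('v)"
  unfolding ordered_basis_def by (metis distinct_card dim_UNIV dim_eq_card_independent dim_span)

context
  fixes B :: "'v::euclidean_space list"
  assumes B: "ordered_basis B"
begin

lemma basis_facts: "distinct B" "independent (set B)" "span (set B) = UNIV" "v \<in> span (set B)"
  using B by (auto simp: ordered_basis_def)

lemma coord_linear: "linear (coord B i)"
  by (rule linearI)
     (simp_all add: coord_def real_vector.representation_add real_vector.representation_scale basis_facts)

lemma coord_basis:
  assumes "i < DIM('v)" "j < DIM('v)"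
  shows "coord B i (B ! j) = (if i = j then 1 else 0)"
proof -
  have "B ! j \<in> set B" using assms ordered_basis_length[OF B] by simp
  then have "representation (set B) (B ! j) = (\<lambda>v. if v = B ! j then 1 else 0)"
    using real_vector.representation_basis basis_facts(2) by blast
  then have "coord B i (B ! j) = (if B ! i = B ! j then 1 else 0)" unfolding coord_def by (rule fun_cong)
  then show ?thesis
    using assms basis_facts(1) ordered_basis_length[OF B] by (simp add: nth_eq_iff_index_eq)
qed

lemma coord_expand: "v = (\<Sum>i<DIM('v). coord B i v *\<^sub>R B ! i)"
proof -
  have "v = (\<Sum>b\<in>set B. representation (set B) v b *\<^sub>R b)"
    by (rule real_vector.sum_representation_eq[symmetric]) (use basis_facts in auto)
  also have "\<dots> = (\<Sum>i<DIM('v). coord B i v *\<^sub>R B ! i)"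
    unfolding coord_def using basis_facts(1) ordered_basis_length[OF B]
    by (intro sum.reindex_bij_betw[symmetric] bij_betw_nth) auto
  finally show ?thesis .
qed

lemma coord_eqI:
  assumes "v = (\<Sum>i<DIM('v). c i *\<^sub>R B ! i)" "j < DIM('v)"
  shows "coord B j v = c j"
proof -
  interpret linear "coord B j" by (rule coord_linear)
  have "coord B j v = (\<Sum>i<DIM('v). c i * (if j = i then 1 else 0))"
    unfolding assms(1) sum scale using assms(2) by (intro sum.cong) (auto simp: coord_basis)
  then show ?thesis using assms(2) by (simp add: if_distrib cong: if_cong)
qed

lemma coord_inject: "(\<And>i. i < DIM('v) \<Longrightarrow> coord B i v = coord B i w) \<Longrightarrow> v = w"
  by (subst coord_expand[of v], subst coord_expand[of w]) simp

lemma matrix_in_carrier [simp]: "matrix_in B f \<in> carrier_mat DIM('v) DIM('v)"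
  by (simp add: matrix_in_def ordered_basis_length[OF B])

lemma matrix_in_entry: "i < DIM('v) \<Longrightarrow> j < DIM('v) \<Longrightarrow> matrix_in B f $$ (i, j) = coord B i (f (B ! j))"
  by (simp add: matrix_in_def ordered_basis_length[OF B] coord_def)

lemma coord_image:
  assumes "linear f" "i < DIM('v)"
  shows "coord B i (f v) = (\<Sum>j<DIM('v). matrix_in B f $$ (i, j) * coord B j v)"
proof -
  interpret f: linear f by fact
  interpret c: linear "coord B i" by (rule coord_linear)
  have "coord B i (f v) = coord B i (f (\<Sum>j<DIM('v). coord B j v *\<^sub>R B ! j))" using coord_expand by metis
  also have "\<dots> = (\<Sum>j<DIM('v). coord B j v * coord B i (f (B ! j)))"
    by (simp add: f.sum f.scale c.sum c.scale)
  finally show ?thesis using assms(2) by (simp add: matrix_in_entry mult.commute)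
qed

lemma matrix_in_comp:
  assumes "linear f"
  shows "matrix_in B (f \<circ> g) = matrix_in B f * matrix_in B g"
proof (rule eq_matI)
  fix i j assume "i < dim_row (matrix_in B f * matrix_in B g)" "j < dim_col (matrix_in B f * matrix_in B g)"
  then have ij: "i < DIM('v)" "j < DIM('v)"
    by (auto simp: matrix_in_def ordered_basis_length[OF B])
  show "matrix_in B (f \<circ> g) $$ (i, j) = (matrix_in B f * matrix_in B g) $$ (i, j)"
    by (subst mult_entry[OF matrix_in_carrier matrix_in_carrier ij])
       (use ij coord_image[OF assms ij(1), of "g (B ! j)"] in \<open>simp add: matrix_in_entry\<close>)
qed (auto simp: matrix_in_def)

lemma matrix_in_id: "matrix_in B id = 1\<^sub>m DIM('v)"
  using carrier_matD[OF matrix_in_carrier[of id]] by (intro eq_matI) (simp_all add: matrix_in_entry coord_basis)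

lemma matrix_in_scale: "matrix_in B (\<lambda>v. c *\<^sub>R f v) = c \<cdot>\<^sub>m matrix_in B f"
proof (rule eq_matI)
  fix i j assume "i < dim_row (c \<cdot>\<^sub>m matrix_in B f)" "j < dim_col (c \<cdot>\<^sub>m matrix_in B f)"
  then have "i < DIM('v)" "j < DIM('v)" by (auto simp: matrix_in_def ordered_basis_length[OF B])
  then show "matrix_in B (\<lambda>v. c *\<^sub>R f v) $$ (i, j) = (c \<cdot>\<^sub>m matrix_in B f) $$ (i, j)"
    using linear_scale[OF coord_linear] carrier_matD[OF matrix_in_carrier[of f]] by (simp add: matrix_in_entry)
qed (auto simp: matrix_in_def)

lemma matrix_in_inverse:
  assumes "linear f" "linear g" "g \<circ> f = id"
  shows "matrix_in B g * matrix_in B f = 1\<^sub>m DIM('v)"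
  using matrix_in_comp[OF assms(2), of f] assms(3) matrix_in_id by simp

lemma det_matrix_in_nonzero:
  assumes "linear f" "bij f"
  shows "Determinant.det (matrix_in B f) \<noteq> 0"
proof -
  let ?g = "inv_into UNIV f"
  have "linear ?g" using assms bij_is_inj inj_linear_imp_inv_linear by blast
  moreover have "?g \<circ> f = id" using assms by (simp add: bij_is_inj)
  ultimately have "matrix_in B ?g * matrix_in B f = 1\<^sub>m DIM('v)" using matrix_in_inverse assms by blast
  then have "Determinant.det (matrix_in B ?g) * Determinant.det (matrix_in B f) = 1"
    using det_mult[OF matrix_in_carrier matrix_in_carrier] by (metis det_one)
  then show ?thesis by auto
qed

lemma coord_bounded: "\<exists>K>0. \<forall>i<DIM('v). \<forall>v. norm v = 1 \<longrightarrow> \<bar>coord B i v\<bar> \<le> K"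
proof -
  have "\<exists>K>0. \<forall>v. norm (coord B i v) \<le> K * norm v" for i
    using linear_bounded_pos[OF coord_linear] by (metis mult.commute)
  then obtain K where K: "\<And>i. K i > 0" "\<And>i v. \<bar>coord B i v\<bar> \<le> K i * norm v" by (metis real_norm_def)
  have "\<bar>coord B i v\<bar> \<le> (\<Sum>i<DIM('v). K i)" if "i < DIM('v)" "norm v = 1" for i v
  proof -
    have "\<bar>coord B i v\<bar> \<le> K i" using K(2)[of i v] that by simp
    also have "\<dots> \<le> (\<Sum>i<DIM('v). K i)" using that K(1) by (intro member_le_sum) (auto simp: less_imp_le)
    finally show ?thesis .
  qed
  moreover have "{..<DIM('v)} \<noteq> {}" using DIM_positive[where 'a = 'v] by blast
  then have "(\<Sum>i<DIM('v). K i) > 0" using K(1) by (intro sum_pos) auto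
  ultimately show ?thesis by blast
qed

end

lemma some_ordered_basis: "ordered_basis (SOME B :: 'v::euclidean_space list. ordered_basis B)"
proof -
  obtain B :: "'v list" where "set B = Basis" "distinct B" using finite_distinct_list[OF finite_Basis] by blast
  then have "ordered_basis B" by (simp add: ordered_basis_def independent_Basis span_Basis)
  then show ?thesis by (rule someI)
qed

section \<open>Singular values\<close>

definition orthonormal :: "'v::euclidean_space list \<Rightarrow> bool" where
  "orthonormal vs \<longleftrightarrow> (\<forall>i<length vs. \<forall>j<length vs. vs ! i \<bullet> vs ! j = (if i = j then 1 else 0))"

lemma orthonormal_norm: "orthonormal vs \<Longrightarrow> i < length vs \<Longrightarrow> norm (vs ! i) = 1"
  by (simp add: orthonormal_def norm_eq_1)

lemma orthonormal_expand:
  fixes vs :: "'v::euclidean_space list"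
  assumes vs: "orthonormal vs" "length vs = DIM('v)"
  shows "v = (\<Sum>i<DIM('v). (v \<bullet> vs ! i) *\<^sub>R vs ! i)" and "distinct vs" and "independent (set vs)"
proof -
  show d: "distinct vs"
    unfolding distinct_conv_nth
  proof (intro allI impI)
    fix i j assume "i < length vs" "j < length vs" "i \<noteq> j"
    then show "vs ! i \<noteq> vs ! j" using vs(1) unfolding orthonormal_def by (metis zero_neq_one)
  qed
  have o: "pairwise real_inner_class.orthogonal (set vs)"
    unfolding pairwise_def real_inner_class.orthogonal_def using vs(1)
    by (metis in_set_conv_nth orthonormal_def)
  have n: "norm b = 1" if "b \<in> set vs" for b using that orthonormal_norm[OF vs(1)] by (auto simp: in_set_conv_nth)
  then have "0 \<notin> set vs" by force
  then show i: "independent (set vs)" using o pairwise_orthogonal_independent by blast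
  have "span (set vs) = UNIV"
    using i d vs(2) by (metis card_eq_dim dim_UNIV distinct_card finite_set subset_UNIV top.extremum_uniqueI)
  then have "v = (\<Sum>b\<in>set vs. (v \<bullet> b) *\<^sub>R b)"
    using orthonormal_basis_expand[OF o n] by simp
  also have "\<dots> = (\<Sum>i<DIM('v). (v \<bullet> vs ! i) *\<^sub>R vs ! i)"
    using d vs(2) by (intro sum.reindex_bij_betw[symmetric] bij_betw_nth) auto
  finally show "v = (\<Sum>i<DIM('v). (v \<bullet> vs ! i) *\<^sub>R vs ! i)" .
qed

text \<open>First-order condition at a maximum.\<close>

lemma quadratic_vanish:
  fixes a b :: real
  assumes "\<And>t. 2 * t * a \<le> t\<^sup>2 * b"
  shows "a = 0"
proof (rule ccontr)
  assume a: "a \<noteq> 0"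
  define K where "K = \<bar>b\<bar> + 1"
  have K: "K > 0" "b < 2 * K" by (auto simp: K_def)
  have "2 * (a / K) * a \<le> (a / K)\<^sup>2 * b" by (rule assms)
  then have "a\<^sup>2 * (2 * K) \<le> a\<^sup>2 * b" using K(1) by (simp add: field_simps power2_eq_square)
  then have "2 * K \<le> b" using a by (simp add: mult_le_cancel_left)
  then show False using K by simp
qed

text \<open>Choose a unit vector \<open>v1\<close> at which the norm of \<open>f v\<close> is maximal.  By maximality its image is orthogonal to the
  images of all vectors orthogonal to \<open>v1\<close>; continue in the orthogonal complement.\<close>

lemma orthogonal_frame_subspace:
  fixes f :: "'v::euclidean_space \<Rightarrow> 'v"
  assumes f: "linear f" and W: "Real_Vector_Spaces.subspace W" "dim W = m"
  shows "\<exists>vs. length vs = m \<and> set vs \<subseteq> W \<and> orthonormal vs \<and>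
     (\<forall>i<m. \<forall>j<m. i \<noteq> j \<longrightarrow> f (vs ! i) \<bullet> f (vs ! j) = 0) \<and>
     sorted_wrt (\<ge>) (map (\<lambda>v. norm (f v)) vs)"
  using W
proof (induction m arbitrary: W)
  case 0
  show ?case by (intro exI[of _ "[]"]) (auto simp: orthonormal_def)
next
  case (Suc m)
  interpret f: linear f by fact
  let ?S = "W \<inter> sphere 0 1"
  have "closed W" using closed_subspace Suc.prems by blast
  then have "compact ?S" by (simp add: closed_Int_compact)
  moreover have "?S \<noteq> {}"
  proof -
    have "\<not> W \<subseteq> {0}" using Suc.prems(2) dim_eq_0[of W] by auto
    then obtain w where w: "w \<in> W" "w \<noteq> 0" by blast
    then have "(1 / norm w) *\<^sub>R w \<in> ?S" using Suc.prems(1) by (auto simp: subspace_scale)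
    then show ?thesis by blast
  qed
  moreover have "continuous_on ?S (\<lambda>v. norm (f v))"
    using f by (intro continuous_on_norm linear_continuous_on) (simp add: linear_conv_bounded_linear)
  ultimately obtain v1 where v1: "v1 \<in> ?S" "\<And>v. v \<in> ?S \<Longrightarrow> norm (f v) \<le> norm (f v1)"
    using continuous_attains_sup[of ?S "\<lambda>v. norm (f v)"] by blast
  have v1W: "v1 \<in> W" "norm v1 = 1" using v1 by auto
  have max: "norm (f w) \<le> norm (f v1) * norm w" if "w \<in> W" for w
  proof (cases "w = 0")
    case False
    then have "(1 / norm w) *\<^sub>R w \<in> ?S" using that Suc.prems(1) by (auto simp: subspace_scale)
    from v1(2)[OF this] have "norm (f w) / norm w \<le> norm (f v1)" by (simp add: f.scale)
    then show ?thesis using False by (simp add: pos_divide_le_eq)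
  qed (simp add: f.zero)
  define W' where "W' = {y \<in> W. \<forall>x\<in>span {v1}. real_inner_class.orthogonal x y}"
  have W'_eq: "W' = {y \<in> W. v1 \<bullet> y = 0}"
    by (auto simp: W'_def real_inner_class.orthogonal_def span_singleton intro: exI[of _ 1])
  have sub: "Real_Vector_Spaces.subspace W'"
    unfolding W'_eq using Suc.prems(1)
    by (auto simp: real_vector.subspace_def inner_add_right)
  have "dim W' + dim (span {v1}) = dim W"
    unfolding W'_def
    by (rule dim_subspace_orthogonal_to_vectors)
       (use Suc.prems(1) v1W in \<open>auto intro: span_minimal[THEN subsetD]\<close>)
  moreover have "dim (span {v1}) = 1" using v1W(2) by (auto simp: dim_singleton)
  ultimately have "dim W' = m" using Suc.prems(2) by simp
  from Suc.IH[OF sub this] obtain vs where vs: "length vs = m" "set vs \<subseteq> W'" "orthonormal vs"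
    "\<And>i j. i < m \<Longrightarrow> j < m \<Longrightarrow> i \<noteq> j \<Longrightarrow> f (vs ! i) \<bullet> f (vs ! j) = 0" "sorted_wrt (\<ge>) (map (\<lambda>v. norm (f v)) vs)"
    by blast
  have W'D: "y \<in> W" "v1 \<bullet> y = 0" if "y \<in> W'" for y using that by (auto simp: W'_eq)
  have orth: "f v1 \<bullet> f w = 0" if w: "w \<in> W'" for w
  proof (rule quadratic_vanish)
    fix t
    have "v1 + t *\<^sub>R w \<in> W" using v1W W'D[OF w] Suc.prems(1) by (simp add: subspace_add subspace_scale)
    then have "(norm (f (v1 + t *\<^sub>R w)))\<^sup>2 \<le> (norm (f v1) * norm (v1 + t *\<^sub>R w))\<^sup>2" by (intro power_mono max) auto
    moreover have "(norm (f (v1 + t *\<^sub>R w)))\<^sup>2 = (norm (f v1))\<^sup>2 + 2 * t * (f v1 \<bullet> f w) + t\<^sup>2 * (norm (f w))\<^sup>2"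
      unfolding power2_norm_eq_inner f.add f.scale
      by (simp add: inner_add_left inner_add_right inner_commute[of "f w" "f v1"] power2_eq_square algebra_simps)
    moreover have "(norm (v1 + t *\<^sub>R w))\<^sup>2 = 1 + t\<^sup>2 * (norm w)\<^sup>2"
      using W'D[OF w] v1W(2) unfolding power2_norm_eq_inner
      by (simp add: inner_add_left inner_add_right inner_commute[of w v1] power2_eq_square norm_eq_1 algebra_simps)
    ultimately show "2 * t * (f v1 \<bullet> f w) \<le> t\<^sup>2 * ((norm (f v1))\<^sup>2 * (norm w)\<^sup>2 - (norm (f w))\<^sup>2)"
      by (simp add: power_mult_distrib algebra_simps)
  qed
  have inW': "vs ! i \<in> W'" if "i < m" for i using vs(1,2) that nth_mem by blast
  show ?case
  proof (intro exI[of _ "v1 # vs"] conjI allI impI)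
    show "length (v1 # vs) = Suc m" using vs by simp
    show "set (v1 # vs) \<subseteq> W" using vs(2) W'D v1W by auto
    show "orthonormal (v1 # vs)"
      unfolding orthonormal_def
    proof (intro allI impI)
      fix i j assume "i < length (v1 # vs)" "j < length (v1 # vs)"
      then show "(v1 # vs) ! i \<bullet> (v1 # vs) ! j = (if i = j then 1 else 0)"
        using vs(1,3) v1W(2) W'D(2)[OF inW'] by (cases i; cases j) (auto simp: orthonormal_def norm_eq_1 inner_commute)
    qed
    show "f ((v1 # vs) ! i) \<bullet> f ((v1 # vs) ! j) = 0" if "i < Suc m" "j < Suc m" "i \<noteq> j" for i j
      using that vs(4) orth[OF inW'] by (cases i; cases j) (auto simp: inner_commute)
    show "sorted_wrt (\<ge>) (map (\<lambda>v. norm (f v)) (v1 # vs))"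
    proof -
      have "norm (f w) \<le> norm (f v1)" if "w \<in> set vs" for w
      proof -
        obtain i where i: "i < m" "w = vs ! i" using \<open>w \<in> set vs\<close> vs(1) by (auto simp: in_set_conv_nth)
        then have "norm w = 1" using orthonormal_norm[OF vs(3)] vs(1) by simp
        then show ?thesis using max[OF W'D(1)[OF inW'[OF i(1)]]] i by simp
      qed
      then show ?thesis using vs(5) by simp
    qed
  qed
qed

text \<open>
  Right singular vectors in the order of decreasing singular values, which are the norms of the
  images.
\<close>

definition singular_frame :: "('v::euclidean_space \<Rightarrow> 'v) \<Rightarrow> 'v list \<Rightarrow> bool" where
  "singular_frame f vs \<longleftrightarrow> length vs = DIM('v) \<and> orthonormal vs \<and>
     (\<forall>i<DIM('v). \<forall>j<DIM('v). i \<noteq> j \<longrightarrow> f (vs ! i) \<bullet> f (vs ! j) = 0) \<and>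
     sorted_wrt (\<ge>) (map (\<lambda>v. norm (f v)) vs)"

lemma exists_singular_frame:
  fixes f :: "'v::euclidean_space \<Rightarrow> 'v"
  shows "linear f \<Longrightarrow> \<exists>vs. singular_frame f vs"
  using orthogonal_frame_subspace[of f UNIV "DIM('v)"] unfolding singular_frame_def by auto

lemma sorted_list_unique:
  fixes xs ys :: "real list"
  assumes "sorted_wrt (\<ge>) xs" "sorted_wrt (\<ge>) ys" "\<And>s. count_list xs s = count_list ys s"
  shows "xs = ys"
proof -
  have "mset xs = mset ys" using assms(3) by (intro multiset_eqI) (simp add: count_mset)
  then have "mset (rev xs) = mset (rev ys)" by simp
  moreover have "sorted (rev xs)" "sorted (rev ys)" using assms by (simp_all add: sorted_wrt_rev)
  ultimately have "rev xs = rev ys" by (metis properties_for_sort)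
  then show ?thesis by simp
qed

text \<open>In the frame, \<open>adjoint f \<circ> f\<close> is diagonal with entries the squared norms of the images.\<close>

lemma singular_values_frame:
  fixes f :: "'v::euclidean_space \<Rightarrow> 'v"
  assumes f: "linear f" and vs: "singular_frame f vs"
  shows "singular_values f = map (\<lambda>v. norm (f v)) vs"
proof -
  interpret f: linear f by fact
  let ?n = "DIM('v)"
  let ?s = "\<lambda>i. norm (f (vs ! i))"
  have vs': "length vs = ?n" "orthonormal vs" "\<And>i j. i < ?n \<Longrightarrow> j < ?n \<Longrightarrow> i \<noteq> j \<Longrightarrow> f (vs ! i) \<bullet> f (vs ! j) = 0"
    "sorted_wrt (\<ge>) (map (\<lambda>v. norm (f v)) vs)"
    using vs by (auto simp: singular_frame_def)
  note expand = orthonormal_expand[OF vs'(2,1)]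
  have adj: "adjoint f (f v) \<bullet> vs ! i = (?s i)\<^sup>2 * (v \<bullet> vs ! i)" if i: "i < ?n" for v i
  proof -
    have "adjoint f (f v) \<bullet> vs ! i = f (vs ! i) \<bullet> f v"
      using adjoint_works[OF f, of "vs ! i" "f v"] by (simp add: inner_commute)
    also have "\<dots> = f (vs ! i) \<bullet> f (\<Sum>j<?n. (v \<bullet> vs ! j) *\<^sub>R vs ! j)" using expand(1)[of v] by simp
    also have "\<dots> = (\<Sum>j<?n. (v \<bullet> vs ! j) * (f (vs ! i) \<bullet> f (vs ! j)))"
      by (simp add: f.sum f.scale inner_sum_right)
    also have "\<dots> = (\<Sum>j<?n. if j = i then (v \<bullet> vs ! i) * (f (vs ! i) \<bullet> f (vs ! i)) else 0)"
      by (rule sum.cong) (use vs'(3) i in auto)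
    finally show ?thesis using i by (simp add: power2_norm_eq_inner)
  qed
  have eig: "adjoint f (f v) = s\<^sup>2 *\<^sub>R v \<longleftrightarrow> (\<forall>i<?n. ?s i = s \<or> v \<bullet> vs ! i = 0)" if "s \<ge> 0" for v s
  proof -
    have "adjoint f (f v) = s\<^sup>2 *\<^sub>R v \<longleftrightarrow> (\<forall>i<?n. adjoint f (f v) \<bullet> vs ! i = (s\<^sup>2 *\<^sub>R v) \<bullet> vs ! i)"
    proof
      assume *: "\<forall>i<?n. adjoint f (f v) \<bullet> vs ! i = (s\<^sup>2 *\<^sub>R v) \<bullet> vs ! i"
      have "adjoint f (f v) = (\<Sum>i<?n. (adjoint f (f v) \<bullet> vs ! i) *\<^sub>R vs ! i)" by (rule expand(1))
      also have "\<dots> = (\<Sum>i<?n. ((s\<^sup>2 *\<^sub>R v) \<bullet> vs ! i) *\<^sub>R vs ! i)" using * by (intro sum.cong) auto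
      also have "\<dots> = s\<^sup>2 *\<^sub>R v" by (rule expand(1)[symmetric])
      finally show "adjoint f (f v) = s\<^sup>2 *\<^sub>R v" .
    qed simp
    also have "\<dots> \<longleftrightarrow> (\<forall>i<?n. ?s i = s \<or> v \<bullet> vs ! i = 0)"
      using that adj by (auto simp: power2_eq_iff_nonneg)
    finally show ?thesis .
  qed
  have cnt: "count_list (map (\<lambda>v. norm (f v)) vs) s = dim {v. adjoint f (f v) = s\<^sup>2 *\<^sub>R v}" if s: "s \<ge> 0" for s
  proof -
    let ?J = "{i. i < ?n \<and> ?s i = s}"
    have "{v. adjoint f (f v) = s\<^sup>2 *\<^sub>R v} = span ((!) vs ` ?J)"
    proof (intro subset_antisym subsetI)
      fix v assume "v \<in> {v. adjoint f (f v) = s\<^sup>2 *\<^sub>R v}"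
      then have "\<forall>i<?n. ?s i = s \<or> v \<bullet> vs ! i = 0" using eig[OF s] by simp
      then have "(\<Sum>i<?n. (v \<bullet> vs ! i) *\<^sub>R vs ! i) = (\<Sum>i\<in>?J. (v \<bullet> vs ! i) *\<^sub>R vs ! i)"
        by (intro sum.mono_neutral_right) auto
      also have "\<dots> \<in> span ((!) vs ` ?J)" by (intro span_sum span_scale span_base) auto
      finally show "v \<in> span ((!) vs ` ?J)" using expand(1)[of v] by simp
    next
      fix v assume "v \<in> span ((!) vs ` ?J)"
      moreover have "span ((!) vs ` ?J) \<subseteq> {v. \<forall>i<?n. ?s i = s \<or> v \<bullet> vs ! i = 0}"
      proof (rule span_minimal)
        show "(!) vs ` ?J \<subseteq> {v. \<forall>i<?n. ?s i = s \<or> v \<bullet> vs ! i = 0}"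
          using vs'(1,2) by (auto simp: orthonormal_def split: if_splits)
        show "Real_Vector_Spaces.subspace {v. \<forall>i<?n. ?s i = s \<or> v \<bullet> vs ! i = 0}"
          by (force simp: real_vector.subspace_def inner_add_left)
      qed
      ultimately show "v \<in> {v. adjoint f (f v) = s\<^sup>2 *\<^sub>R v}" using eig[OF s] by auto
    qed
    then have "dim {v. adjoint f (f v) = s\<^sup>2 *\<^sub>R v} = dim ((!) vs ` ?J)" by simp
    also have "\<dots> = card ((!) vs ` ?J)"
      by (rule dim_eq_card_independent) (rule independent_mono[OF expand(3)], use vs'(1) in auto)
    also have "\<dots> = card ?J"
      by (rule card_image) (use expand(2) vs'(1) in \<open>auto simp: inj_on_def nth_eq_iff_index_eq\<close>)
    also have "\<dots> = count_list (map (\<lambda>v. norm (f v)) vs) s"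
      unfolding count_list_eq_length_filter length_filter_conv_card using vs'(1)
      by (intro arg_cong[where f = card]) auto
    finally show ?thesis by simp
  qed
  show ?thesis
    unfolding singular_values_def
  proof (rule the_equality)
    show "sorted_wrt (\<ge>) (map (\<lambda>v. norm (f v)) vs) \<and> (\<forall>s\<in>set (map (\<lambda>v. norm (f v)) vs). 0 \<le> s) \<and>
       (\<forall>s\<ge>0. count_list (map (\<lambda>v. norm (f v)) vs) s = dim {v. adjoint f (f v) = s\<^sup>2 *\<^sub>R v})"
      using vs'(4) cnt by auto
    fix xs assume xs: "sorted_wrt (\<ge>) xs \<and> (\<forall>s\<in>set xs. 0 \<le> s) \<and>
       (\<forall>s\<ge>0. count_list xs s = dim {v. adjoint f (f v) = s\<^sup>2 *\<^sub>R v})"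
    show "xs = map (\<lambda>v. norm (f v)) vs"
    proof (rule sorted_list_unique)
      fix s
      show "count_list xs s = count_list (map (\<lambda>v. norm (f v)) vs) s"
      proof (cases "s \<ge> 0")
        case True
        then show ?thesis using xs cnt by simp
      next
        case False
        then have "s \<notin> set xs" "s \<notin> set (map (\<lambda>v. norm (f v)) vs)" using xs by auto
        then show ?thesis by (metis count_list_0_iff)
      qed
    qed (use xs vs'(4) in auto)
  qed
qed

lemma singular_values_scale:
  assumes "linear f"
  shows "singular_values (\<lambda>v. c *\<^sub>R f v) = map (\<lambda>s. \<bar>c\<bar> * s) (singular_values f)"
proof -
  obtain vs where vs: "singular_frame f vs" using exists_singular_frame[OF assms] by blast
  have "sorted_wrt (\<lambda>x y. y \<le> x) (map (\<lambda>v. \<bar>c\<bar> * norm (f v)) vs)"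
    using vs unfolding singular_frame_def sorted_wrt_map
    by (auto elim!: sorted_wrt_mono_rel[rotated] intro: mult_left_mono)
  then have "singular_frame (\<lambda>v. c *\<^sub>R f v) vs"
    using vs by (auto simp: singular_frame_def)
  then show ?thesis
    using singular_values_frame[OF assms vs] singular_values_frame[of "\<lambda>v. c *\<^sub>R f v" vs] assms
    by (simp add: linear_compose_scale_right)
qed

lemma singular_values_inverse:
  fixes f g :: "'v::euclidean_space \<Rightarrow> 'v"
  assumes f: "linear f" and g: "linear g" and gf: "\<And>v. g (f v) = v"
  shows "singular_values g = rev (map inverse (singular_values f))"
proof -
  interpret g: linear g by fact
  interpret f: linear f by fact
  let ?n = "DIM('v)"
  obtain vs where vs: "singular_frame f vs" using exists_singular_frame[OF f] by blast
  define us where "us = map (\<lambda>v. (1 / norm (f v)) *\<^sub>R f v) vs"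
  have vs': "length vs = ?n" "orthonormal vs" "\<And>i j. i < ?n \<Longrightarrow> j < ?n \<Longrightarrow> i \<noteq> j \<Longrightarrow> f (vs ! i) \<bullet> f (vs ! j) = 0"
    "sorted_wrt (\<ge>) (map (\<lambda>v. norm (f v)) vs)"
    using vs by (auto simp: singular_frame_def)
  have nz: "f (vs ! i) \<noteq> 0" if "i < ?n" for i
    using gf[of "vs ! i"] orthonormal_norm[OF vs'(2), of i] vs'(1) that g.zero by force
  have us: "us ! i = (1 / norm (f (vs ! i))) *\<^sub>R f (vs ! i)" if "i < ?n" for i using that vs'(1) by (simp add: us_def)
  have gus: "g (us ! i) = (1 / norm (f (vs ! i))) *\<^sub>R vs ! i" if "i < ?n" for i by (simp add: us that g.scale gf)
  have norm_g: "norm (g (us ! i)) = inverse (norm (f (vs ! i)))" if "i < ?n" for i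
    using orthonormal_norm[OF vs'(2), of i] vs'(1) that by (simp add: gus inverse_eq_divide)
  have map_g: "map (\<lambda>v. norm (g v)) us = map inverse (map (\<lambda>v. norm (f v)) vs)"
    by (rule nth_equalityI) (use norm_g vs'(1) in \<open>auto simp: us_def\<close>)
  have "singular_frame g (rev us)"
    unfolding singular_frame_def
  proof (intro conjI allI impI)
    show "length (rev us) = ?n" using vs' by (simp add: us_def)
    have ort: "us ! i \<bullet> us ! j = (if i = j then 1 else 0)" if "i < ?n" "j < ?n" for i j
      using that nz vs'(3)[of i j] by (auto simp: us norm_eq_sqrt_inner)
    then show "orthonormal (rev us)" using vs'(1) by (auto simp: orthonormal_def us_def rev_nth)
    show "g (rev us ! i) \<bullet> g (rev us ! j) = 0" if "i < ?n" "j < ?n" "i \<noteq> j" for i j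
      using that vs'(1,2) gus[of "?n - Suc i"] gus[of "?n - Suc j"]
      by (auto simp: rev_nth us_def orthonormal_def)
    have "sorted_wrt (\<lambda>x y. x \<le> y) (map inverse (map (\<lambda>v. norm (f v)) vs))"
    proof -
      have "\<forall>s\<in>set (map (\<lambda>v. norm (f v)) vs). s > 0" using nz vs'(1) by (auto simp: in_set_conv_nth)
      then show ?thesis using vs'(4)
        unfolding sorted_wrt_map[of _ inverse]
        by (intro sorted_wrt_mono_rel[OF _ vs'(4)]) (auto intro!: le_imp_inverse_le)
    qed
    then show "sorted_wrt (\<ge>) (map (\<lambda>v. norm (g v)) (rev us))"
      unfolding rev_map[symmetric] map_g by (simp add: sorted_wrt_rev)
  qed
  then have "singular_values g = map (\<lambda>v. norm (g v)) (rev us)" by (rule singular_values_frame[OF g])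
  also have "\<dots> = rev (map (\<lambda>v. norm (g v)) us)" by (rule rev_map[symmetric])
  finally show ?thesis unfolding map_g singular_values_frame[OF f vs] .
qed

section \<open>Ratios of consecutive singular values\<close>

text \<open>Leibniz formula.\<close>

lemma minor_bounded:
  assumes X: "\<And>i j. i < n \<Longrightarrow> j < n \<Longrightarrow> \<bar>X $$ (i, j)\<bar> \<le> K"
    and I: "I \<in> index_lists n k" and J: "J \<in> index_lists n k"
  shows "\<bar>minor X I J\<bar> \<le> fact k * K ^ k"
proof -
  let ?M = "mat k k (\<lambda>(r, c). X $$ (I ! r, J ! c))"
  have M: "minor X I J = (\<Sum>p | p permutes {0..<k}. signof p * (\<Prod>i=0..<k. ?M $$ (i, p i)))"
    unfolding minor_def index_lists_length[OF I] index_lists_length[OF J]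
    by (rule det_def') simp
  have "\<bar>signof p * (\<Prod>i=0..<k. ?M $$ (i, p i))\<bar> \<le> K ^ k" if p: "p permutes {0..<k}" for p
  proof -
    have "\<bar>signof p * (\<Prod>i=0..<k. ?M $$ (i, p i))\<bar> = (\<Prod>i=0..<k. \<bar>?M $$ (i, p i)\<bar>)"
      by (simp add: abs_mult abs_prod sign_def)
    also have "\<dots> \<le> (\<Prod>i=0..<k. K)"
    proof (rule prod_mono)
      fix i assume i: "i \<in> {0..<k}"
      then have "p i < k" using permutes_in_image[OF p] by simp
      then show "0 \<le> \<bar>?M $$ (i, p i)\<bar> \<and> \<bar>?M $$ (i, p i)\<bar> \<le> K"
        using i X[OF index_lists_nth[OF I, of i] index_lists_nth[OF J, of "p i"]] by simp
    qed
    finally show ?thesis by simp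
  qed
  then have "\<bar>minor X I J\<bar> \<le> (\<Sum>p | p permutes {0..<k}. K ^ k)"
    unfolding M by (intro order_trans[OF sum_abs sum_mono]) auto
  then show ?thesis by (simp add: card_permutations[of "{0..<k}" k])
qed

lemma minor_one:
  assumes I: "I \<in> index_lists n k" and J: "J \<in> index_lists n k"
  shows "minor (1\<^sub>m n) I J = (if I = J then 1 else 0)"
proof (cases "I = J")
  case True
  have "mat (length I) (length J) (\<lambda>(r, c). 1\<^sub>m n $$ (I ! r, J ! c)) = (1\<^sub>m k :: real mat)"
    using True index_lists_length[OF I] index_lists_nth[OF I] index_lists_distinct[OF I]
    by (intro eq_matI) (auto simp: nth_eq_iff_index_eq)
  then show ?thesis using True by (simp add: minor_def)
next
  case False
  let ?M = "mat k k (\<lambda>(r, c). (1\<^sub>m n :: real mat) $$ (I ! r, J ! c))"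
  have "set I \<noteq> set J" using False index_lists_set_eq[OF I J] by blast
  moreover have "card (set I) = card (set J)"
    using distinct_card[OF index_lists_distinct[OF I]] distinct_card[OF index_lists_distinct[OF J]]
      index_lists_length[OF I] index_lists_length[OF J] by simp
  ultimately have "\<not> set I \<subseteq> set J" using card_subset_eq[of "set J" "set I"] by auto
  then obtain r where r: "r < k" "I ! r \<notin> set J"
    using index_lists_length[OF I] by (metis in_set_conv_nth subsetI)
  have "minor (1\<^sub>m n) I J = (\<Sum>p | p permutes {0..<k}. signof p * (\<Prod>i=0..<k. ?M $$ (i, p i)))"
    unfolding minor_def index_lists_length[OF I] index_lists_length[OF J]
    by (rule det_def') simp
  also have "\<dots> = 0"
  proof (rule sum.neutral, intro ballI)
    fix p assume "p \<in> {p. p permutes {0..<k}}"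
    then have p: "p r < k" using permutes_in_image[of p "{0..<k}" r] r by simp
    then have "J ! p r \<in> set J" using index_lists_length[OF J] by simp
    then have "?M $$ (r, p r) = 0"
      using r p index_lists_nth[OF I r(1)] index_lists_nth[OF J p] by (auto simp: one_mat_def)
    then have "(\<Prod>i=0..<k. ?M $$ (i, p i)) = 0" using r(1) by (intro prod_zero) auto
    then show "signof p * (\<Prod>i=0..<k. ?M $$ (i, p i)) = 0" by simp
  qed
  finally show ?thesis using False by simp
qed

lemma minor_diagonal:
  assumes T: "upper n T" "lower n T" and I: "I \<in> index_lists n k" and J: "J \<in> index_lists n k"
  shows "minor T I J = (if I = J then \<Prod>c<k. T $$ (J ! c, J ! c) else 0)"
proof -
  have "T \<in> carrier_mat n n" using T by (simp add: upper_def)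
  then show ?thesis
    using minor_mult_diagonal[OF one_carrier_mat T I J] minor_one[OF I J] by simp
qed

lemma abs_mult_le: "\<bar>a\<bar> \<le> A \<Longrightarrow> \<bar>b\<bar> \<le> B \<Longrightarrow> \<bar>a * b\<bar> \<le> A * (B :: real)"
  unfolding abs_mult by (intro mult_mono) auto

lemma index_lists_nth_ge:
  assumes "K \<in> index_lists n k" "r < k" shows "r \<le> K ! r"
  using assms(2)
proof (induction r)
  case (Suc r)
  then have "K ! r < K ! Suc r" using assms(1)
    by (auto simp: index_lists_def sorted_wrt_iff_nth_less)
  then show ?case using Suc by simp
qed simp

lemma cauchy_binet_triple:
  assumes "X \<in> carrier_mat n n" "M \<in> carrier_mat n n" "Y \<in> carrier_mat n n"
    and I: "I \<in> index_lists n k" and J: "J \<in> index_lists n k"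
  shows "minor (X * (M * Y)) I J =
    (\<Sum>P\<in>index_lists n k. \<Sum>R\<in>index_lists n k. minor X I P * minor M P R * minor Y R J)"
proof -
  have IJ: "set I \<subseteq> {..<n}" "length I = k" "set J \<subseteq> {..<n}" "length J = k"
    using I J by (auto simp: index_lists_def)
  have "minor (X * (M * Y)) I J = (\<Sum>P\<in>index_lists n k. minor X I P * minor (M * Y) P J)"
    by (rule cauchy_binet) (use assms IJ in auto)
  also have "\<dots> = (\<Sum>P\<in>index_lists n k. minor X I P * (\<Sum>R\<in>index_lists n k. minor M P R * minor Y R J))"
    using assms IJ by (intro sum.cong refl arg_cong2[where f = "(*)"] cauchy_binet) (auto simp: index_lists_def)
  finally show ?thesis by (simp add: sum_distrib_left mult.assoc)
qed

text \<open>The Cauchy--Binet formula for \<open>2 \<times> 2\<close> minors, before cancelling repeated terms.\<close>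

lemma two_minor_of_product:
  fixes A :: "'i \<Rightarrow> 'i \<Rightarrow> real"
  assumes "finite S"
  shows "(\<Sum>P\<in>S. \<Sum>R\<in>S. x0 P * A P R * y0 R) * (\<Sum>P\<in>S. \<Sum>R\<in>S. x1 P * A P R * y1 R)
      - (\<Sum>P\<in>S. \<Sum>R\<in>S. x0 P * A P R * y1 R) * (\<Sum>P\<in>S. \<Sum>R\<in>S. x1 P * A P R * y0 R)
    = (\<Sum>P\<in>S. \<Sum>P'\<in>S. \<Sum>R\<in>S. \<Sum>R'\<in>S.
        x0 P * x1 P' * y0 R * y1 R' * (A P R * A P' R' - A P R' * A P' R))"
proof -
  have e: "(\<Sum>P\<in>S. \<Sum>R\<in>S. x P * A P R * y R) * (\<Sum>P\<in>S. \<Sum>R\<in>S. x' P * A P R * y' R)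
    = (\<Sum>P\<in>S. \<Sum>P'\<in>S. \<Sum>R\<in>S. \<Sum>R'\<in>S. x P * A P R * y R * (x' P' * A P' R' * y' R'))" for x y x' y'
    by (simp only: sum_product)
  have s: "(\<Sum>R\<in>S. \<Sum>R'\<in>S. x0 P * A P R * y1 R * (x1 P' * A P' R' * y0 R'))
     = (\<Sum>R\<in>S. \<Sum>R'\<in>S. x0 P * A P R' * y1 R' * (x1 P' * A P' R * y0 R))" for P P'
    by (rule sum.swap)
  show ?thesis
    unfolding e s sum_subtractf[symmetric]
    by (intro sum.cong refl) (simp add: algebra_simps)
qed

text \<open>The singular value decomposition relates \<open>matrix_in B f\<close> and the diagonal matrix \<open>T\<close> of singular values by
  factors whose entries are bounded independently of \<open>f\<close>.  Pass to \<open>k\<close>-th compound matrices, that is, to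
  matrices of \<open>k \<times> k\<close> minors.  The largest entry of the compound of \<open>T\<close> is \<open>m = s 0 \<cdot> \<dots> \<cdot> s (k - 1)\<close>,
  and its \<open>2 \<times> 2\<close> minor on the first two places is \<open>m\<^sup>2 s k / s (k - 1)\<close>.  By Cauchy--Binet the former
  bounds the entries of the compound of \<open>matrix_in B f\<close> from above, and the latter is bounded by its
  \<open>2 \<times> 2\<close> minors.\<close>

theorem singular_value_ratio:
  fixes B :: "'v::euclidean_space list"
  assumes B: "ordered_basis B" and k: "1 \<le> k" "k < DIM('v)"
  shows "\<exists>C>0. \<forall>f \<eta>. linear f \<longrightarrow> bij f \<longrightarrow> \<eta> \<ge> 0 \<longrightarrow>
    (\<exists>P\<in>index_lists DIM('v) k. \<exists>R\<in>index_lists DIM('v) k.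
      \<forall>I\<in>index_lists DIM('v) k. \<forall>I'\<in>index_lists DIM('v) k.
      \<forall>J\<in>index_lists DIM('v) k. \<forall>J'\<in>index_lists DIM('v) k.
        \<bar>minor (matrix_in B f) I J * minor (matrix_in B f) I' J'
          - minor (matrix_in B f) I J' * minor (matrix_in B f) I' J\<bar>
        \<le> \<eta> * (minor (matrix_in B f) P R)\<^sup>2) \<longrightarrow>
    singular_values f ! k \<le> C * \<eta> * singular_values f ! (k - 1)"
proof -
  let ?n = "DIM('v)" and ?S = "index_lists DIM('v) k"
  obtain K1 where K1: "K1 > 0" "\<And>i v. i < ?n \<Longrightarrow> norm v = 1 \<Longrightarrow> \<bar>coord B i v\<bar> \<le> K1"
    using coord_bounded[OF B] by blast
  define K where "K = K1 + (\<Sum>j<?n. norm (B ! j))"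
  have K: "K > 0" "K1 \<le> K" using K1(1) by (auto simp: K_def sum_nonneg add_pos_nonneg)
  have KB: "norm (B ! j) \<le> K" if "j < ?n" for j
    using member_le_sum[of j "{..<?n}" "\<lambda>j. norm (B ! j)"] that K1(1) by (simp add: K_def)
  define c where "c = fact k * K ^ k"
  have c: "c > 0" using K by (simp add: c_def)
  define N where "N = real (card ?S)"
  have "[0..<k] \<in> ?S" using k by simp
  then have N: "N > 0" by (auto simp: N_def card_gt_0_iff)
  show ?thesis
  proof (intro exI[of _ "N ^ 4 * c ^ 4 * (N * c\<^sup>2)\<^sup>2"] conjI allI impI)
    show "0 < N ^ 4 * c ^ 4 * (N * c\<^sup>2)\<^sup>2" using c N by simp
    fix f :: "'v \<Rightarrow> 'v" and \<eta> :: real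
    assume f: "linear f" "bij f" and \<eta>: "\<eta> \<ge> 0"
    let ?A = "minor (matrix_in B f)"
    assume "\<exists>P\<in>?S. \<exists>R\<in>?S. \<forall>I\<in>?S. \<forall>I'\<in>?S. \<forall>J\<in>?S. \<forall>J'\<in>?S.
        \<bar>?A I J * ?A I' J' - ?A I J' * ?A I' J\<bar> \<le> \<eta> * (?A P R)\<^sup>2"
    then obtain P R where PR: "P \<in> ?S" "R \<in> ?S"
      "\<And>I I' J J'. I \<in> ?S \<Longrightarrow> I' \<in> ?S \<Longrightarrow> J \<in> ?S \<Longrightarrow> J' \<in> ?S \<Longrightarrow>
        \<bar>?A I J * ?A I' J' - ?A I J' * ?A I' J\<bar> \<le> \<eta> * (?A P R)\<^sup>2"
      by blast
    interpret f: linear f by fact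
    obtain vs where vs: "singular_frame f vs" using exists_singular_frame[OF f(1)] by blast
    have vs': "length vs = ?n" "orthonormal vs" "\<And>i j. i < ?n \<Longrightarrow> j < ?n \<Longrightarrow> i \<noteq> j \<Longrightarrow> f (vs ! i) \<bullet> f (vs ! j) = 0"
      "sorted_wrt (\<ge>) (map (\<lambda>v. norm (f v)) vs)"
      using vs by (auto simp: singular_frame_def)
    note expand = orthonormal_expand[OF vs'(2,1)]
    define s where "s i = norm (f (vs ! i))" for i
    have vn: "norm (vs ! i) = 1" if "i < ?n" for i using orthonormal_norm[OF vs'(2)] vs'(1) that by simp
    have s: "s i > 0" if "i < ?n" for i
    proof -
      have "vs ! i \<noteq> 0" using vn[OF that] by auto
      then have "f (vs ! i) \<noteq> 0" using f(2) f.zero by (metis bij_is_inj injD)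
      then show ?thesis by (simp add: s_def)
    qed
    have smono: "s j \<le> s i" if "i \<le> j" "j < ?n" for i j
      using vs'(1,4) that by (cases "i = j") (auto simp: s_def sorted_wrt_iff_nth_less)
    have sv: "singular_values f ! i = s i" if "i < ?n" for i
      using singular_values_frame[OF f(1) vs] vs'(1) that by (simp add: s_def)
    define u where "u i = (1 / s i) *\<^sub>R f (vs ! i)" for i
    have fu: "f (vs ! i) = s i *\<^sub>R u i" if "i < ?n" for i using s[OF that] by (simp add: u_def)
    have un: "norm (u i) = 1" if "i < ?n" for i using s[OF that] by (simp add: u_def s_def)
    have uf: "u i \<bullet> f (vs ! j) = (if i = j then s j else 0)" if "i < ?n" "j < ?n" for i j
      using vs'(3)[OF that] s[OF that(1)] by (auto simp: u_def s_def dot_square_norm power2_eq_square)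
    define T where "T = mat ?n ?n (\<lambda>(i, j). if i = j then s i else 0)"
    define X where "X = mat ?n ?n (\<lambda>(i, j). u i \<bullet> B ! j)"
    define Y where "Y = mat ?n ?n (\<lambda>(i, j). coord B i (vs ! j))"
    define X' where "X' = mat ?n ?n (\<lambda>(i, j). coord B i (u j))"
    define Y' where "Y' = mat ?n ?n (\<lambda>(i, j). vs ! i \<bullet> B ! j)"
    have cm: "T \<in> carrier_mat ?n ?n" "X \<in> carrier_mat ?n ?n" "Y \<in> carrier_mat ?n ?n"
      "X' \<in> carrier_mat ?n ?n" "Y' \<in> carrier_mat ?n ?n" "matrix_in B f \<in> carrier_mat ?n ?n"
      by (auto simp: T_def X_def Y_def X'_def Y'_def matrix_in_carrier[OF B])
    have Tdiag: "upper ?n T" "lower ?n T" by (auto simp: T_def upper_def lower_def)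
    \<comment> \<open>the decomposition read in both directions: \<open>T = X M Y\<close> and \<open>M = X' T Y'\<close>\<close>
    have T_eq: "T = X * (matrix_in B f * Y)"
    proof (rule eq_matI)
      fix i j assume "i < dim_row (X * (matrix_in B f * Y))" "j < dim_col (X * (matrix_in B f * Y))"
      then have ij: "i < ?n" "j < ?n" using cm by auto
      have "(X * (matrix_in B f * Y)) $$ (i, j) = (\<Sum>l<?n. X $$ (i, l) * (matrix_in B f * Y) $$ (l, j))"
        by (rule mult_entry) (use cm ij in auto)
      also have "\<dots> = (\<Sum>l<?n. (u i \<bullet> B ! l) * coord B l (f (vs ! j)))"
      proof (intro sum.cong refl arg_cong2[where f = "(*)"])
        fix l assume "l \<in> {..<?n}"
        then have l: "l < ?n" by simp
        show "X $$ (i, l) = u i \<bullet> B ! l" using ij l by (simp add: X_def)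
        show "(matrix_in B f * Y) $$ (l, j) = coord B l (f (vs ! j))"
          unfolding coord_image[OF B f(1) l] mult_entry[OF cm(6,3) l ij(2)]
          using ij(2) by (intro sum.cong) (auto simp: Y_def)
      qed
      also have "\<dots> = u i \<bullet> (\<Sum>l<?n. coord B l (f (vs ! j)) *\<^sub>R B ! l)"
        by (simp add: inner_sum_right mult.commute)
      also have "\<dots> = u i \<bullet> f (vs ! j)" using coord_expand[OF B, of "f (vs ! j)"] by simp
      finally show "T $$ (i, j) = (X * (matrix_in B f * Y)) $$ (i, j)"
        using uf[OF ij] ij by (simp add: T_def)
    qed (use cm in auto)
    have M_eq: "matrix_in B f = X' * (T * Y')"
    proof (rule eq_matI)
      fix i j assume "i < dim_row (X' * (T * Y'))" "j < dim_col (X' * (T * Y'))"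
      then have ij: "i < ?n" "j < ?n" using cm by auto
      interpret ci: linear "coord B i" by (rule coord_linear[OF B])
      have "matrix_in B f $$ (i, j) = coord B i (f (\<Sum>l<?n. (B ! j \<bullet> vs ! l) *\<^sub>R vs ! l))"
        using expand(1)[of "B ! j"] matrix_in_entry[OF B ij, of f] by simp
      also have "\<dots> = (\<Sum>l<?n. coord B i (u l) * (s l * (vs ! l \<bullet> B ! j)))"
        by (simp add: f.sum f.scale ci.sum ci.scale fu inner_commute mult_ac)
      also have "\<dots> = (\<Sum>l<?n. X' $$ (i, l) * (T * Y') $$ (l, j))"
      proof (intro sum.cong refl arg_cong2[where f = "(*)"])
        fix l assume "l \<in> {..<?n}"
        then have l: "l < ?n" by simp
        show "coord B i (u l) = X' $$ (i, l)" using ij l by (simp add: X'_def)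
        have "(T * Y') $$ (l, j) = (\<Sum>m<?n. if l = m then s l * (vs ! l \<bullet> B ! j) else 0)"
          unfolding mult_entry[OF cm(1,5) l ij(2)]
          using ij(2) l by (intro sum.cong) (auto simp: T_def Y'_def)
        then show "s l * (vs ! l \<bullet> B ! j) = (T * Y') $$ (l, j)" using l by simp
      qed
      also have "\<dots> = (X' * (T * Y')) $$ (i, j)" by (rule mult_entry[symmetric]) (use cm ij in auto)
      finally show "matrix_in B f $$ (i, j) = (X' * (T * Y')) $$ (i, j)" .
    qed (use cm in auto)
    have bX: "\<bar>minor X I J\<bar> \<le> c" if "I \<in> ?S" "J \<in> ?S" for I J
      unfolding c_def
    proof (rule minor_bounded[OF _ that])
      fix i j assume ij: "i < ?n" "j < ?n"
      have "\<bar>u i \<bullet> B ! j\<bar> \<le> norm (u i) * norm (B ! j)" by (rule Cauchy_Schwarz_ineq2)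
      then show "\<bar>X $$ (i, j)\<bar> \<le> K" using ij un KB[of j] by (simp add: X_def)
    qed
    have bY': "\<bar>minor Y' I J\<bar> \<le> c" if "I \<in> ?S" "J \<in> ?S" for I J
      unfolding c_def
    proof (rule minor_bounded[OF _ that])
      fix i j assume ij: "i < ?n" "j < ?n"
      have "\<bar>vs ! i \<bullet> B ! j\<bar> \<le> norm (vs ! i) * norm (B ! j)" by (rule Cauchy_Schwarz_ineq2)
      then show "\<bar>Y' $$ (i, j)\<bar> \<le> K" using ij vn KB[of j] by (simp add: Y'_def)
    qed
    have bY: "\<bar>minor Y I J\<bar> \<le> c" if "I \<in> ?S" "J \<in> ?S" for I J
      unfolding c_def
      by (rule minor_bounded[OF _ that]) (use K1(2) K(2) vn in \<open>force simp: Y_def\<close>)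
    have bX': "\<bar>minor X' I J\<bar> \<le> c" if "I \<in> ?S" "J \<in> ?S" for I J
      unfolding c_def
      by (rule minor_bounded[OF _ that]) (use K1(2) K(2) un in \<open>force simp: X'_def\<close>)
    define m where "m = (\<Prod>i<k. s i)"
    have m: "m > 0" unfolding m_def using k s by (intro prod_pos) auto
    have Tm: "\<bar>minor T I J\<bar> \<le> (if I = J then m else 0)" if IJ: "I \<in> ?S" "J \<in> ?S" for I J
    proof -
      have "\<bar>\<Prod>c<k. T $$ (J ! c, J ! c)\<bar> \<le> (\<Prod>i<k. s i)"
        unfolding abs_prod
      proof (rule prod_mono)
        fix i assume i: "i \<in> {..<k}"
        then have b: "J ! i < ?n" "i \<le> J ! i" using index_lists_nth[OF IJ(2)] index_lists_nth_ge[OF IJ(2)] by auto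
        then show "0 \<le> \<bar>T $$ (J ! i, J ! i)\<bar> \<and> \<bar>T $$ (J ! i, J ! i)\<bar> \<le> s i"
          using smono[of i "J ! i"] s[of "J ! i"] by (simp add: T_def)
      qed
      then show ?thesis unfolding minor_diagonal[OF Tdiag IJ] m_def by simp
    qed
    have APR: "\<bar>?A P R\<bar> \<le> N * c\<^sup>2 * m"
    proof -
      have "?A P R = (\<Sum>I\<in>?S. \<Sum>J\<in>?S. minor X' P I * minor T I J * minor Y' J R)"
        unfolding M_eq by (rule cauchy_binet_triple) (use cm PR in auto)
      also have "\<bar>\<dots>\<bar> \<le> (\<Sum>I\<in>?S. \<Sum>J\<in>?S. if I = J then c * m * c else 0)"
      proof (intro order_trans[OF sum_abs sum_mono] order_trans[OF sum_abs sum_mono])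
        fix I J assume IJ: "I \<in> ?S" "J \<in> ?S"
        have "\<bar>minor X' P I * minor T I J * minor Y' J R\<bar> \<le> c * (if I = J then m else 0) * c"
          by (intro abs_mult_le bX' PR IJ Tm bY')
        then show "\<bar>minor X' P I * minor T I J * minor Y' J R\<bar> \<le> (if I = J then c * m * c else 0)"
          by (simp split: if_splits)
      qed
      also have "\<dots> = N * c\<^sup>2 * m"
        by (simp add: N_def power2_eq_square mult_ac)
      finally show ?thesis .
    qed
    define I0 I1 where "I0 = [0..<k]" and "I1 = [0..<k - 1] @ [k]"
    have I01: "I0 \<in> ?S" "I1 \<in> ?S" "I0 \<noteq> I1"
    proof -
      show "I0 \<in> ?S" using k by (simp add: I0_def)
      show "I1 \<in> ?S" using k by (auto simp: I1_def index_lists_def sorted_wrt_append)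
      have "k \<in> set I1" "k \<notin> set I0" by (auto simp: I0_def I1_def)
      then show "I0 \<noteq> I1" by metis
    qed
    obtain h where h: "k = Suc h" using k by (cases k) auto
    have T0: "minor T I0 I0 = m"
      unfolding minor_diagonal[OF Tdiag I01(1,1)] m_def using k by (auto simp: T_def I0_def intro!: prod.cong)
    have T1: "minor T I1 I1 * s (k - 1) = m * s k"
    proof -
      have "minor T I1 I1 = (\<Prod>c<h. s c) * s k"
        unfolding minor_diagonal[OF Tdiag I01(2,2)] using k h
        by (auto simp: T_def I1_def nth_append intro!: prod.cong)
      then show ?thesis by (simp add: m_def h)
    qed
    have T01: "minor T I0 I1 = 0" using minor_diagonal[OF Tdiag I01(1,2)] I01(3) by simp
    have tri: "minor T I J = (\<Sum>P\<in>?S. \<Sum>R\<in>?S. minor X I P * ?A P R * minor Y R J)" if "I \<in> ?S" "J \<in> ?S" for I J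
      by (subst T_eq) (rule cauchy_binet_triple, use cm that in auto)
    have "minor T I0 I0 * minor T I1 I1 - minor T I0 I1 * minor T I1 I0
      = (\<Sum>P\<in>?S. \<Sum>P'\<in>?S. \<Sum>R\<in>?S. \<Sum>R'\<in>?S.
          minor X I0 P * minor X I1 P' * minor Y R I0 * minor Y R' I1 * (?A P R * ?A P' R' - ?A P R' * ?A P' R))"
      unfolding tri[OF I01(1,1)] tri[OF I01(2,2)] tri[OF I01(1,2)] tri[OF I01(2,1)]
      by (rule two_minor_of_product) simp
    also have "\<dots> \<le> (\<Sum>_\<in>?S. \<Sum>_\<in>?S. \<Sum>_\<in>?S. \<Sum>_\<in>?S. c * c * c * c * (\<eta> * (?A P R)\<^sup>2))"
    proof (intro sum_mono)
      fix I I' J J' assume IJ: "I \<in> ?S" "I' \<in> ?S" "J \<in> ?S" "J' \<in> ?S"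
      have "\<bar>minor X I0 I * minor X I1 I' * minor Y J I0 * minor Y J' I1 * (?A I J * ?A I' J' - ?A I J' * ?A I' J)\<bar>
        \<le> c * c * c * c * (\<eta> * (?A P R)\<^sup>2)"
        by (intro abs_mult_le bX bY PR(3) IJ I01)
      then show "minor X I0 I * minor X I1 I' * minor Y J I0 * minor Y J' I1 * (?A I J * ?A I' J' - ?A I J' * ?A I' J)
        \<le> c * c * c * c * (\<eta> * (?A P R)\<^sup>2)" by linarith
    qed
    also have "\<dots> = N ^ 4 * c ^ 4 * \<eta> * (?A P R)\<^sup>2"
      by (simp add: N_def power4_eq_xxxx)
    also have "\<dots> \<le> N ^ 4 * c ^ 4 * \<eta> * (N * c\<^sup>2 * m)\<^sup>2"
      using APR N c \<eta> by (intro mult_left_mono) (auto simp: abs_le_square_iff[symmetric] abs_of_pos m)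
    finally have "m * minor T I1 I1 \<le> m * (N ^ 4 * c ^ 4 * (N * c\<^sup>2)\<^sup>2 * \<eta> * m)"
      by (simp add: T0 T01 power2_eq_square mult_ac)
    then have "minor T I1 I1 \<le> N ^ 4 * c ^ 4 * (N * c\<^sup>2)\<^sup>2 * \<eta> * m" using m by simp
    then have "minor T I1 I1 * s (k - 1) \<le> N ^ 4 * c ^ 4 * (N * c\<^sup>2)\<^sup>2 * \<eta> * m * s (k - 1)"
      using s[of "k - 1"] k by (intro mult_right_mono) (auto intro: less_imp_le)
    then have "m * s k \<le> m * (N ^ 4 * c ^ 4 * (N * c\<^sup>2)\<^sup>2 * \<eta> * s (k - 1))"
      unfolding T1 by (simp add: mult_ac)
    then have "s k \<le> N ^ 4 * c ^ 4 * (N * c\<^sup>2)\<^sup>2 * \<eta> * s (k - 1)" using m by simp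
    then show "singular_values f ! k \<le> N ^ 4 * c ^ 4 * (N * c\<^sup>2)\<^sup>2 * \<eta> * singular_values f ! (k - 1)"
      using k sv by simp
  qed
qed

section \<open>Representatives of projective transformations\<close>

definition gl :: "('v::euclidean_space \<Rightarrow> 'v) \<Rightarrow> bool" where
  "gl f \<longleftrightarrow> linear f \<and> bij f"

text \<open>The element of \<open>PGL\<close> represented by \<open>f\<close>.\<close>

definition projective_class :: "('v::euclidean_space \<Rightarrow> 'v) \<Rightarrow> ('v \<Rightarrow> 'v) set" where
  "projective_class f = {(\<lambda>v. c *\<^sub>R f v) | c. c \<noteq> 0}"

lemma gl_id [simp]: "gl id"
  by (simp add: gl_def linear_id)

lemma gl_comp [simp]: "gl f \<Longrightarrow> gl g \<Longrightarrow> gl (f \<circ> g)"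
  by (auto simp: gl_def linear_compose bij_comp)

lemma gl_inverse [simp]: "gl f \<Longrightarrow> gl (inv_into UNIV f)"
  by (auto simp: gl_def bij_imp_bij_inv bij_is_inj inj_linear_imp_inv_linear)

lemma gl_inverse_apply [simp]:
  "gl f \<Longrightarrow> inv_into UNIV f (f v) = v" "gl f \<Longrightarrow> f (inv_into UNIV f v) = v"
  by (auto simp: gl_def bij_is_inj bij_is_surj surj_f_inv_f)

lemma gl_by_inverse:
  assumes "linear f" "linear g" "\<And>v. g (f v) = v" "\<And>v. f (g v) = v"
  shows "gl f"
  unfolding gl_def using assms by (metis bij_betw_byWitness UNIV_I subset_UNIV)

lemma gl_scale:
  assumes "gl f" "c \<noteq> 0" shows "gl (\<lambda>v. c *\<^sub>R f v)"
proof -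
  have "gl (\<lambda>v::'a. c *\<^sub>R v)"
    by (rule gl_by_inverse[of _ "\<lambda>v. inverse c *\<^sub>R v"])
       (use assms in \<open>auto intro: linear_compose_scale_right linear_ident\<close>)
  from gl_comp[OF this assms(1)] show ?thesis by (simp add: o_def)
qed

lemma projective_class_self [simp]: "f \<in> projective_class f"
  unfolding projective_class_def by (auto intro!: exI[of _ 1])

lemma projective_class_scale:
  assumes "c \<noteq> 0" shows "projective_class (\<lambda>v. c *\<^sub>R f v) = projective_class f"
  unfolding projective_class_def
proof (intro subset_antisym subsetI; clarify)
  fix d :: real assume "d \<noteq> 0"
  then show "\<exists>e. (\<lambda>v. d *\<^sub>R c *\<^sub>R f v) = (\<lambda>v. e *\<^sub>R f v) \<and> e \<noteq> 0"
    using assms by (intro exI[of _ "d * c"]) auto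
  show "\<exists>e. (\<lambda>v. d *\<^sub>R f v) = (\<lambda>v. e *\<^sub>R c *\<^sub>R f v) \<and> e \<noteq> 0"
    using assms \<open>d \<noteq> 0\<close> by (intro exI[of _ "d / c"]) auto
qed

lemma GL_group: "group (GL :: ('v::euclidean_space \<Rightarrow> 'v) monoid)"
proof (rule groupI)
  fix f :: "'v \<Rightarrow> 'v" assume "f \<in> carrier GL"
  then have "gl f" by (simp add: GL_def gl_def)
  then have "inv_into UNIV f \<in> carrier GL" "inv_into UNIV f \<circ> f = id"
    using gl_inverse[of f] by (auto simp: GL_def gl_def bij_is_inj)
  then show "\<exists>g\<in>carrier GL. g \<otimes>\<^bsub>GL\<^esub> f = \<one>\<^bsub>GL\<^esub>" by (auto simp: GL_def)
qed (use gl_comp gl_id in \<open>auto simp: GL_def gl_def comp_assoc\<close>)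

lemma homotheties_normal: "homotheties \<lhd> (GL :: ('v::euclidean_space \<Rightarrow> 'v) monoid)"
proof -
  interpret G: group "GL :: ('v \<Rightarrow> 'v) monoid" by (rule GL_group)
  have glI: "f \<in> carrier GL \<longleftrightarrow> gl f" for f :: "'v \<Rightarrow> 'v" by (simp add: GL_def gl_def)
  have m: "f \<otimes>\<^bsub>GL\<^esub> g = f \<circ> g" for f g :: "'v \<Rightarrow> 'v" by (simp add: GL_def)
  have o: "\<one>\<^bsub>GL\<^esub> = (id :: 'v \<Rightarrow> 'v)" by (simp add: GL_def)
  have hc: "(\<lambda>v :: 'v. c *\<^sub>R v) \<in> carrier GL" if "c \<noteq> 0" for c
    using gl_scale[OF gl_id that] by (simp add: glI)
  have hinv: "inv\<^bsub>GL\<^esub> (\<lambda>v. c *\<^sub>R v) = (\<lambda>v :: 'v. inverse c *\<^sub>R v)" if "c \<noteq> 0" for c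
    by (rule G.inv_equality) (use that hc[OF that] hc[of "inverse c"] in \<open>auto simp: m o fun_eq_iff\<close>)
  have sub: "subgroup homotheties (GL :: ('v \<Rightarrow> 'v) monoid)"
  proof (rule G.subgroupI)
    show "homotheties \<subseteq> carrier (GL :: ('v \<Rightarrow> 'v) monoid)" using hc by (auto simp: homotheties_def)
    show "homotheties \<noteq> ({} :: ('v \<Rightarrow> 'v) set)" by (auto simp: homotheties_def intro: exI[of _ 1])
    show "inv\<^bsub>GL\<^esub> h \<in> homotheties" if "h \<in> homotheties" for h :: "'v \<Rightarrow> 'v"
      using that hinv by (auto simp: homotheties_def intro: nonzero_imp_inverse_nonzero)
    show "h \<otimes>\<^bsub>GL\<^esub> h' \<in> homotheties" if hh': "h \<in> homotheties" "h' \<in> homotheties" for h h' :: "'v \<Rightarrow> 'v"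
    proof -
      from hh' obtain c d where "h = (\<lambda>v. c *\<^sub>R v)" "c \<noteq> 0" "h' = (\<lambda>v. d *\<^sub>R v)" "d \<noteq> 0"
        unfolding homotheties_def by blast
      then show ?thesis unfolding homotheties_def by (auto simp: m o_def intro!: exI[of _ "c * d"])
    qed
  qed
  have "f \<otimes>\<^bsub>GL\<^esub> h \<otimes>\<^bsub>GL\<^esub> inv\<^bsub>GL\<^esub> f \<in> homotheties" if f: "f \<in> carrier GL" and h: "h \<in> homotheties" for f h :: "'v \<Rightarrow> 'v"
  proof -
    obtain c where c: "h = (\<lambda>v. c *\<^sub>R v)" "c \<noteq> 0" using h by (auto simp: homotheties_def)
    have "f \<circ> h = h \<circ> f" using f c by (auto simp: fun_eq_iff glI gl_def linear_scale)
    then have "f \<otimes>\<^bsub>GL\<^esub> h \<otimes>\<^bsub>GL\<^esub> inv\<^bsub>GL\<^esub> f = h \<otimes>\<^bsub>GL\<^esub> f \<otimes>\<^bsub>GL\<^esub> inv\<^bsub>GL\<^esub> f" by (simp add: m)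
    also have "\<dots> = h" using f subgroup.mem_carrier[OF sub h] by (simp add: G.m_assoc)
    finally show ?thesis using h by simp
  qed
  then show ?thesis using sub by (auto simp: G.normal_inv_iff)
qed

lemma PGL_group: "group (PGL :: ('v::euclidean_space \<Rightarrow> 'v) set monoid)"
  unfolding PGL_def by (rule normal.factorgroup_is_group[OF homotheties_normal])

lemma homotheties_coset: "homotheties #>\<^bsub>GL\<^esub> f = projective_class f"
  unfolding r_coset_def homotheties_def projective_class_def GL_def by (auto simp: o_def)

lemma PGL_carrier: "g \<in> carrier PGL \<longleftrightarrow> (\<exists>f. gl f \<and> g = projective_class f)"
  unfolding PGL_def FactGroup_def RCOSETS_def by (auto simp: homotheties_coset) (auto simp: GL_def gl_def)

lemma PGL_mult:
  assumes "gl f" "gl g"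
  shows "projective_class f \<otimes>\<^bsub>PGL\<^esub> projective_class g = projective_class (f \<circ> g)"
  using normal.rcos_sum[OF homotheties_normal, of f g] assms
  unfolding PGL_def FactGroup_def homotheties_coset by (simp add: GL_def gl_def)

lemma PGL_one: "\<one>\<^bsub>PGL\<^esub> = projective_class id"
proof -
  have "homotheties = (projective_class id :: ('v::euclidean_space \<Rightarrow> 'v) set)"
    by (simp add: homotheties_def projective_class_def)
  then show ?thesis by (simp add: PGL_def FactGroup_def)
qed

lemma PGL_inv:
  fixes f :: "'v::euclidean_space \<Rightarrow> 'v"
  assumes "gl f"
  shows "inv\<^bsub>PGL\<^esub> (projective_class f) = projective_class (inv_into UNIV f)"
proof -
  interpret group "PGL :: ('v \<Rightarrow> 'v) set monoid" by (rule PGL_group)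
  have "inv_into UNIV f \<circ> f = id" using assms by (simp add: fun_eq_iff)
  then show ?thesis
    using assms by (intro inv_equality) (auto simp: PGL_mult PGL_one PGL_carrier intro: gl_inverse)
qed

lemma PGL_representative:
  assumes "g \<in> carrier PGL" "f \<in> g"
  shows "gl f" "g = projective_class f"
proof -
  obtain h where h: "gl h" "g = projective_class h" using assms(1) by (auto simp: PGL_carrier)
  then obtain c where c: "f = (\<lambda>v. c *\<^sub>R h v)" "c \<noteq> 0" using assms(2) by (auto simp: projective_class_def)
  show "gl f" using gl_scale[OF h(1) c(2)] c by simp
  show "g = projective_class f" using projective_class_scale[OF c(2), of h] c h by simp
qed

lemma flag_act_representative:
  assumes "Real_Vector_Spaces.subspace (F k)" "linear f"
  shows "(projective_class f \<cdot>\<^sub>F F) k = f ` F k"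
proof -
  have "(\<lambda>v. c *\<^sub>R f v) ` F k \<subseteq> f ` F k" for c
  proof clarify
    fix v assume "v \<in> F k"
    then have "c *\<^sub>R v \<in> F k" using assms(1) by (simp add: subspace_scale)
    then show "c *\<^sub>R f v \<in> f ` F k" using linear_scale[OF assms(2), of c v] by (metis imageI)
  qed
  then show ?thesis unfolding flag_act_def using projective_class_self[of f]
    by (auto simp: projective_class_def) 
qed

lemma singular_values_pos:
  fixes f :: "'v::euclidean_space \<Rightarrow> 'v"
  assumes "gl f"
  shows "length (singular_values f) = DIM('v)" and "i < DIM('v) \<Longrightarrow> singular_values f ! i > 0"
proof -
  have f: "linear f" "inj f" using assms by (auto simp: gl_def bij_is_inj)
  obtain vs where vs: "singular_frame f vs" using exists_singular_frame[OF f(1)] by blast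
  have l: "length vs = DIM('v)" and o: "orthonormal vs" using vs by (auto simp: singular_frame_def)
  show "length (singular_values f) = DIM('v)" using singular_values_frame[OF f(1) vs] l by simp
  assume i: "i < DIM('v)"
  then have "vs ! i \<noteq> 0" using orthonormal_norm[OF o, of i] l by auto
  then have "f (vs ! i) \<noteq> 0" using f linear_0[OF f(1)] by (metis injD)
  then show "singular_values f ! i > 0" using singular_values_frame[OF f(1) vs] i l by simp
qed

lemma linear_det_scale:
  fixes f :: "'v::euclidean_space \<Rightarrow> 'v"
  shows "linear_det (\<lambda>v. c *\<^sub>R f v) = c ^ DIM('v) * linear_det f"
  unfolding linear_det_def matrix_in_scale[OF some_ordered_basis]
  using carrier_matD[OF matrix_in_carrier[OF some_ordered_basis, of f]] by (simp add: det_smult)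

text \<open>Normalizing the determinant multiplies all singular values by the same number, so the simple roots
  can be computed from any representative.\<close>

lemma cartan_projection_difference:
  fixes f :: "'v::euclidean_space \<Rightarrow> 'v"
  assumes f: "gl f" and k: "1 \<le> k" "k < DIM('v)"
  shows "cartan_projection (projective_class f) ! (k - 1) - cartan_projection (projective_class f) ! k =
    ln (singular_values f ! (k - 1)) - ln (singular_values f ! k)"
proof -
  let ?n = "DIM('v)"
  have d: "linear_det f \<noteq> 0"
    unfolding linear_det_def using det_matrix_in_nonzero[OF some_ordered_basis] f by (auto simp: gl_def)
  define c where "c = root ?n (1 / \<bar>linear_det f\<bar>)"
  have "c > 0" "c ^ ?n = 1 / \<bar>linear_det f\<bar>"
    unfolding c_def using d by (auto intro: real_root_pow_pos2)
  then have "\<bar>linear_det (\<lambda>v. c *\<^sub>R f v)\<bar> = 1" "(\<lambda>v. c *\<^sub>R f v) \<in> projective_class f"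
    using d by (auto simp: linear_det_scale abs_mult projective_class_def)
  then have "(SOME h. h \<in> projective_class f \<and> \<bar>linear_det h\<bar> = 1) \<in> projective_class f"
    using someI[of "\<lambda>h. h \<in> projective_class f \<and> \<bar>linear_det h\<bar> = 1"] by blast
  then obtain e where e: "e \<noteq> 0" "(SOME h. h \<in> projective_class f \<and> \<bar>linear_det h\<bar> = 1) = (\<lambda>v. e *\<^sub>R f v)"
    by (auto simp: projective_class_def)
  have "cartan_projection (projective_class f) ! i = ln \<bar>e\<bar> + ln (singular_values f ! i)" if "i < ?n" for i
    unfolding cartan_projection_def e(2)
    using singular_values_scale[of f e] f singular_values_pos(1)[OF f] singular_values_pos(2)[OF f that] that e(1)
      ln_mult_pos[of "\<bar>e\<bar>" "singular_values f ! i"]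
    by (simp add: gl_def)
  then show ?thesis using k by simp
qed

section \<open>Eigenframes and their flags\<close>

lemma ordered_basis_of_coefficients:
  fixes E :: "'v::euclidean_space list"
  assumes l: "length E = DIM('v)"
    and c: "\<And>c i. (\<Sum>i<DIM('v). c i *\<^sub>R E ! i) = 0 \<Longrightarrow> i < DIM('v) \<Longrightarrow> c i = 0"
  shows "ordered_basis E"
proof -
  have d: "distinct E"
    unfolding distinct_conv_nth
  proof (intro allI impI notI)
    fix i j assume ij: "i < length E" "j < length E" "i \<noteq> j" "E ! i = E ! j"
    let ?c = "\<lambda>m. (if m = i then 1 else 0) - (if m = j then 1 else 0) :: real"
    have "(\<Sum>m<DIM('v). ?c m *\<^sub>R E ! m) = E ! i - E ! j"
      using ij l by (simp add: scaleR_left_diff_distrib sum_subtractf if_distrib[of "\<lambda>c. c *\<^sub>R _"] cong: if_cong)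
    then have "?c i = 0" using c[of ?c i] ij l by simp
    then show False using ij by simp
  qed
  have i: "independent (set E)"
  proof
    assume "dependent (set E)"
    then obtain u where u: "\<exists>v\<in>set E. u v \<noteq> 0" "(\<Sum>v\<in>set E. u v *\<^sub>R v) = 0"
      by (auto simp: real_vector.dependent_finite)
    have "(\<Sum>i<DIM('v). u (E ! i) *\<^sub>R E ! i) = (\<Sum>v\<in>set E. u v *\<^sub>R v)"
      using d l by (intro sum.reindex_bij_betw bij_betw_nth) auto
    then have "u (E ! i) = 0" if "i < DIM('v)" for i using c[of "\<lambda>i. u (E ! i)" i] u(2) that by simp
    then show False using u(1) l by (auto simp: in_set_conv_nth)
  qed
  have "span (set E) = UNIV"
    using i d l by (metis card_eq_dim dim_UNIV distinct_card finite_set subset_UNIV top.extremum_uniqueI)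
  then show ?thesis using d i by (simp add: ordered_basis_def)
qed

text \<open>Apply \<open>f - \<mu> m\<close> to a linear relation to remove its last term.\<close>

lemma eigenvectors_independent:
  fixes m :: nat
  assumes f: "linear f" and \<mu>: "\<And>i j. i < m \<Longrightarrow> j < m \<Longrightarrow> i \<noteq> j \<Longrightarrow> \<mu> i \<noteq> \<mu> j"
    and e: "\<And>i. i < m \<Longrightarrow> e i \<noteq> 0 \<and> f (e i) = \<mu> i *\<^sub>R e i"
    and s: "(\<Sum>i<m. c i *\<^sub>R e i) = 0" and i: "i < m"
  shows "c i = 0"
  using \<mu> e s i
proof (induction m arbitrary: c i)
  case (Suc m)
  interpret f: linear f by fact
  have "f (\<Sum>i<Suc m. c i *\<^sub>R e i) - \<mu> m *\<^sub>R (\<Sum>i<Suc m. c i *\<^sub>R e i) = (\<Sum>i<m. (c i * (\<mu> i - \<mu> m)) *\<^sub>R e i)"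
    using Suc.prems(2)
    by (simp add: f.sum f.scale f.add scaleR_sum_right scaleR_right_distrib algebra_simps sum_subtractf)
  then have "(\<Sum>i<m. (c i * (\<mu> i - \<mu> m)) *\<^sub>R e i) = 0" using Suc.prems(3) f.zero by simp
  then have "c j * (\<mu> j - \<mu> m) = 0" if "j < m" for j
    using Suc.IH[of "\<lambda>i. c i * (\<mu> i - \<mu> m)" j] Suc.prems(1,2) that by simp
  then have z: "c j = 0" if "j < m" for j using Suc.prems(1)[of j m] that by force
  then have "c m *\<^sub>R e m = 0" using Suc.prems(3) by simp
  then show ?case using z Suc.prems(2)[of m] Suc.prems(4) by (cases "i = m") auto
qed simp

text \<open>The eigenvalues are strictly decreasing in absolute value, so the attracting flag is spanned by initial
  and the repelling flag by final segments of the list.\<close>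

definition eigenframe :: "('v::euclidean_space \<Rightarrow> 'v) \<Rightarrow> (nat \<Rightarrow> real) \<Rightarrow> 'v list \<Rightarrow> bool" where
  "eigenframe f \<mu> E \<longleftrightarrow> gl f \<and> ordered_basis E \<and> (\<forall>i<DIM('v). f (E ! i) = \<mu> i *\<^sub>R E ! i) \<and>
     (\<forall>i j. i < j \<longrightarrow> j < DIM('v) \<longrightarrow> \<bar>\<mu> j\<bar> < \<bar>\<mu> i\<bar>)"

lemma eigenframe_scale: "eigenframe f \<mu> E \<Longrightarrow> d \<noteq> 0 \<Longrightarrow> eigenframe (\<lambda>v. d *\<^sub>R f v) (\<lambda>i. d * \<mu> i) E"
  by (auto simp: eigenframe_def gl_scale abs_mult)

text \<open>
  Complex eigenvalues of a real matrix come in conjugate pairs of equal absolute value, so distinct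
  absolute values force them to be real.
\<close>

lemma eigenvalue_list_real:
  fixes f :: "'v::euclidean_space \<Rightarrow> 'v"
  assumes f: "linear f" and zs: "eigenvalue_list f zs" "distinct (map cmod zs)"
  obtains rs where "length rs = DIM('v)" "distinct (map abs rs)" "\<And>r. r \<in> set rs \<Longrightarrow> real_eigenvalue f r"
proof -
  define B :: "'v list" where "B = (SOME B. ordered_basis B)"
  have B: "ordered_basis B" unfolding B_def by (rule some_ordered_basis)
  let ?A = "matrix_in B f" and ?n = "DIM('v)"
  have A: "?A \<in> carrier_mat ?n ?n" by (rule matrix_in_carrier[OF B])
  have cp: "map_poly complex_of_real (char_poly ?A) = (\<Prod>z\<leftarrow>zs. [:- z, 1:])"
    using zs(1) of_real_hom.char_poly_hom[OF A] unfolding eigenvalue_list_def B_def[symmetric] by metis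
  have root: "poly (map_poly complex_of_real (char_poly ?A)) z = 0 \<longleftrightarrow> z \<in> set zs" for z
    unfolding cp poly_prod_list by (auto simp: prod_list_zero_iff)
  have deg: "length zs = ?n"
  proof -
    have "length zs = degree (\<Prod>z\<leftarrow>zs. [:- z, 1:])" by (rule degree_linear_factors[symmetric])
    also have "\<dots> = degree (char_poly ?A)" unfolding cp[symmetric] by simp
    finally show ?thesis using degree_monic_char_poly[OF A] by simp
  qed
  have real: "of_real (Re z) = z" if z: "z \<in> set zs" for z
  proof -
    have "poly (map_poly complex_of_real (char_poly ?A)) (cnj z) = cnj (poly (map_poly complex_of_real (char_poly ?A)) z)"
      by (rule poly_cnj_real[symmetric]) (simp add: coeff_map_poly)
    then have "cnj z \<in> set zs" using root[of z] root[of "cnj z"] z by (metis complex_cnj_zero)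
    then have "cnj z = z" using zs(2) z by (auto simp: distinct_map inj_on_def)
    then show ?thesis by (simp add: complex_eq_iff)
  qed
  have ev: "real_eigenvalue f (Re z)" if z: "z \<in> set zs" for z
  proof -
    have "complex_of_real (poly (char_poly ?A) (Re z)) = 0"
    proof -
      have "complex_of_real (poly (char_poly ?A) (Re z)) =
          poly (map_poly complex_of_real (char_poly ?A)) (complex_of_real (Re z))" by simp
      then show ?thesis using root[of z] z real[OF z] by metis
    qed
    then have "eigenvalue ?A (Re z)" using eigenvalue_root_char_poly[OF A] by simp
    then obtain v where v: "v \<in> carrier_vec ?n" "v \<noteq> 0\<^sub>v ?n" "?A *\<^sub>v v = Re z \<cdot>\<^sub>v v"
      using A by (auto simp: eigenvalue_def eigenvector_def)
    define w where "w = (\<Sum>i<?n. vec_index v i *\<^sub>R B ! i)"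
    have cw: "coord B i w = vec_index v i" if "i < ?n" for i by (rule coord_eqI[OF B w_def that])
    have "f w = Re z *\<^sub>R w"
    proof (rule coord_inject[OF B])
      fix i assume i: "i < ?n"
      have "coord B i (f w) = (\<Sum>j<?n. ?A $$ (i, j) * vec_index v j)"
        unfolding coord_image[OF B f i] by (intro sum.cong) (auto simp: cw)
      also have "\<dots> = vec_index (?A *\<^sub>v v) i" using A v(1) i by (simp add: scalar_prod_def atLeast0LessThan)
      also have "\<dots> = coord B i (Re z *\<^sub>R w)"
        using v(1,3) i linear_scale[OF coord_linear[OF B]] by (simp add: cw)
      finally show "coord B i (f w) = coord B i (Re z *\<^sub>R w)" .
    qed
    moreover have "w \<noteq> 0"
    proof
      assume "w = 0"
      then have "vec_index v i = 0" if "i < ?n" for i using cw[OF that] linear_0[OF coord_linear[OF B]] by simp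
      then show False using v(1,2) by (metis eq_vecI carrier_vecD index_zero_vec)
    qed
    ultimately show ?thesis by (auto simp: real_eigenvalue_def)
  qed
  have "map abs (map Re zs) = map cmod zs"
    using real by (auto intro!: map_cong) (metis norm_of_real)
  then have "distinct (map abs (map Re zs))" using zs(2) by metis
  then show ?thesis using ev deg by (intro that[of "map Re zs"]) auto
qed

lemma loxodromic_eigenframe:
  fixes g :: "('v::euclidean_space \<Rightarrow> 'v) set"
  assumes "loxodromic g"
  obtains f \<mu> E where "g = projective_class f" "eigenframe f \<mu> E"
proof -
  obtain f zs where f: "g \<in> carrier PGL" "f \<in> g" and zs: "eigenvalue_list f zs" "distinct (map cmod zs)"
    using assms by (auto simp: loxodromic_def)
  have gl: "gl f" "g = projective_class f" using PGL_representative[OF f] by auto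
  then have lin: "linear f" by (simp add: gl_def)
  obtain rs where rs: "length rs = DIM('v)" "distinct (map abs rs)" "\<And>r. r \<in> set rs \<Longrightarrow> real_eigenvalue f r"
    using eigenvalue_list_real[OF lin zs] by blast
  define ss where "ss = sort_key (\<lambda>r. - \<bar>r\<bar>) rs"
  have ss: "length ss = DIM('v)" "set ss = set rs" by (simp_all add: ss_def rs)
  have "sorted (map (\<lambda>r. - \<bar>r\<bar>) ss)" by (simp add: ss_def)
  moreover have "distinct (map abs ss)" using rs(2) unfolding ss_def distinct_map by simp
  ultimately have \<mu>: "\<bar>ss ! j\<bar> < \<bar>ss ! i\<bar>" if "i < j" "j < DIM('v)" for i j
    using that ss(1) sorted_nth_mono[of "map (\<lambda>r. - \<bar>r\<bar>) ss" i j] nth_eq_iff_index_eq[of "map abs ss" i j]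
    by (simp add: order_less_le)
  have "\<forall>i<DIM('v). \<exists>v. v \<noteq> 0 \<and> f v = (ss ! i) *\<^sub>R v"
    using rs(3) ss by (metis nth_mem real_eigenvalue_def)
  then obtain e where e: "\<And>i. i < DIM('v) \<Longrightarrow> e i \<noteq> 0 \<and> f (e i) = (ss ! i) *\<^sub>R e i" by metis
  define E where "E = map e [0..<DIM('v)]"
  have "ordered_basis E"
  proof (rule ordered_basis_of_coefficients)
    fix c i assume c: "(\<Sum>i<DIM('v). c i *\<^sub>R E ! i) = 0" "i < DIM('v)"
    then have "(\<Sum>i<DIM('v). c i *\<^sub>R e i) = 0" by (simp add: E_def)
    moreover have "ss ! i \<noteq> ss ! j" if "i < DIM('v)" "j < DIM('v)" "i \<noteq> j" for i j
      using \<mu>[of i j] \<mu>[of j i] that by (metis less_irrefl linorder_neqE_nat)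
    ultimately show "c i = 0"
      using eigenvectors_independent[OF lin, of "DIM('v)" "\<lambda>i. ss ! i" e c i] e c(2) by blast
  qed (simp add: E_def)
  then have "eigenframe f (\<lambda>i. ss ! i) E"
    using gl \<mu> e by (auto simp: eigenframe_def E_def)
  then show ?thesis using that gl by blast
qed

text \<open>Spans of the first \<open>k\<close> and of the last \<open>k\<close> vectors of a basis, described by the vanishing of coordinates.\<close>

definition initial_span :: "'v::euclidean_space list \<Rightarrow> nat \<Rightarrow> 'v set" where
  "initial_span B k = {v. \<forall>i<DIM('v). k \<le> i \<longrightarrow> coord B i v = 0}"

definition final_span :: "'v::euclidean_space list \<Rightarrow> nat \<Rightarrow> 'v set" where
  "final_span B k = {v. \<forall>i<DIM('v). i + k < DIM('v) \<longrightarrow> coord B i v = 0}"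

lemma coord_subspace:
  assumes "ordered_basis B" shows "Real_Vector_Spaces.subspace {v. \<forall>i<m. P i \<longrightarrow> coord B i v = 0}"
  using linear_0[OF coord_linear[OF assms]] linear_add[OF coord_linear[OF assms]] linear_scale[OF coord_linear[OF assms]]
  by (auto simp: real_vector.subspace_def)

lemma span_subspaces [simp]:
  "ordered_basis B \<Longrightarrow> Real_Vector_Spaces.subspace (initial_span B k)"
  "ordered_basis B \<Longrightarrow> Real_Vector_Spaces.subspace (final_span B k)"
  unfolding initial_span_def final_span_def by (rule coord_subspace, assumption)+

lemma coordinate_span:
  fixes B :: "'v::euclidean_space list"
  assumes B: "ordered_basis B" and S: "\<And>i. i < DIM('v) \<Longrightarrow> \<not> P i \<Longrightarrow> B ! i \<in> span S"
    and S': "\<And>v. v \<in> S \<Longrightarrow> \<forall>i<DIM('v). P i \<longrightarrow> coord B i v = 0"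
  shows "span S = {v. \<forall>i<DIM('v). P i \<longrightarrow> coord B i v = 0}"
proof (intro subset_antisym)
  show "span S \<subseteq> {v. \<forall>i<DIM('v). P i \<longrightarrow> coord B i v = 0}"
    using S' by (intro span_minimal coord_subspace B) auto
  show "{v. \<forall>i<DIM('v). P i \<longrightarrow> coord B i v = 0} \<subseteq> span S"
  proof clarify
    fix v assume v: "\<forall>i<DIM('v). P i \<longrightarrow> coord B i v = 0"
    have "coord B i v *\<^sub>R B ! i \<in> span S" if "i < DIM('v)" for i
      using S[OF that] v that by (cases "P i") (auto intro: span_scale simp: span_zero)
    then have "(\<Sum>i<DIM('v). coord B i v *\<^sub>R B ! i) \<in> span S" by (intro span_sum) auto
    then show "v \<in> span S" using coord_expand[OF B, of v] by simp
  qed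
qed

context
  fixes f :: "'v::euclidean_space \<Rightarrow> 'v" and \<mu> E
  assumes fE: "eigenframe f \<mu> E"
begin

lemma eigenframe_facts: "gl f" "linear f" "ordered_basis E" "i < DIM('v) \<Longrightarrow> f (E ! i) = \<mu> i *\<^sub>R E ! i"
    "i < j \<Longrightarrow> j < DIM('v) \<Longrightarrow> \<bar>\<mu> j\<bar> < \<bar>\<mu> i\<bar>"
  using fE by (auto simp: eigenframe_def gl_def)

lemma eigenframe_less: "i < DIM('v) \<Longrightarrow> j < DIM('v) \<Longrightarrow> \<bar>\<mu> j\<bar> < \<bar>\<mu> i\<bar> \<longleftrightarrow> i < j"
  using eigenframe_facts(5)[of i j] eigenframe_facts(5)[of j i] by (cases i j rule: linorder_cases) auto

lemma eigenframe_coord: 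
  assumes "i < DIM('v)" shows "coord E i (f v) = \<mu> i * coord E i v"
proof -
  have "f v = f (\<Sum>j<DIM('v). coord E j v *\<^sub>R E ! j)" using coord_expand[OF eigenframe_facts(3), of v] by simp
  also have "\<dots> = (\<Sum>j<DIM('v). (\<mu> j * coord E j v) *\<^sub>R E ! j)"
    using eigenframe_facts(4)
    by (simp add: linear_sum[OF eigenframe_facts(2)] linear_scale[OF eigenframe_facts(2)] mult.commute)
  finally show ?thesis by (rule coord_eqI[OF eigenframe_facts(3) _ assms])
qed

lemma eigenframe_nonzero: "i < DIM('v) \<Longrightarrow> E ! i \<noteq> 0"
  using coord_basis[OF eigenframe_facts(3), of i i] linear_0[OF coord_linear[OF eigenframe_facts(3)], of i] by auto

lemma eigenframe_value_nonzero: "i < DIM('v) \<Longrightarrow> \<mu> i \<noteq> 0"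
  using eigenframe_facts(1) eigenframe_facts(4)[of i] eigenframe_nonzero[of i] linear_0[OF eigenframe_facts(2)]
  unfolding gl_def by (metis bij_is_inj injD scaleR_zero_left)

lemma eigenframe_eigenvalue: "real_eigenvalue f c \<longleftrightarrow> (\<exists>i<DIM('v). c = \<mu> i)"
proof
  assume "real_eigenvalue f c"
  then obtain v where v: "v \<noteq> 0" "f v = c *\<^sub>R v" by (auto simp: real_eigenvalue_def)
  obtain i where i: "i < DIM('v)" "coord E i v \<noteq> 0"
    using coord_inject[OF eigenframe_facts(3), of v 0] v(1) linear_0[OF coord_linear[OF eigenframe_facts(3)]]
    by metis
  have "\<mu> i * coord E i v = coord E i (c *\<^sub>R v)" using eigenframe_coord[OF i(1), of v] v(2) by metis
  then have "\<mu> i * coord E i v = c * coord E i v"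
    unfolding linear_scale[OF coord_linear[OF eigenframe_facts(3)]] by (simp only: real_scaleR_def)
  then show "\<exists>i<DIM('v). c = \<mu> i" using i by auto
qed (use eigenframe_facts(4) eigenframe_nonzero in \<open>auto simp: real_eigenvalue_def\<close>)

lemma eigenframe_inj: "i < DIM('v) \<Longrightarrow> j < DIM('v) \<Longrightarrow> \<mu> i = \<mu> j \<Longrightarrow> i = j"
  using eigenframe_less[of i j] eigenframe_less[of j i] by auto

lemma eigenframe_eigenvector:
  assumes "f v = \<mu> i *\<^sub>R v" "i < DIM('v)" "j < DIM('v)" "j \<noteq> i"
  shows "coord E j v = 0"
proof -
  have "\<mu> j * coord E j v = coord E j (\<mu> i *\<^sub>R v)" using eigenframe_coord[OF assms(3), of v] assms(1) by metis
  then have "\<mu> j * coord E j v = \<mu> i * coord E j v"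
    unfolding linear_scale[OF coord_linear[OF eigenframe_facts(3)]] by (simp only: real_scaleR_def)
  then show ?thesis using eigenframe_inj assms by auto
qed

lemma eigenframe_rank:
  assumes "i < DIM('v)"
  shows "card {c. real_eigenvalue f c \<and> \<bar>c\<bar> > \<bar>\<mu> i\<bar>} = i"
    and "card {c. real_eigenvalue f c \<and> \<bar>c\<bar> < \<bar>\<mu> i\<bar>} = DIM('v) - 1 - i"
proof -
  have "{c. real_eigenvalue f c \<and> \<bar>c\<bar> > \<bar>\<mu> i\<bar>} = \<mu> ` {..<i}"
  proof (intro subset_antisym subsetI)
    fix c assume "c \<in> {c. real_eigenvalue f c \<and> \<bar>c\<bar> > \<bar>\<mu> i\<bar>}"
    then obtain j where "j < DIM('v)" "c = \<mu> j" "\<bar>\<mu> i\<bar> < \<bar>\<mu> j\<bar>" by (auto simp: eigenframe_eigenvalue)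
    then show "c \<in> \<mu> ` {..<i}" using eigenframe_less[of j i] assms by blast
  next
    fix c assume "c \<in> \<mu> ` {..<i}"
    then obtain j where "j < i" "c = \<mu> j" by blast
    then show "c \<in> {c. real_eigenvalue f c \<and> \<bar>c\<bar> > \<bar>\<mu> i\<bar>}"
      using eigenframe_less[of j i] assms less_trans[of j i] unfolding eigenframe_eigenvalue by blast
  qed
  moreover have "inj_on \<mu> {..<i}" using eigenframe_inj assms by (auto simp: inj_on_def)
  ultimately show "card {c. real_eigenvalue f c \<and> \<bar>c\<bar> > \<bar>\<mu> i\<bar>} = i" by (simp add: card_image)
  have "{c. real_eigenvalue f c \<and> \<bar>c\<bar> < \<bar>\<mu> i\<bar>} = \<mu> ` {i<..<DIM('v)}"
  proof (intro subset_antisym subsetI)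
    fix c assume "c \<in> {c. real_eigenvalue f c \<and> \<bar>c\<bar> < \<bar>\<mu> i\<bar>}"
    then obtain j where "j < DIM('v)" "c = \<mu> j" "\<bar>\<mu> j\<bar> < \<bar>\<mu> i\<bar>" by (auto simp: eigenframe_eigenvalue)
    then show "c \<in> \<mu> ` {i<..<DIM('v)}" using eigenframe_less[of i j] assms by auto
  next
    fix c assume "c \<in> \<mu> ` {i<..<DIM('v)}"
    then obtain j where "i < j" "j < DIM('v)" "c = \<mu> j" by auto
    then show "c \<in> {c. real_eigenvalue f c \<and> \<bar>c\<bar> < \<bar>\<mu> i\<bar>}"
      using eigenframe_less[of i j] assms unfolding eigenframe_eigenvalue by blast
  qed
  moreover have "inj_on \<mu> {i<..<DIM('v)}" using eigenframe_inj assms by (auto simp: inj_on_def)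
  ultimately show "card {c. real_eigenvalue f c \<and> \<bar>c\<bar> < \<bar>\<mu> i\<bar>} = DIM('v) - 1 - i" by (simp add: card_image)
qed

end

text \<open>All representatives of the class have the same eigenframe, and the eigenvalue with index \<open>i\<close> has
  exactly \<open>i\<close> eigenvalues of larger absolute value.\<close>

lemma eigenframe_flags:
  fixes f :: "'v::euclidean_space \<Rightarrow> 'v"
  assumes fE: "eigenframe f \<mu> E"
  shows "attracting_flag (projective_class f) = initial_span E"
    and "repelling_flag (projective_class f) = final_span E"
proof -
  let ?n = "DIM('v)"
  note E = eigenframe_facts(3)[OF fE]
  have frame: "eigenframe h (\<lambda>i. d * \<mu> i) E" if "h = (\<lambda>v. d *\<^sub>R f v)" "d \<noteq> 0" for h d
    using eigenframe_scale[OF fE that(2)] that(1) by simp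
  have rep: "h \<in> projective_class f \<longleftrightarrow> (\<exists>d. h = (\<lambda>v. d *\<^sub>R f v) \<and> d \<noteq> 0)" for h
    by (auto simp: projective_class_def)
  have top: "span {v. \<exists>h\<in>projective_class f. \<exists>c. real_eigenvalue h c \<and> h v = c *\<^sub>R v \<and>
     card {c'. real_eigenvalue h c' \<and> \<bar>c'\<bar> > \<bar>c\<bar>} < k} = {v. \<forall>i<?n. k \<le> i \<longrightarrow> coord E i v = 0}" for k
  proof (rule coordinate_span[OF E])
    fix i assume i: "i < ?n" "\<not> k \<le> i"
    then show "E ! i \<in> span {v. \<exists>h\<in>projective_class f. \<exists>c. real_eigenvalue h c \<and> h v = c *\<^sub>R v \<and>
        card {c'. real_eigenvalue h c' \<and> \<bar>c'\<bar> > \<bar>c\<bar>} < k}"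
    proof (intro span_base CollectI bexI exI conjI)
      show "real_eigenvalue f (\<mu> i)" using eigenframe_eigenvalue[OF fE] i(1) by blast
      show "f (E ! i) = \<mu> i *\<^sub>R E ! i" by (rule eigenframe_facts(4)[OF fE i(1)])
    qed (use i eigenframe_rank(1)[OF fE i(1)] in simp_all)
  next
    fix v assume "v \<in> {v. \<exists>h\<in>projective_class f. \<exists>c. real_eigenvalue h c \<and> h v = c *\<^sub>R v \<and>
        card {c'. real_eigenvalue h c' \<and> \<bar>c'\<bar> > \<bar>c\<bar>} < k}"
    then obtain h c where hc: "h \<in> projective_class f" and c: "real_eigenvalue h c" "h v = c *\<^sub>R v"
      "card {c'. real_eigenvalue h c' \<and> \<bar>c'\<bar> > \<bar>c\<bar>} < k"
      by blast
    obtain d where h: "h = (\<lambda>v. d *\<^sub>R f v)" "d \<noteq> 0" using hc rep by blast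
    obtain j where j: "j < ?n" "c = d * \<mu> j" using c(1) eigenframe_eigenvalue[OF frame[OF h]] by auto
    then have "j < k" using c(3) eigenframe_rank(1)[OF frame[OF h] j(1)] by simp
    then show "\<forall>i<?n. k \<le> i \<longrightarrow> coord E i v = 0"
    proof (intro allI impI)
      fix i assume i: "i < ?n" "k \<le> i"
      have "h v = (d * \<mu> j) *\<^sub>R v" using c(2) j(2) by simp
      moreover have "i \<noteq> j" using i \<open>j < k\<close> by auto
      ultimately show "coord E i v = 0" using eigenframe_eigenvector[OF frame[OF h] _ j(1) i(1)] by blast
    qed
  qed
  show "attracting_flag (projective_class f) = initial_span E"
    unfolding attracting_flag_def initial_span_def top ..
  have bot: "span {v. \<exists>h\<in>projective_class f. \<exists>c. real_eigenvalue h c \<and> h v = c *\<^sub>R v \<and>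
     card {c'. real_eigenvalue h c' \<and> \<bar>c'\<bar> < \<bar>c\<bar>} < k} = {v. \<forall>i<?n. i + k < ?n \<longrightarrow> coord E i v = 0}" for k
  proof (rule coordinate_span[OF E])
    fix i assume i: "i < ?n" "\<not> i + k < ?n"
    then show "E ! i \<in> span {v. \<exists>h\<in>projective_class f. \<exists>c. real_eigenvalue h c \<and> h v = c *\<^sub>R v \<and>
        card {c'. real_eigenvalue h c' \<and> \<bar>c'\<bar> < \<bar>c\<bar>} < k}"
    proof (intro span_base CollectI bexI exI conjI)
      show "real_eigenvalue f (\<mu> i)" using eigenframe_eigenvalue[OF fE] i(1) by blast
      show "f (E ! i) = \<mu> i *\<^sub>R E ! i" by (rule eigenframe_facts(4)[OF fE i(1)])
    qed (use i eigenframe_rank(2)[OF fE i(1)] in simp_all)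
  next
    fix v assume "v \<in> {v. \<exists>h\<in>projective_class f. \<exists>c. real_eigenvalue h c \<and> h v = c *\<^sub>R v \<and>
        card {c'. real_eigenvalue h c' \<and> \<bar>c'\<bar> < \<bar>c\<bar>} < k}"
    then obtain h c where hc: "h \<in> projective_class f" and c: "real_eigenvalue h c" "h v = c *\<^sub>R v"
      "card {c'. real_eigenvalue h c' \<and> \<bar>c'\<bar> < \<bar>c\<bar>} < k"
      by blast
    obtain d where h: "h = (\<lambda>v. d *\<^sub>R f v)" "d \<noteq> 0" using hc rep by blast
    obtain j where j: "j < ?n" "c = d * \<mu> j" using c(1) eigenframe_eigenvalue[OF frame[OF h]] by auto
    then have "?n - 1 - j < k" using c(3) eigenframe_rank(2)[OF frame[OF h] j(1)] by simp
    then show "\<forall>i<?n. i + k < ?n \<longrightarrow> coord E i v = 0"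
    proof (intro allI impI)
      fix i assume i: "i < ?n" "i + k < ?n"
      have "h v = (d * \<mu> j) *\<^sub>R v" using c(2) j(2) by simp
      moreover have "i \<noteq> j" using i \<open>?n - 1 - j < k\<close> by auto
      ultimately show "coord E i v = 0" using eigenframe_eigenvector[OF frame[OF h] _ j(1) i(1)] by blast
    qed
  qed
  show "repelling_flag (projective_class f) = final_span E"
    unfolding repelling_flag_def final_span_def bot ..
qed

text \<open>Multiply a representative by the common sign of its eigenvalues.\<close>

lemma positive_loxodromic_eigenframe:
  fixes g :: "('v::euclidean_space \<Rightarrow> 'v) set"
  assumes "positive_loxodromic g"
  obtains f \<mu> E where "g = projective_class f" "eigenframe f \<mu> E" "\<And>i. i < DIM('v) \<Longrightarrow> \<mu> i > 0"
proof -
  have lox: "loxodromic g" using assms by (simp add: positive_loxodromic_def)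
  obtain f \<mu> E where f: "g = projective_class f" "eigenframe f \<mu> E"
    using loxodromic_eigenframe[OF lox] by blast
  obtain h where h: "h \<in> g" "\<And>c c'. real_eigenvalue h c \<Longrightarrow> real_eigenvalue h c' \<Longrightarrow> sgn c = sgn c'"
    using assms by (auto simp: positive_loxodromic_def)
  obtain d where d: "h = (\<lambda>v. d *\<^sub>R f v)" "d \<noteq> 0" using h(1) f(1) by (auto simp: projective_class_def)
  have fr: "eigenframe h (\<lambda>i. d * \<mu> i) E" using eigenframe_scale[OF f(2) d(2)] d(1) by simp
  define \<sigma> where "\<sigma> = sgn (d * \<mu> 0)"
  have \<sigma>: "\<sigma> = sgn (d * \<mu> i)" if "i < DIM('v)" for i
    unfolding \<sigma>_def
  proof (rule h(2))
    show "real_eigenvalue h (d * \<mu> 0)" "real_eigenvalue h (d * \<mu> i)"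
      unfolding eigenframe_eigenvalue[OF fr] using that DIM_positive[where 'a = 'v] by blast+
  qed
  have \<sigma>0: "\<sigma> \<noteq> 0" using eigenframe_value_nonzero[OF fr, of 0] DIM_positive by (simp add: \<sigma>_def sgn_zero_iff)
  have "\<sigma> * (d * \<mu> i) > 0" if "i < DIM('v)" for i
    using \<sigma>[OF that] \<sigma>0 by (simp add: sgn_mult_abs[symmetric] mult_sgn_abs) (metis abs_sgn mult.commute zero_less_abs_iff sgn_zero_iff)
  moreover have "eigenframe (\<lambda>v. \<sigma> *\<^sub>R h v) (\<lambda>i. \<sigma> * (d * \<mu> i)) E" by (rule eigenframe_scale[OF fr \<sigma>0])
  moreover have "projective_class (\<lambda>v. \<sigma> *\<^sub>R h v) = g"
    using projective_class_scale[OF \<sigma>0, of h] projective_class_scale[OF d(2), of f] f(1) d(1) by simp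
  ultimately show ?thesis using that by blast
qed

section \<open>From positive tuples to totally positive matrices\<close>

lemma coordinate_subspace_dim:
  fixes B :: "'v::euclidean_space list"
  assumes B: "ordered_basis B"
  shows "dim {v. \<forall>i<DIM('v). P i \<longrightarrow> coord B i v = 0} = card {i. i < DIM('v) \<and> \<not> P i}"
proof -
  let ?J = "{i. i < DIM('v) \<and> \<not> P i}"
  have "span ((!) B ` ?J) = {v. \<forall>i<DIM('v). P i \<longrightarrow> coord B i v = 0}"
  proof (rule coordinate_span[OF B])
    show "B ! i \<in> span ((!) B ` ?J)" if "i < DIM('v)" "\<not> P i" for i
      using that by (intro span_base imageI CollectI conjI)
    fix v assume "v \<in> (!) B ` ?J"
    then obtain j where j: "j < DIM('v)" "\<not> P j" "v = B ! j" by auto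
    show "\<forall>i<DIM('v). P i \<longrightarrow> coord B i v = 0"
    proof (intro allI impI)
      fix i assume i: "i < DIM('v)" "P i"
      then have "i \<noteq> j" using j(2) by blast
      then show "coord B i v = 0" using coord_basis[OF B i(1) j(1)] j(3) by simp
    qed
  qed
  then have "dim {v. \<forall>i<DIM('v). P i \<longrightarrow> coord B i v = 0} = dim ((!) B ` ?J)" using dim_span[of "(!) B ` ?J"] by simp
  also have "\<dots> = card ((!) B ` ?J)"
    by (rule dim_eq_card_independent, rule independent_mono[of "set B"])
       (use B in \<open>auto simp: ordered_basis_def ordered_basis_length\<close>)
  also have "\<dots> = card ?J"
    by (rule card_image) (use B in \<open>auto simp: inj_on_def ordered_basis_def ordered_basis_length nth_eq_iff_index_eq\<close>)
  finally show ?thesis .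
qed

lemma span_dims:
  fixes B :: "'v::euclidean_space list"
  assumes "ordered_basis B" "k \<le> DIM('v)"
  shows "dim (initial_span B k) = k" and "dim (final_span B k) = k"
proof -
  have "{i. i < DIM('v) \<and> \<not> k \<le> i} = {..<k}" using assms(2) by auto
  then show "dim (initial_span B k) = k"
    unfolding initial_span_def coordinate_subspace_dim[OF assms(1)] by simp
  have "{i. i < DIM('v) \<and> \<not> i + k < DIM('v)} = {DIM('v) - k..<DIM('v)}" using assms(2) by auto
  then show "dim (final_span B k) = k"
    unfolding final_span_def coordinate_subspace_dim[OF assms(1)] using assms(2) by simp
qed

lemma flag_mono: "flag F \<Longrightarrow> i \<le> j \<Longrightarrow> F i \<subseteq> F j"
  by (rule lift_Suc_mono_le) (auto simp: flag_def)

text \<open>The inclusion from right to left is clear, and the dimensions agree.\<close>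

lemma flag_eq_span:
  fixes B :: "'v::euclidean_space list"
  assumes B: "ordered_basis B" and F: "flag F" and k: "k \<le> DIM('v)"
  shows "(\<And>i. i < DIM('v) \<Longrightarrow> B ! i \<in> F (Suc i)) \<Longrightarrow> F k = initial_span B k"
    and "(\<And>i. i < DIM('v) \<Longrightarrow> B ! i \<in> F (DIM('v) - i)) \<Longrightarrow> F k = final_span B k"
proof -
  have sub: "Real_Vector_Spaces.subspace (F k)" and d: "dim (F k) = k" using F k by (auto simp: flag_def)
  have in_span: "v \<in> F k" if P: "\<And>i. i < DIM('v) \<Longrightarrow> coord B i v \<noteq> 0 \<Longrightarrow> B ! i \<in> F k" for v
  proof -
    have "coord B i v *\<^sub>R B ! i \<in> F k" if "i < DIM('v)" for i
      using P[OF that] subspace_scale[OF sub] subspace_0[OF sub] by (cases "coord B i v = 0") auto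
    then have "(\<Sum>i<DIM('v). coord B i v *\<^sub>R B ! i) \<in> F k" by (intro subspace_sum[OF sub]) auto
    then show ?thesis using coord_expand[OF B, of v] by simp
  qed
  { assume b: "\<And>i. i < DIM('v) \<Longrightarrow> B ! i \<in> F (Suc i)"
    have "initial_span B k \<subseteq> F k"
    proof
      fix v assume v: "v \<in> initial_span B k"
      show "v \<in> F k"
      proof (rule in_span)
        fix i assume "i < DIM('v)" "coord B i v \<noteq> 0"
        then show "B ! i \<in> F k" using v b[of i] flag_mono[OF F, of "Suc i" k] by (force simp: initial_span_def)
      qed
    qed
    then show "F k = initial_span B k"
      using subspace_dim_equal[of "initial_span B k" "F k"] span_dims(1)[OF B k] d sub B by simp }
  { assume b: "\<And>i. i < DIM('v) \<Longrightarrow> B ! i \<in> F (DIM('v) - i)"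
    have "final_span B k \<subseteq> F k"
    proof
      fix v assume v: "v \<in> final_span B k"
      show "v \<in> F k"
      proof (rule in_span)
        fix i assume i: "i < DIM('v)" "coord B i v \<noteq> 0"
        then have "DIM('v) - i \<le> k" using v by (force simp: final_span_def)
        then show "B ! i \<in> F k" using b[OF i(1)] flag_mono[OF F, of "DIM('v) - i" k] by blast
      qed
    qed
    then show "F k = final_span B k"
      using subspace_dim_equal[of "final_span B k" "F k"] span_dims(2)[OF B k] d sub B by simp }
qed

definition basis_map :: "'v::euclidean_space list \<Rightarrow> 'v list \<Rightarrow> 'v \<Rightarrow> 'v" where
  "basis_map B E v = (\<Sum>i<DIM('v). coord B i v *\<^sub>R E ! i)"

context
  fixes B E :: "'v::euclidean_space list"
  assumes B: "ordered_basis B" and E: "ordered_basis E"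
begin

lemma basis_map_coord: "i < DIM('v) \<Longrightarrow> coord E i (basis_map B E v) = coord B i v"
  by (rule coord_eqI[OF E basis_map_def])

lemma basis_map_linear: "linear (basis_map B E)"
  unfolding basis_map_def
  by (rule linearI) (simp_all add: linear_add[OF coord_linear[OF B]] linear_scale[OF coord_linear[OF B]]
      scaleR_left_distrib sum.distrib scaleR_sum_right)

lemma basis_map_basis: "i < DIM('v) \<Longrightarrow> basis_map B E (B ! i) = E ! i"
  by (rule coord_inject[OF E]) (simp add: basis_map_coord coord_basis[OF B] coord_basis[OF E])

end

lemma basis_map_inverse:
  fixes B E :: "'v::euclidean_space list"
  assumes "ordered_basis B" "ordered_basis E"
  shows "basis_map E B (basis_map B E v) = v"
  by (rule coord_inject[OF assms(1)]) (simp add: basis_map_coord assms)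

lemma basis_map_gl: "ordered_basis B \<Longrightarrow> ordered_basis E \<Longrightarrow> gl (basis_map B E)"
  by (rule gl_by_inverse[of _ "basis_map E B"]) (auto intro: basis_map_linear basis_map_inverse)

lemma basis_map_initial_span:
  fixes B E :: "'v::euclidean_space list"
  assumes B: "ordered_basis B" and E: "ordered_basis E"
  shows "basis_map B E ` initial_span B k = initial_span E k"
proof -
  have s: "basis_map B E ` initial_span B k \<subseteq> initial_span E k" if "ordered_basis B" "ordered_basis E" for B E :: "'v list"
    using basis_map_coord[OF that] by (auto simp: initial_span_def)
  have "v \<in> basis_map B E ` initial_span B k" if "v \<in> initial_span E k" for v
  proof -
    have "basis_map E B v \<in> initial_span B k" using s[OF E B] that by blast
    then show ?thesis using basis_map_inverse[OF E B, of v] by (metis imageI)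
  qed
  then show ?thesis using s[OF B E] by blast
qed

lemma reversed_basis:
  fixes B :: "'v::euclidean_space list"
  assumes B: "ordered_basis B"
  shows "ordered_basis (rev B)" and "initial_span (rev B) = final_span B"
    and "matrix_in B (basis_map B (rev B)) = flip_mat DIM('v)"
proof -
  let ?n = "DIM('v)"
  show R: "ordered_basis (rev B)" using B by (simp add: ordered_basis_def)
  have l: "length B = ?n" by (rule ordered_basis_length[OF B])
  have c: "coord (rev B) i v = coord B (?n - Suc i) v" if "i < ?n" for i v
    using that l by (simp add: coord_def rev_nth)
  show "initial_span (rev B) = final_span B"
  proof (intro ext subset_antisym subsetI)
    fix k v assume v: "v \<in> initial_span (rev B) k"
    show "v \<in> final_span B k"
      unfolding final_span_def
    proof (intro CollectI allI impI)
      fix i assume "i < ?n" "i + k < ?n"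
      then show "coord B i v = 0" using v c[of "?n - Suc i" v] by (simp add: initial_span_def)
    qed
  next
    fix k v assume v: "v \<in> final_span B k"
    show "v \<in> initial_span (rev B) k"
      unfolding initial_span_def
    proof (intro CollectI allI impI)
      fix i assume "i < ?n" "k \<le> i"
      then show "coord (rev B) i v = 0" using v c[of i v] by (simp add: final_span_def)
    qed
  qed
  show "matrix_in B (basis_map B (rev B)) = flip_mat ?n"
  proof (rule eq_matI)
    fix i j assume "i < dim_row (flip_mat ?n)" "j < dim_col (flip_mat ?n)"
    then have ij: "i < ?n" "j < ?n" by (auto simp: flip_mat_def)
    show "matrix_in B (basis_map B (rev B)) $$ (i, j) = flip_mat ?n $$ (i, j)"
      using ij l by (auto simp: matrix_in_entry[OF B] basis_map_basis[OF B R] rev_nth coord_basis[OF B] flip_mat_def)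
  qed (use matrix_in_carrier[OF B] in \<open>auto simp: flip_mat_def\<close>)
qed

text \<open>The matrix \<open>Q\<close> is that of \<open>y\<^sup>-\<^sup>1 x\<close>, which preserves the standard flag.\<close>

lemma flag_relation:
  fixes B :: "'v::euclidean_space list"
  assumes B: "ordered_basis B" and x: "gl x" and y: "gl y"
    and sub: "\<And>k. k \<le> DIM('v) \<Longrightarrow> x ` initial_span B k \<subseteq> y ` initial_span B k"
  shows "\<exists>Q. upper DIM('v) Q \<and> matrix_in B x = matrix_in B y * Q"
proof (intro exI conjI)
  let ?z = "inv_into UNIV y \<circ> x"
  have "y \<circ> ?z = x" using y by (simp add: fun_eq_iff)
  then show "matrix_in B x = matrix_in B y * matrix_in B ?z"
    using matrix_in_comp[OF B, of y ?z] y by (simp add: gl_def)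
  have "coord B i (?z (B ! j)) = 0" if "i < DIM('v)" "j < i" for i j
  proof -
    have "B ! j \<in> initial_span B (Suc j)"
      using that by (auto simp: initial_span_def coord_basis[OF B])
    moreover have "Suc j \<le> DIM('v)" using that by simp
    ultimately have "x (B ! j) \<in> y ` initial_span B (Suc j)" using sub by blast
    then obtain v where "x (B ! j) = y v" "v \<in> initial_span B (Suc j)" by blast
    then show ?thesis using that y by (simp add: initial_span_def)
  qed
  then show "upper DIM('v) (matrix_in B ?z)"
    using matrix_in_entry[OF B] matrix_in_carrier[OF B] by (auto simp: upper_def)
qed

lemma eigenframe_normalize:
  fixes f :: "'v::euclidean_space \<Rightarrow> 'v"
  assumes fE: "eigenframe f \<mu> E" and c: "\<And>i. i < DIM('v) \<Longrightarrow> c i \<noteq> 0"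
  shows "eigenframe f \<mu> (map (\<lambda>i. c i *\<^sub>R E ! i) [0..<DIM('v)])"
proof -
  note E = eigenframe_facts[OF fE]
  have "ordered_basis (map (\<lambda>i. c i *\<^sub>R E ! i) [0..<DIM('v)])"
  proof (rule ordered_basis_of_coefficients)
    fix d i assume d: "(\<Sum>i<DIM('v). d i *\<^sub>R map (\<lambda>i. c i *\<^sub>R E ! i) [0..<DIM('v)] ! i) = 0" and i: "i < DIM('v)"
    have "0 = (\<Sum>i<DIM('v). (d i * c i) *\<^sub>R E ! i)" using d by simp
    then have "coord E i 0 = d i * c i" by (rule coord_eqI[OF E(3) _ i])
    then show "d i = 0" using c[OF i] linear_0[OF coord_linear[OF E(3)]] by simp
  qed simp
  then show ?thesis using fE E(4) by (auto simp: eigenframe_def linear_scale[OF E(2)])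
qed

lemma eigenframe_invariant:
  assumes fE: "eigenframe f \<mu> E"
  shows "f ` initial_span E k \<subseteq> initial_span E k" and "f ` final_span E k \<subseteq> final_span E k"
  using eigenframe_coord[OF fE] by (auto simp: initial_span_def final_span_def)

text \<open>In the basis \<open>B\<close> of the positive tuple, the first flag is the opposite standard flag and the last is
  the standard flag.\<close>

lemma positive_tuple_six:
  fixes F1 :: "nat \<Rightarrow> 'v::euclidean_space set"
  assumes "positive_tuple [F1, F2, F3, F4, F5, F6]"
  obtains B g1 g2 g3 g4 where "ordered_basis B"
    "\<And>k. k \<le> DIM('v) \<Longrightarrow> F1 k = final_span B k" "\<And>k. k \<le> DIM('v) \<Longrightarrow> F6 k = initial_span B k"
    "gl g1" "gl g2" "gl g3" "gl g4"
    "\<forall>g\<in>{g1, g2, g3, g4}. totally_positive_unitriangular (matrix_in B g)"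
    "\<And>k. F2 k = g1 ` F1 k" "\<And>k. F3 k = (g1 \<circ> g2) ` F1 k" "\<And>k. F4 k = (g1 \<circ> (g2 \<circ> g3)) ` F1 k"
    "\<And>k. F5 k = (g1 \<circ> (g2 \<circ> (g3 \<circ> g4))) ` F1 k"
proof -
  let ?Fs = "[F1, F2, F3, F4, F5, F6]" and ?n = "DIM('v)"
  have hd_last: "hd ?Fs = F1" "last ?Fs = F6" "length ?Fs - 2 = 4" by simp_all
  have fl: "flag F1" "flag F6" using assms unfolding positive_tuple_def by simp_all
  obtain B us where B: "ordered_basis B"
    and Bk: "\<forall>k\<in>{1..?n}. B ! (k - 1) \<in> F1 (?n - k + 1) \<inter> F6 k"
    and us: "length us = 4" "set us \<subseteq> U_pos B"
    and act: "\<forall>i\<le>length us. ?Fs ! i = foldr (\<otimes>\<^bsub>PGL\<^esub>) (take i us) \<one>\<^bsub>PGL\<^esub> \<cdot>\<^sub>F F1"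
    using assms unfolding positive_tuple_def hd_last by blast
  obtain u1 u2 u3 u4 where us_eq: "us = [u1, u2, u3, u4]"
    using us(1) by (auto simp: length_Suc_conv numeral_eq_Suc)
  have rep: "\<exists>g. gl g \<and> u = projective_class g \<and> totally_positive_unitriangular (matrix_in B g)" if "u \<in> set us" for u
    using that us(2) PGL_representative by (force simp: U_pos_def)
  obtain g1 g2 g3 g4 where g: "gl g1" "gl g2" "gl g3" "gl g4"
    "u1 = projective_class g1" "u2 = projective_class g2" "u3 = projective_class g3" "u4 = projective_class g4"
    "\<forall>g\<in>{g1, g2, g3, g4}. totally_positive_unitriangular (matrix_in B g)"
    using rep[of u1] rep[of u2] rep[of u3] rep[of u4] us_eq by auto
  have sub: "Real_Vector_Spaces.subspace (F1 k)" for k using fl by (simp add: flag_def)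
  have F: "?Fs ! i = projective_class h \<cdot>\<^sub>F F1" if "i \<le> 4" "foldr (\<otimes>\<^bsub>PGL\<^esub>) (take i us) \<one>\<^bsub>PGL\<^esub> = projective_class h" for i h
    using act us(1) that by metis
  have r: "(projective_class h \<cdot>\<^sub>F F1) k = h ` F1 k" if "gl h" for h k
    using flag_act_representative[of F1 k h] sub that by (simp add: gl_def)
  have "F2 = projective_class g1 \<cdot>\<^sub>F F1"
    using F[of 1 g1] g by (simp add: us_eq PGL_one PGL_mult)
  moreover have "F3 = projective_class (g1 \<circ> g2) \<cdot>\<^sub>F F1"
    using F[of 2 "g1 \<circ> g2"] g by (simp add: us_eq PGL_one PGL_mult)
  moreover have "F4 = projective_class (g1 \<circ> (g2 \<circ> g3)) \<cdot>\<^sub>F F1"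
    using F[of 3 "g1 \<circ> (g2 \<circ> g3)"] g by (simp add: us_eq PGL_one PGL_mult)
  moreover have "F5 = projective_class (g1 \<circ> (g2 \<circ> (g3 \<circ> g4))) \<cdot>\<^sub>F F1"
    using F[of 4 "g1 \<circ> (g2 \<circ> (g3 \<circ> g4))"] g by (simp add: us_eq PGL_one PGL_mult)
  moreover have "F6 k = initial_span B k" if "k \<le> ?n" for k
  proof (rule flag_eq_span(1)[OF B fl(2) that])
    fix i assume "i < ?n"
    then show "B ! i \<in> F6 (Suc i)" using Bk[rule_format, of "Suc i"] by simp
  qed
  moreover have "F1 k = final_span B k" if "k \<le> ?n" for k
  proof (rule flag_eq_span(2)[OF B fl(1) that])
    fix i assume "i < ?n"
    then show "B ! i \<in> F1 (?n - i)" using Bk[rule_format, of "Suc i"] by (simp add: Suc_diff_Suc)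
  qed
  ultimately show ?thesis using that[OF B] g r by simp
qed

text \<open>The two kinds of positive tuple differ only in which of the flags \<open>F2\<close> and \<open>F4\<close> is the image of the
  repelling flag of \<open>b\<close>; these are the two cases of \<open>eigenframe_sign_regular\<close>.  The eigenvectors
  of \<open>b\<close> are rescaled so that their matrix \<open>L\<close> in the basis of the tuple, which is lower triangular, has unit
  diagonal.\<close>

theorem positive_tuple_sign_regular:
  fixes fa fb :: "'v::euclidean_space \<Rightarrow> 'v"
  assumes fa: "eigenframe fa \<alpha> Ea" and fb: "eigenframe fb \<beta> E"
    and a: "a = projective_class fa" and b: "b = projective_class fb"
    and pos: "positive_tuple [repelling_flag b, a \<cdot>\<^sub>F repelling_flag b, attracting_flag a,
                         a \<cdot>\<^sub>F attracting_flag b, attracting_flag b, repelling_flag a] \<or>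
         positive_tuple [repelling_flag b, a \<cdot>\<^sub>F attracting_flag b, attracting_flag a,
                         a \<cdot>\<^sub>F repelling_flag b, attracting_flag b, repelling_flag a]"
  shows "\<exists>E' \<epsilon>. eigenframe fb \<beta> E' \<and> (\<forall>k. \<forall>I\<in>index_lists DIM('v) k. \<forall>J\<in>index_lists DIM('v) k.
     \<epsilon> k * minor (matrix_in E' fa) I J > 0)"
proof -
  let ?n = "DIM('v)"
  note Efa = eigenframe_facts[OF fa] and Efb = eigenframe_facts[OF fb]
  note fl_a = eigenframe_flags[OF fa, folded a] and fl_b = eigenframe_flags[OF fb, folded b]
  obtain F2 F4 where pt: "positive_tuple [repelling_flag b, F2, attracting_flag a, F4, attracting_flag b, repelling_flag a]"
    and cs: "(F2 = a \<cdot>\<^sub>F repelling_flag b \<and> F4 = a \<cdot>\<^sub>F attracting_flag b) \<or>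
      (F2 = a \<cdot>\<^sub>F attracting_flag b \<and> F4 = a \<cdot>\<^sub>F repelling_flag b)"
    using pos by blast
  obtain B g1 g2 g3 g4 where B: "ordered_basis B"
    and F1: "\<And>k. k \<le> ?n \<Longrightarrow> final_span E k = final_span B k"
    and F6: "\<And>k. k \<le> ?n \<Longrightarrow> final_span Ea k = initial_span B k"
    and g: "gl g1" "gl g2" "gl g3" "gl g4"
      "\<forall>g\<in>{g1, g2, g3, g4}. totally_positive_unitriangular (matrix_in B g)"
    and F2: "\<And>k. F2 k = g1 ` final_span E k" and F3: "\<And>k. initial_span Ea k = (g1 \<circ> g2) ` final_span E k"
    and F4: "\<And>k. F4 k = (g1 \<circ> (g2 \<circ> g3)) ` final_span E k"
    and F5: "\<And>k. initial_span E k = (g1 \<circ> (g2 \<circ> (g3 \<circ> g4))) ` final_span E k"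
    using positive_tuple_six[OF pt] unfolding fl_a fl_b by blast
  have act: "(a \<cdot>\<^sub>F initial_span E) k = fa ` initial_span E k" "(a \<cdot>\<^sub>F final_span E) k = fa ` final_span E k" for k
    unfolding a using Efa Efb by (auto intro!: flag_act_representative)
  let ?M = "matrix_in B"
  have M [simp]: "?M f \<in> carrier_mat ?n ?n" for f by (rule matrix_in_carrier[OF B])
  \<comment> \<open>\<open>w\<close> has the flip as its matrix, and \<open>l\<close> below has \<open>L\<close>\<close>
  define w where "w = basis_map B (rev B)"
  have w: "gl w" "?M w = flip_mat ?n" "w ` initial_span B k = final_span B k" for k
    unfolding w_def using reversed_basis[OF B] basis_map_gl[OF B] basis_map_initial_span[OF B] by auto
  \<comment> \<open>the repelling flag of \<open>b\<close> is the opposite flag both of \<open>E\<close> and of \<open>B\<close>\<close>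
  have diag: "coord B i (E ! i) \<noteq> 0" if i: "i < ?n" for i
  proof
    assume z: "coord B i (E ! i) = 0"
    have "E ! i \<in> final_span E (?n - i)"
      using i by (auto simp: final_span_def coord_basis[OF Efb(3)])
    then have "E ! i \<in> final_span B (?n - i)" using F1[of "?n - i"] by simp
    have "E ! i \<in> final_span B (?n - i - 1)"
      unfolding final_span_def
    proof (intro CollectI allI impI)
      fix j assume "j < ?n" "j + (?n - i - 1) < ?n"
      then consider "j = i" | "j + (?n - i) < ?n" "j < ?n" using i by linarith
      then show "coord B j (E ! i) = 0"
        using z \<open>E ! i \<in> final_span B (?n - i)\<close> by cases (auto simp: final_span_def)
    qed
    then have "E ! i \<in> final_span E (?n - i - 1)" using F1[of "?n - i - 1"] by simp
    then have "coord E i (E ! i) = 0" using i by (simp add: final_span_def)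
    then show False using coord_basis[OF Efb(3) i i] by simp
  qed
  define E' where "E' = map (\<lambda>i. (1 / coord B i (E ! i)) *\<^sub>R E ! i) [0..<?n]"
  have fb': "eigenframe fb \<beta> E'" unfolding E'_def by (rule eigenframe_normalize[OF fb]) (use diag in simp)
  note E' = eigenframe_facts(3)[OF fb']
  have spans: "initial_span E' = initial_span E" "final_span E' = final_span E"
    using eigenframe_flags[OF fb'] eigenframe_flags[OF fb] by simp_all
  define l where "l = basis_map B E'"
  define li where "li = basis_map E' B"
  have l: "gl l" "gl li" "l ` initial_span B k = initial_span E k" "l \<circ> li = id" for k
    unfolding l_def li_def using basis_map_gl[OF B E'] basis_map_gl[OF E' B] basis_map_initial_span[OF B E']
      basis_map_inverse[OF E' B] spans by auto
  have lE: "?M l $$ (i, j) = coord B i (E' ! j)" if "i < ?n" "j < ?n" for i j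
    using that by (simp add: matrix_in_entry[OF B] l_def basis_map_basis[OF B E'])
  have L: "lower ?n (?M l)"
    unfolding lower_def
  proof (intro conjI allI impI)
    fix j i assume ij: "j < ?n" "i < j"
    have "E' ! j \<in> final_span E' (?n - j)"
      using ij by (auto simp: final_span_def coord_basis[OF E'])
    then have "E' ! j \<in> final_span B (?n - j)" using F1[of "?n - j"] spans by simp
    then show "?M l $$ (i, j) = 0" using ij lE[of i j] by (simp add: final_span_def)
  qed simp
  have Lu: "unit_diag ?n (?M l)"
    using diag by (auto simp: unit_diag_def lE E'_def linear_scale[OF coord_linear[OF B]])
  have gF: "linear g1" "linear g2" "linear g3" "linear g4" "linear fa" "linear w" "linear l" "linear li"
    using g w l Efa by (auto simp: gl_def)
  note comp = matrix_in_comp[OF B]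
  have rel: "\<exists>Q. upper ?n Q \<and> ?M x = ?M y * Q"
    if "gl x" "gl y" "\<And>k. k \<le> ?n \<Longrightarrow> x ` initial_span B k \<subseteq> y ` initial_span B k" for x y
    using flag_relation[OF B that] by blast
  have A: "upper ?n (?M fa)"
  proof -
    have "fa ` initial_span B k \<subseteq> id ` initial_span B k" if "k \<le> ?n" for k
      using eigenframe_invariant(2)[OF fa, of k] F6[OF that] by simp
    from rel[OF Efa(1) gl_id this] obtain Q where "upper ?n Q" "?M fa = ?M id * Q" by blast
    moreover have "?M id * Q = Q" unfolding matrix_in_id[OF B] using \<open>upper ?n Q\<close> left_mult_one_mat[of Q ?n ?n] by (simp only: upper_def)
    ultimately show ?thesis by simp
  qed
  obtain Q1 where Q1: "upper ?n Q1" "?M (fa \<circ> ((g1 \<circ> g2) \<circ> w)) = ?M ((g1 \<circ> g2) \<circ> w) * Q1"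
  proof -
    have "(fa \<circ> ((g1 \<circ> g2) \<circ> w)) ` initial_span B k \<subseteq> ((g1 \<circ> g2) \<circ> w) ` initial_span B k" if "k \<le> ?n" for k
      using eigenframe_invariant(1)[OF fa, of k] F3[of k] F1[OF that] w(3)[of k]
      by (simp only: image_comp[symmetric])
    then show ?thesis using rel[of "fa \<circ> ((g1 \<circ> g2) \<circ> w)" "(g1 \<circ> g2) \<circ> w"] Efa(1) g w(1) that by auto
  qed
  obtain Q2 where Q2: "upper ?n Q2" "?M l = ?M (g1 \<circ> (g2 \<circ> (g3 \<circ> (g4 \<circ> w)))) * Q2"
  proof -
    have "l ` initial_span B k \<subseteq> (g1 \<circ> (g2 \<circ> (g3 \<circ> (g4 \<circ> w)))) ` initial_span B k" if "k \<le> ?n" for k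
      using F5[of k] F1[OF that] w(3)[of k] l(3)[of k] by (simp only: image_comp[symmetric] subset_refl)
    then show ?thesis using rel[of l "g1 \<circ> (g2 \<circ> (g3 \<circ> (g4 \<circ> w)))"] l(1) g w(1) that by auto
  qed
  have cases: "(\<exists>Q3 Q4. upper ?n Q3 \<and> upper ?n Q4 \<and> ?M (fa \<circ> w) = ?M (g1 \<circ> w) * Q3 \<and>
        ?M (fa \<circ> l) = ?M (g1 \<circ> (g2 \<circ> (g3 \<circ> w))) * Q4) \<or>
      (\<exists>Q3 Q4. upper ?n Q3 \<and> upper ?n Q4 \<and> ?M (fa \<circ> w) = ?M (g1 \<circ> (g2 \<circ> (g3 \<circ> w))) * Q3 \<and>
        ?M (fa \<circ> l) = ?M (g1 \<circ> w) * Q4)"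
  proof -
    have gg: "gl (fa \<circ> w)" "gl (fa \<circ> l)" "gl (g1 \<circ> w)" "gl (g1 \<circ> (g2 \<circ> (g3 \<circ> w)))"
      using Efa(1) g w(1) l(1) by auto
    have wk: "(fa \<circ> w) ` initial_span B k = fa ` final_span E k" "(g1 \<circ> w) ` initial_span B k = F2 k"
      "(g1 \<circ> (g2 \<circ> (g3 \<circ> w))) ` initial_span B k = F4 k" if "k \<le> ?n" for k
      using F1[OF that] w(3)[of k] F2[of k] F4[of k] by (simp_all only: image_comp[symmetric])
    have lk: "(fa \<circ> l) ` initial_span B k = fa ` initial_span E k" for k
      using l(3)[of k] by (simp only: image_comp[symmetric])
    from cs show ?thesis
    proof
      assume c: "F2 = a \<cdot>\<^sub>F repelling_flag b \<and> F4 = a \<cdot>\<^sub>F attracting_flag b"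
      have "\<exists>Q. upper ?n Q \<and> ?M (fa \<circ> w) = ?M (g1 \<circ> w) * Q"
        by (rule rel) (use gg wk c act fl_b in auto)
      moreover have "\<exists>Q. upper ?n Q \<and> ?M (fa \<circ> l) = ?M (g1 \<circ> (g2 \<circ> (g3 \<circ> w))) * Q"
        by (rule rel) (use gg wk lk c act fl_b in auto)
      ultimately show ?thesis by blast
    next
      assume c: "F2 = a \<cdot>\<^sub>F attracting_flag b \<and> F4 = a \<cdot>\<^sub>F repelling_flag b"
      have "\<exists>Q. upper ?n Q \<and> ?M (fa \<circ> w) = ?M (g1 \<circ> (g2 \<circ> (g3 \<circ> w))) * Q"
        by (rule rel) (use gg wk c act fl_b in auto)
      moreover have "\<exists>Q. upper ?n Q \<and> ?M (fa \<circ> l) = ?M (g1 \<circ> w) * Q"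
        by (rule rel) (use gg wk lk c act fl_b in auto)
      ultimately show ?thesis by blast
    qed
  qed
  have up: "upper_pos ?n (?M h)" "unit_diag ?n (?M h)" if "h \<in> {g1, g2, g3, g4}" for h
    using totally_positive_upper_pos[of "?M h" ?n] g(5) that carrier_matD(1)[OF M[of h]] by auto
  have uc: "Q \<in> carrier_mat ?n ?n" if "upper ?n Q" for Q using that by (simp add: upper_def)
  have assoc: "X * Y * Z = X * (Y * Z)"
    if "X \<in> carrier_mat ?n ?n" "Y \<in> carrier_mat ?n ?n" "Z \<in> carrier_mat ?n ?n" for X Y Z :: "real mat"
    using mat_assoc that by blast
  obtain Q3 Q4 where Q34: "upper ?n Q3" "upper ?n Q4"
    "(?M fa * flip_mat ?n = ?M g1 * (flip_mat ?n * Q3) \<and>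
        ?M fa * ?M l = ?M g1 * (?M g2 * (?M g3 * (flip_mat ?n * Q4)))) \<or>
     (?M fa * flip_mat ?n = ?M g1 * (?M g2 * (?M g3 * (flip_mat ?n * Q3))) \<and>
        ?M fa * ?M l = ?M g1 * (flip_mat ?n * Q4))"
  proof -
    from cases obtain Q3 Q4 where q: "upper ?n Q3" "upper ?n Q4"
      "(?M (fa \<circ> w) = ?M (g1 \<circ> w) * Q3 \<and> ?M (fa \<circ> l) = ?M (g1 \<circ> (g2 \<circ> (g3 \<circ> w))) * Q4) \<or>
       (?M (fa \<circ> w) = ?M (g1 \<circ> (g2 \<circ> (g3 \<circ> w))) * Q3 \<and> ?M (fa \<circ> l) = ?M (g1 \<circ> w) * Q4)" by blast
    show ?thesis
      by (rule that[OF q(1,2)]) (use q(3) uc[OF q(1)] uc[OF q(2)] gF in \<open>simp add: comp w(2) assoc\<close>)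
  qed
  have "\<exists>\<epsilon>. \<forall>k. \<forall>I\<in>index_lists ?n k. \<forall>J\<in>index_lists ?n k. \<epsilon> k * minor (?M li * (?M fa * ?M l)) I J > 0"
  proof (rule eigenframe_sign_regular[of ?n "?M g1" "?M g2" "?M g3" "?M g4" "?M fa" "?M l" "?M li" Q1 Q2 Q3 Q4])
    show "Determinant.det (?M fa) \<noteq> 0"
      using det_matrix_in_nonzero[OF B] Efa(1) by (simp add: gl_def)
    show "?M l * ?M li = 1\<^sub>m ?n"
      using comp[of l li] gF l(4) matrix_in_id[OF B] by simp
    show "?M fa * (?M g1 * ?M g2 * flip_mat ?n) = ?M g1 * ?M g2 * (flip_mat ?n * Q1)"
      using Q1(2) gF uc[OF Q1(1)] by (simp add: comp linear_compose w(2) assoc)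
    show "?M l = ?M g1 * (?M g2 * (?M g3 * (?M g4 * (flip_mat ?n * Q2))))"
      using Q2(2) gF uc[OF Q2(1)] by (simp add: comp w(2) assoc)
  qed (use up A L Lu Q1 Q2 Q34 in auto)
  moreover have "?M li * (?M fa * ?M l) = matrix_in E' fa"
  proof -
    have "?M li * (?M fa * ?M l) = ?M (li \<circ> (fa \<circ> l))" using gF by (simp add: comp)
    also have "\<dots> = matrix_in E' fa"
    proof (rule eq_matI)
      fix i j assume "i < dim_row (matrix_in E' fa)" "j < dim_col (matrix_in E' fa)"
      then have ij: "i < ?n" "j < ?n" using carrier_matD[OF matrix_in_carrier[OF E', of fa]] by auto
      show "?M (li \<circ> (fa \<circ> l)) $$ (i, j) = matrix_in E' fa $$ (i, j)"
        using ij by (simp add: matrix_in_entry[OF B] matrix_in_entry[OF E'] l_def li_def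
            basis_map_basis[OF B E'] basis_map_coord[OF E' B])
    qed (use carrier_matD[OF matrix_in_carrier[OF E', of fa]] carrier_matD[OF M] in auto)
    finally show ?thesis .
  qed
  ultimately show ?thesis using fb' by auto
qed

section \<open>Words in the two transformations\<close>

context positive_words
begin

lemma word_mat_shift:
  assumes "ks \<noteq> []" "i \<in> S"
  shows "word_mat ((k + hd ks) # tl ks) i j = D i powi k * word_mat ks i j"
proof -
  have D: "D i \<noteq> 0" using D[OF assms(2)] by simp
  obtain m ms where ks: "ks = m # ms" using assms(1) by (cases ks) auto
  show ?thesis unfolding ks using D by (cases ms) (auto simp: power_int_add)
qed

lemma word_mat_zero: "ks \<noteq> [] \<Longrightarrow> word_mat (0 # ks) i j = (\<Sum>l\<in>S. P i l * word_mat ks l j)"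
  by (cases ks) auto

end

text \<open>The letter \<open>x\<close> acts by \<open>f\<close>, and every other letter by \<open>h\<close>.\<close>

definition letter_map :: "('v \<Rightarrow> 'v) \<Rightarrow> ('v \<Rightarrow> 'v) \<Rightarrow> 'g \<Rightarrow> 'g \<times> bool \<Rightarrow> 'v \<Rightarrow> 'v" where
  "letter_map f h x l =
    (let m = (if fst l = x then f else h) in if snd l then m else inv_into UNIV m)"

definition word_map :: "('v \<Rightarrow> 'v) \<Rightarrow> ('v \<Rightarrow> 'v) \<Rightarrow> 'g \<Rightarrow> ('g \<times> bool) list \<Rightarrow> 'v \<Rightarrow> 'v" where
  "word_map f h x w = foldr (\<lambda>l m. letter_map f h x l \<circ> m) w id"

lemma word_map_simps:
  "word_map f h x [] = id" "word_map f h x (l # w) = letter_map f h x l \<circ> word_map f h x w"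
  by (simp_all add: word_map_def)

lemma letter_map_gl: "gl f \<Longrightarrow> gl h \<Longrightarrow> gl (letter_map f h x l)"
  by (simp add: letter_map_def Let_def)

text \<open>The exponents \<open>[k\<^sub>0, \<dots>, k\<^sub>r]\<close> of a word \<open>y\<^sup>k\<^sup>0 x y\<^sup>k\<^sup>1 x \<dots> x y\<^sup>k\<^sup>r\<close>, for words in which the letter \<open>x\<close>
  occurs only positively.\<close>

fun exponents :: "'g \<Rightarrow> ('g \<times> bool) list \<Rightarrow> int list" where
  "exponents x [] = [0]"
| "exponents x (l # w) = (if fst l = x then 0 # exponents x w
    else ((if snd l then 1 else - 1) + hd (exponents x w)) # tl (exponents x w))"

lemma exponents_nonempty [simp]: "exponents x w \<noteq> []"
  by (cases w) auto

text \<open>In a reduced word the letters \<open>y\<close> in one block have the same sign, so the block contributes the absolute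
  value of its exponent to the length.\<close>

lemma exponents_length:
  assumes "reduced_word w" "set w \<subseteq> {(x, True), (y, True), (y, False)}" "x \<noteq> y"
  shows "int (length (exponents x w)) - 1 + (\<Sum>k\<leftarrow>exponents x w. \<bar>k\<bar>) = int (length w) \<and>
    (hd (exponents x w) > 0 \<longrightarrow> w \<noteq> [] \<and> hd w = (y, True)) \<and>
    (hd (exponents x w) < 0 \<longrightarrow> w \<noteq> [] \<and> hd w = (y, False))"
  using assms(1,2)
proof (induction w)
  case (Cons l w)
  obtain k ks where k: "exponents x w = k # ks" by (cases "exponents x w") (auto dest: arg_cong[where f = "\<lambda>z. z = []"])
  have red: "reduced_word w" "w = [] \<or> hd w \<noteq> inv_letter l" using Cons.prems(1) by (auto simp: reduced_word_Cons)
  have IH: "int (length ks) + \<bar>k\<bar> + (\<Sum>k\<leftarrow>ks. \<bar>k\<bar>) = int (length w)"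
    "k > 0 \<Longrightarrow> w \<noteq> [] \<and> hd w = (y, True)" "k < 0 \<Longrightarrow> w \<noteq> [] \<and> hd w = (y, False)"
    using Cons.IH[OF red(1)] Cons.prems(2) k by auto
  consider "l = (x, True)" | "l = (y, True)" | "l = (y, False)" using Cons.prems(2) by auto
  then show ?case
  proof cases
    case 1
    then show ?thesis using IH k by simp
  next
    case 2
    then have "\<not> k < 0" using IH(3) red(2) by (auto simp: inv_letter_def)
    then show ?thesis using 2 IH k assms(3) by simp
  next
    case 3
    then have "\<not> k > 0" using IH(2) red(2) by (auto simp: inv_letter_def)
    then show ?thesis using 3 IH k assms(3) by simp
  qed
qed simp

lemma word_map_gl: "gl f \<Longrightarrow> gl h \<Longrightarrow> gl (word_map f h x w)"
  by (induction w) (simp_all only: word_map_simps gl_id gl_comp letter_map_gl)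

lemma word_map_inverse:
  assumes "gl f" "gl h"
  shows "word_map f h x (inv_word w) (word_map f h x w v) = v"
proof -
  have app: "word_map f h x (u @ u') = word_map f h x u \<circ> word_map f h x u'" for u u'
    by (induction u) (simp_all only: word_map_simps comp_assoc append.simps id_comp)
  have inv: "letter_map f h x (inv_letter l) (letter_map f h x l v) = v" for l v
    using assms by (simp add: inv_letter_def letter_map_def Let_def)
  show ?thesis
    by (induction w arbitrary: v) (simp_all add: app inv word_map_simps)
qed

lemma word_map_class:
  fixes \<rho> :: "'g \<Rightarrow> ('v::euclidean_space \<Rightarrow> 'v) set"
  assumes G: "group G" and \<rho>: "\<rho> \<in> hom G PGL" and f: "gl f" "\<rho> x = projective_class f"
    and h: "gl h" "\<rho> y = projective_class h" and xy: "x \<in> carrier G" "y \<in> carrier G" "x \<noteq> y"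
    and w: "fst ` set w \<subseteq> {x, y}"
  shows "\<rho> (word_value G w) = projective_class (word_map f h x w)"
  using w
proof (induction w)
  interpret G: group G by fact
  interpret \<rho>: group_hom G PGL \<rho>
    using G PGL_group \<rho> by (simp add: group_hom_def group_hom_axioms_def)
  case Nil
  then show ?case unfolding word_map_simps PGL_one[symmetric] by simp
next
  interpret G: group G by fact
  interpret \<rho>: group_hom G PGL \<rho>
    using G PGL_group \<rho> by (simp add: group_hom_def group_hom_axioms_def)
  case (Cons l w)
  let ?m = "if fst l = x then f else h"
  have m: "gl ?m" "\<rho> (fst l) = projective_class ?m" "fst l \<in> carrier G" using Cons.prems f h xy by auto
  have wc: "word_value G w \<in> carrier G"
    using Cons.prems xy by (intro G.word_value_closed) auto
  have l: "\<rho> (if snd l then fst l else inv\<^bsub>G\<^esub> (fst l)) = projective_class (letter_map f h x l)"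
    unfolding letter_map_def Let_def using m by (simp add: \<rho>.hom_inv PGL_inv)
  have "\<rho> (word_value G (l # w)) =
      \<rho> (if snd l then fst l else inv\<^bsub>G\<^esub> (fst l)) \<otimes>\<^bsub>PGL\<^esub> \<rho> (word_value G w)"
    unfolding G.word_value_simps(2) by (rule \<rho>.hom_mult) (use m(3) wc in auto)
  also have "\<dots> = projective_class (letter_map f h x l \<circ> word_map f h x w)"
  proof -
    have "\<rho> (word_value G w) = projective_class (word_map f h x w)" using Cons by simp
    then show ?thesis
      unfolding l by (simp only: PGL_mult[OF letter_map_gl[OF f(1) h(1)] word_map_gl[OF f(1) h(1)]])
  qed
  finally show ?case unfolding word_map_simps .
qed

lemma index_lists_nth_le:
  assumes "K \<in> index_lists n k" "r < k" shows "K ! r \<le> n - k + r"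
proof -
  have "K ! r + (k - 1 - r) \<le> K ! (k - 1)"
  proof -
    have "K ! r + d \<le> K ! (r + d)" if "r + d < k" for d
      using that
    proof (induction d)
      case (Suc d)
      then have "K ! (r + d) < K ! Suc (r + d)" using assms(1)
        by (auto simp: index_lists_def sorted_wrt_iff_nth_less)
      then show ?case using Suc by simp
    qed simp
    from this[of "k - 1 - r"] assms(2) show ?thesis by simp
  qed
  moreover have "K ! (k - 1) < n" using index_lists_nth[OF assms(1), of "k - 1"] assms(2) by simp
  ultimately show ?thesis using assms(2) index_lists_le[OF assms(1)] by simp
qed

lemma index_lists_nth_neq:
  assumes "I \<in> index_lists n k" "J \<in> index_lists n k" "I \<noteq> J"
  obtains r where "r < k" "I ! r \<noteq> J ! r"
  using assms by (metis index_lists_length nth_equalityI)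

text \<open>One factor that is smaller by \<open>q\<close> makes the whole product smaller by \<open>q\<close>.\<close>

lemma prod_one_factor:
  fixes f g :: "nat \<Rightarrow> real"
  assumes fg: "\<And>i. i < k \<Longrightarrow> 0 < f i \<and> f i \<le> g i" and r: "r < k" "f r \<le> q * g r"
  shows "(\<Prod>i<k. f i) \<le> q * (\<Prod>i<k. g i)"
proof -
  have "(\<Prod>i<k. f i) = f r * (\<Prod>i\<in>{..<k} - {r}. f i)" using r(1) by (subst prod.remove[of _ r]) auto
  also have "\<dots> \<le> (q * g r) * (\<Prod>i\<in>{..<k} - {r}. g i)"
    using fg r by (intro mult_mono prod_mono prod_nonneg) (auto simp: less_imp_le intro: order_trans[of 0 "f r"])
  also have "\<dots> = q * (\<Prod>i<k. g i)" using r(1) by (subst (2) prod.remove[of _ r]) auto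
  finally show ?thesis .
qed

lemma exists_gap:
  fixes \<beta> :: "nat \<Rightarrow> real"
  assumes pos: "\<And>i. i < n \<Longrightarrow> \<beta> i > 0" and dec: "\<And>i j. i < j \<Longrightarrow> j < n \<Longrightarrow> \<beta> j < \<beta> i"
  obtains q where "0 < q" "q < 1" "\<And>i j. i < j \<Longrightarrow> j < n \<Longrightarrow> \<beta> j \<le> q * \<beta> i"
proof -
  let ?R = "insert (1 / 2) ((\<lambda>(i, j). \<beta> j / \<beta> i) ` {(i, j). i < j \<and> j < n})"
  have "finite {(i, j). i < j \<and> j < n}"
    by (rule finite_subset[of _ "{..<n} \<times> {..<n}"]) auto
  then have fin: "finite ?R" by simp
  show thesis
  proof (rule that[of "Max ?R"])
    have "1 / 2 \<le> Max ?R" using fin by (intro Max_ge) auto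
    then show "0 < Max ?R" by linarith
    have "x < 1" if "x \<in> ?R" for x
    proof -
      from that have "x = 1 / 2 \<or> (\<exists>i j. i < j \<and> j < n \<and> x = \<beta> j / \<beta> i)" by auto
      then consider "x = 1 / 2" | i j where "i < j" "j < n" "x = \<beta> j / \<beta> i" by blast
      then show ?thesis
      proof cases
        case (2 i j)
        then show ?thesis using dec[of i j] pos[of i] by (simp add: divide_less_eq)
      qed simp
    qed
    then show "Max ?R < 1" using fin by (subst Max_less_iff) auto
    fix i j assume ij: "i < j" "j < n"
    then have "\<beta> j / \<beta> i \<le> Max ?R" using fin by (intro Max_ge) auto
    then show "\<beta> j \<le> Max ?R * \<beta> i" using pos[of i] ij by (simp add: pos_divide_le_eq)
  qed
qed

text \<open>The minors of size \<open>k\<close> of the matrix of a word are, up to a common factor, the entries of \<open>word_mat\<close> for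
  \<open>P\<close> the compound of \<open>f\<close>, with signs removed, and \<open>D\<close> the compound of \<open>h\<close>.  So
  \<open>word_mat_two_minors\<close> provides the hypothesis of \<open>singular_value_ratio\<close>, with an exponentially
  small \<open>\<eta>\<close>.\<close>

theorem word_map_gap:
  fixes f h :: "'v::euclidean_space \<Rightarrow> 'v" and x y :: 'g
  assumes f: "gl f" and h: "eigenframe h \<beta> E" and \<beta>: "\<And>i. i < DIM('v) \<Longrightarrow> \<beta> i > 0"
    and \<epsilon>: "\<And>I J. I \<in> index_lists DIM('v) k \<Longrightarrow> J \<in> index_lists DIM('v) k \<Longrightarrow>
      (\<epsilon> :: real) * minor (matrix_in E f) I J > 0"
    and k: "1 \<le> k" "k < DIM('v)" and xy: "x \<noteq> y"
  shows "\<exists>\<kappa>>0. \<exists>K. \<forall>w. reduced_word w \<longrightarrow> set w \<subseteq> {(x, True), (y, True), (y, False)} \<longrightarrow>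
    ln (singular_values (word_map f h x w) ! (k - 1)) - ln (singular_values (word_map f h x w) ! k)
      \<ge> \<kappa> * real (length w) - K"
proof -
  let ?n = "DIM('v)"
  note Eh = eigenframe_facts[OF h]
  note E = Eh(3)
  define S where "S = index_lists ?n k"
  define P where "P I J = \<epsilon> * minor (matrix_in E f) I J" for I J
  define D where "D I = (\<Prod>c<k. \<beta> (I ! c))" for I
  have dec: "\<beta> j < \<beta> i" if "i < j" "j < ?n" for i j
    using Eh(5)[OF that] \<beta>[of i] \<beta>[of j] that by simp
  have dec': "\<beta> j \<le> \<beta> i" if "i \<le> j" "j < ?n" for i j using dec[of i j] that by (cases "i = j") auto
  obtain q where q: "0 < q" "q < 1" "\<And>i j. i < j \<Longrightarrow> j < ?n \<Longrightarrow> \<beta> j \<le> q * \<beta> i"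
    using exists_gap[of ?n \<beta>] \<beta> dec by blast
  have \<epsilon>0: "\<epsilon> \<noteq> 0" using \<epsilon>[of "[0..<k]" "[0..<k]"] k by auto
  have nth: "I ! c < ?n" if "I \<in> S" "c < k" for I c using index_lists_nth that unfolding S_def by blast
  have bot: "[?n - k..<?n] \<in> S" "[?n - k..<?n] ! c = ?n - k + c" if "c < k" for c
    using index_lists_upt[of "?n - k" k ?n] k that by (simp_all add: S_def)
  interpret positive_words S P D "[0..<k]" "[?n - k..<?n]" q
  proof
    show "finite S" "[0..<k] \<in> S" "0 < q" "q < 1" using k q by (auto simp: S_def)
    show "[?n - k..<?n] \<in> S" using bot(1)[of 0] k by simp
    show "P I J > 0" if "I \<in> S" "J \<in> S" for I J using \<epsilon> that by (simp add: P_def S_def)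
    show "D I > 0" if "I \<in> S" for I unfolding D_def using nth[OF that] \<beta> by (intro prod_pos) auto
    show "D I \<le> q * D [0..<k]" if I: "I \<in> S" "I \<noteq> [0..<k]" for I
    proof -
      obtain r where r: "r < k" "I ! r \<noteq> [0..<k] ! r"
        using index_lists_nth_neq[of I ?n k "[0..<k]"] I k by (auto simp: S_def)
      have ge: "c \<le> I ! c" if "c < k" for c using index_lists_nth_ge I(1) that by (simp add: S_def)
      then have "r < I ! r" using r by (simp add: order_less_le)
      show ?thesis
        unfolding D_def
      proof (rule prod_one_factor[OF _ r(1)])
        show "\<beta> (I ! r) \<le> q * \<beta> ([0..<k] ! r)" using q(3)[OF \<open>r < I ! r\<close>] nth[OF I(1) r(1)] r(1) by simp
        show "0 < \<beta> (I ! c) \<and> \<beta> (I ! c) \<le> \<beta> ([0..<k] ! c)" if "c < k" for c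
          using \<beta> nth[OF I(1) that] dec'[OF ge[OF that]] that by simp
      qed
    qed
    show "D [?n - k..<?n] \<le> q * D I" if I: "I \<in> S" "I \<noteq> [?n - k..<?n]" for I
    proof -
      obtain r where r: "r < k" "I ! r \<noteq> [?n - k..<?n] ! r"
        using index_lists_nth_neq[of I ?n k "[?n - k..<?n]"] I bot(1)[of 0] k by (auto simp: S_def)
      have le: "I ! c \<le> ?n - k + c" if "c < k" for c using index_lists_nth_le I(1) that by (simp add: S_def)
      then have "I ! r < ?n - k + r" using r bot(2)[OF r(1)] by (simp add: order_less_le)
      show ?thesis
        unfolding D_def
      proof (rule prod_one_factor[OF _ r(1)])
        show "\<beta> ([?n - k..<?n] ! r) \<le> q * \<beta> (I ! r)"
          unfolding bot(2)[OF r(1)] using q(3)[OF \<open>I ! r < ?n - k + r\<close>] r(1) k by simp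
        show "0 < \<beta> ([?n - k..<?n] ! c) \<and> \<beta> ([?n - k..<?n] ! c) \<le> \<beta> (I ! c)" if "c < k" for c
          unfolding bot(2)[OF that] using \<beta>[of "?n - k + c"] dec'[OF le[OF that]] that k by simp
      qed
    qed
  qed
  obtain C \<kappa> where C: "C > 0" and \<kappa>: "\<kappa> > 0" and two: "\<And>ks. ks \<noteq> [] \<Longrightarrow> \<exists>p\<in>S. \<exists>r\<in>S. \<forall>i\<in>S. \<forall>i'\<in>S. \<forall>j\<in>S. \<forall>j'\<in>S.
     \<bar>word_mat ks i j * word_mat ks i' j' - word_mat ks i j' * word_mat ks i' j\<bar>
       \<le> C * exp (- \<kappa> * real_of_int (int (length ks) - 1 + (\<Sum>k\<leftarrow>ks. \<bar>k\<bar>))) * (word_mat ks p r)\<^sup>2"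
    using word_mat_two_minors by blast
  obtain C' where C': "C' > 0" "\<And>g \<eta>. linear g \<Longrightarrow> bij g \<Longrightarrow> \<eta> \<ge> 0 \<Longrightarrow>
    (\<exists>P\<in>S. \<exists>R\<in>S. \<forall>I\<in>S. \<forall>I'\<in>S. \<forall>J\<in>S. \<forall>J'\<in>S.
        \<bar>minor (matrix_in E g) I J * minor (matrix_in E g) I' J'
          - minor (matrix_in E g) I J' * minor (matrix_in E g) I' J\<bar>
        \<le> \<eta> * (minor (matrix_in E g) P R)\<^sup>2) \<Longrightarrow>
    singular_values g ! k \<le> C' * \<eta> * singular_values g ! (k - 1)"
    using singular_value_ratio[OF E k] unfolding S_def by blast
  let ?W = "word_map f h x"
  have cb: "minor (matrix_in E (u \<circ> v)) I J = (\<Sum>L\<in>S. minor (matrix_in E u) I L * minor (matrix_in E v) L J)"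
    if "linear u" "I \<in> S" "J \<in> S" for u v I J
    unfolding matrix_in_comp[OF E that(1)] S_def
    by (rule cauchy_binet) (use that matrix_in_carrier[OF E] in \<open>auto simp: S_def index_lists_def\<close>)
  have diag: "minor (matrix_in E (u \<circ> v)) I J = (\<Prod>c<k. \<gamma> (I ! c)) * minor (matrix_in E v) I J"
    if u: "linear u" "\<And>i. i < ?n \<Longrightarrow> u (E ! i) = \<gamma> i *\<^sub>R E ! i" and IJ: "I \<in> S" "J \<in> S" for u v \<gamma> I J
  proof -
    let ?T = "matrix_in E u"
    have Te: "?T $$ (i, j) = (if i = j then \<gamma> j else 0)" if "i < ?n" "j < ?n" for i j
      using that u(2)[of j] linear_scale[OF coord_linear[OF E]] by (simp add: matrix_in_entry[OF E] coord_basis[OF E])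
    have T: "upper ?n ?T" "lower ?n ?T"
      using Te matrix_in_carrier[OF E] by (auto simp: upper_def lower_def)
    have "minor ?T I L = (if I = L then (\<Prod>c<k. \<gamma> (I ! c)) else 0)" if "L \<in> S" for L
      using minor_diagonal[OF T, of I k L] IJ that nth[OF that] Te by (simp add: S_def)
    then have "minor (matrix_in E (u \<circ> v)) I J = (\<Sum>L\<in>S. if I = L then (\<Prod>c<k. \<gamma> (I ! c)) * minor (matrix_in E v) L J else 0)"
      unfolding cb[OF u(1) IJ] by (intro sum.cong) auto
    then show ?thesis using IJ(1) fin by simp
  qed
  have minors: "\<exists>c. c \<noteq> 0 \<and> (\<forall>I\<in>S. \<forall>J\<in>S. minor (matrix_in E (?W w)) I J = c * word_mat (exponents x w) I J)"
    if "set w \<subseteq> {(x, True), (y, True), (y, False)}" for w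
    using that
  proof (induction w)
    case Nil
    have "minor (matrix_in E id) I J = (if I = J then 1 else 0)" if "I \<in> S" "J \<in> S" for I J
      unfolding matrix_in_id[OF E] using minor_one that unfolding S_def by blast
    moreover have "1 * word_mat (exponents x []) I J = (if I = J then 1 else 0)" for I J by simp
    ultimately show ?case unfolding word_map_simps by (metis zero_neq_one)
  next
    case (Cons l w)
    then obtain c where c: "c \<noteq> 0" "\<And>I J. I \<in> S \<Longrightarrow> J \<in> S \<Longrightarrow> minor (matrix_in E (?W w)) I J = c * word_mat (exponents x w) I J"
      by auto
    consider "l = (x, True)" | "l = (y, True)" | "l = (y, False)" using Cons.prems by auto
    then show ?case
    proof cases
      case 1
      have "minor (matrix_in E (f \<circ> ?W w)) I J = c / \<epsilon> * word_mat (0 # exponents x w) I J" if IJ: "I \<in> S" "J \<in> S" for I J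
      proof -
        have "minor (matrix_in E (f \<circ> ?W w)) I J = (\<Sum>L\<in>S. P I L / \<epsilon> * (c * word_mat (exponents x w) L J))"
          using cb[of f I J "?W w"] f IJ c(2) \<epsilon>0 by (simp add: gl_def P_def)
        then show ?thesis by (simp add: word_mat_zero sum_distrib_left mult_ac)
      qed
      moreover have "letter_map f h x l = f" using 1 by (simp add: letter_map_def)
      moreover have "exponents x (l # w) = 0 # exponents x w" using 1 by simp
      moreover have "c / \<epsilon> \<noteq> 0" using c(1) \<epsilon>0 by simp
      ultimately show ?thesis unfolding word_map_simps by metis
    next
      case 2
      have "minor (matrix_in E (h \<circ> ?W w)) I J = c * word_mat ((1 + hd (exponents x w)) # tl (exponents x w)) I J"
        if IJ: "I \<in> S" "J \<in> S" for I J
        using diag[of h \<beta> I J "?W w"] Eh(2,4) IJ c(2)[OF IJ] word_mat_shift[OF exponents_nonempty IJ(1), of 1 x w]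
        by (simp add: D_def)
      moreover have "letter_map f h x l = h" using 2 xy by (simp add: letter_map_def)
      moreover have "exponents x (l # w) = (1 + hd (exponents x w)) # tl (exponents x w)" using 2 xy by simp
      ultimately show ?thesis unfolding word_map_simps using c(1) by metis
    next
      case 3
      have hi: "linear (inv_into UNIV h)" using gl_inverse[OF Eh(1)] by (simp add: gl_def)
      have hE: "inv_into UNIV h (E ! i) = inverse (\<beta> i) *\<^sub>R E ! i" if "i < ?n" for i
      proof -
        have "h (inverse (\<beta> i) *\<^sub>R E ! i) = E ! i" using Eh(4)[OF that] \<beta>[OF that] by (simp add: linear_scale[OF Eh(2)])
        then show ?thesis using gl_inverse_apply(1)[OF Eh(1)] by metis
      qed
      have "minor (matrix_in E (inv_into UNIV h \<circ> ?W w)) I J = c * word_mat ((- 1 + hd (exponents x w)) # tl (exponents x w)) I J"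
        if IJ: "I \<in> S" "J \<in> S" for I J
        using diag[of "inv_into UNIV h" "\<lambda>i. inverse (\<beta> i)" I J "?W w"] hi hE IJ c(2)[OF IJ]
          word_mat_shift[OF exponents_nonempty IJ(1), of "- 1" x w]
        by (simp add: D_def prod_inversef[symmetric] power_int_minus)
      moreover have "letter_map f h x l = inv_into UNIV h" using 3 xy by (simp add: letter_map_def)
      moreover have "exponents x (l # w) = (- 1 + hd (exponents x w)) # tl (exponents x w)" using 3 xy by simp
      ultimately show ?thesis unfolding word_map_simps using c(1) by metis
    qed
  qed
  show ?thesis
  proof (rule exI[of _ \<kappa>], rule conjI[OF \<kappa>], rule exI[of _ "ln (C' * C)"], intro allI impI)
    fix w assume w: "reduced_word w" "set w \<subseteq> {(x, True), (y, True), (y, False)}"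
    let ?A = "minor (matrix_in E (?W w))" and ?ks = "exponents x w" and ?s = "singular_values (?W w)"
    define \<eta> where "\<eta> = C * exp (- \<kappa> * real (length w))"
    have \<eta>: "\<eta> > 0" using C by (simp add: \<eta>_def)
    obtain c where c: "c \<noteq> 0" "\<And>I J. I \<in> S \<Longrightarrow> J \<in> S \<Longrightarrow> ?A I J = c * word_mat ?ks I J"
      using minors[OF w(2)] by blast
    have len: "real_of_int (int (length ?ks) - 1 + (\<Sum>k\<leftarrow>?ks. \<bar>k\<bar>)) = real (length w)"
      using exponents_length[OF w xy] by simp
    obtain p r where pr: "p \<in> S" "r \<in> S" "\<And>i i' j j'. i \<in> S \<Longrightarrow> i' \<in> S \<Longrightarrow> j \<in> S \<Longrightarrow> j' \<in> S \<Longrightarrow>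
       \<bar>word_mat ?ks i j * word_mat ?ks i' j' - word_mat ?ks i j' * word_mat ?ks i' j\<bar> \<le> \<eta> * (word_mat ?ks p r)\<^sup>2"
      using two[of ?ks] unfolding len \<eta>_def[symmetric] by auto
    have "\<bar>?A I J * ?A I' J' - ?A I J' * ?A I' J\<bar> \<le> \<eta> * (?A p r)\<^sup>2" if "I \<in> S" "I' \<in> S" "J \<in> S" "J' \<in> S" for I I' J J'
    proof -
      have e: "?A I J * ?A I' J' - ?A I J' * ?A I' J =
          c\<^sup>2 * (word_mat ?ks I J * word_mat ?ks I' J' - word_mat ?ks I J' * word_mat ?ks I' J)"
        using that by (simp add: c(2) power2_eq_square algebra_simps)
      show ?thesis
        unfolding e c(2)[OF pr(1,2)] using mult_left_mono[OF pr(3)[OF that], of "c\<^sup>2"]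
        by (simp add: abs_mult power_mult_distrib mult.left_commute)
    qed
    then have "?s ! k \<le> C' * \<eta> * ?s ! (k - 1)"
      using C'(2)[of "?W w" \<eta>] word_map_gl[OF f Eh(1), of x w] \<eta> pr(1,2) by (force simp: gl_def)
    moreover have pos: "?s ! k > 0" "?s ! (k - 1) > 0"
      using singular_values_pos(2)[OF word_map_gl[OF f Eh(1), of x w]] k by auto
    ultimately have "ln (?s ! k) \<le> ln (C' * \<eta> * ?s ! (k - 1))" by (intro ln_mono) auto
    also have "\<dots> = ln (C' * C) - \<kappa> * real (length w) + ln (?s ! (k - 1))"
      using pos C C'(1) by (simp add: \<eta>_def ln_mult_pos)
    finally show "ln (?s ! (k - 1)) - ln (?s ! k) \<ge> \<kappa> * real (length w) - ln (C' * C)" by simp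
  qed
qed

section \<open>Primitive stability\<close>

theorem theorem1p6:
  fixes F\<^sub>2 :: "'g monoid"
    and \<gamma>\<^sub>1 \<gamma>\<^sub>2 :: 'g
    and a b :: "('v::euclidean_space \<Rightarrow> 'v) set"
    and \<rho> :: "'g \<Rightarrow> ('v \<Rightarrow> 'v) set"
  assumes "DIM('v) \<ge> 2"
    and "free_group F\<^sub>2 2"
    and "\<gamma>\<^sub>1 \<in> carrier F\<^sub>2" and "\<gamma>\<^sub>2 \<in> carrier F\<^sub>2"
    and "generate F\<^sub>2 {\<gamma>\<^sub>1, \<gamma>\<^sub>2} = carrier F\<^sub>2"
    and "positive_loxodromic b"
    and "loxodromic a"
    and "positive_tuple [repelling_flag b, a \<cdot>\<^sub>F repelling_flag b, attracting_flag a,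
                         a \<cdot>\<^sub>F attracting_flag b, attracting_flag b, repelling_flag a] \<or>
         positive_tuple [repelling_flag b, a \<cdot>\<^sub>F attracting_flag b, attracting_flag a,
                         a \<cdot>\<^sub>F repelling_flag b, attracting_flag b, repelling_flag a]"
    and "\<rho> \<in> hom F\<^sub>2 PGL" and "\<rho> \<gamma>\<^sub>1 = a" and "\<rho> \<gamma>\<^sub>2 = b"
  shows "primitive_stable F\<^sub>2 2 \<rho>"
proof -
  let ?n = "DIM('v)"
  obtain fa \<alpha> Ea where fa: "a = projective_class fa" "eigenframe fa \<alpha> Ea"
    using loxodromic_eigenframe[OF assms(7)] by blast
  obtain fb \<beta> E where fb: "b = projective_class fb" "eigenframe fb \<beta> E" "\<And>i. i < ?n \<Longrightarrow> \<beta> i > 0"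
    using positive_loxodromic_eigenframe[OF assms(6)] by blast
  obtain E' \<epsilon> where E': "eigenframe fb \<beta> E'"
    and \<epsilon>: "\<And>k I J. I \<in> index_lists ?n k \<Longrightarrow> J \<in> index_lists ?n k \<Longrightarrow> \<epsilon> k * minor (matrix_in E' fa) I J > 0"
    using positive_tuple_sign_regular[OF fa(2) fb(2) fa(1) fb(1) assms(8)] by blast
  have gl: "gl fa" "gl fb" using eigenframe_facts(1) fa(2) fb(2) by blast+
  obtain X where X: "finite X" "card X = 2" "free_basis F\<^sub>2 X" and G: "group F\<^sub>2"
    using assms(2) by (auto simp: free_group_def)
  obtain s t where st: "X = {s, t}" "s \<noteq> t" using X(2) by (auto simp: card_2_iff)
  interpret G: group F\<^sub>2 by (rule G)
  interpret generating_pair F\<^sub>2 s t \<gamma>\<^sub>1 \<gamma>\<^sub>2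
    using X(3) st assms(3,4,5) by unfold_locales auto
  obtain e1 e2 where "G.dual_pair \<gamma>\<^sub>1 \<gamma>\<^sub>2 e1 e2"
    using exists_dual_pair[OF assms(3,4,5)] by blast
  from G.dual_pair_word_value(3)[OF this assms(3,4), of "[]"] have ne: "\<gamma>\<^sub>1 \<noteq> \<gamma>\<^sub>2" by simp
  let ?W = "word_map fa fb \<gamma>\<^sub>1"
  let ?L = "\<lambda>p. {(\<gamma>\<^sub>1, p), (\<gamma>\<^sub>2, True), (\<gamma>\<^sub>2, False)}"
  let ?gap = "\<lambda>k w. ln (singular_values (?W w) ! (k - 1)) - ln (singular_values (?W w) ! k)"
  have "\<forall>k\<in>{1..<?n}. \<exists>\<kappa>>0. \<exists>K. \<forall>w. reduced_word w \<longrightarrow> set w \<subseteq> ?L True \<longrightarrow>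
     ?gap k w \<ge> \<kappa> * real (length w) - K"
  proof
    fix k assume "k \<in> {1..<?n}"
    then show "\<exists>\<kappa>>0. \<exists>K. \<forall>w. reduced_word w \<longrightarrow> set w \<subseteq> ?L True \<longrightarrow> ?gap k w \<ge> \<kappa> * real (length w) - K"
      using word_map_gap[OF gl(1) E' fb(3) \<epsilon>[of _ k] _ _ ne] by simp
  qed
  then obtain \<kappa> K where \<kappa>: "\<And>k. k \<in> {1..<?n} \<Longrightarrow> \<kappa> k > 0" and K: "\<And>k w. k \<in> {1..<?n} \<Longrightarrow> reduced_word w \<Longrightarrow>
     set w \<subseteq> ?L True \<Longrightarrow> ?gap k w \<ge> \<kappa> k * real (length w) - K k"
    by metis
  define \<kappa>0 where "\<kappa>0 = Min (\<kappa> ` {1..<?n})"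
  define K0 where "K0 = 1 + (\<Sum>k\<in>{1..<?n}. \<bar>K k\<bar>)"
  have \<kappa>0: "\<kappa>0 > 0" "\<And>k. k \<in> {1..<?n} \<Longrightarrow> \<kappa>0 \<le> \<kappa> k"
    unfolding \<kappa>0_def using \<kappa> assms(1) by (auto simp: Min_gr_iff)
  have K0: "K0 > 0" by (simp add: K0_def add_pos_nonneg sum_nonneg)
  have K0': "K k \<le> K0" if "k \<in> {1..<?n}" for k
    using member_le_sum[OF that, of "\<lambda>k. \<bar>K k\<bar>"] by (simp add: K0_def)
  have pos: "?gap k w \<ge> \<kappa>0 * real (length w) - K0" if "k \<in> {1..<?n}" "reduced_word w" "set w \<subseteq> ?L True" for k w
    using K[OF that] K0'[OF that(1)] mult_right_mono[OF \<kappa>0(2)[OF that(1)], of "real (length w)"] by simp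
  \<comment> \<open>for the negative sign of \<open>\<gamma>\<^sub>1\<close> use the inverse word; inversion reverses the list of singular values\<close>
  have all: "?gap k w \<ge> \<kappa>0 * real (length w) - K0" if k: "k \<in> {1..<?n}" and w: "reduced_word w" "set w \<subseteq> ?L p" for k w p
  proof (cases p)
    case True
    then show ?thesis using pos k w by simp
  next
    case False
    let ?s = "singular_values (?W (inv_word w))"
    have lin: "linear (?W u)" "gl (?W u)" for u using word_map_gl[OF gl, of \<gamma>\<^sub>1 u] by (simp_all add: gl_def)
    have s: "singular_values (?W w) = rev (map inverse ?s)"
      using word_map_inverse[OF gl, of \<gamma>\<^sub>1 "inv_word w"] lin by (intro singular_values_inverse) auto
    have len: "length ?s = ?n" by (rule singular_values_pos(1)[OF lin(2)])
    have "ln (singular_values (?W w) ! i) = - ln (?s ! (?n - Suc i))" if "i < ?n" for i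
      unfolding s using that len singular_values_pos(2)[OF lin(2), of "?n - Suc i" "inv_word w"]
      by (simp add: rev_nth ln_inverse)
    moreover have "k - 1 < ?n" "?n - Suc (k - 1) = ?n - k" "?n - Suc k = ?n - k - 1" using k by auto
    ultimately have "?gap k w = ?gap (?n - k) (inv_word w)" using k by simp
    moreover have "set (inv_word w) \<subseteq> ?L True"
      using w(2) False by (auto simp: inv_word_def inv_letter_def)
    moreover have "?n - k \<in> {1..<?n}" using k by auto
    ultimately show ?thesis using pos[of "?n - k" "inv_word w"] w(1) by (metis inv_word_simps(4) reduced_inv_word)
  qed
  show ?thesis
    unfolding primitive_stable_def
  proof (rule exI[of _ "{\<gamma>\<^sub>1, \<gamma>\<^sub>2}"], intro conjI)
    show "\<exists>\<kappa>>0. \<exists>\<kappa>'>0. \<forall>\<eta>. primitive_geodesic_ray F\<^sub>2 2 {\<gamma>\<^sub>1, \<gamma>\<^sub>2} \<eta> \<and> \<eta> 0 = \<one>\<^bsub>F\<^sub>2\<^esub> \<longrightarrow>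
        (\<forall>i. \<forall>\<alpha>\<in>simple_roots ?n. \<kappa> * real i - \<kappa>' \<le> \<alpha> (cartan_projection (\<rho> (\<eta> i))))"
    proof (rule exI[of _ \<kappa>0], rule conjI[OF \<kappa>0(1)], rule exI[of _ K0], rule conjI[OF K0], intro allI impI ballI; elim conjE)
      fix \<eta> i \<alpha>
      assume ray: "primitive_geodesic_ray F\<^sub>2 2 {\<gamma>\<^sub>1, \<gamma>\<^sub>2} \<eta>" "\<eta> 0 = \<one>\<^bsub>F\<^sub>2\<^esub>" and "\<alpha> \<in> simple_roots ?n"
      then obtain k where k: "k \<in> {1..<?n}" "\<alpha> = (\<lambda>x. x ! (k - 1) - x ! k)" by (auto simp: simple_roots_def)
      obtain q where "\<And>i. \<exists>w. length w = i \<and> set w \<subseteq> ?L q \<and> reduced_word w \<and> word_value F\<^sub>2 w = \<eta> i"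
        using primitive_ray_words[OF ray] by blast
      then obtain w where w: "length w = i" "set w \<subseteq> ?L q" "reduced_word w" "word_value F\<^sub>2 w = \<eta> i" by blast
      have "\<rho> (\<eta> i) = projective_class (?W w)"
        unfolding w(4)[symmetric]
        by (rule word_map_class[OF G assms(9) gl(1) _ gl(2) _ assms(3,4) ne]) (use assms(10,11) fa fb w(2) in auto)
      then have "\<alpha> (cartan_projection (\<rho> (\<eta> i))) = ?gap k w"
        using cartan_projection_difference[OF word_map_gl[OF gl, of \<gamma>\<^sub>1 w]] k by simp
      then show "\<alpha> (cartan_projection (\<rho> (\<eta> i))) \<ge> \<kappa>0 * real i - K0"
        using all[OF k(1) w(3,2)] w(1) by simp
    qed
  qed (use assms(3,4,5) in auto)
qed

end
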